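(* Let $E\subset\mathbb{C}$ be a regular compact set and let $\{p_n\}_{n\in\mathbb{N}}$ be an asymptotically minimal sequence of polynomials on $E$ (with $\deg p_n=n$). Assume that for all $\varepsilon>0$ there exists $N\in\mathbb{N}$ such that the zeros of $p_n$ are contained in $\mathrm{Pc}(E)^{\varepsilon}=\{z\in\mathbb{C}:\mathrm{dist}(z,\mathrm{Pc}(E))<\varepsilon\}$ for all $n\ge N$. Let $K_\infty\subset\mathbb{C}$ be a compact set that is a limit point of the sequence of filled Julia sets $\{K_{p_n}\}_{n}$ with respect to the Hausdorff metric (i.e. the limit of some subsequence). Then $\mathrm{Pc}(K_\infty)=\mathrm{Pc}(E)$.
   Context: Logarithmic energy of a finite Borel measure $\mu$ with compact support: $I(\mu)=\int\int\log|z-w|\,d\mu(w)\,d\mu(z)$. For a non-polar compact set $E\subset\mathbb{C}$, $\omega_E$ is the equilibrium measure, i.e. the unique maximizer of $I$ among Borel probability measures supported on $E$, and $\mathrm{cap}(E)=e^{I(\omega_E)}$ is the logarithmic capacity. For a compact set $A\subset\mathbb{C}$, $\mathrm{Pc}(A)$ denotes the polynomially convex hull, i.e. the complement in $\mathbb{C}$ of the unbounded component $\Omega_A$ of $\widehat{\mathbb{C}}\setminus A$. The Green's function with pole at infinity is $g_{\Omega_E}(z)=\int\log|z-w|\,d\omega_E(w)-\log\mathrm{cap}(E)$, regarded as a function on all of $\mathbb{C}$. A compact non-polar set $E$ is regular if $g_{\Omega_E}$ is continuous on $\mathbb{C}$, equivalently $g_{\Omega_E}=0$ on $\mathrm{Pc}(E)$.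 Hausdorff metric on non-empty compact subsets of $\mathbb{C}$: $\chi(A,B)=\max(h(A,B),h(B,A))$ with $h(A,B)=\sup_{a\in A}\inf_{b\in B}|a-b|$. Class $\mathbf{Reg}$: for a finite Borel measure $\tau$ with compact support $S_\tau\subset\mathbb{C}$, let $P_n^\tau(z)=\gamma_n(\tau)z^n+\cdots$, $\gamma_n(\tau)>0$, be the orthonormal polynomials with respect to $\langle f,g\rangle=\int f\overline{g}\,d\tau$. Then $\tau\in\mathbf{Reg}$ if $\lim_{n\to\infty}\gamma_n(\tau)^{1/n}=1/\mathrm{cap}(S_\tau)$. Asymptotically minimal: a sequence of polynomials $p_n(z)=\sum_{j=0}^n a_{n,j}z^j$ with $a_{n,n}\neq 0$ is asymptotically minimal on $E$ if there exist a measure $\tau\in\mathbf{Reg}$ with $\mathrm{supp}(\tau)=E$ and a constant $p\in(0,\infty]$ such that $\lim_{n\to\infty}\frac1n\log|a_{n,n}|=-\log\mathrm{cap}(E)$ and $\lim_{n\to\infty}\frac1n\log\|p_n\|_{L^p(\tau)}=0$. For $p=\infty$ no reference measure is needed and the norm is the supremum norm on $E$. For a polynomial $p$ of degree at least $2$, the filled Julia set $K_p$ is the set of points of $\mathbb{C}$ with bounded forward orbit under $p$. (For sequences $\{p_n\}$ with $\deg p_n=n$, $K_{p_n}$ is considered for $n\ge2$.) *)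

theory Defs
  imports "HOL-Probability.Probability" "HOL-Computational_Algebra.Polynomial"
begin

section \<open>Measures and integrals\<close>

definition msupport :: "complex measure \<Rightarrow> complex set" where
  "msupport \<mu> = {z. \<forall>U. open U \<and> z \<in> U \<longrightarrow> emeasure \<mu> U > 0}"

definition finite_compact_measure :: "complex measure \<Rightarrow> bool" where
  "finite_compact_measure \<mu> \<longleftrightarrow>
     finite_measure \<mu> \<and> sets \<mu> = sets borel \<and> compact (msupport \<mu>)"

text \<open>The logarithm and the integral are extended-real valued, since the logarithmic kernel
  is \<open>-\<infinity>\<close> on the diagonal (whereas \<^term>\<open>ln (0::real)\<close> is \<open>0\<close>) and energies may be \<open>-\<infinity>\<close>.
  For finite measures of compact support the positive parts below are finite, so the
  indeterminate \<open>\<infinity> - \<infinity>\<close> does not arise.\<close>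

definition elog :: "real \<Rightarrow> ereal" where
  "elog x = (if x = 0 then -\<infinity> else ereal (ln x))"

definition ext_integral :: "complex measure \<Rightarrow> (complex \<Rightarrow> ereal) \<Rightarrow> ereal" where
  "ext_integral \<mu> f =
     enn2ereal (\<integral>\<^sup>+ z. e2ennreal (f z) \<partial>\<mu>) - enn2ereal (\<integral>\<^sup>+ z. e2ennreal (- f z) \<partial>\<mu>)"

section \<open>Potential theory\<close>

definition log_potential :: "complex measure \<Rightarrow> complex \<Rightarrow> ereal" where
  "log_potential \<mu> z = ext_integral \<mu> (\<lambda>w. elog (cmod (z - w)))"

definition log_energy :: "complex measure \<Rightarrow> ereal" where
  "log_energy \<mu> = ext_integral \<mu> (log_potential \<mu>)"

definition prob_measures_on :: "complex set \<Rightarrow> complex measure set" where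
  "prob_measures_on E = {\<mu>. prob_space \<mu> \<and> sets \<mu> = sets borel \<and> msupport \<mu> \<subseteq> E}"

definition nonpolar :: "complex set \<Rightarrow> bool" where
  "nonpolar E \<longleftrightarrow> (\<exists>\<mu> \<in> prob_measures_on E. log_energy \<mu> > -\<infinity>)"

text \<open>For non-polar compact \<open>E\<close> the maximizer exists and is unique, so that the choice made
  by \<^const>\<open>arg_max_on\<close> is immaterial.\<close>

definition equilibrium_measure :: "complex set \<Rightarrow> complex measure" where
  "equilibrium_measure E = arg_max_on log_energy (prob_measures_on E)"

definition log_cap :: "complex set \<Rightarrow> real" where
  "log_cap E =
     (if nonpolar E then exp (real_of_ereal (log_energy (equilibrium_measure E))) else 0)"

text \<open>For compact \<open>A\<close>, \<^term>\<open>outside A\<close> is the unbounded component of the complement of \<open>A\<close>.\<close>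

definition Pc :: "complex set \<Rightarrow> complex set" where
  "Pc A = - outside A"

definition green :: "complex set \<Rightarrow> complex \<Rightarrow> ereal" where
  "green E z = log_potential (equilibrium_measure E) z - ereal (ln (log_cap E))"

definition regular_compact :: "complex set \<Rightarrow> bool" where
  "regular_compact E \<longleftrightarrow> compact E \<and> nonpolar E \<and> continuous_on UNIV (green E)"

section \<open>The Hausdorff metric\<close>

definition hausdorff_excess :: "complex set \<Rightarrow> complex set \<Rightarrow> real" where
  "hausdorff_excess A B = (SUP a\<in>A. infdist a B)"

definition hausdorff_distance :: "complex set \<Rightarrow> complex set \<Rightarrow> real" where
  "hausdorff_distance A B = max (hausdorff_excess A B) (hausdorff_excess B A)"

section \<open>Asymptotically minimal polynomials\<close>

definition orthonormal_polys :: "complex measure \<Rightarrow> (nat \<Rightarrow> complex poly) \<Rightarrow> bool" where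
  "orthonormal_polys \<tau> P \<longleftrightarrow>
     (\<forall>n. degree (P n) = n \<and> lead_coeff (P n) \<in> \<real> \<and> Re (lead_coeff (P n)) > 0) \<and>
     (\<forall>m n. (LINT z|\<tau>. poly (P m) z * cnj (poly (P n) z)) = (if m = n then 1 else 0))"

text \<open>The limit is taken in the extended reals, where \<open>1 / 0 = \<infinity>\<close>; this is the usual
  convention for \<open>1 / cap\<close> when the support is polar. The orthonormal polynomials of all degrees
  are unique when they exist, and they exist iff the support is infinite.\<close>

definition Reg :: "complex measure set" where
  "Reg = {\<tau>. finite_compact_measure \<tau> \<and>
     (\<exists>P. orthonormal_polys \<tau> P \<and>
       (\<lambda>n. ereal (root n (Re (lead_coeff (P n))))) \<longlonglongrightarrow> 1 / ereal (log_cap (msupport \<tau>)))}"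

definition Lq_norm :: "real \<Rightarrow> complex measure \<Rightarrow> (complex \<Rightarrow> complex) \<Rightarrow> real" where
  "Lq_norm q \<tau> f = (LINT z|\<tau>. cmod (f z) powr q) powr (1 / q)"

definition sup_norm :: "complex set \<Rightarrow> (complex \<Rightarrow> complex) \<Rightarrow> real" where
  "sup_norm E f = (SUP z\<in>E. cmod (f z))"

text \<open>Meant for non-polar compact \<open>E\<close>; then the capacity and all the norms below are positive,
  so the real logarithm is applied to positive numbers only. The second disjunct is the
  exponent \<open>\<infinity>\<close>.\<close>

definition asymptotically_minimal :: "complex set \<Rightarrow> (nat \<Rightarrow> complex poly) \<Rightarrow> bool" where
  "asymptotically_minimal E p \<longleftrightarrow>
     (\<forall>n. degree (p n) = n \<and> coeff (p n) n \<noteq> 0) \<and>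
     (\<lambda>n. 1 / real n * ln (cmod (coeff (p n) n))) \<longlonglongrightarrow> - ln (log_cap E) \<and>
     ((\<exists>\<tau>\<in>Reg. \<exists>q>0. msupport \<tau> = E \<and>
         (\<lambda>n. 1 / real n * ln (Lq_norm q \<tau> (poly (p n)))) \<longlonglongrightarrow> 0) \<or>
      (\<lambda>n. 1 / real n * ln (sup_norm E (poly (p n)))) \<longlonglongrightarrow> 0)"

section \<open>Filled Julia sets\<close>

definition filled_julia :: "complex poly \<Rightarrow> complex set" where
  "filled_julia p = {z. bounded (range (\<lambda>n. (poly p ^^ n) z))}"

text \<open>The Hausdorff metric lives on non-empty compact sets, and filled Julia sets are considered
  for degree at least \<open>2\<close> only (they are then non-empty and compact).\<close>

definition julia_limit_point :: "(nat \<Rightarrow> complex poly) \<Rightarrow> complex set \<Rightarrow> bool" where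
  "julia_limit_point p K \<longleftrightarrow> compact K \<and> K \<noteq> {} \<and>
     (\<exists>r. strict_mono r \<and> (\<forall>k. r k \<ge> 2) \<and>
       (\<lambda>k. hausdorff_distance (filled_julia (p (r k))) K) \<longlonglongrightarrow> 0)"

end

theory Submission
  imports Defs "HOL-Complex_Analysis.Complex_Analysis" "HOL-Computational_Algebra.Fundamental_Theorem_Algebra"
begin

text \<open>Write \<open>g\<close> for the Green's function and \<open>c\<close> for the capacity of \<open>E\<close>.

  If a point \<open>z\<^sub>0\<close> of \<open>E\<close> lies outside \<open>Pc K\<close>, then along the subsequence a fixed neighbourhood of
  \<open>z\<^sub>0\<close> stays off the filled Julia sets, and Harnack's inequality for \<open>ln\<close> of the iterates carries the
  rate of escape from infinity to \<open>z\<^sub>0\<close>: there \<open>\<bar>p\<^sub>n\<bar>\<close> grows exponentially, against the assumption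
  on the norms.

  Conversely, once \<open>\<bar>p\<^sub>n\<bar>\<close> grows subexponentially on the support of the equilibrium measure, the
  Bernstein-Walsh inequality gives \<open>\<bar>p\<^sub>n\<bar> \<le> exp (n (g + o(1)))\<close> everywhere.  Outside \<open>Pc E\<close> the
  quotient of \<open>p\<^sub>n\<close> by a polynomial with zeros distributed according to the equilibrium measure is
  eventually zero-free, and the leading coefficients show that its logarithm is \<open>o(n)\<close> near infinity;
  by Harnack's inequality this propagates, so \<open>\<bar>p\<^sub>n\<bar>\<close> grows exponentially and every point outside
  \<open>Pc E\<close> escapes.

  For a finite exponent the subexponential growth on the support has to be derived from the \<open>L\<^sup>q\<close>
  bound and the regularity of \<open>\<tau>\<close>.  Continuity of \<open>g\<close> leaves a possible polar part of \<open>E\<close> on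
  which \<open>g > 0\<close>; there \<open>p\<^sub>n\<close> is multiplied by a polynomial of degree \<open>o(n)\<close> which is extremely
  small.  The remaining part is controlled by Cauchy transforms of the orthonormal polynomials of
  \<open>\<tau>\<close>.\<close>

section \<open>The two constants principle\<close>

text \<open>No theory of subharmonic functions is used: maximum principles for \<open>g\<close> are
  obtained for products with n zeros by the maximum modulus principle, on the scale of n-th roots
  and up to an error that vanishes as n grows. The two constants principle concerns a pair of
  functions because it is also applied to Cauchy transforms, which may vanish, whereas Harnack's
  inequality needs a zero-free function. The obstacle for a finite exponent is that regularity of
  \<open>\<tau>\<close> gives no lower bound for the mass of small discs; it is a statement about
  leading coefficients only. They are therefore made visible as values at infinity of Cauchy
  transforms, which supply the lower bound in the two constants principle. A polar part of
  \<open>E\<close> may lie in the region \<open>g > \<delta>\<close> where these transforms have to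
  be holomorphic; a factor of degree o(n) makes it negligible and costs only a subexponential amount
  elsewhere. The outcome bounds the polynomial by the square norm of its product with that factor,
  and the same bound then lets the given exponent control this square norm.\<close>

lemma exterior_maximum_modulus:
  fixes f :: "complex \<Rightarrow> complex"
  assumes G: "open G" and hol: "f holomorphic_on G" and cont: "continuous_on (closure G) f"
    and r: "r > 0" "ball x0 r \<inter> G = {}"
    and inf: "eventually (\<lambda>z. z \<in> G \<longrightarrow> cmod (f z) \<le> C) at_infinity"
    and fr: "\<And>z. z \<in> frontier G \<Longrightarrow> cmod (f z) \<le> b" and b: "b \<ge> 0"
    and z: "z \<in> G"
  shows "cmod (f z) \<le> b"
proof -
  have "ball x0 r \<inter> closure G = {}"
    using r(2) open_Int_closure_eq_empty[of "ball x0 r" G] by simp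
  then have far: "r \<le> cmod (w - x0)" if "w \<in> closure G" for w
    using that by (force simp: dist_norm norm_minus_commute not_less)
  have clG: "closure G = G \<union> frontier G"
    using G by (auto simp: frontier_def interior_open closure_def)
  obtain R0 where R0: "\<And>w. cmod w \<ge> R0 \<Longrightarrow> w \<in> G \<Longrightarrow> cmod (f w) \<le> C"
    using inf unfolding eventually_at_infinity by blast
  define D where "D = max 0 (max C b)"
  have D: "cmod (f w) \<le> D" if "cmod w \<ge> R0" "w \<in> closure G" for w
    using R0[OF that(1)] fr[of w] that(2) clG unfolding D_def by fastforce
  have "D \<ge> 0" by (simp add: D_def)
  \<comment> \<open>Only boundedness of \<open>f\<close> at infinity is known, so the k-th power is
    damped by \<open>r / (w - x0)\<close>, which vanishes at infinity and has modulus at most 1 off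
    the ball. The fixed factor lost at \<open>z\<close> becomes irrelevant for large
    \<open>k\<close>.\<close>
  have pw: "cmod (f z) ^ k * (r / cmod (z - x0)) \<le> b ^ k" for k
  proof (rule field_le_epsilon)
    fix e :: real assume "e > 0"
    \<comment> \<open>Beyond radius \<open>R\<close> the damping factor pushes the bound
      \<open>D ^ k\<close> below \<open>e\<close>.\<close>
    define R where "R = Max {R0, cmod x0 + D ^ k * r / e, cmod z + 1}"
    have R: "R0 \<le> R" "cmod x0 + D ^ k * r / e \<le> R" "cmod z < R"
      unfolding R_def by auto
    define S where "S = G \<inter> ball 0 R"
    have intS: "interior S = S" using G by (simp add: S_def interior_open open_Int)
    have clS: "closure S \<subseteq> closure G" by (simp add: S_def closure_mono)
    let ?h = "\<lambda>w. f w ^ k * (of_real r / (w - x0))"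
    have "cmod (?h z) \<le> b ^ k + e"
    proof (rule maximum_modulus_frontier[of ?h S])
      show "?h holomorphic_on interior S"
        unfolding intS using hol far clG r(1)
        by (intro holomorphic_intros) (auto simp: S_def intro: holomorphic_on_subset, fastforce)
      show "continuous_on (closure S) ?h"
        using clS far r(1) by (intro continuous_intros continuous_on_subset[OF cont]) (auto, fastforce)
      show "bounded S" by (simp add: S_def bounded_Int)
      show "z \<in> S" using z R by (simp add: S_def)
    next
      fix w assume w: "w \<in> frontier S"
      then have wcl: "w \<in> closure G" using clS by (auto simp: frontier_def)
      then have fw: "r \<le> cmod (w - x0)" by (rule far)
      have "cmod (?h w) \<le> b ^ k \<or> cmod (?h w) \<le> e"
      proof (cases "w \<in> frontier G")
        case True
        then have "cmod (f w) ^ k \<le> b ^ k" using fr power_mono norm_ge_zero by blast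
        moreover have "r / cmod (w - x0) \<le> 1" using fw r(1) by (simp add: divide_simps)
        ultimately have "cmod (f w) ^ k * (r / cmod (w - x0)) \<le> b ^ k * 1"
          using r(1) b by (intro mult_mono) auto
        then show ?thesis using r(1) by (simp add: norm_mult norm_power norm_divide)
      next
        case False
        then have wG: "w \<in> G" using wcl clG by auto
        have "w \<notin> S" using w intS by (simp add: frontier_def)
        then have wR: "cmod w \<ge> R" using wG by (auto simp: S_def)
        have "D ^ k * r / e \<le> cmod (w - x0)"
          using wR R(2) norm_triangle_ineq2[of w x0] by linarith
        then have "D ^ k * r \<le> e * cmod (w - x0)" using \<open>e > 0\<close> by (simp add: divide_simps mult.commute)
        moreover have "cmod (f w) ^ k \<le> D ^ k"
          using D[of w] wR R(1) wcl by (intro power_mono) auto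
        then have "cmod (f w) ^ k * r \<le> D ^ k * r" using r(1) by simp
        ultimately have "cmod (f w) ^ k * r \<le> e * cmod (w - x0)" by linarith
        then have "cmod (f w) ^ k * (r / cmod (w - x0)) \<le> e"
          using fw r(1) \<open>e > 0\<close> by (simp add: divide_simps)
        then show ?thesis using r(1) by (simp add: norm_mult norm_power norm_divide)
      qed
      moreover have "b ^ k \<ge> 0" using b by simp
      ultimately show "cmod (?h w) \<le> b ^ k + e" using \<open>e > 0\<close> by linarith
    qed
    then show "cmod (f z) ^ k * (r / cmod (z - x0)) \<le> b ^ k + e"
      using r(1) by (simp add: norm_mult norm_power norm_divide)
  qed
  have pz: "r / cmod (z - x0) > 0"
    using far[of z] z clG r(1) by (metis UnI1 divide_pos_pos less_le_trans)
  show ?thesis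
  proof (rule ccontr)
    assume "\<not> ?thesis"
    then have gt: "cmod (f z) > b" by simp
    then have b0: "b > 0" using pw[of 1] pz b by (metis le_less_trans less_eq_real_def mult_pos_pos not_le power_one_right)
    then have "1 < cmod (f z) / b" using gt by simp
    then obtain k where "1 / (r / cmod (z - x0)) < (cmod (f z) / b) ^ k" using real_arch_pow by blast
    then have "b ^ k < cmod (f z) ^ k * (r / cmod (z - x0))"
      using b0 pz by (simp add: power_divide divide_simps mult.commute split: if_splits)
    then show False using pw[of k] by simp
  qed
qed

text \<open>Hadamard's three circles theorem, read backwards: extreme smallness on the inner disc
  would spread to the larger one. Integer powers of \<open>B\<close> and of
  \<open>T / (z - x)\<close> are compared, since real powers of \<open>z - x\<close> have no
  holomorphic branch on an annulus.\<close>

lemma three_circles_lower: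
  fixes x :: complex
  assumes "0 < \<rho>" "\<rho> < R'" "R' < R"
  shows "\<exists>M\<ge>1. \<forall>B s. B holomorphic_on ball x R \<longrightarrow> (\<forall>z\<in>ball x R. cmod (B z) \<le> 1) \<longrightarrow> s > 0 \<longrightarrow>
     (\<exists>y\<in>ball x R'. exp (-s) \<le> cmod (B y)) \<longrightarrow> (\<exists>y\<in>ball x \<rho>. exp (- (M * s)) \<le> cmod (B y))"
proof -
  define T where "T = (R' + R) / 2"
  define u where "u = \<rho> / 2"
  define a where "a = ln (T / R')"
  define b where "b = ln (T / u)"
  have T: "R' < T" "T < R" and u: "0 < u" "u < \<rho>" using assms by (auto simp: T_def u_def)
  have pos: "0 < R'" "0 < T" using assms T by auto
  have a: "a > 0" using T pos by (simp add: a_def)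
  have ab: "a < b" unfolding a_def b_def using T pos u assms by (simp add: frac_less2)
  \<comment> \<open>The sharp constant for the radii \<open>u\<close>, \<open>R'\<close>,
    \<open>T\<close> is \<open>b / a\<close>; the factor 2 pays for rounding the exponent
    \<open>p\<close> down to an integer.\<close>
  define M where "M = 2 * b / a"
  have M: "M \<ge> 1" using a ab by (simp add: M_def divide_simps)
  show ?thesis
  proof (intro exI[of _ M] conjI M allI impI)
    fix B :: "complex \<Rightarrow> complex" and s :: real
    assume hol: "B holomorphic_on ball x R" and le1: "\<forall>z\<in>ball x R. cmod (B z) \<le> 1" and s: "s > 0"
      and "\<exists>y\<in>ball x R'. exp (-s) \<le> cmod (B y)"
    then obtain y where y: "y \<in> ball x R'" "exp (-s) \<le> cmod (B y)" by blast
    show "\<exists>y\<in>ball x \<rho>. exp (- (M * s)) \<le> cmod (B y)"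
    proof (rule ccontr)
      assume "\<not> ?thesis"
      then have small: "cmod (B z) < exp (- (M * s))" if "z \<in> ball x \<rho>" for z
        using that by force
      have "exp (- (M * s)) \<le> exp (-s)" using M s by simp
      then have yo: "y \<notin> ball x \<rho>" using small[of y] y(2) by linarith
      \<comment> \<open>So large that rounding costs less than the surplus:
        \<open>p * a \<le> s * q\<close> and \<open>2 * s * q < (p + 1) * a\<close> would give
        \<open>s * q < a\<close>.\<close>
      obtain q :: nat where q: "a / s < real q" using reals_Archimedean2 by blast
      then have sq: "a < s * q" using s by (simp add: divide_simps mult.commute)
      define p where "p = nat \<lfloor>M * s * q / b\<rfloor>"
      have nn: "0 \<le> M * s * q / b" using M s a ab by simp
      have p1: "real p \<le> M * s * q / b" and p2: "M * s * q / b < real p + 1"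
        unfolding p_def using nn by linarith+
      let ?S = "ball x T - cball x u"
      let ?h = "\<lambda>z. B z ^ q * (of_real T / (z - x)) ^ p"
      have So: "open ?S" by auto
      have clS: "closure ?S \<subseteq> cball x T - ball x u"
        by (rule closure_minimal) auto
      have "cmod (?h y) \<le> 1"
      proof (rule maximum_modulus_frontier[of ?h ?S])
        show "?h holomorphic_on interior ?S"
          unfolding interior_open[OF So] using T u
          by (intro holomorphic_intros holomorphic_on_subset[OF hol]) auto
        show "continuous_on (closure ?S) ?h"
          using T u clS
          by (intro continuous_intros continuous_on_subset[OF holomorphic_on_imp_continuous_on[OF hol]]) fastforce+
        show "bounded ?S" by (simp add: bounded_diff)
        show "y \<in> ?S" using y(1) yo T u by (auto simp: dist_norm)
      next
        fix w assume w: "w \<in> frontier ?S"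
        then have "w \<in> cball x T - ball x u" "w \<notin> ?S"
          using clS interior_open[OF So] by (auto simp: frontier_def)
        then consider "dist x w = T" | "dist x w = u" by force
        then show "cmod (?h w) \<le> 1"
        proof cases
          case 1
          then have "cmod (B w) \<le> 1" using le1 T by auto
          moreover have "cmod (w - x) = T" using 1 by (simp add: dist_norm norm_minus_commute)
          ultimately show ?thesis using pos
            by (simp add: norm_mult norm_power norm_divide power_le_one)
        next
          case 2
          then have "cmod (B w) \<le> exp (- (M * s))" using small[of w] u by auto
          then have "cmod (B w) ^ q \<le> exp (- (M * s)) ^ q" by (intro power_mono) auto
          also have "\<dots> = exp (- (M * s * q))" by (simp add: exp_of_nat_mult[symmetric] mult.commute mult.left_commute)
          finally have 3: "cmod (B w) ^ q \<le> exp (- (M * s * q))" .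
          have "(T / u) ^ p = exp (real p * b)"
            using pos u by (simp add: b_def exp_of_nat_mult)
          also have "\<dots> \<le> exp (M * s * q)"
            using p1 a ab by (simp add: divide_simps split: if_splits)
          finally have 4: "(T / u) ^ p \<le> exp (M * s * q)" .
          have "cmod (w - x) = u" using 2 by (simp add: dist_norm norm_minus_commute)
          then have "cmod (?h w) = cmod (B w) ^ q * (T / u) ^ p"
            using pos u by (simp add: norm_mult norm_power norm_divide)
          also have "\<dots> \<le> exp (- (M * s * q)) * exp (M * s * q)"
            using 3 4 pos u by (intro mult_mono) auto
          finally show ?thesis by (simp add: exp_minus)
        qed
      qed
      then have 5: "cmod (B y) ^ q * (T / cmod (y - x)) ^ p \<le> 1"
        using pos by (simp add: norm_mult norm_power norm_divide)
      have dy: "0 < cmod (y - x)" "cmod (y - x) < R'" using y(1) yo assms(1)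
        by (auto simp: dist_norm norm_minus_commute)
      have "exp (- s * q) = exp (-s) ^ q" by (simp add: exp_of_nat_mult[symmetric] mult.commute)
      also have "\<dots> \<le> cmod (B y) ^ q" using y(2) by (intro power_mono) auto
      finally have 6: "exp (- s * q) \<le> cmod (B y) ^ q" .
      have "exp (real p * a) = (T / R') ^ p" using pos by (simp add: a_def exp_of_nat_mult)
      also have "\<dots> \<le> (T / cmod (y - x)) ^ p"
        using dy pos by (intro power_mono divide_left_mono) auto
      finally have 7: "exp (real p * a) \<le> (T / cmod (y - x)) ^ p" .
      have "exp (- s * q) * exp (real p * a) \<le> 1"
        using mult_mono[OF 6 7] 5 by (meson exp_ge_zero norm_ge_zero order_trans zero_le_power)
      then have "real p * a \<le> s * q" by (simp add: exp_add[symmetric])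
      moreover have "M * s * q / b * a = 2 * (s * q)" using a ab by (simp add: M_def)
      then have "2 * (s * q) < (real p + 1) * a" using p2 a by (metis mult_strict_right_mono)
      ultimately show False using sq by (simp add: algebra_simps)
    qed
  qed
qed

text \<open>The roots in the ball are moved to their mirror images, as in a Blaschke product.\<close>

lemma poly_remove_roots_in_ball:
  fixes P :: "complex poly"
  assumes "P \<noteq> 0" "r > 0"
  shows "\<exists>H. (\<forall>z\<in>ball c r. poly H z \<noteq> 0) \<and> (\<forall>z\<in>sphere c r. cmod (poly H z) = cmod (poly P z))
    \<and> (\<forall>z\<in>cball c r. cmod (poly P z) \<le> cmod (poly H z))"
  using assms(1)
proof (induction "degree P" arbitrary: P rule: less_induct)
  case less
  show ?case
  proof (cases "\<exists>a\<in>ball c r. poly P a = 0")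
    case False
    then show ?thesis by (intro exI[of _ P]) auto
  next
    case True
    then obtain a where a: "a \<in> ball c r" "poly P a = 0" by blast
    then obtain Q where Q: "P = [:-a, 1:] * Q" by (metis dvdE poly_eq_0_iff_dvd)
    then have Q0: "Q \<noteq> 0" using less.prems by auto
    have "degree P = Suc (degree Q)" unfolding Q using Q0 by (subst degree_mult_eq) auto
    then obtain H where H: "\<And>z. z \<in> ball c r \<Longrightarrow> poly H z \<noteq> 0"
      "\<And>z. z \<in> sphere c r \<Longrightarrow> cmod (poly H z) = cmod (poly Q z)"
      "\<And>z. z \<in> cball c r \<Longrightarrow> cmod (poly Q z) \<le> cmod (poly H z)"
      using less.hyps[of Q] Q0 by (metis lessI)
    \<comment> \<open>The denominator of the Blaschke factor of \<open>a\<close>: on the circle its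
      modulus is that of \<open>z - a\<close>, and its zero is the mirror image of \<open>a\<close>
      (infinity if \<open>a = c\<close>).\<close>
    define F where "F = [: of_real r + cnj (a - c) * c / of_real r, - cnj (a - c) / of_real r :]"
    have F: "poly F z = (of_real (r\<^sup>2) - cnj (a - c) * (z - c)) / of_real r" for z
      using assms(2) by (simp add: F_def field_simps power2_eq_square)
    have ac: "cmod (a - c) < r" using a by (simp add: dist_norm norm_minus_commute)
    have sq: "(cmod (poly F z))\<^sup>2 = (cmod (z - a))\<^sup>2 + (r\<^sup>2 - (cmod (a - c))\<^sup>2) * (r\<^sup>2 - (cmod (z - c))\<^sup>2) / r\<^sup>2" for z
    proof -
      have "(cmod (of_real (r\<^sup>2) - cnj (a - c) * (z - c)))\<^sup>2 =
          r\<^sup>2 * (cmod (z - a))\<^sup>2 + (r\<^sup>2 - (cmod (a - c))\<^sup>2) * (r\<^sup>2 - (cmod (z - c))\<^sup>2)"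
        unfolding cmod_power2 by (simp add: power2_eq_square) algebra
      then show ?thesis unfolding F using assms(2)
        by (simp add: norm_divide power_divide field_simps)
    qed
    have acs: "(cmod (a - c))\<^sup>2 < r\<^sup>2" using ac by (simp add: power_strict_mono)
    have le: "cmod (z - a) \<le> cmod (poly F z)" if "z \<in> cball c r" for z
    proof (rule power2_le_imp_le)
      have "(cmod (z - c))\<^sup>2 \<le> r\<^sup>2" using that by (intro power_mono) (auto simp: dist_norm norm_minus_commute)
      then show "(cmod (z - a))\<^sup>2 \<le> (cmod (poly F z))\<^sup>2" unfolding sq using acs by simp
    qed simp
    have eq: "cmod (poly F z) = cmod (z - a)" if "z \<in> sphere c r" for z
    proof (rule power2_eq_imp_eq)
      have "cmod (z - c) = r" using that by (auto simp: dist_norm norm_minus_commute)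
      then show "(cmod (poly F z))\<^sup>2 = (cmod (z - a))\<^sup>2" unfolding sq by simp
    qed auto
    have nz: "poly F z \<noteq> 0" if "z \<in> ball c r" for z
    proof
      assume "poly F z = 0"
      then have "of_real (r\<^sup>2) = cnj (a - c) * (z - c)" unfolding F using assms(2) by simp
      then have "r\<^sup>2 = cmod (a - c) * cmod (z - c)"
        by (metis complex_mod_cnj norm_mult norm_of_real abs_power2 power2_abs real_norm_def)
      moreover have "cmod (a - c) * cmod (z - c) < r * r"
        using ac that by (intro mult_strict_mono') (auto simp: dist_norm norm_minus_commute)
      ultimately show False by (simp add: power2_eq_square)
    qed
    show ?thesis
    proof (intro exI[of _ "F * H"] conjI ballI)
      show "poly (F * H) z \<noteq> 0" if "z \<in> ball c r" for z using nz H(1) that by simp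
      show "cmod (poly (F * H) z) = cmod (poly P z)" if "z \<in> sphere c r" for z
        using eq[OF that] H(2)[OF that] by (simp add: Q norm_mult left_diff_distrib[symmetric])
      show "cmod (poly P z) \<le> cmod (poly (F * H) z)" if "z \<in> cball c r" for z
        using le[OF that] H(3)[OF that] by (auto simp: Q norm_mult left_diff_distrib[symmetric] intro: mult_mono)
    qed
  qed
qed

text \<open>A Cayley map takes \<open>- ln h\<close>, which has values in the right half-plane, to
  the unit disc, where the Schwarz lemma applies. The constant 5 is Harnack's (1 + t) / (1 - t) at t
  = 2/3.\<close>

lemma harnack_zero_free:
  assumes hol: "h holomorphic_on ball c r" and nz: "\<And>z. z \<in> ball c r \<Longrightarrow> h z \<noteq> 0"
    and le1: "\<And>z. z \<in> ball c r \<Longrightarrow> cmod (h z) \<le> 1" and r: "r > 0"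
    and hc: "exp (-s) \<le> cmod (h c)" and z: "dist c z \<le> 2/3 * r"
  shows "exp (- (5 * s)) \<le> cmod (h z)"
proof -
  obtain L where L: "L holomorphic_on ball c r" "\<And>z. z \<in> ball c r \<Longrightarrow> h z = exp (L z)"
    using contractible_imp_holomorphic_log[OF hol _ nz] convex_imp_contractible convex_ball by metis
  have ReL: "Re (L w) = ln (cmod (h w))" if "w \<in> ball c r" for w
    using L(2)[OF that] by simp
  have zb: "z \<in> ball c r" using z r by auto
  have cb: "c \<in> ball c r" using r by simp
  have "- (5 * s) - Re (L z) \<le> 0 + e" if e: "e > 0" for e
  proof -
    \<comment> \<open>The shift makes the real part strictly positive, so that the Cayley image lies
      in the open disc; it contributes \<open>5 * (e/4) - e/4 = e\<close> in the end.\<close>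
    define H where "H w = of_real (e/4) - L (c + of_real r * w)" for w
    have inb: "c + of_real r * w \<in> ball c r" if "cmod w < 1" for w
      using that r by (simp add: dist_norm norm_mult)
    have ReH: "Re (H w) \<ge> e/4" if "cmod w < 1" for w
      using ReL[OF inb[OF that]] le1[OF inb[OF that]] nz[OF inb[OF that]]
      by (simp add: H_def ln_le_zero_iff)
    have holH: "H holomorphic_on ball 0 1"
      unfolding H_def
      by (intro holomorphic_intros holomorphic_on_compose_gen[OF _ L(1), unfolded o_def]) (use inb in auto)
    define v where "v = H 0"
    have vp: "Re v > 0" using ReH[of 0] e by (simp add: v_def)
    define \<phi> where "\<phi> w = (H w - v) / (H w + cnj v)" for w
    have den: "H w + cnj v \<noteq> 0" if "cmod w < 1" for w
    proof -
      have "Re (H w + cnj v) > 0" using ReH[OF that] vp e by simp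
      then show ?thesis by (metis less_irrefl zero_complex.simps(1))
    qed
    define \<xi> where "\<xi> = (z - c) / of_real r"
    have \<xi>: "cmod \<xi> \<le> 2/3" using z r by (simp add: \<xi>_def norm_divide dist_norm norm_minus_commute divide_simps)
    have "cmod (\<phi> \<xi>) \<le> cmod \<xi>"
    proof (rule Schwarz_Lemma(1))
      show "\<phi> holomorphic_on ball 0 1" unfolding \<phi>_def
        by (intro holomorphic_intros holH) (use den in auto)
      show "\<phi> 0 = 0" by (simp add: \<phi>_def v_def)
      show "cmod \<xi> < 1" using \<xi> by simp
      show "cmod (\<phi> w) < 1" if w: "cmod w < 1" for w
      proof -
        have "(cmod (H w + cnj v))\<^sup>2 - (cmod (H w - v))\<^sup>2 = 4 * Re (H w) * Re v"
          unfolding cmod_power2 by (simp add: power2_eq_square algebra_simps)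
        moreover have "4 * Re (H w) * Re v > 0" using ReH[OF w] vp e by (intro mult_pos_pos) auto
        ultimately have "(cmod (H w - v))\<^sup>2 < (cmod (H w + cnj v))\<^sup>2" by linarith
        then have "cmod (H w - v) < cmod (H w + cnj v)" by (rule power2_less_imp_less) simp
        then show ?thesis unfolding \<phi>_def norm_divide by (simp add: divide_simps)
      qed
    qed
    then have "cmod (\<phi> \<xi>) \<le> 2/3" using \<xi> by linarith
    then have "cmod (H \<xi> - v) \<le> 2/3 * cmod (H \<xi> + cnj v)"
      using den[of \<xi>] \<xi> unfolding \<phi>_def norm_divide by (simp add: divide_simps split: if_splits)
    then have "(cmod (H \<xi> - v))\<^sup>2 \<le> (2/3 * cmod (H \<xi> + cnj v))\<^sup>2" by (intro power_mono) auto
    then have **: "9 * ((Re (H \<xi>) - Re v)\<^sup>2 + (Im (H \<xi>) - Im v)\<^sup>2) \<le> 4 * ((Re (H \<xi>) + Re v)\<^sup>2 + (Im (H \<xi>) - Im v)\<^sup>2)"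
      unfolding power_mult_distrib cmod_power2 by (simp add: power2_eq_square algebra_simps)
    have "0 \<le> (Im (H \<xi>) - Im v)\<^sup>2" by simp
    with ** have "9 * (Re (H \<xi>) - Re v)\<^sup>2 \<le> 4 * (Re (H \<xi>) + Re v)\<^sup>2"
      unfolding distrib_left by linarith
    then have "(3 * (Re (H \<xi>) - Re v))\<^sup>2 \<le> (2 * (Re (H \<xi>) + Re v))\<^sup>2"
      unfolding power_mult_distrib by simp
    moreover have "0 \<le> 2 * (Re (H \<xi>) + Re v)" using ReH[of \<xi>] \<xi> vp e by simp
    ultimately have "3 * (Re (H \<xi>) - Re v) \<le> 2 * (Re (H \<xi>) + Re v)" by (rule power2_le_imp_le)
    then have "Re (H \<xi>) \<le> 5 * Re v" by simp
    moreover have "H \<xi> = of_real (e/4) - L z" using r by (simp add: H_def \<xi>_def)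
    moreover have "v = of_real (e/4) - L c" by (simp add: v_def H_def)
    moreover have "- s \<le> Re (L c)" using ReL[OF cb] hc nz[OF cb] by (metis exp_gt_zero ln_exp ln_mono)
    ultimately show ?thesis by simp
  qed
  then have "- (5 * s) - Re (L z) \<le> 0" by (rule field_le_epsilon)
  then have "exp (- (5 * s)) \<le> exp (Re (L z))" by simp
  then show ?thesis using L(2)[OF zb] by simp
qed

text \<open>Partial sums of the Taylor series. They are wanted because zeros are moved out of a disc
  by induction on a degree, hence for polynomials.\<close>

lemma holomorphic_approx_poly_cball:
  fixes B :: "complex \<Rightarrow> complex"
  assumes "B holomorphic_on ball c R" "r < R" "0 < r" "e > 0"
  shows "\<exists>P. \<forall>z\<in>cball c r. cmod (B z - poly P z) \<le> e"
proof -
  define a where "a = fps_nth (fps_expansion B c)"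
  have cr: "ereal r < conv_radius a"
    using conv_radius_fps_expansion[of B c "ereal R"] assms
    by (simp add: a_def fps_conv_radius_def eball_def) (metis assms(1) assms(2) ereal_less_le less_ereal.simps(1) conv_radius_fps_expansion eball_ereal fps_conv_radius_def order.strict_trans1 order_less_le_trans)
  obtain l where l: "uniform_limit (cball c r) (\<lambda>n x. \<Sum>i<n. a i * (x - c) ^ i) l sequentially"
    using powser_uniformly_convergent[OF cr] unfolding uniformly_convergent_on_def by blast
  have "l z = B z" if z: "z \<in> cball c r" for z
  proof -
    have "(\<lambda>n. (deriv ^^ n) B c / fact n * (z - c) ^ n) sums B z"
      using holomorphic_power_series[of B c R z] assms z by auto
    then have "(\<lambda>n. \<Sum>i<n. a i * (z - c) ^ i) \<longlonglongrightarrow> B z"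
      by (simp add: sums_def a_def fps_expansion_def)
    moreover have "(\<lambda>n. \<Sum>i<n. a i * (z - c) ^ i) \<longlonglongrightarrow> l z" using tendsto_uniform_limitI[OF l z] .
    ultimately show ?thesis using LIMSEQ_unique by blast
  qed
  moreover have "\<forall>\<^sub>F n in sequentially. \<forall>x\<in>cball c r. dist (\<Sum>i<n. a i * (x - c) ^ i) (l x) < e"
    using uniform_limitD[OF l \<open>e > 0\<close>] .
  then obtain n where "\<forall>x\<in>cball c r. dist (\<Sum>i<n. a i * (x - c) ^ i) (l x) < e"
    using eventually_happens'[OF sequentially_bot] by blast
  ultimately have "\<forall>x\<in>cball c r. cmod (B x - poly (\<Sum>i<n. smult (a i) ([:-c, 1:] ^ i)) x) \<le> e"
    by (auto simp: poly_sum dist_norm norm_minus_commute intro: less_imp_le)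
  then show ?thesis by blast
qed

text \<open>Harnack cannot be applied to \<open>B\<close>, which may vanish. A polynomial close to
  \<open>B\<close> has its zeros reflected out of the disc: the modulus is unchanged on the circle,
  where the bound on the product is used, and not decreased at the centre, where the lower bound is
  used. The approximation error \<open>e\<close> tends to 0 at the end.\<close>

lemma two_constants_local:
  assumes A: "A holomorphic_on ball c R" and B: "B holomorphic_on ball c R"
    and r: "0 < r" "r < R"
    and B1: "\<And>z. z \<in> ball c R \<Longrightarrow> cmod (B z) \<le> 1"
    and AB: "\<And>z. z \<in> ball c R \<Longrightarrow> cmod (A z * B z) \<le> exp m"
    and Bc: "exp (-s) \<le> cmod (B c)" and z: "dist c z \<le> 2/3 * r"
  shows "cmod (A z) \<le> exp (m + 5 * s)"
proof -
  have contA: "continuous_on (cball c r) A"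
    using holomorphic_on_imp_continuous_on[OF A] by (rule continuous_on_subset) (use r in auto)
  then have "bounded (A ` cball c r)" by (simp add: compact_continuous_image compact_imp_bounded)
  then obtain K where K: "\<And>z. z \<in> cball c r \<Longrightarrow> cmod (A z) \<le> K" unfolding bounded_iff by blast
  have K0: "K \<ge> 0" using K[of c] r norm_ge_zero[of "A c"] by (simp del: norm_ge_zero)
  have main: "cmod (A z) * ((1 + e) * ((exp (-s) - e) / (1 + e)) ^ 5) \<le> exp m + e * K"
    if e: "0 < e" "e < exp (-s)" for e
  proof -
    obtain P where P: "\<And>z. z \<in> cball c r \<Longrightarrow> cmod (B z - poly P z) \<le> e"
      using holomorphic_approx_poly_cball[OF B r(2,1) e(1)] by blast
    have Pc: "exp (-s) - e \<le> cmod (poly P c)"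
      using P[of c] Bc r norm_triangle_ineq2[of "B c" "poly P c"] by simp
    then have "P \<noteq> 0" using e by auto
    then obtain H where H: "\<And>z. z \<in> ball c r \<Longrightarrow> poly H z \<noteq> 0"
      "\<And>z. z \<in> sphere c r \<Longrightarrow> cmod (poly H z) = cmod (poly P z)"
      "\<And>z. z \<in> cball c r \<Longrightarrow> cmod (poly P z) \<le> cmod (poly H z)"
      using poly_remove_roots_in_ball[of P r c] r by metis
    have PB: "cmod (poly P w) \<le> cmod (B w) + e" if "w \<in> cball c r" for w
      using P[OF that] norm_triangle_ineq2[of "poly P w" "B w"] by (simp add: norm_minus_commute)
    have H1: "cmod (poly H w) \<le> 1 + e" if "w \<in> cball c r" for w
    proof (rule maximum_modulus_frontier[of "poly H" "cball c r"])
      show "cmod (poly H v) \<le> 1 + e" if "v \<in> frontier (cball c r)" for v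
        using that H(2)[of v] PB[of v] B1[of v] r by auto
    qed (use that in \<open>auto intro!: holomorphic_intros continuous_intros\<close>)
    have AH: "cmod (A w * poly H w) \<le> exp m + e * K" if "w \<in> cball c r" for w
    proof (rule maximum_modulus_frontier[of "\<lambda>w. A w * poly H w" "cball c r"])
      show "(\<lambda>w. A w * poly H w) holomorphic_on interior (cball c r)"
        using r by (intro holomorphic_intros holomorphic_on_subset[OF A]) auto
      show "continuous_on (closure (cball c r)) (\<lambda>w. A w * poly H w)"
        using contA by (auto intro!: continuous_intros)
      fix v assume "v \<in> frontier (cball c r)"
      then have v: "v \<in> sphere c r" "v \<in> cball c r" "v \<in> ball c R" using r by auto
      have "cmod (A v * poly H v) = cmod (A v) * cmod (poly P v)" using H(2)[OF v(1)] by (simp add: norm_mult)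
      also have "\<dots> \<le> cmod (A v) * (cmod (B v) + e)" using PB[OF v(2)] by (simp add: mult_left_mono)
      also have "\<dots> = cmod (A v * B v) + e * cmod (A v)" by (simp add: norm_mult algebra_simps)
      also have "\<dots> \<le> exp m + e * K" using AB[OF v(3)] K[OF v(2)] e by (intro add_mono mult_left_mono) auto
      finally show "cmod (A v * poly H v) \<le> exp m + e * K" .
    qed (use that in auto)
    let ?q = "(exp (-s) - e) / (1 + e)"
    have q: "?q > 0" using e by simp
    have "exp (- (5 * (- ln ?q))) \<le> cmod (poly H z / of_real (1 + e))"
    proof (rule harnack_zero_free[where h = "\<lambda>z. poly H z / of_real (1 + e)"])
      show "(\<lambda>z. poly H z / of_real (1 + e)) holomorphic_on ball c r"
        using e by (intro holomorphic_intros) auto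
      show "poly H w / of_real (1 + e) \<noteq> 0" if "w \<in> ball c r" for w
        using H(1)[OF that] e by (simp add: add_eq_0_iff complex_eq_iff)
      show "cmod (poly H w / of_real (1 + e)) \<le> 1" if "w \<in> ball c r" for w
        using H1[of w] that e unfolding norm_divide norm_of_real by (simp add: divide_simps)
      show "exp (- (- ln ?q)) \<le> cmod (poly H c / of_real (1 + e))"
        using q Pc H(3)[of c] r e unfolding norm_divide norm_of_real
        by (simp add: divide_right_mono)
    qed (use r z in auto)
    moreover have "exp (- (5 * (- ln ?q))) = ?q ^ 5"
      using q exp_of_nat_mult[of 5 "ln ?q"] by simp
    ultimately have "?q ^ 5 \<le> cmod (poly H z) / (1 + e)"
      using e unfolding norm_divide norm_of_real by simp
    then have "(1 + e) * ?q ^ 5 \<le> cmod (poly H z)" using e by (simp add: le_divide_eq mult.commute)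
    then have "cmod (A z) * ((1 + e) * ?q ^ 5) \<le> cmod (A z) * cmod (poly H z)" by (rule mult_left_mono) simp
    also have "\<dots> \<le> exp m + e * K" using AH[of z] z r by (simp add: norm_mult)
    finally show ?thesis .
  qed
  have "((\<lambda>e. cmod (A z) * ((1 + e) * ((exp (-s) - e) / (1 + e)) ^ 5)) \<longlongrightarrow>
      cmod (A z) * ((1 + 0) * ((exp (-s) - 0) / (1 + 0)) ^ 5)) (at_right 0)"
    by (intro tendsto_intros) auto
  moreover have "((\<lambda>e. exp m + e * K) \<longlongrightarrow> exp m + 0 * K) (at_right 0)" by (intro tendsto_intros)
  moreover have "\<forall>\<^sub>F e in at_right 0. cmod (A z) * ((1 + e) * ((exp (-s) - e) / (1 + e)) ^ 5) \<le> exp m + e * K"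
    using eventually_at_right_real[of 0 "exp (-s)"] main by (auto elim: eventually_mono)
  ultimately have "cmod (A z) * ((1 + 0) * ((exp (-s) - 0) / (1 + 0)) ^ 5) \<le> exp m + 0 * K"
    by (intro tendsto_le[OF trivial_limit_at_right_real])
  moreover have "exp (-s) ^ 5 = exp (- (5 * s))" by (simp add: exp_of_nat_mult[symmetric])
  ultimately have "cmod (A z) * exp (- (5 * s)) \<le> exp m" by simp
  then show ?thesis by (simp add: exp_add exp_minus field_simps)
qed

text \<open>A lower bound for \<open>B\<close> travels along a chain of discs by the three circles
  lemma, losing a constant factor in the exponent at each link. A disc about the point finally
  reached near \<open>x\<close> then gives the bound for \<open>A\<close>.\<close>

lemma two_constants_pair:
  assumes G: "open G" "connected G" and a: "a \<in> G" and x: "x \<in> G"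
  shows "\<exists>t>0. \<exists>u>0. \<exists>M\<ge>0. \<forall>A B m s y. A holomorphic_on G \<longrightarrow> B holomorphic_on G \<longrightarrow>
    (\<forall>z\<in>G. cmod (B z) \<le> 1) \<longrightarrow> (\<forall>z\<in>G. cmod (A z * B z) \<le> exp m) \<longrightarrow> s > 0 \<longrightarrow>
    y \<in> ball a t \<longrightarrow> exp (-s) \<le> cmod (B y) \<longrightarrow> (\<forall>z\<in>ball x u. cmod (A z) \<le> exp (m + M * s))"
proof -
  obtain t' where "t' > 0" "ball a t' \<subseteq> G" using G(1) a openE by blast
  define t where "t = t' / 3"
  have t: "t > 0" "ball a (3 * t) \<subseteq> G" using \<open>t' > 0\<close> \<open>ball a t' \<subseteq> G\<close> by (auto simp: t_def)
  \<comment> \<open>All radii are allowed in the conclusion, so that the point found at one link can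
    be placed close enough to the next centre.\<close>
  define Q where "Q x \<longleftrightarrow> (\<forall>\<rho>>0. \<exists>M\<ge>1. \<forall>B s. B holomorphic_on G \<longrightarrow> (\<forall>z\<in>G. cmod (B z) \<le> 1) \<longrightarrow> s > 0 \<longrightarrow>
    (\<exists>y\<in>ball a t. exp (-s) \<le> cmod (B y)) \<longrightarrow> (\<exists>y\<in>ball x \<rho>. exp (- (M * s)) \<le> cmod (B y)))" for x
  have step: "\<exists>M::real\<ge>1. \<forall>B s. B holomorphic_on G \<longrightarrow> (\<forall>z\<in>G. cmod (B z) \<le> 1) \<longrightarrow> s > 0 \<longrightarrow>
    (\<exists>y\<in>ball x R'. exp (-s) \<le> cmod (B y)) \<longrightarrow> (\<exists>y\<in>ball x \<rho>. exp (- (M * s)) \<le> cmod (B y))"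
    if "ball x R \<subseteq> G" "0 < \<rho>" "0 < R'" "R' < R" for x R R' \<rho>
  proof -
    define \<rho>' where "\<rho>' = min \<rho> (R'/2)"
    have \<rho>': "0 < \<rho>'" "\<rho>' < R'" "\<rho>' \<le> \<rho>" using that by (auto simp: \<rho>'_def)
    obtain M where "M \<ge> 1" and M: "\<And>B s. B holomorphic_on ball x R \<Longrightarrow> (\<forall>z\<in>ball x R. cmod (B z) \<le> 1) \<Longrightarrow> s > 0 \<Longrightarrow>
     (\<exists>y\<in>ball x R'. exp (-s) \<le> cmod (B y)) \<Longrightarrow> (\<exists>y\<in>ball x \<rho>'. exp (- (M * s)) \<le> cmod (B y))"
      using three_circles_lower[OF \<rho>'(1,2) \<open>R' < R\<close>] by blast
    have "\<exists>y\<in>ball x \<rho>. exp (- (M * s)) \<le> cmod (B y)"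
      if BB: "B holomorphic_on G" "\<forall>z\<in>G. cmod (B z) \<le> 1" "s > 0" "\<exists>y\<in>ball x R'. exp (-s) \<le> cmod (B y)" for B s
      using M[of B s] BB \<open>ball x R \<subseteq> G\<close> \<rho>'(3) subset_ball[of \<rho>' \<rho> x]
      by (meson holomorphic_on_subset subset_eq)
    then show ?thesis using \<open>M \<ge> 1\<close> by blast
  qed
  have Qa: "Q a"
    unfolding Q_def using step[OF t(2), of _ t] t(1) by auto
  have spread: "Q x2" if x1: "Q x1" and d: "ball x2 (3*u) \<subseteq> G" "dist x1 x2 < 2 * u" "u > 0" for x1 x2 u
    unfolding Q_def
  proof (intro allI impI)
    fix \<rho> :: real assume \<rho>: "\<rho> > 0"
    obtain M1 where M1: "M1 \<ge> 1" "\<And>B s. B holomorphic_on G \<Longrightarrow> (\<forall>z\<in>G. cmod (B z) \<le> 1) \<Longrightarrow> s > 0 \<Longrightarrow>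
      (\<exists>y\<in>ball a t. exp (-s) \<le> cmod (B y)) \<Longrightarrow> (\<exists>y\<in>ball x1 (u/2). exp (- (M1 * s)) \<le> cmod (B y))"
      using x1 d(3) unfolding Q_def by (metis half_gt_zero)
    obtain M2 where M2: "M2 \<ge> 1" "\<And>B s. B holomorphic_on G \<Longrightarrow> (\<forall>z\<in>G. cmod (B z) \<le> 1) \<Longrightarrow> s > 0 \<Longrightarrow>
      (\<exists>y\<in>ball x2 (5/2*u). exp (-s) \<le> cmod (B y)) \<Longrightarrow> (\<exists>y\<in>ball x2 \<rho>. exp (- (M2 * s)) \<le> cmod (B y))"
      using step[OF d(1) \<rho>, of "5/2*u"] d(3) by auto
    have sub: "ball x1 (u/2) \<subseteq> ball x2 (5/2*u)"
    proof
      fix y assume "y \<in> ball x1 (u/2)"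
      then show "y \<in> ball x2 (5/2*u)" using d(2) dist_triangle[of x2 y x1] by (simp add: dist_commute)
    qed
    have "\<exists>y\<in>ball x2 \<rho>. exp (- ((M2 * M1) * s)) \<le> cmod (B y)"
      if "B holomorphic_on G" "\<forall>z\<in>G. cmod (B z) \<le> 1" "s > 0" "\<exists>y\<in>ball a t. exp (-s) \<le> cmod (B y)" for B s
    proof -
      have "\<exists>y\<in>ball x2 (5/2*u). exp (- (M1 * s)) \<le> cmod (B y)" using M1(2)[OF that] sub by blast
      then show ?thesis using M2(2)[of B "M1 * s"] that M1(1) by (simp add: mult.assoc)
    qed
    moreover have "M2 * M1 \<ge> 1" using M1(1) M2(1) by (metis mult_mono mult_1 order_trans zero_le_one)
    ultimately show "\<exists>M\<ge>1. \<forall>B s. B holomorphic_on G \<longrightarrow> (\<forall>z\<in>G. cmod (B z) \<le> 1) \<longrightarrow> s > 0 \<longrightarrow>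
      (\<exists>y\<in>ball a t. exp (-s) \<le> cmod (B y)) \<longrightarrow> (\<exists>y\<in>ball x2 \<rho>. exp (- (M * s)) \<le> cmod (B y))" by blast
  qed
  have Qx: "Q x"
  proof (rule connected_induction_simple[where P = Q, OF G(2) a x Qa])
    fix w assume "w \<in> G"
    then obtain v where v: "v > 0" "ball w v \<subseteq> G" using G(1) openE by blast
    define u where "u = v / 4"
    have u: "u > 0" "ball w (4*u) \<subseteq> G" using v by (auto simp: u_def)
    show "\<exists>T. openin (top_of_set G) T \<and> w \<in> T \<and> (\<forall>x\<in>T. \<forall>y\<in>T. Q x \<longrightarrow> Q y)"
    proof (intro exI[of _ "ball w u"] conjI ballI impI)
      have "ball w u \<subseteq> G" using u subset_ball[of u "4*u" w] by auto
      then show "openin (top_of_set G) (ball w u)" using G(1) by (simp add: openin_open_eq)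
      show "w \<in> ball w u" using u by simp
      fix x1 x2 assume x12: "x1 \<in> ball w u" "x2 \<in> ball w u" "Q x1"
      show "Q x2"
      proof (rule spread[OF x12(3) _ _ u(1)])
        show "ball x2 (3*u) \<subseteq> G"
        proof
          fix y assume "y \<in> ball x2 (3*u)"
          then have "y \<in> ball w (4*u)" using x12(2) dist_triangle[of w y x2] by simp
          then show "y \<in> G" using u by blast
        qed
        show "dist x1 x2 < 2 * u" using x12 dist_triangle[of x1 x2 w] by (simp add: dist_commute)
      qed
    qed
  qed
  obtain v where v: "v > 0" "ball x v \<subseteq> G" using G(1) x openE by blast
  define u where "u = v / 5"
  have u: "u > 0" "ball x (5*u) \<subseteq> G" using v by (auto simp: u_def)
  obtain M where M: "M \<ge> 1" "\<And>B s. B holomorphic_on G \<Longrightarrow> (\<forall>z\<in>G. cmod (B z) \<le> 1) \<Longrightarrow> s > 0 \<Longrightarrow>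
      (\<exists>y\<in>ball a t. exp (-s) \<le> cmod (B y)) \<Longrightarrow> (\<exists>y\<in>ball x u. exp (- (M * s)) \<le> cmod (B y))"
    using Qx u(1) unfolding Q_def by blast
  have "cmod (A z) \<le> exp (m + (5*M) * s)"
    if A: "A holomorphic_on G" and B: "B holomorphic_on G" "\<forall>z\<in>G. cmod (B z) \<le> 1"
      and AB: "\<forall>z\<in>G. cmod (A z * B z) \<le> exp m" and s: "s > 0" "y \<in> ball a t" "exp (-s) \<le> cmod (B y)"
      and z: "z \<in> ball x u" for A B m s y z
  proof -
    obtain y' where y': "y' \<in> ball x u" "exp (- (M * s)) \<le> cmod (B y')" using M(2)[OF B s(1)] s by blast
    have sub: "ball y' (4*u) \<subseteq> G"
    proof
      fix w assume "w \<in> ball y' (4*u)"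
      then have "w \<in> ball x (5*u)" using y'(1) dist_triangle[of x w y'] by simp
      then show "w \<in> G" using u by blast
    qed
    have "cmod (A z) \<le> exp (m + 5 * (M * s))"
    proof (rule two_constants_local[where A = A and z = z and R = "4*u" and r = "3*u" and c = y' and B = B])
      show "dist y' z \<le> 2 / 3 * (3 * u)" using y'(1) z dist_triangle[of y' z x] by (simp add: dist_commute)
    qed (use sub u A B AB y' in \<open>auto intro: holomorphic_on_subset\<close>)
    then show ?thesis by (simp add: mult.assoc)
  qed
  then show ?thesis using t(1) u(1) M(1)
    by (intro exI[of _ t] conjI exI[of _ u] exI[of _ "5*M"]) auto
qed

text \<open>A quantitative uniqueness principle.  With \<open>A = 1 / B\<close> it is Harnack's inequality for
  \<open>- ln \<bar>B\<bar>\<close>; in general both functions may have zeros.\<close>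

lemma two_constants:
  assumes G: "open G" "connected G" and C: "compact C" "C \<subseteq> G"
  shows "\<exists>M\<ge>0. \<forall>A B m s y. A holomorphic_on G \<longrightarrow> B holomorphic_on G \<longrightarrow>
    (\<forall>z\<in>G. cmod (B z) \<le> 1) \<longrightarrow> (\<forall>z\<in>G. cmod (A z * B z) \<le> exp m) \<longrightarrow>
    y \<in> C \<longrightarrow> exp (-s) \<le> cmod (B y) \<longrightarrow> (\<forall>z\<in>C. cmod (A z) \<le> exp (m + M * s))"
proof -
  define P where "P M S T \<longleftrightarrow> (\<forall>A B m s y. A holomorphic_on G \<longrightarrow> B holomorphic_on G \<longrightarrow>
    (\<forall>z\<in>G. cmod (B z) \<le> 1) \<longrightarrow> (\<forall>z\<in>G. cmod (A z * B z) \<le> exp m) \<longrightarrow> s > 0 \<longrightarrow>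
    y \<in> S \<longrightarrow> exp (-s) \<le> cmod (B y) \<longrightarrow> (\<forall>z\<in>T. cmod (A z) \<le> exp (m + M * s)))" for M :: real and S T
  \<comment> \<open>The constants of the preceding lemma depend on the pair of points; product
    neighbourhoods and compactness of \<open>C \<times> C\<close> make them uniform.\<close>
  have ex: "\<exists>U M. open U \<and> w \<in> U \<and> M \<ge> 0 \<and> (\<exists>S T. U = S \<times> T \<and> P M S T)" if "w \<in> C \<times> C" for w
  proof -
    obtain a x where w: "w = (a, x)" by fastforce
    then have "a \<in> G" "x \<in> G" using that C by auto
    from two_constants_pair[OF G this] obtain t u M where *: "t > 0" "u > 0" "M \<ge> 0" "P M (ball a t) (ball x u)"
      unfolding P_def by blast
    then show ?thesis unfolding w
      by (intro exI[of _ "ball a t \<times> ball x u"] exI[of _ M] conjI) (auto simp: open_Times)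
  qed
  then obtain U M where UM: "\<And>w. w \<in> C \<times> C \<Longrightarrow> open (U w) \<and> w \<in> U w \<and> M w \<ge> 0 \<and> (\<exists>S T. U w = S \<times> T \<and> P (M w) S T)"
    by metis
  have "compact (C \<times> C)" using C by (simp add: compact_Times)
  then obtain D where D: "D \<subseteq> C \<times> C" "finite D" "C \<times> C \<subseteq> (\<Union>w\<in>D. U w)"
    by (rule compactE_image[of _ "C \<times> C" U]) (use UM in auto)
  define N where "N = Max (insert 0 (M ` D))"
  have N: "N \<ge> 0" "\<And>w. w \<in> D \<Longrightarrow> M w \<le> N" unfolding N_def using D(2) by auto
  have pos: "cmod (A z) \<le> exp (m + N * s)"
    if h: "A holomorphic_on G" "B holomorphic_on G" "\<forall>z\<in>G. cmod (B z) \<le> 1"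
      "\<forall>z\<in>G. cmod (A z * B z) \<le> exp m" "s > 0" "y \<in> C" "exp (-s) \<le> cmod (B y)" "z \<in> C" for A B m s y z
  proof -
    obtain w where w: "w \<in> D" "(y, z) \<in> U w" using D(3) h by blast
    then obtain S T where "U w = S \<times> T" "P (M w) S T" using UM[of w] D(1) by auto
    then have "cmod (A z) \<le> exp (m + M w * s)" using w(2) h unfolding P_def by blast
    also have "\<dots> \<le> exp (m + N * s)" using N(2)[OF w(1)] h by simp
    finally show ?thesis .
  qed
  have "cmod (A z) \<le> exp (m + N * s)"
    if h: "A holomorphic_on G" "B holomorphic_on G" "\<forall>z\<in>G. cmod (B z) \<le> 1"
      "\<forall>z\<in>G. cmod (A z * B z) \<le> exp m" "y \<in> C" "exp (-s) \<le> cmod (B y)" "z \<in> C" for A B m s y z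
  proof -
    have "exp (-s) \<le> 1" using h C by (meson order_trans subsetD)
    then have s: "s \<ge> 0" by simp
    \<comment> \<open>The case \<open>s = 0\<close>, where \<open>B\<close> attains modulus 1, is
      reached as a limit.\<close>
    have "((\<lambda>e. exp (m + N * (s + e))) \<longlongrightarrow> exp (m + N * (s + 0))) (at_right 0)"
      by (intro tendsto_intros)
    moreover have "\<forall>\<^sub>F e in at_right 0. cmod (A z) \<le> exp (m + N * (s + e))"
    proof (rule eventually_at_rightI[of 0 1])
      fix e :: real assume "e \<in> {0<..<1}"
      then have "exp (- (s + e)) \<le> cmod (B y)" using h(6) by (smt (verit) exp_le_cancel_iff greaterThanLessThan_iff)
      then show "cmod (A z) \<le> exp (m + N * (s + e))" using pos[OF h(1-4) _ h(5) _ h(7)] s \<open>e \<in> _\<close> by auto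
    qed simp
    ultimately show ?thesis using tendsto_lowerbound[OF _ _ trivial_limit_at_right_real] by fastforce
  qed
  then show ?thesis using N(1) by blast
qed

section \<open>Weak limits of empirical measures\<close>

lemma binary_expansion:
  fixes x :: real
  assumes "0 \<le> x" "x \<le> 1"
  shows "\<exists>a. (\<forall>k. a k = 0 \<or> a k = 1) \<and> (\<lambda>k. a k / 2 ^ Suc k) sums x"
proof -
  define d :: "real \<Rightarrow> real" where "d y = (if y \<ge> 1/2 then 1 else 0)" for y
  define r where "r = rec_nat x (\<lambda>_ y. 2 * y - d y)"
  have r: "r 0 = x" "r (Suc k) = 2 * r k - d (r k)" for k by (auto simp: r_def)
  have r01: "0 \<le> r k \<and> r k \<le> 1" for k
    by (induction k) (use assms in \<open>auto simp: r d_def\<close>)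
  have s: "(\<Sum>k<n. d (r k) / 2 ^ Suc k) = x - r n / 2 ^ n" for n
    by (induction n) (auto simp: r field_simps)
  have "(\<lambda>n. r n / 2 ^ n) \<longlonglongrightarrow> 0"
  proof (rule Lim_null_comparison)
    show "\<forall>\<^sub>F n in sequentially. norm (r n / 2 ^ n) \<le> (1/2) ^ n"
      using r01 by (auto simp: power_divide divide_right_mono)
  qed (simp add: LIMSEQ_realpow_zero)
  then have "(\<lambda>n. x - r n / 2 ^ n) \<longlonglongrightarrow> x - 0" by (intro tendsto_intros)
  then have "(\<lambda>k. d (r k) / 2 ^ Suc k) sums x" unfolding sums_def s by simp
  then show ?thesis by (intro exI[of _ "\<lambda>k. d (r k)"]) (auto simp: d_def)
qed

text \<open>Schoenberg's space-filling curve: the ternary digits of the parameter, halved, are the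
  binary digits of the two coordinates.\<close>

definition schoenberg_wave :: "real \<Rightarrow> real" where
  "schoenberg_wave s = max 0 (min 1 (1/2 - cos (pi * s)))"

lemma schoenberg_wave_periodic: "schoenberg_wave (s + 2 * real n) = schoenberg_wave s"
proof (induction n)
  case (Suc n)
  have "cos (pi * (s + 2 * real (Suc n))) = cos (pi * (s + 2 * real n) + 2 * pi)" by (simp add: algebra_simps)
  then show ?case using Suc by (simp add: schoenberg_wave_def)
qed simp

text \<open>The clamped cosine is 0 on [0, 1/3] and 1 on [2/3, 1], so the first ternary digit is
  read off exactly, whatever the later digits are.\<close>

lemma schoenberg_wave_digit:
  assumes "d = 0 \<or> d = 1" "0 \<le> \<rho>" "\<rho> \<le> 1/3"
  shows "schoenberg_wave (2 * d / 3 + \<rho>) = d"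
proof -
  have *: "cos (pi * s) \<ge> 1/2" if "0 \<le> s" "s \<le> 1/3" for s
    using cos_monotone_0_pi_le[of "pi * s" "pi / 3"] that pi_gt_zero
    by (simp add: cos_60 field_simps)
  have "cos (pi * (2/3 + \<rho>)) = - cos (pi * (1/3 - \<rho>))"
    using cos_minus_pi[of "pi * (2/3 + \<rho>)"] cos_minus[of "pi * (1/3 - \<rho>)"]
    by (simp add: algebra_simps)
  then have "cos (pi * (2/3 + \<rho>)) \<le> - 1/2" using *[of "1/3 - \<rho>"] assms by simp
  moreover have "cos (pi * \<rho>) \<ge> 1/2" using * assms by simp
  ultimately show ?thesis using assms(1) by (auto simp: schoenberg_wave_def)
qed

lemma schoenberg_coordinates:
  assumes c: "\<And>k. c k = 0 \<or> c k = (1::real)"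
  shows "\<exists>t\<in>{0..1}. \<forall>m. schoenberg_wave (3 ^ m * t) = c m"
proof -
  define T where "T b = (\<Sum>k. 2 * b k / 3 ^ Suc k)" for b :: "nat \<Rightarrow> real"
  have geo: "(\<lambda>k. 2 / 3 ^ Suc k :: real) sums 1"
    using sums_mult[OF geometric_sums[of "1/3::real"], of "2/3"] by (simp add: power_divide)
  have sm: "summable (\<lambda>k. 2 * b k / 3 ^ Suc k)" and T01: "0 \<le> T b \<and> T b \<le> 1"
    if b: "\<And>k. b k = 0 \<or> b k = (1::real)" for b
  proof -
    have le: "norm (2 * b k / 3 ^ Suc k) \<le> 2 / 3 ^ Suc k" and nn: "0 \<le> 2 * b k / 3 ^ Suc k"
      and le': "2 * b k / 3 ^ Suc k \<le> 2 / 3 ^ Suc k" for k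
      using b[of k] by auto
    show sm: "summable (\<lambda>k. 2 * b k / 3 ^ Suc k)"
      by (rule summable_comparison_test'[OF sums_summable[OF geo], of 0]) (use le in blast)
    show "0 \<le> T b \<and> T b \<le> 1" unfolding T_def
      using suminf_nonneg[OF sm nn] suminf_le[OF le' sm sums_summable[OF geo]] sums_unique[OF geo] by auto
  qed
  have Tr: "3 * T b = 2 * b 0 + T (\<lambda>k. b (Suc k))" if b: "\<And>k. b k = 0 \<or> b k = (1::real)" for b
  proof -
    have "T b = 2 * b 0 / 3 + (\<Sum>k. 2 * b (Suc k) / 3 ^ Suc (Suc k))"
      unfolding T_def using suminf_split_head[OF sm[where b = b]] b by simp
    also have "(\<Sum>k. 2 * b (Suc k) / 3 ^ Suc (Suc k)) = (\<Sum>k. 2 * b (Suc k) / 3 ^ Suc k / 3)" by simp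
    also have "\<dots> = T (\<lambda>k. b (Suc k)) / 3"
      unfolding T_def using suminf_divide[OF sm[of "\<lambda>k. b (Suc k)"], of 3] b by simp
    finally show ?thesis by simp
  qed
  \<comment> \<open>Multiplication by \<open>3 ^ m\<close> shifts the ternary expansion. All digits
    are 0 or 2, so what moves in front of the point is even, a multiple of the period of the
    wave.\<close>
  have "\<exists>N. 3 ^ m * T c = 2 * real N + T (\<lambda>k. c (m + k))" for m
  proof (induction m)
    case (Suc m)
    then obtain N where "3 ^ m * T c = 2 * real N + T (\<lambda>k. c (m + k))" by blast
    then have "3 ^ Suc m * T c = 6 * real N + 3 * T (\<lambda>k. c (m + k))" by simp
    also have "3 * T (\<lambda>k. c (m + k)) = 2 * c m + T (\<lambda>k. c (Suc m + k))"
      using Tr[of "\<lambda>k. c (m + k)"] c by simp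
    finally have "3 ^ Suc m * T c = 2 * real (3 * N + (if c m = 1 then 1 else 0)) + T (\<lambda>k. c (Suc m + k))"
      using c[of m] by auto
    then show ?case by blast
  qed (auto intro: exI[of _ 0])
  then have "schoenberg_wave (3 ^ m * T c) = c m" for m
  proof -
    obtain N where "3 ^ m * T c = 2 * real N + T (\<lambda>k. c (m + k))" using \<open>\<exists>N. 3 ^ m * T c = _ N\<close> by blast
    then have "schoenberg_wave (3 ^ m * T c) = schoenberg_wave (T (\<lambda>k. c (m + k)))"
      using schoenberg_wave_periodic[of "T (\<lambda>k. c (m + k))" N] by (simp add: add.commute)
    also have "T (\<lambda>k. c (m + k)) = 2 * c m / 3 + T (\<lambda>k. c (m + Suc k)) / 3"
      using Tr[of "\<lambda>k. c (m + k)"] c by simp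
    also have "schoenberg_wave \<dots> = c m"
      using T01[of "\<lambda>k. c (m + Suc k)"] c by (intro schoenberg_wave_digit) auto
    finally show ?thesis .
  qed
  moreover have "T c \<in> {0..1}" using T01[OF c] by simp
  ultimately show ?thesis by blast
qed

lemma schoenberg_coordinate_continuous:
  "continuous_on UNIV (\<lambda>t. \<Sum>k. schoenberg_wave (3 ^ (2 * k + j) * t) / 2 ^ Suc k)"
proof -
  have "uniform_limit UNIV (\<lambda>n t. \<Sum>k<n. schoenberg_wave (3 ^ (2 * k + j) * t) / 2 ^ Suc k)
      (\<lambda>t. \<Sum>k. schoenberg_wave (3 ^ (2 * k + j) * t) / 2 ^ Suc k) sequentially"
  proof (rule Weierstrass_m_test)
    show "summable (\<lambda>k. 1 / 2 ^ Suc k :: real)"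
      using summable_mult[OF summable_geometric[of "1/2::real"], of "1/2"] by (simp add: power_divide)
  qed (auto simp: schoenberg_wave_def divide_right_mono)
  then show ?thesis
    by (rule uniform_limit_theorem[rotated])
      (auto simp: schoenberg_wave_def intro!: always_eventually continuous_intros)
qed

text \<open>This reduces weak compactness in the plane to the line, because points of
  \<open>E\<close> can be pulled back to parameters in [0, 1]. Even and odd digits of the parameter
  encode the two coordinates, rescaled from [0, 1] to [-R, R].\<close>

lemma continuous_curve_onto_bounded:
  assumes "bounded (E :: complex set)"
  shows "\<exists>\<gamma>::real \<Rightarrow> complex. continuous_on UNIV \<gamma> \<and> (\<forall>z\<in>E. \<exists>t\<in>{0..1}. \<gamma> t = z)"
proof -
  obtain R where R: "R > 0" "\<And>z. z \<in> E \<Longrightarrow> cmod z \<le> R" using assms bounded_pos by blast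
  define X where "X j t = (\<Sum>k. schoenberg_wave (3 ^ (2 * k + j) * t) / 2 ^ Suc k)" for j t
  define \<gamma> where "\<gamma> t = Complex (R * (2 * X 0 t - 1)) (R * (2 * X 1 t - 1))" for t
  have "\<gamma> = (\<lambda>t. of_real (R * (2 * X 0 t - 1)) + \<i> * of_real (R * (2 * X 1 t - 1)))"
    by (auto simp: \<gamma>_def complex_eq_iff)
  then have cont: "continuous_on UNIV \<gamma>"
    using schoenberg_coordinate_continuous
    by (simp only: X_def[abs_def]) (intro continuous_intros; assumption)
  have ex: "\<exists>t\<in>{0..1}. \<gamma> t = z" if z: "z \<in> E" for z
  proof -
    have b: "\<bar>Re z\<bar> \<le> R" "\<bar>Im z\<bar> \<le> R" using R(2)[OF z] abs_Re_le_cmod abs_Im_le_cmod order_trans by blast+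
    obtain a where a: "\<And>k. a k = 0 \<or> a k = 1" "(\<lambda>k. a k / 2 ^ Suc k) sums ((Re z / R + 1) / 2)"
      using binary_expansion[of "(Re z / R + 1) / 2"] b R(1) by (auto simp: field_simps abs_le_iff)
    obtain c where c: "\<And>k. c k = 0 \<or> c k = 1" "(\<lambda>k. c k / 2 ^ Suc k) sums ((Im z / R + 1) / 2)"
      using binary_expansion[of "(Im z / R + 1) / 2"] b R(1) by (auto simp: field_simps abs_le_iff)
    obtain t where t01: "t \<in> {0..1}" and t: "\<And>m. schoenberg_wave (3 ^ m * t) = (if even m then a (m div 2) else c (m div 2))"
      using schoenberg_coordinates[of "\<lambda>m. if even m then a (m div 2) else c (m div 2)"] a(1) c(1) by metis
    have "X 0 t = (Re z / R + 1) / 2" using a(2) by (simp add: X_def t sums_iff)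
    moreover have "X 1 t = (Im z / R + 1) / 2" using c(2) by (simp add: X_def t sums_iff del: power_Suc)
    ultimately have "\<gamma> t = z" using R(1) by (simp add: \<gamma>_def complex_eq_iff field_simps del: One_nat_def)
    then show ?thesis using t01 by blast
  qed
  show ?thesis using cont ex by blast
qed

text \<open>Parameters on a space-filling curve turn the empirical measures into distributions on
  [0, 1], which are tight; a weak limit there is pushed forward along the curve.\<close>

lemma empirical_measures_weak_limit:
  fixes x :: "nat \<Rightarrow> nat \<Rightarrow> complex"
  assumes E: "compact E" "E \<noteq> {}" and x: "\<And>n i. i < n \<Longrightarrow> x n i \<in> E"
  obtains \<mu> and r :: "nat \<Rightarrow> nat" where "strict_mono r" "\<And>k. r k > 0" "prob_space \<mu>" "sets \<mu> = sets borel"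
    "AE z in \<mu>. z \<in> E"
    "\<And>\<phi>::complex \<Rightarrow> real. continuous_on UNIV \<phi> \<Longrightarrow> bounded (range \<phi>) \<Longrightarrow>
      (\<lambda>k. (\<Sum>i<r k. \<phi> (x (r k) i)) / real (r k)) \<longlonglongrightarrow> (\<integral>z. \<phi> z \<partial>\<mu>)"
proof -
  obtain \<gamma> :: "real \<Rightarrow> complex" where \<gamma>: "continuous_on UNIV \<gamma>" "\<And>z. z \<in> E \<Longrightarrow> \<exists>t\<in>{0..1}. \<gamma> t = z"
    using continuous_curve_onto_bounded[OF compact_imp_bounded[OF E(1)]] by blast
  have "\<exists>s. s \<in> {0..1} \<and> (i < n \<longrightarrow> \<gamma> s = x n i)" for n i
    by (cases "i < n") (use \<gamma>(2)[OF x[of i n]] in \<open>auto intro: exI[of _ 0]\<close>)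
  then have "\<forall>n i. \<exists>s. s \<in> {0..1} \<and> (i < n \<longrightarrow> \<gamma> s = x n i)" by blast
  then obtain t where t': "\<forall>n i. t n i \<in> {0..1} \<and> (i < n \<longrightarrow> \<gamma> (t n i) = x n i)"
    unfolding choice_iff by blast
  then have t: "\<And>n i. t n i \<in> {0..1}" "\<And>n i. i < n \<Longrightarrow> \<gamma> (t n i) = x n i" by blast+
  \<comment> \<open>Shifted by one because a uniform distribution needs at least one point;
    accordingly \<open>r k = Suc (r' k)\<close>.\<close>
  define \<nu> where "\<nu> n = distr (measure_pmf (pmf_of_set {..<Suc n})) borel (t (Suc n))" for n
  have rd: "real_distribution (\<nu> n)" for n
    unfolding \<nu>_def by (intro prob_space.real_distribution_distr measure_pmf.prob_space_axioms) auto
  have "tight \<nu>"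
    unfolding tight_def
  proof (intro conjI allI impI rd)
    fix e :: real assume "e > 0"
    have "measure (\<nu> n) {-1<..1} = 1" for n
    proof -
      have "t (Suc n) -` {-1<..1} = UNIV" using t(1)[of "Suc n"] by (auto simp: less_le_trans[of "-1" 0])
      then show ?thesis unfolding \<nu>_def by (simp add: measure_distr)
    qed
    then show "\<exists>a b. a < b \<and> (\<forall>n. 1 - e < measure (\<nu> n) {a<..b})"
      using \<open>e > 0\<close> by (intro exI[of _ "-1"] exI[of _ 1]) auto
  qed
  then obtain r' M where r': "strict_mono (r' :: nat \<Rightarrow> nat)" and M: "real_distribution M"
    and wc: "weak_conv_m (\<nu> \<circ> id \<circ> r') M"
    using tight_imp_convergent_subsubsequence[of \<nu> id] by (auto simp: strict_mono_id)
  interpret M: real_distribution M by fact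
  define \<mu> where "\<mu> = distr M borel \<gamma>"
  define r where "r k = Suc (r' k)" for k
  have \<gamma>m[measurable]: "\<gamma> \<in> borel_measurable borel"
    using \<gamma>(1) by (rule borel_measurable_continuous_onI)
  have lim: "(\<lambda>k. (\<Sum>i<r k. \<phi> (x (r k) i)) / real (r k)) \<longlonglongrightarrow> (\<integral>z. \<phi> z \<partial>\<mu>)"
    if \<phi>: "continuous_on UNIV \<phi>" "bounded (range \<phi>)" for \<phi> :: "complex \<Rightarrow> real"
  proof -
    obtain B where B: "\<And>z. norm (\<phi> z) \<le> B" using \<phi>(2) unfolding bounded_iff by auto
    have [measurable]: "\<phi> \<in> borel_measurable borel" using \<phi>(1) by (rule borel_measurable_continuous_onI)
    have "continuous_on UNIV (\<lambda>s. \<phi> (\<gamma> s))"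
      by (rule continuous_on_compose2[OF \<phi>(1) \<gamma>(1)]) auto
    then have ic: "isCont (\<lambda>s. \<phi> (\<gamma> s)) s" for s by (simp add: continuous_on_eq_continuous_at)
    have "(\<lambda>n. integral\<^sup>L ((\<nu> \<circ> id \<circ> r') n) (\<lambda>s. \<phi> (\<gamma> s))) \<longlonglongrightarrow> integral\<^sup>L M (\<lambda>s. \<phi> (\<gamma> s))"
      by (rule weak_conv_imp_integral_bdd_continuous_conv[OF _ M wc]) (use rd B ic in auto)
    moreover have "integral\<^sup>L M (\<lambda>s. \<phi> (\<gamma> s)) = integral\<^sup>L \<mu> \<phi>"
      unfolding \<mu>_def by (subst integral_distr) auto
    moreover have "integral\<^sup>L (\<nu> n) (\<lambda>s. \<phi> (\<gamma> s)) = (\<Sum>i<Suc n. \<phi> (x (Suc n) i)) / real (Suc n)" for n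
    proof -
      have "integral\<^sup>L (\<nu> n) (\<lambda>s. \<phi> (\<gamma> s)) = (\<Sum>i<Suc n. \<phi> (\<gamma> (t (Suc n) i))) / real (Suc n)"
        unfolding \<nu>_def by (subst integral_distr) (auto simp: integral_pmf_of_set lessThan_empty_iff simp del: sum.lessThan_Suc)
      also have "(\<Sum>i<Suc n. \<phi> (\<gamma> (t (Suc n) i))) = (\<Sum>i<Suc n. \<phi> (x (Suc n) i))"
        by (rule sum.cong) (auto simp: t(2))
      finally show ?thesis .
    qed
    ultimately show ?thesis by (simp add: r_def del: sum.lessThan_Suc)
  qed
  have ps: "prob_space \<mu>" unfolding \<mu>_def by (rule M.prob_space_distr) simp
  have "(AE z in \<mu>. z \<in> E)"
  proof -
    interpret \<mu>: prob_space \<mu> by fact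
    \<comment> \<open>The curve need not stay in \<open>E\<close>. A bounded continuous function
      vanishing exactly on \<open>E\<close> shows that the limit is nevertheless carried by
      \<open>E\<close>.\<close>
    define \<phi> where "\<phi> z = min 1 (infdist z E)" for z
    have cont: "continuous_on UNIV \<phi>" unfolding \<phi>_def by (intro continuous_intros)
    have bd: "bounded (range \<phi>)" by (rule boundedI[of _ 1]) (auto simp: \<phi>_def infdist_nonneg)
    have [measurable]: "\<phi> \<in> borel_measurable borel" using cont by (rule borel_measurable_continuous_onI)
    have "(\<Sum>i<r k. \<phi> (x (r k) i)) = 0" for k
      by (rule sum.neutral) (auto simp: \<phi>_def x)
    then have "(\<lambda>k::nat. 0) \<longlonglongrightarrow> (\<integral>z. \<phi> z \<partial>\<mu>)" using lim[OF cont bd] by simp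
    then have "(\<integral>z. \<phi> z \<partial>\<mu>) = 0" using LIMSEQ_unique tendsto_const by blast
    moreover have "integrable \<mu> \<phi>"
      by (rule \<mu>.integrable_const_bound[of _ 1]) (auto simp: \<phi>_def infdist_nonneg \<mu>_def)
    ultimately have "AE z in \<mu>. \<phi> z = 0"
      by (subst (asm) integral_nonneg_eq_0_iff_AE) (auto simp: \<phi>_def infdist_nonneg)
    then show ?thesis
    proof eventually_elim
      case (elim z)
      then have "infdist z E = 0" unfolding \<phi>_def by (simp add: min_def split: if_splits)
      then show "z \<in> E" using E in_closed_iff_infdist_zero compact_imp_closed by blast
    qed
  qed
  moreover have "strict_mono r" using r' by (auto simp: strict_mono_def r_def)
  moreover have "sets \<mu> = sets borel" by (simp add: \<mu>_def)
  ultimately show ?thesis using ps lim by (intro that[of r \<mu>]) (auto simp: r_def)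
qed

section \<open>Logarithmic energy\<close>

text \<open>Lindelof: the complement of the support is already a countable union of null open
  sets.\<close>

lemma AE_msupport:
  assumes "sets \<mu> = sets borel"
  shows "AE z in \<mu>. z \<in> msupport \<mu>"
proof -
  let ?F = "{U. open U \<and> emeasure \<mu> U = 0}"
  obtain F' where F': "F' \<subseteq> ?F" "countable F'" "\<Union>F' = \<Union>?F"
    using Lindelof[of ?F] by blast
  have "(\<Union>U\<in>F'. U) \<in> null_sets \<mu>"
    by (rule null_sets_UN') (use F' assms in \<open>auto intro!: null_setsI\<close>)
  moreover have "z \<in> (\<Union>U\<in>F'. U)" if "z \<notin> msupport \<mu>" for z
    using that F'(3) unfolding msupport_def by (auto simp: zero_less_iff_neq_zero)
  ultimately show ?thesis by (intro AE_I') auto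
qed

lemma prob_measures_on_iff:
  assumes "closed E"
  shows "\<mu> \<in> prob_measures_on E \<longleftrightarrow> prob_space \<mu> \<and> sets \<mu> = sets borel \<and> (AE z in \<mu>. z \<in> E)"
proof -
  have "msupport \<mu> \<subseteq> E" if s: "sets \<mu> = sets borel" and ae: "AE z in \<mu>. z \<in> E"
  proof
    fix z assume z: "z \<in> msupport \<mu>"
    show "z \<in> E"
    proof (rule ccontr)
      assume "z \<notin> E"
      then have "emeasure \<mu> (- E) > 0" using z assms by (simp add: msupport_def open_Compl)
      moreover have "AE z in \<mu>. z \<notin> - E" using ae by eventually_elim auto
      then have "emeasure \<mu> (- E) = 0"
        using AE_iff_measurable[of "- E" \<mu> "\<lambda>z. z \<notin> - E"] s assms
        by (auto simp: sets_eq_imp_space_eq[OF s])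
      ultimately show False by simp
    qed
  qed
  moreover have "AE z in \<mu>. z \<in> E" if "sets \<mu> = sets borel" "msupport \<mu> \<subseteq> E"
    using AE_msupport[OF that(1)] by eventually_elim (use that in auto)
  ultimately show ?thesis unfolding prob_measures_on_def by blast
qed

lemma closed_msupport: "closed (msupport \<mu>)"
proof -
  have "- msupport \<mu> = \<Union>{U. open U \<and> \<not> emeasure \<mu> U > 0}"
    by (auto simp: msupport_def)
  then have "open (- msupport \<mu>)" by auto
  then show ?thesis by (simp add: closed_def)
qed

lemma measurable_elog[measurable]: "elog \<in> borel_measurable borel"
  unfolding elog_def[abs_def] by measurable

text \<open>The energy is handled through the nonnegative kernel \<open>ln (D / \<bar>z - w\<bar>)\<close>, where \<open>D\<close> bounds
  the diameter of the set carrying the measures.\<close>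

definition log_kernel :: "real \<Rightarrow> complex \<Rightarrow> complex \<Rightarrow> ennreal" where
  "log_kernel D z w = e2ennreal (ereal (ln D) - elog (cmod (z - w)))"

definition mutual_energy :: "real \<Rightarrow> complex measure \<Rightarrow> complex measure \<Rightarrow> ennreal" where
  "mutual_energy D \<mu> \<nu> = (\<integral>\<^sup>+z. \<integral>\<^sup>+w. log_kernel D z w \<partial>\<nu> \<partial>\<mu>)"

lemma log_kernel_simps:
  "log_kernel D z z = top" "z \<noteq> w \<Longrightarrow> log_kernel D z w = ennreal (ln D - ln (cmod (z - w)))"
  by (auto simp: log_kernel_def elog_def e2ennreal_ereal)

lemma log_kernel_commute: "log_kernel D z w = log_kernel D w z"
  by (simp add: log_kernel_def norm_minus_commute)

lemma measurable_log_kernel[measurable]: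
  "(\<lambda>(z, w). log_kernel D z w) \<in> borel_measurable (borel \<Otimes>\<^sub>M borel)"
  "log_kernel D z \<in> borel_measurable borel"
  unfolding log_kernel_def[abs_def] by measurable

lemma measurable_log_kernel_nn_integral:
  assumes "finite_measure \<nu>" "sets \<nu> = sets borel"
  shows "(\<lambda>z. \<integral>\<^sup>+w. log_kernel D z w \<partial>\<nu>) \<in> borel_measurable borel"
proof -
  interpret finite_measure \<nu> by fact
  note [measurable_cong] = assms(2)
  show ?thesis by measurable
qed

lemma mutual_energy_commute:
  assumes "finite_measure \<mu>" "sets \<mu> = sets borel" "finite_measure \<nu>" "sets \<nu> = sets borel"
  shows "mutual_energy D \<mu> \<nu> = mutual_energy D \<nu> \<mu>"
proof -
  interpret \<mu>: finite_measure \<mu> by fact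
  interpret \<nu>: finite_measure \<nu> by fact
  interpret pair_sigma_finite \<mu> \<nu> ..
  note [measurable_cong] = assms(2,4)
  have "(\<integral>\<^sup>+w. \<integral>\<^sup>+z. log_kernel D z w \<partial>\<mu> \<partial>\<nu>) = (\<integral>\<^sup>+z. \<integral>\<^sup>+w. log_kernel D z w \<partial>\<nu> \<partial>\<mu>)"
    by (rule Fubini') measurable
  then show ?thesis unfolding mutual_energy_def by (simp add: log_kernel_commute)
qed

text \<open>Under an upper bound the difference of positive and negative part becomes a constant
  minus one nonnegative integral, possibly infinite, to which Tonelli and monotone convergence
  apply.\<close>

lemma ext_integral_bounded_above:
  assumes "prob_space \<mu>" and f[measurable]: "f \<in> borel_measurable \<mu>"
    and le: "AE z in \<mu>. f z \<le> ereal c" and c: "c \<ge> 0"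
  shows "ext_integral \<mu> f = ereal c - enn2ereal (\<integral>\<^sup>+z. e2ennreal (ereal c - f z) \<partial>\<mu>)"
proof -
  interpret prob_space \<mu> by fact
  let ?P = "\<integral>\<^sup>+z. e2ennreal (f z) \<partial>\<mu>" and ?N = "\<integral>\<^sup>+z. e2ennreal (- f z) \<partial>\<mu>"
    and ?A = "\<integral>\<^sup>+z. e2ennreal (ereal c - f z) \<partial>\<mu>"
  have "AE z in \<mu>. e2ennreal (ereal c - f z) + e2ennreal (f z) = ennreal c + e2ennreal (- f z)"
    using le
  proof eventually_elim
    case (elim z)
    then show ?case
    proof (cases "f z")
      case (real r)
      then have "r \<le> c" using elim by simp
      then show ?thesis using real c
        by (cases "r \<ge> 0") (auto simp: e2ennreal_ereal ennreal_plus[symmetric] ennreal_neg simp del: ennreal_plus)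
    qed auto
  qed
  then have "(\<integral>\<^sup>+z. e2ennreal (ereal c - f z) + e2ennreal (f z) \<partial>\<mu>) = (\<integral>\<^sup>+z. ennreal c + e2ennreal (- f z) \<partial>\<mu>)"
    by (rule nn_integral_cong_AE)
  then have eq: "?A + ?P = ennreal c + ?N"
    by (simp add: nn_integral_add emeasure_space_1)
  have "?P \<le> (\<integral>\<^sup>+z. ennreal c \<partial>\<mu>)"
    by (rule nn_integral_mono_AE) (use le in eventually_elim, use e2ennreal_mono e2ennreal_ereal in metis)
  then have P: "?P \<le> ennreal c" by (simp add: emeasure_space_1)
  then have "?P < top" using le_less_trans ennreal_less_top by blast
  then obtain p where p: "?P = ennreal p" "p \<ge> 0" by (cases ?P) auto
  show ?thesis
  proof (cases ?N)
    case (real n)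
    then have A: "?A + ennreal p = ennreal (c + n)" using eq p c by (simp add: ennreal_plus)
    then have "?A < top" by (metis add_eq_0_iff_both_eq_0 ennreal_add_eq_top ennreal_less_top less_top)
    then obtain a where a: "?A = ennreal a" "a \<ge> 0" by (cases ?A) auto
    then have "a + p = c + n" using A p real c by (simp add: ennreal_plus[symmetric] del: ennreal_plus)
    then show ?thesis unfolding ext_integral_def using a p real by (simp add: enn2ereal_ennreal)
  next
    case top
    then have "?A = top" using eq p by (simp add: ennreal_add_eq_top)
    then show ?thesis unfolding ext_integral_def using top p by (simp add: enn2ereal_ennreal)
  qed
qed

lemma log_potential_conv_log_kernel:
  assumes \<mu>: "\<mu> \<in> prob_measures_on E" and E: "closed E" and D: "D \<ge> 1" "\<And>w. w \<in> E \<Longrightarrow> cmod (z - w) \<le> D"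
  shows "log_potential \<mu> z = ereal (ln D) - enn2ereal (\<integral>\<^sup>+w. log_kernel D z w \<partial>\<mu>)"
proof -
  have p: "prob_space \<mu>" "sets \<mu> = sets borel" "AE z in \<mu>. z \<in> E"
    using \<mu> prob_measures_on_iff[OF E] by auto
  note [measurable_cong] = p(2)
  show ?thesis
    unfolding log_potential_def log_kernel_def
  proof (rule ext_integral_bounded_above[OF p(1)])
    show "AE w in \<mu>. elog (cmod (z - w)) \<le> ereal (ln D)"
      using p(3)
    proof eventually_elim
      case (elim w)
      then show ?case using D(2)[OF elim] D(1) by (auto simp: elog_def)
    qed
    show "0 \<le> ln D" using D by simp
  qed measurable
qed

lemma log_energy_conv_mutual_energy:
  assumes \<mu>: "\<mu> \<in> prob_measures_on E" and E: "closed E"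
    and D: "D \<ge> 1" "\<And>z w. z \<in> E \<Longrightarrow> w \<in> E \<Longrightarrow> cmod (z - w) \<le> D"
  shows "log_energy \<mu> = ereal (ln D) - enn2ereal (mutual_energy D \<mu> \<mu>)"
proof -
  have p: "prob_space \<mu>" "sets \<mu> = sets borel" "AE z in \<mu>. z \<in> E"
    using \<mu> prob_measures_on_iff[OF E] by auto
  interpret prob_space \<mu> by fact
  note [measurable_cong] = p(2)
  have m[measurable]: "log_potential \<mu> \<in> borel_measurable borel"
    unfolding log_potential_def[abs_def] ext_integral_def[abs_def] by measurable
  have pot: "log_potential \<mu> z = ereal (ln D) - enn2ereal (\<integral>\<^sup>+w. log_kernel D z w \<partial>\<mu>)" if "z \<in> E" for z
    using log_potential_conv_log_kernel[OF \<mu> E D(1)] D(2) that by blast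
  have "ext_integral \<mu> (log_potential \<mu>) = ereal (ln D) - enn2ereal (\<integral>\<^sup>+z. e2ennreal (ereal (ln D) - log_potential \<mu> z) \<partial>\<mu>)"
  proof (rule ext_integral_bounded_above[OF p(1)])
    show "AE z in \<mu>. log_potential \<mu> z \<le> ereal (ln D)"
      using p(3)
    proof eventually_elim
      case (elim z)
      then show ?case using enn2ereal_nonneg[of "\<integral>\<^sup>+w. log_kernel D z w \<partial>\<mu>"] unfolding pot[OF elim]
        by (cases "enn2ereal (\<integral>\<^sup>+w. log_kernel D z w \<partial>\<mu>)") auto
    qed
    show "0 \<le> ln D" using D by simp
  qed measurable
  also have "(\<integral>\<^sup>+z. e2ennreal (ereal (ln D) - log_potential \<mu> z) \<partial>\<mu>) = mutual_energy D \<mu> \<mu>"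
    unfolding mutual_energy_def
  proof (rule nn_integral_cong_AE, use p(3) in eventually_elim)
    case (elim z)
    have "ereal (ln D) - log_potential \<mu> z = enn2ereal (\<integral>\<^sup>+w. log_kernel D z w \<partial>\<mu>)"
      unfolding pot[OF elim] by (cases "enn2ereal (\<integral>\<^sup>+w. log_kernel D z w \<partial>\<mu>)") auto
    then show ?case by simp
  qed
  finally show ?thesis by (simp add: log_energy_def)
qed

section \<open>Point configurations of small energy and the measures they converge to\<close>

lemma (in prob_space) exists_le_nn_integral:
  assumes [measurable]: "f \<in> borel_measurable M" and E: "AE z in M. z \<in> E"
  shows "\<exists>y\<in>E. f y \<le> (\<integral>\<^sup>+z. f z \<partial>M)"
proof (rule ccontr)
  assume "\<not> ?thesis"
  then have gt: "(\<integral>\<^sup>+z. f z \<partial>M) < f y" if "y \<in> E" for y using that by force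
  let ?I = "\<integral>\<^sup>+z. f z \<partial>M"
  have ae: "AE z in M. ?I < f z" using E by eventually_elim (rule gt)
  have "(\<integral>\<^sup>+z. ?I \<partial>M) < (\<integral>\<^sup>+z. f z \<partial>M)"
  proof (rule nn_integral_less)
    have "\<exists>y. ?I < f y" using ae by (metis (no_types, lifting) AE_E2 AE_False eventually_mono)
    then show "(\<integral>\<^sup>+z. ?I \<partial>M) \<noteq> \<infinity>" by (auto simp: emeasure_space_1)
    show "AE z in M. ?I \<le> f z" using ae by eventually_elim simp
    show "\<not> (AE z in M. f z \<le> ?I)"
    proof
      assume "AE z in M. f z \<le> ?I"
      then have "AE z in M. False" using ae by eventually_elim (simp add: not_le[symmetric])
      then show False by simp
    qed
  qed measurable
  then show False by (simp add: emeasure_space_1)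
qed

text \<open>The first moment method: for independent points \<open>x i\<close> distributed as
  \<open>\<omega> i\<close> the right side is the expected value of the left one. Points are fixed
  one at a time; the one-body terms \<open>c i\<close> serve the induction, where they collect the
  interaction with points already fixed.\<close>

lemma configuration_below_mean_energy:
  fixes n :: nat and c :: "nat \<Rightarrow> complex \<Rightarrow> ennreal"
  assumes "closed E" and "\<And>i. i < n \<Longrightarrow> \<omega> i \<in> prob_measures_on E"
    and "\<And>i. i < n \<Longrightarrow> c i \<in> borel_measurable borel"
  shows "\<exists>x. (\<forall>i<n. x i \<in> E) \<and>
    (\<Sum>i<n. (\<Sum>j<i. log_kernel D (x i) (x j)) + c i (x i)) \<le>
    (\<Sum>i<n. (\<Sum>j<i. mutual_energy D (\<omega> i) (\<omega> j)) + (\<integral>\<^sup>+z. c i z \<partial>\<omega> i))"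
  using assms(2,3)
proof (induction n arbitrary: c)
  case (Suc n)
  have pm: "prob_space (\<omega> i)" "sets (\<omega> i) = sets borel" "AE z in \<omega> i. z \<in> E" if "i < Suc n" for i
    using Suc.prems(1)[OF that] prob_measures_on_iff[OF assms(1)] by auto
  interpret \<omega>: prob_space "\<omega> n" by (rule pm) simp
  have mK: "(\<lambda>y. \<integral>\<^sup>+z. log_kernel D y z \<partial>\<omega> i) \<in> borel_measurable borel" if "i < Suc n" for i
    using pm[OF that] by (intro measurable_log_kernel_nn_integral prob_space.finite_measure)
  have mb: "f \<in> borel_measurable borel \<Longrightarrow> f \<in> borel_measurable (\<omega> i)" if "i < Suc n"
    for f :: "complex \<Rightarrow> ennreal" and i
    using measurable_cong_sets[OF pm(2)[OF that] refl, of "borel :: ennreal measure"] by blast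
  \<comment> \<open>The conditional mean, given the last point \<open>y\<close>, of all terms in
    which it occurs.\<close>
  define G where "G y = c n y + (\<Sum>i<n. \<integral>\<^sup>+z. log_kernel D y z \<partial>\<omega> i)" for y
  have "G \<in> borel_measurable borel"
    unfolding G_def by (rule borel_measurable_add; (rule borel_measurable_sum Suc.prems(2))?; (rule mK)?; simp)
  then have "\<exists>y\<in>E. G y \<le> (\<integral>\<^sup>+y. G y \<partial>\<omega> n)"
    by (intro \<omega>.exists_le_nn_integral mb pm(3)) simp_all
  then obtain y where y: "y \<in> E" "G y \<le> (\<integral>\<^sup>+y. G y \<partial>\<omega> n)" by blast
  note y(2)
  also have "(\<integral>\<^sup>+y. G y \<partial>\<omega> n) = (\<integral>\<^sup>+y. c n y \<partial>\<omega> n) + (\<integral>\<^sup>+y. (\<Sum>i<n. \<integral>\<^sup>+z. log_kernel D y z \<partial>\<omega> i) \<partial>\<omega> n)"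
    unfolding G_def
    by (rule nn_integral_add; rule mb; (rule borel_measurable_sum Suc.prems(2))?; (rule mK)?; simp)
  also have "(\<integral>\<^sup>+y. (\<Sum>i<n. \<integral>\<^sup>+z. log_kernel D y z \<partial>\<omega> i) \<partial>\<omega> n) = (\<Sum>i<n. mutual_energy D (\<omega> n) (\<omega> i))"
    unfolding mutual_energy_def by (rule nn_integral_sum; rule mb; (rule mK)?; simp)
  finally have Gy: "G y \<le> (\<integral>\<^sup>+y. c n y \<partial>\<omega> n) + (\<Sum>i<n. mutual_energy D (\<omega> n) (\<omega> i))" .
  obtain x where x: "\<And>i. i < n \<Longrightarrow> x i \<in> E"
    "(\<Sum>i<n. (\<Sum>j<i. log_kernel D (x i) (x j)) + (c i (x i) + log_kernel D y (x i))) \<le>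
    (\<Sum>i<n. (\<Sum>j<i. mutual_energy D (\<omega> i) (\<omega> j)) + (\<integral>\<^sup>+z. c i z + log_kernel D y z \<partial>\<omega> i))"
  proof -
    have "\<exists>x. (\<forall>i<n. x i \<in> E) \<and>
      (\<Sum>i<n. (\<Sum>j<i. log_kernel D (x i) (x j)) + (c i (x i) + log_kernel D y (x i))) \<le>
      (\<Sum>i<n. (\<Sum>j<i. mutual_energy D (\<omega> i) (\<omega> j)) + (\<integral>\<^sup>+z. c i z + log_kernel D y z \<partial>\<omega> i))"
      by (rule Suc.IH) (use Suc.prems in auto)
    then show ?thesis using that by blast
  qed
  let ?x = "x(n := y)"
  have "(\<Sum>i<Suc n. (\<Sum>j<i. log_kernel D (?x i) (?x j)) + c i (?x i)) =
     (\<Sum>i<n. (\<Sum>j<i. log_kernel D (x i) (x j)) + (c i (x i) + log_kernel D y (x i))) + c n y"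
  proof -
    have "(\<Sum>i<n. (\<Sum>j<i. log_kernel D (?x i) (?x j)) + c i (?x i)) = (\<Sum>i<n. (\<Sum>j<i. log_kernel D (x i) (x j)) + c i (x i))"
      by (intro sum.cong arg_cong2[where f = "(+)"]) auto
    moreover have "(\<Sum>j<n. log_kernel D (?x n) (?x j)) = (\<Sum>j<n. log_kernel D y (x j))"
      by (intro sum.cong) auto
    ultimately show ?thesis unfolding sum.lessThan_Suc by (simp only: sum.distrib fun_upd_same) (simp add: ac_simps)
  qed
  also have "\<dots> \<le> (\<Sum>i<n. (\<Sum>j<i. mutual_energy D (\<omega> i) (\<omega> j)) + (\<integral>\<^sup>+z. c i z + log_kernel D y z \<partial>\<omega> i)) + c n y"
    using x(2) by (rule add_right_mono)
  also have "\<dots> = (\<Sum>i<n. (\<Sum>j<i. mutual_energy D (\<omega> i) (\<omega> j)) + (\<integral>\<^sup>+z. c i z \<partial>\<omega> i)) + G y"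
  proof -
    have "(\<integral>\<^sup>+z. c i z + log_kernel D y z \<partial>\<omega> i) = (\<integral>\<^sup>+z. c i z \<partial>\<omega> i) + (\<integral>\<^sup>+z. log_kernel D y z \<partial>\<omega> i)"
      if "i < n" for i
      using that Suc.prems(2)[of i] by (intro nn_integral_add mb) simp_all
    then have "(\<Sum>i<n. (\<Sum>j<i. mutual_energy D (\<omega> i) (\<omega> j)) + (\<integral>\<^sup>+z. c i z + log_kernel D y z \<partial>\<omega> i)) =
      (\<Sum>i<n. (\<Sum>j<i. mutual_energy D (\<omega> i) (\<omega> j)) + ((\<integral>\<^sup>+z. c i z \<partial>\<omega> i) + (\<integral>\<^sup>+z. log_kernel D y z \<partial>\<omega> i)))"
      by (intro sum.cong) auto
    then show ?thesis unfolding G_def by (simp only: sum.distrib) (simp add: ac_simps)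
  qed
  also have "\<dots> \<le> (\<Sum>i<n. (\<Sum>j<i. mutual_energy D (\<omega> i) (\<omega> j)) + (\<integral>\<^sup>+z. c i z \<partial>\<omega> i)) +
     ((\<integral>\<^sup>+y. c n y \<partial>\<omega> n) + (\<Sum>i<n. mutual_energy D (\<omega> n) (\<omega> i)))"
    using Gy by (rule add_left_mono)
  also have "\<dots> = (\<Sum>i<Suc n. (\<Sum>j<i. mutual_energy D (\<omega> i) (\<omega> j)) + (\<integral>\<^sup>+z. c i z \<partial>\<omega> i))"
    by (simp add: ac_simps)
  finally show ?case using x(1) y(1) by (intro exI[of _ ?x]) (auto simp: less_Suc_eq)
qed auto

text \<open>The kernel cut off at height \<open>M\<close>: bounded, Lipschitz, and increasing to
  \<open>log_kernel\<close> with \<open>M\<close>, hence a test kernel for weak convergence.\<close>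

definition truncated_kernel :: "real \<Rightarrow> nat \<Rightarrow> complex \<Rightarrow> complex \<Rightarrow> real" where
  "truncated_kernel D M z w = max 0 (ln D - ln (max (cmod (z - w)) (D * exp (- real M))))"

context
  fixes D :: real
  assumes D: "D \<ge> 1"
begin

lemma truncated_kernel_bounds: "0 \<le> truncated_kernel D M z w" "truncated_kernel D M z w \<le> real M"
proof -
  have "ln (D * exp (- real M)) \<le> ln (max (cmod (z - w)) (D * exp (- real M)))"
    using D by (intro ln_mono) auto
  then show "truncated_kernel D M z w \<le> real M"
    using D by (simp add: truncated_kernel_def ln_mult)
qed (simp add: truncated_kernel_def)

lemma truncated_kernel_commute: "truncated_kernel D M z w = truncated_kernel D M w z"
  by (simp add: truncated_kernel_def norm_minus_commute)

lemma truncated_kernel_le: "ennreal (truncated_kernel D M z w) \<le> log_kernel D z w"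
proof (cases "z = w")
  case False
  then have "ln (cmod (z - w)) \<le> ln (max (cmod (z - w)) (D * exp (- real M)))" by (intro ln_mono) auto
  then have "truncated_kernel D M z w \<le> max 0 (ln D - ln (cmod (z - w)))" by (simp add: truncated_kernel_def)
  then show ?thesis using False by (simp add: log_kernel_simps) (metis ennreal_le_iff2 ennreal_leI ennreal_max_0)
qed (simp add: log_kernel_simps)

text \<open>The logarithm is only evaluated above \<open>D * exp (- M)\<close>, where its slope is
  at most \<open>exp M / D\<close>. Uniformity in \<open>w\<close> makes the discrete potentials
  equicontinuous.\<close>

lemma truncated_kernel_Lipschitz:
  "\<bar>truncated_kernel D M z w - truncated_kernel D M z' w\<bar> \<le> exp (real M) * cmod (z - z')"
proof -
  have main: "truncated_kernel D M z w - truncated_kernel D M z' w \<le> exp (real M) * cmod (z - z')" for z z'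
  proof -
    let ?a = "D * exp (- real M)"
    let ?p = "max (cmod (z - w)) ?a" and ?q = "max (cmod (z' - w)) ?a"
    have a: "?a > 0" using D by simp
    have pq: "?p > 0" "?q > 0" "?a \<le> ?p" using a by auto
    have "cmod (z' - w) \<le> cmod (z - w) + cmod (z - z')"
      using norm_triangle_ineq[of "z - w" "z' - z"] by (simp add: norm_minus_commute)
    then have d: "?q - ?p \<le> cmod (z - z')" using norm_ge_zero[of "z - z'"] by linarith
    have "ln ?q - ln ?p = ln (?q / ?p)" using pq by (simp add: ln_div)
    also have "\<dots> \<le> ?q / ?p - 1" using pq by (intro ln_le_minus_one) simp
    also have "\<dots> = (?q - ?p) / ?p" using pq by (simp add: diff_divide_distrib)
    also have "\<dots> \<le> cmod (z - z') / ?p" using d pq by (intro divide_right_mono) auto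
    also have "\<dots> \<le> cmod (z - z') / ?a" using pq a by (intro divide_left_mono) auto
    also have "\<dots> = exp (real M) * cmod (z - z') / D" by (simp add: exp_minus field_simps)
    also have "\<dots> \<le> exp (real M) * cmod (z - z')" using D
      by (simp add: divide_le_eq mult_le_cancel_left1) (metis mult_nonneg_nonneg norm_ge_zero exp_ge_zero mult_le_cancel_left1 not_le)
    finally have "ln ?q - ln ?p \<le> exp (real M) * cmod (z - z')" .
    moreover have "0 \<le> exp (real M) * cmod (z - z')" by simp
    ultimately show ?thesis unfolding truncated_kernel_def by linarith
  qed
  show ?thesis using main[of z z'] main[of z' z] by (simp add: abs_le_iff norm_minus_commute)
qed

lemma truncated_kernel_continuous: "continuous_on UNIV (truncated_kernel D M z)"
  unfolding truncated_kernel_def[abs_def] using D by (intro continuous_intros) (auto simp: max_def split: if_splits)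

lemma truncated_kernel_SUP: "log_kernel D z w = (SUP M. ennreal (truncated_kernel D M z w))"
proof (cases "z = w")
  case True
  then have "truncated_kernel D M z w = real M" for M
    using D by (simp add: truncated_kernel_def ln_mult)
  then have "(SUP M. ennreal (truncated_kernel D M z w)) = (SUP M. of_nat M)" by (simp add: ennreal_of_nat_eq_real_of_nat)
  then have "(SUP M. ennreal (truncated_kernel D M z w)) = top" by (simp only: ennreal_SUP_of_nat_eq_top)
  then show ?thesis using True by (simp only: log_kernel_simps)
next
  case False
  then have t: "cmod (z - w) > 0" by simp
  obtain M where M: "ln D - ln (cmod (z - w)) \<le> real M" using real_arch_simple by blast
  have "ln (D * exp (- real M)) \<le> ln (cmod (z - w))" using M D by (simp add: ln_mult)
  then have "D * exp (- real M) \<le> cmod (z - w)" using D t by (subst (asm) ln_le_cancel_iff) auto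
  then have "truncated_kernel D M z w = max 0 (ln D - ln (cmod (z - w)))" by (simp add: truncated_kernel_def max_absorb1)
  then have "log_kernel D z w = ennreal (truncated_kernel D M z w)" using False by (simp add: log_kernel_simps)
  then have "log_kernel D z w \<le> (SUP M. ennreal (truncated_kernel D M z w))"
    by (metis SUP_upper UNIV_I)
  then show ?thesis using truncated_kernel_le by (intro antisym SUP_least) auto
qed

lemma truncated_kernel_mono: "M \<le> M' \<Longrightarrow> truncated_kernel D M z w \<le> truncated_kernel D M' z w"
proof -
  assume "M \<le> M'"
  then have "D * exp (- real M') \<le> D * exp (- real M)" using D by simp
  then have "max (cmod (z - w)) (D * exp (- real M')) \<le> max (cmod (z - w)) (D * exp (- real M))"
    by (intro max.mono) auto
  then have "ln (max (cmod (z - w)) (D * exp (- real M'))) \<le> ln (max (cmod (z - w)) (D * exp (- real M)))"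
    using D by (intro ln_mono) (auto simp: less_max_iff_disj)
  then show ?thesis by (simp add: truncated_kernel_def)
qed

lemma sum_symmetric_square:
  fixes k :: "nat \<Rightarrow> nat \<Rightarrow> real"
  assumes "\<And>i j. k i j = k j i"
  shows "(\<Sum>i<n. \<Sum>j<n. k i j) = 2 * (\<Sum>i<n. \<Sum>j<i. k i j) + (\<Sum>i<n. k i i)"
proof (induction n)
  case (Suc n)
  have "(\<Sum>i<n. k i n) = (\<Sum>j<n. k n j)" by (intro sum.cong) (auto intro: assms)
  then show ?case using Suc by (simp add: sum.distrib)
qed simp

text \<open>Lower semicontinuity of the energy under weak limits. Empirical measures have infinite
  energy because of the diagonal, so only pairs \<open>j < i\<close> are counted; the diagonal is
  restored for the truncated kernel, where it costs at most \<open>M / n\<close>.\<close>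

lemma energy_of_limit_measure:
  assumes E: "compact E" "E \<noteq> {}"
    and x: "\<And>n i. i < n \<Longrightarrow> x n i \<in> E"
    and en: "\<And>n. n > 0 \<Longrightarrow> (\<Sum>i<n. \<Sum>j<i. log_kernel D (x n i) (x n j)) \<le> ennreal ((real n)\<^sup>2 * \<kappa> n / 2)"
    and \<kappa>: "\<kappa> \<longlonglongrightarrow> l" "\<And>n. \<kappa> n \<ge> 0"
  shows "\<exists>\<mu>\<in>prob_measures_on E. mutual_energy D \<mu> \<mu> \<le> ennreal l"
proof -
  obtain \<mu> r where r: "strict_mono (r :: nat \<Rightarrow> nat)" "\<And>k. r k > 0" and \<mu>: "prob_space \<mu>" "sets \<mu> = sets borel" "AE z in \<mu>. z \<in> E"
    and lim: "\<And>\<phi>::complex \<Rightarrow> real. continuous_on UNIV \<phi> \<Longrightarrow> bounded (range \<phi>) \<Longrightarrow>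
      (\<lambda>k. (\<Sum>i<r k. \<phi> (x (r k) i)) / real (r k)) \<longlonglongrightarrow> (\<integral>z. \<phi> z \<partial>\<mu>)"
    by (rule empirical_measures_weak_limit[OF E, of x]) (use x in auto)
  interpret prob_space \<mu> by fact
  note [measurable_cong] = \<mu>(2)
  have bd: "(\<integral>z. \<integral>w. truncated_kernel D M z w \<partial>\<mu> \<partial>\<mu>) \<le> l \<and>
      (\<integral>\<^sup>+z. \<integral>\<^sup>+w. ennreal (truncated_kernel D M z w) \<partial>\<mu> \<partial>\<mu>) = ennreal (\<integral>z. \<integral>w. truncated_kernel D M z w \<partial>\<mu> \<partial>\<mu>)" for M
  proof -
    let ?t = "truncated_kernel D M" and ?L = "exp (real M)"
    have [measurable]: "?t z \<in> borel_measurable borel" for z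
      using truncated_kernel_continuous by (rule borel_measurable_continuous_onI)
    have int: "integrable \<mu> (?t z)" for z
      by (rule integrable_const_bound[of _ "real M"]) (auto simp: truncated_kernel_bounds)
    define H where "H z = (\<integral>w. ?t z w \<partial>\<mu>)" for z
    define h where "h n z = (\<Sum>j<n. ?t z (x n j)) / real n" for n z
    have H_Lip: "\<bar>H z - H z'\<bar> \<le> ?L * cmod (z - z')" for z z'
    proof -
      have "\<bar>H z - H z'\<bar> = \<bar>\<integral>w. ?t z w - ?t z' w \<partial>\<mu>\<bar>" unfolding H_def using int by simp
      also have "\<dots> \<le> (\<integral>w. \<bar>?t z w - ?t z' w\<bar> \<partial>\<mu>)" by (rule integral_abs_bound)
      also have "\<dots> \<le> (\<integral>w. ?L * cmod (z - z') \<partial>\<mu>)"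
        using int truncated_kernel_Lipschitz by (intro integral_mono) auto
      finally show ?thesis by (simp add: prob_space)
    qed
    have h_Lip: "\<bar>h n z - h n z'\<bar> \<le> ?L * cmod (z - z')" if "n > 0" for n z z'
    proof -
      have "\<bar>h n z - h n z'\<bar> = \<bar>\<Sum>j<n. ?t z (x n j) - ?t z' (x n j)\<bar> / real n"
        by (simp add: h_def sum_subtractf diff_divide_distrib[symmetric] abs_divide)
      also have "\<bar>\<Sum>j<n. ?t z (x n j) - ?t z' (x n j)\<bar> \<le> (\<Sum>j<n. ?L * cmod (z - z'))"
        by (rule order_trans[OF sum_abs sum_mono]) (rule truncated_kernel_Lipschitz)
      finally show ?thesis using that by (simp add: divide_right_mono)
    qed
    have H_cont: "continuous_on UNIV H"
      by (rule lipschitz_on_continuous_on[of ?L], rule lipschitz_onI) (auto simp: dist_norm H_Lip)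
    have H_bd: "0 \<le> H z" "H z \<le> real M" for z
      unfolding H_def using int truncated_kernel_bounds
      by (auto intro!: integral_nonneg_AE integral_le_const)
    have [measurable]: "H \<in> borel_measurable borel" using H_cont by (rule borel_measurable_continuous_onI)
    have intH: "integrable \<mu> H" by (rule integrable_const_bound[of _ "real M"]) (auto simp: H_bd)
    have Hlim: "(\<lambda>k. (\<Sum>i<r k. H (x (r k) i)) / real (r k)) \<longlonglongrightarrow> (\<integral>z. H z \<partial>\<mu>)"
      by (rule lim[OF H_cont]) (rule boundedI[of _ "real M"], auto simp: H_bd)
    have ptw: "(\<lambda>k. h (r k) z) \<longlonglongrightarrow> H z" for z
      unfolding h_def H_def
      by (rule lim[OF truncated_kernel_continuous]) (rule boundedI[of _ "real M"], auto simp: truncated_kernel_bounds)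
    \<comment> \<open>The points at which the potentials are evaluated move with \<open>k\<close>,
      so uniform convergence is needed; it follows from convergence on a finite net of mesh
      \<open>d\<close> and the common Lipschitz constant.\<close>
    have unif: "\<forall>\<^sub>F k in sequentially. \<forall>z\<in>E. \<bar>h (r k) z - H z\<bar> \<le> e" if e: "e > 0" for e
    proof -
      define d where "d = e / (3 * ?L)"
      have d: "d > 0" "?L * d = e / 3" using e by (auto simp: d_def)
      obtain N where N: "finite N" "N \<subseteq> E" "E \<subseteq> (\<Union>c\<in>N. ball c d)"
        using compactE_image[OF E(1), of E "\<lambda>c. ball c d"] d(1) by (metis UN_I centre_in_ball open_ball subsetI)
      have "\<forall>\<^sub>F k in sequentially. \<forall>c\<in>N. \<bar>h (r k) c - H c\<bar> < e / 3"
        using N(1) e tendstoD[OF ptw, of "e/3"] by (simp add: eventually_ball_finite_distrib dist_real_def)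
      then show ?thesis
      proof eventually_elim
        case (elim k)
        show ?case
        proof
          fix z assume "z \<in> E"
          then obtain c where c: "c \<in> N" "dist c z < d" using N(3) by auto
          have "cmod (z - c) \<le> d" using c(2) by (simp add: dist_norm norm_minus_commute)
          then have "?L * cmod (z - c) \<le> e / 3" using d(2) by (metis exp_ge_zero mult_left_mono)
          then show "\<bar>h (r k) z - H z\<bar> \<le> e"
            using h_Lip[OF r(2), of k z c] H_Lip[of z c] bspec[OF elim c(1)] by linarith
        qed
      qed
    qed
    define S where "S n = (\<Sum>i<n. h n (x n i)) / real n" for n
    have "(\<lambda>k. S (r k) - (\<Sum>i<r k. H (x (r k) i)) / real (r k)) \<longlonglongrightarrow> 0"
    proof (rule tendstoI)
      fix e :: real assume "e > 0"
      then have "\<forall>\<^sub>F k in sequentially. \<forall>z\<in>E. \<bar>h (r k) z - H z\<bar> \<le> e / 2" by (intro unif) simp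
      then show "\<forall>\<^sub>F k in sequentially. dist (S (r k) - (\<Sum>i<r k. H (x (r k) i)) / real (r k)) 0 < e"
      proof eventually_elim
        case (elim k)
        have "\<bar>S (r k) - (\<Sum>i<r k. H (x (r k) i)) / real (r k)\<bar> = \<bar>\<Sum>i<r k. h (r k) (x (r k) i) - H (x (r k) i)\<bar> / real (r k)"
          by (simp add: S_def sum_subtractf diff_divide_distrib[symmetric] abs_divide)
        also have "\<bar>\<Sum>i<r k. h (r k) (x (r k) i) - H (x (r k) i)\<bar> \<le> (\<Sum>i<r k. e / 2)"
          by (rule order_trans[OF sum_abs sum_mono]) (use elim x in auto)
        finally show ?case using r(2)[of k] \<open>e > 0\<close> by (simp add: divide_right_mono dist_real_def)
      qed
    qed
    from tendsto_add[OF this Hlim] have Slim: "(\<lambda>k. S (r k)) \<longlonglongrightarrow> (\<integral>z. H z \<partial>\<mu>)" by simp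
    have Sle: "S n \<le> \<kappa> n + real M / real n" if n: "n > 0" for n
    proof -
      have "ennreal (\<Sum>i<n. \<Sum>j<i. ?t (x n i) (x n j)) = (\<Sum>i<n. \<Sum>j<i. ennreal (?t (x n i) (x n j)))"
        by (simp add: truncated_kernel_bounds sum_nonneg flip: sum_ennreal)
      also have "\<dots> \<le> (\<Sum>i<n. \<Sum>j<i. log_kernel D (x n i) (x n j))" by (intro sum_mono truncated_kernel_le)
      also have "\<dots> \<le> ennreal ((real n)\<^sup>2 * \<kappa> n / 2)" by (rule en[OF n])
      finally have 1: "(\<Sum>i<n. \<Sum>j<i. ?t (x n i) (x n j)) \<le> (real n)\<^sup>2 * \<kappa> n / 2"
        using \<kappa>(2)[of n] by (subst (asm) ennreal_le_iff) auto
      have 2: "(\<Sum>i<n. ?t (x n i) (x n i)) \<le> real n * real M"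
        using sum_mono[of "{..<n}" "\<lambda>i. ?t (x n i) (x n i)" "\<lambda>i. real M"] truncated_kernel_bounds by simp
      have "S n = (\<Sum>i<n. \<Sum>j<n. ?t (x n i) (x n j)) / (real n)\<^sup>2"
        unfolding S_def h_def by (simp add: sum_divide_distrib[symmetric] power2_eq_square)
      also have "\<dots> = (2 * (\<Sum>i<n. \<Sum>j<i. ?t (x n i) (x n j)) + (\<Sum>i<n. ?t (x n i) (x n i))) / (real n)\<^sup>2"
        by (subst sum_symmetric_square) (auto simp: truncated_kernel_commute)
      also have "\<dots> \<le> ((real n)\<^sup>2 * \<kappa> n + real n * real M) / (real n)\<^sup>2"
        using 1 2 by (intro divide_right_mono) auto
      also have "\<dots> = \<kappa> n + real M / real n" using n by (simp add: field_simps power2_eq_square)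
      finally show ?thesis .
    qed
    have "(\<lambda>n. \<kappa> n + real M / real n) \<longlonglongrightarrow> l + 0"
      by (intro tendsto_add \<kappa>(1) lim_const_over_n)
    then have "(\<lambda>k. \<kappa> (r k) + real M / real (r k)) \<longlonglongrightarrow> l"
      using LIMSEQ_subseq_LIMSEQ[OF _ r(1)] by (fastforce simp: o_def)
    then have "(\<integral>z. H z \<partial>\<mu>) \<le> l" using Slim Sle r(2) by (intro LIMSEQ_le) auto
    moreover have "(\<integral>\<^sup>+z. \<integral>\<^sup>+w. ennreal (?t z w) \<partial>\<mu> \<partial>\<mu>) = (\<integral>\<^sup>+z. ennreal (H z) \<partial>\<mu>)"
      unfolding H_def using int truncated_kernel_bounds by (intro nn_integral_cong nn_integral_eq_integral) auto
    moreover have "(\<integral>\<^sup>+z. ennreal (H z) \<partial>\<mu>) = ennreal (\<integral>z. H z \<partial>\<mu>)"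
      using intH H_bd by (intro nn_integral_eq_integral) auto
    ultimately show ?thesis by (simp add: H_def)
  qed
  have [measurable]: "(\<lambda>(z, w). truncated_kernel D M z w) \<in> borel_measurable (borel \<Otimes>\<^sub>M borel)"
    "truncated_kernel D M z \<in> borel_measurable borel" for M z
    unfolding truncated_kernel_def[abs_def] by measurable
  have "mutual_energy D \<mu> \<mu> = (\<integral>\<^sup>+z. \<integral>\<^sup>+w. (SUP M. ennreal (truncated_kernel D M z w)) \<partial>\<mu> \<partial>\<mu>)"
    by (simp add: mutual_energy_def truncated_kernel_SUP)
  also have "\<dots> = (\<integral>\<^sup>+z. (SUP M. \<integral>\<^sup>+w. ennreal (truncated_kernel D M z w) \<partial>\<mu>) \<partial>\<mu>)"
    by (intro nn_integral_cong nn_integral_monotone_convergence_SUP)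
       (auto simp: incseq_def le_fun_def intro!: ennreal_leI truncated_kernel_mono)
  also have "\<dots> = (SUP M. \<integral>\<^sup>+z. \<integral>\<^sup>+w. ennreal (truncated_kernel D M z w) \<partial>\<mu> \<partial>\<mu>)"
  proof (rule nn_integral_monotone_convergence_SUP)
    show "incseq (\<lambda>M z. \<integral>\<^sup>+w. ennreal (truncated_kernel D M z w) \<partial>\<mu>)"
      by (auto simp: incseq_def le_fun_def intro!: nn_integral_mono ennreal_leI truncated_kernel_mono)
  qed measurable
  also have "\<dots> \<le> ennreal l" using bd by (intro SUP_least) (auto intro: ennreal_leI)
  finally have "mutual_energy D \<mu> \<mu> \<le> ennreal l" .
  moreover have "\<mu> \<in> prob_measures_on E"
    using \<mu> prob_measures_on_iff[OF compact_imp_closed[OF E(1)]] by simp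
  ultimately show ?thesis by blast
qed

lemma sum_index_le: "(\<Sum>i<n. real i) \<le> (real n)\<^sup>2 / 2"
  by (induction n) (auto simp: power2_eq_square algebra_simps)

text \<open>Measures within \<open>1 / n\<close> of the infimum are replaced by configurations of
  \<open>n\<close> points with no larger mean energy, whose limit attains the infimum. Thus weak
  compactness is called upon for empirical measures only.\<close>

lemma exists_minimal_energy:
  assumes E: "compact E" and \<nu>: "\<nu>\<^sub>0 \<in> prob_measures_on E" "mutual_energy D \<nu>\<^sub>0 \<nu>\<^sub>0 < top"
  shows "\<exists>\<mu>\<in>prob_measures_on E. \<forall>\<nu>\<in>prob_measures_on E. mutual_energy D \<mu> \<mu> \<le> mutual_energy D \<nu> \<nu>"
proof -
  have cl: "closed E" using E by (rule compact_imp_closed)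
  have "E \<noteq> {}"
  proof
    assume "E = {}"
    then have "AE z in \<nu>\<^sub>0. False" "prob_space \<nu>\<^sub>0" using \<nu>(1) prob_measures_on_iff[OF cl] by auto
    then show False by (simp add: prob_space.AE_False)
  qed
  define I where "I = (INF \<nu>\<in>prob_measures_on E. mutual_energy D \<nu> \<nu>)"
  have "I \<le> mutual_energy D \<nu>\<^sub>0 \<nu>\<^sub>0" unfolding I_def using \<nu>(1) by (rule INF_lower)
  then have "I < top" using \<nu>(2) by (rule le_less_trans)
  then obtain e where e: "I = ennreal e" "e \<ge> 0" by (cases I) auto
  define \<kappa> where "\<kappa> n = e + 1 / real n" for n
  have "\<exists>x. (\<forall>i<n. x i \<in> E) \<and> (n > 0 \<longrightarrow> (\<Sum>i<n. \<Sum>j<i. log_kernel D (x i) (x j)) \<le> ennreal ((real n)\<^sup>2 * \<kappa> n / 2))" for n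
  proof (cases "n > 0")
    case True
    have "I < ennreal (\<kappa> n)" using True e by (simp add: \<kappa>_def ennreal_less_iff)
    then obtain \<nu> where \<nu>: "\<nu> \<in> prob_measures_on E" "mutual_energy D \<nu> \<nu> < ennreal (\<kappa> n)"
      unfolding I_def INF_less_iff by blast
    obtain x where x: "\<forall>i<n. x i \<in> E" and
      "(\<Sum>i<n. (\<Sum>j<i. log_kernel D (x i) (x j)) + 0) \<le> (\<Sum>i<n. (\<Sum>j<i. mutual_energy D \<nu> \<nu>) + (\<integral>\<^sup>+z. 0 \<partial>\<nu>))"
      using configuration_below_mean_energy[OF cl, of n "\<lambda>_. \<nu>" "\<lambda>_ _. 0" D] \<nu>(1) by auto
    then have "(\<Sum>i<n. \<Sum>j<i. log_kernel D (x i) (x j)) \<le> (\<Sum>i<n. \<Sum>j<i. mutual_energy D \<nu> \<nu>)" by simp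
    also have "\<dots> \<le> (\<Sum>i<n. \<Sum>j<i. ennreal (\<kappa> n))" using \<nu>(2) by (intro sum_mono) auto
    also have "\<dots> = ennreal (\<Sum>i<n. real i * \<kappa> n)"
      using e by (subst sum_ennreal[symmetric]) (auto simp: \<kappa>_def ennreal_mult ennreal_of_nat_eq_real_of_nat)
    also have "(\<Sum>i<n. real i * \<kappa> n) = (\<Sum>i<n. real i) * \<kappa> n" by (simp add: sum_distrib_right)
    also have "ennreal ((\<Sum>i<n. real i) * \<kappa> n) \<le> ennreal ((real n)\<^sup>2 / 2 * \<kappa> n)"
      using e sum_index_le[of n] by (intro ennreal_leI mult_right_mono) (auto simp: \<kappa>_def)
    finally show ?thesis using x by auto
  next
    case False
    then show ?thesis by auto
  qed
  then have "\<exists>x. \<forall>n. (\<forall>i<n. x n i \<in> E) \<and> (n > 0 \<longrightarrow>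
      (\<Sum>i<n. \<Sum>j<i. log_kernel D (x n i) (x n j)) \<le> ennreal ((real n)\<^sup>2 * \<kappa> n / 2))"
    by (intro choice allI)
  then obtain x where "\<forall>n. (\<forall>i<n. x n i \<in> E) \<and> (n > 0 \<longrightarrow>
      (\<Sum>i<n. \<Sum>j<i. log_kernel D (x n i) (x n j)) \<le> ennreal ((real n)\<^sup>2 * \<kappa> n / 2))" by (elim exE)
  then have x: "\<And>n i. i < n \<Longrightarrow> x n i \<in> E"
    "\<And>n. n > 0 \<Longrightarrow> (\<Sum>i<n. \<Sum>j<i. log_kernel D (x n i) (x n j)) \<le> ennreal ((real n)\<^sup>2 * \<kappa> n / 2)"
    by simp_all
  have \<kappa>: "\<kappa> \<longlonglongrightarrow> e + 0" unfolding \<kappa>_def by (intro tendsto_add tendsto_const lim_const_over_n)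
  have "\<exists>\<mu>\<in>prob_measures_on E. mutual_energy D \<mu> \<mu> \<le> ennreal (e + 0)"
    by (rule energy_of_limit_measure[OF E \<open>E \<noteq> {}\<close> x \<kappa>]) (use e in \<open>auto simp: \<kappa>_def\<close>)
  then obtain \<mu> where \<mu>: "\<mu> \<in> prob_measures_on E" "mutual_energy D \<mu> \<mu> \<le> I" using e(1) by auto
  have "I \<le> mutual_energy D \<nu> \<nu>" if "\<nu> \<in> prob_measures_on E" for \<nu>
    unfolding I_def using that by (rule INF_lower)
  then show ?thesis using \<mu> order_trans by blast
qed

text \<open>Were there no such product, points could be chosen greedily, each with a large product
  of distances to its predecessors, as for Leja points. Their mean energies stay bounded, so a limit
  measure on \<open>F\<close> would have finite energy.\<close>

lemma small_polynomial_on_polar_set: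
  assumes F: "compact F" "F \<subseteq> E" "E \<noteq> {}" and polar: "\<And>\<mu>. \<mu> \<in> prob_measures_on F \<Longrightarrow> mutual_energy D \<mu> \<mu> = top"
    and diam: "\<And>z w. z \<in> F \<Longrightarrow> w \<in> F \<Longrightarrow> cmod (z - w) \<le> D" and \<rho>: "\<rho> > 0"
  shows "\<exists>m>0. \<exists>c::nat \<Rightarrow> complex. (\<forall>i<m. c i \<in> E) \<and> (\<forall>z\<in>F. (\<Prod>i<m. cmod (z - c i)) \<le> \<rho> ^ m)"
proof (cases "F = {}")
  case True
  then show ?thesis using F(3) by (intro exI[of _ 1]) auto
next
  case False
  show ?thesis
  proof (rule ccontr)
    assume neg: "\<not> ?thesis"
    \<comment> \<open>At most 1, so that the energy bound \<open>L\<close> below is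
      nonnegative.\<close>
    define \<sigma> where "\<sigma> = min \<rho> 1"
    have \<sigma>: "0 < \<sigma>" "\<sigma> \<le> 1" "\<sigma> \<le> \<rho>" using \<rho> by (auto simp: \<sigma>_def)
    have "\<exists>y. \<forall>n. (y n \<in> F \<and> (n > 0 \<longrightarrow> \<sigma> ^ n < (\<Prod>i<n. cmod (y n - y i))))"
    proof (rule dependent_wellorder_choice)
      fix n :: nat and y assume y: "\<And>k. k < n \<Longrightarrow> y k \<in> F \<and> (k > 0 \<longrightarrow> \<sigma> ^ k < (\<Prod>i<k. cmod (y k - y i)))"
      show "\<exists>r. r \<in> F \<and> (n > 0 \<longrightarrow> \<sigma> ^ n < (\<Prod>i<n. cmod (r - y i)))"
      proof (cases "n > 0")
        case True
        have "\<not> (\<forall>z\<in>F. (\<Prod>i<n. cmod (z - y i)) \<le> \<rho> ^ n)"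
          using neg True y F(2) by blast
        then obtain z where "z \<in> F" "\<rho> ^ n < (\<Prod>i<n. cmod (z - y i))" by force
        moreover have "\<sigma> ^ n \<le> \<rho> ^ n" using \<sigma> by (intro power_mono) auto
        ultimately show ?thesis by (intro exI[of _ z]) auto
      qed (use False in auto)
    qed auto
    then obtain y where y: "\<And>n. y n \<in> F" "\<And>n. n > 0 \<Longrightarrow> \<sigma> ^ n < (\<Prod>i<n. cmod (y n - y i))" by blast
    define L where "L = ln D - ln \<sigma>"
    have L: "L \<ge> 0" using D \<sigma> by (simp add: L_def ln_le_zero_iff)
    have row: "(\<Sum>j<i. log_kernel D (y i) (y j)) \<le> ennreal (real i * L)" for i
    proof (cases "i > 0")
      case True
      have nz: "y i \<noteq> y j" if "j < i" for j
      proof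
        assume "y i = y j"
        then have "(\<Prod>j<i. cmod (y i - y j)) = 0" using that by (intro prod_zero) auto
        moreover have "0 < \<sigma> ^ i" using \<sigma>(1) by simp
        ultimately show False using y(2)[OF True] by linarith
      qed
      have "ln (\<sigma> ^ i) \<le> ln (\<Prod>j<i. cmod (y i - y j))"
        using y(2)[of i] True \<sigma>(1) by (intro ln_mono) auto
      moreover have "ln (\<Prod>j<i. cmod (y i - y j)) = (\<Sum>j<i. ln (cmod (y i - y j)))"
        using nz by (intro ln_prod) auto
      ultimately have "real i * ln \<sigma> \<le> (\<Sum>j<i. ln (cmod (y i - y j)))"
        using \<sigma> by (simp add: ln_realpow)
      then have "(\<Sum>j<i. ln D - ln (cmod (y i - y j))) \<le> real i * L"
        by (simp add: sum_subtractf L_def algebra_simps)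
      moreover have "(\<Sum>j<i. log_kernel D (y i) (y j)) = (\<Sum>j<i. ennreal (ln D - ln (cmod (y i - y j))))"
        using nz by (intro sum.cong) (auto simp: log_kernel_simps)
      moreover have "\<dots> = ennreal (\<Sum>j<i. ln D - ln (cmod (y i - y j)))"
        using y(1) nz diam by (intro sum_ennreal) (auto intro!: ln_mono)
      ultimately show ?thesis by (simp add: ennreal_leI)
    qed auto
    have "\<exists>\<mu>\<in>prob_measures_on F. mutual_energy D \<mu> \<mu> \<le> ennreal L"
    proof (rule energy_of_limit_measure[OF F(1) False, of "\<lambda>n. y" "\<lambda>n. L"])
      fix n :: nat
      have "(\<Sum>i<n. \<Sum>j<i. log_kernel D (y i) (y j)) \<le> (\<Sum>i<n. ennreal (real i * L))" by (intro sum_mono row)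
      also have "\<dots> = ennreal ((\<Sum>i<n. real i) * L)" using L by (simp add: sum_distrib_right)
      also have "\<dots> \<le> ennreal ((real n)\<^sup>2 / 2 * L)" using L sum_index_le by (intro ennreal_leI mult_right_mono) auto
      finally show "(\<Sum>i<n. \<Sum>j<i. log_kernel D (y i) (y j)) \<le> ennreal ((real n)\<^sup>2 * L / 2)" by simp
    qed (use y(1) L in auto)
    then show False using polar by (auto simp: top_unique)
  qed
qed

end

section \<open>Variation of the minimizing measure\<close>

lemma mixture_of_prob_measures:
  assumes \<mu>: "prob_space \<mu>" "sets \<mu> = sets borel" and \<nu>: "prob_space \<nu>" "sets \<nu> = sets borel"
    and t: "0 \<le> t" "t \<le> (1::real)"
  obtains \<xi> where "prob_space \<xi>" "sets \<xi> = sets borel"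
    "\<And>f. f \<in> borel_measurable borel \<Longrightarrow>
      (\<integral>\<^sup>+z. f z \<partial>\<xi>) = (\<integral>\<^sup>+z. f z \<partial>\<mu>) * ennreal t + (\<integral>\<^sup>+z. f z \<partial>\<nu>) * ennreal (1 - t)"
proof -
  \<comment> \<open>A convex combination as a coin toss: with probability \<open>t\<close> sample
    from \<open>\<mu>\<close>, otherwise from \<open>\<nu>\<close>.\<close>
  define k where "k b = (if b then \<mu> else \<nu>)" for b
  have km: "k \<in> measurable (measure_pmf (bernoulli_pmf t)) (subprob_algebra borel)"
    using assms by (auto simp: k_def space_subprob_algebra prob_space_imp_subprob_space)
  define \<xi> where "\<xi> = measure_pmf (bernoulli_pmf t) \<bind> k"
  have int: "(\<integral>\<^sup>+z. f z \<partial>\<xi>) = (\<integral>\<^sup>+z. f z \<partial>\<mu>) * ennreal t + (\<integral>\<^sup>+z. f z \<partial>\<nu>) * ennreal (1 - t)"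
    if "f \<in> borel_measurable borel" for f
    unfolding \<xi>_def using t by (subst nn_integral_bind[OF that km]) (simp add: k_def)
  have s: "sets \<xi> = sets borel" unfolding \<xi>_def using assms by (subst sets_bind[where N = borel]) (auto simp: k_def)
  have "emeasure \<xi> (space \<xi>) = (\<integral>\<^sup>+z. indicator UNIV z \<partial>\<xi>)"
    using sets_eq_imp_space_eq[OF s] s by (subst nn_integral_indicator) auto
  also have "\<dots> = emeasure \<mu> (space \<mu>) * ennreal t + emeasure \<nu> (space \<nu>) * ennreal (1 - t)"
    by (subst int) auto
  also have "\<dots> = 1"
    using t prob_space.emeasure_space_1[OF \<mu>(1)] prob_space.emeasure_space_1[OF \<nu>(1)]
    by (simp add: ennreal_plus[symmetric] del: ennreal_plus)
  finally have "prob_space \<xi>" by (rule prob_spaceI)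
  then show thesis using s int by (rule that)
qed

text \<open>Along the segment from \<open>\<omega>\<close> to \<open>\<mu>\<close> the energy is a
  quadratic polynomial in \<open>t\<close>, minimal at 0; the inequality says that its derivative
  there is nonnegative.\<close>

lemma minimal_energy_variation:
  assumes E: "closed E" and \<omega>: "\<omega> \<in> prob_measures_on E"
    and min: "\<And>\<nu>. \<nu> \<in> prob_measures_on E \<Longrightarrow> mutual_energy D \<omega> \<omega> \<le> mutual_energy D \<nu> \<nu>"
    and fin: "mutual_energy D \<omega> \<omega> < top"
    and \<mu>: "\<mu> \<in> prob_measures_on E" "mutual_energy D \<mu> \<mu> < top"
  shows "mutual_energy D \<omega> \<omega> \<le> mutual_energy D \<mu> \<omega>"
proof (cases "mutual_energy D \<mu> \<omega>")
  case (real x)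
  have p: "prob_space \<omega>" "sets \<omega> = sets borel" "AE z in \<omega>. z \<in> E"
    "prob_space \<mu>" "sets \<mu> = sets borel" "AE z in \<mu>. z \<in> E"
    using \<omega> \<mu>(1) prob_measures_on_iff[OF E] by auto
  obtain e where e: "mutual_energy D \<omega> \<omega> = ennreal e" "e \<ge> 0" using fin by (cases "mutual_energy D \<omega> \<omega>") auto
  obtain j where j: "mutual_energy D \<mu> \<mu> = ennreal j" "j \<ge> 0" using \<mu>(2) by (cases "mutual_energy D \<mu> \<mu>") auto
  have com: "mutual_energy D \<omega> \<mu> = ennreal x"
    using mutual_energy_commute p prob_space.finite_measure real by metis
  have quad: "e \<le> t\<^sup>2 * j + 2 * t * (1 - t) * x + (1 - t)\<^sup>2 * e" if t: "0 < t" "t < 1" for t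
  proof -
    obtain \<xi> where \<xi>: "prob_space \<xi>" "sets \<xi> = sets borel" and
      int: "\<And>f. f \<in> borel_measurable borel \<Longrightarrow>
      (\<integral>\<^sup>+z. f z \<partial>\<xi>) = (\<integral>\<^sup>+z. f z \<partial>\<mu>) * ennreal t + (\<integral>\<^sup>+z. f z \<partial>\<omega>) * ennreal (1 - t)"
      by (rule mixture_of_prob_measures[OF p(4,5,1,2), of t]) (use t in auto)
    have "emeasure \<xi> (- E) = (\<integral>\<^sup>+z. indicator (- E) z \<partial>\<xi>)"
      using \<xi>(2) E by (subst nn_integral_indicator) auto
    also have "\<dots> = (\<integral>\<^sup>+z. indicator (- E) z \<partial>\<mu>) * ennreal t + (\<integral>\<^sup>+z. indicator (- E) z \<partial>\<omega>) * ennreal (1 - t)"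
      using E by (intro int) auto
    also have "(\<integral>\<^sup>+z. indicator (- E) z \<partial>\<mu>) = 0"
      using p E by (subst nn_integral_0_iff_AE) (auto elim: eventually_mono)
    also have "(\<integral>\<^sup>+z. indicator (- E) z \<partial>\<omega>) = 0"
      using p E by (subst nn_integral_0_iff_AE) (auto elim: eventually_mono)
    finally have "emeasure \<xi> (- E) = 0" by simp
    then have "AE z in \<xi>. z \<in> E"
      using \<xi>(2) E by (intro AE_I[of _ _ "- E"]) auto
    then have "\<xi> \<in> prob_measures_on E" using \<xi> prob_measures_on_iff[OF E] by blast
    then have le: "ennreal e \<le> mutual_energy D \<xi> \<xi>" using min e(1) by metis
    have [measurable]: "(\<lambda>z. \<integral>\<^sup>+w. log_kernel D z w \<partial>\<mu>) \<in> borel_measurable borel" "(\<lambda>z. \<integral>\<^sup>+w. log_kernel D z w \<partial>\<omega>) \<in> borel_measurable borel"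
      using p by (simp_all add: measurable_log_kernel_nn_integral prob_space.finite_measure)
    let ?f = "\<lambda>z. (\<integral>\<^sup>+w. log_kernel D z w \<partial>\<mu>) * ennreal t + (\<integral>\<^sup>+w. log_kernel D z w \<partial>\<omega>) * ennreal (1 - t)"
    have lin: "(\<integral>\<^sup>+z. ?f z \<partial>\<nu>) = mutual_energy D \<nu> \<mu> * ennreal t + mutual_energy D \<nu> \<omega> * ennreal (1 - t)"
      if "sets \<nu> = sets borel" for \<nu>
    proof -
      note [measurable_cong] = that
      show ?thesis unfolding mutual_energy_def by (subst nn_integral_add) (auto simp: nn_integral_multc)
    qed
    have "mutual_energy D \<xi> \<xi> = (\<integral>\<^sup>+z. ?f z \<partial>\<xi>)"
      unfolding mutual_energy_def by (intro nn_integral_cong int) simp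
    also have "\<dots> = (\<integral>\<^sup>+z. ?f z \<partial>\<mu>) * ennreal t + (\<integral>\<^sup>+z. ?f z \<partial>\<omega>) * ennreal (1 - t)"
      by (intro int) measurable
    also have "\<dots> = (ennreal j * ennreal t + ennreal x * ennreal (1 - t)) * ennreal t
      + (ennreal x * ennreal t + ennreal e * ennreal (1 - t)) * ennreal (1 - t)"
      using lin[OF p(5)] lin[OF p(2)] com real e(1) j(1) by simp
    also have "\<dots> = ennreal ((j * t + x * (1 - t)) * t + (x * t + e * (1 - t)) * (1 - t))"
      using t e(2) j(2) real by (simp add: ennreal_mult ennreal_plus)
    finally have "ennreal e \<le> ennreal ((j * t + x * (1 - t)) * t + (x * t + e * (1 - t)) * (1 - t))"
      using le by metis
    moreover have "0 \<le> (j * t + x * (1 - t)) * t + (x * t + e * (1 - t)) * (1 - t)"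
      using t e(2) j(2) real by (intro add_nonneg_nonneg mult_nonneg_nonneg) auto
    ultimately have "e \<le> (j * t + x * (1 - t)) * t + (x * t + e * (1 - t)) * (1 - t)"
      by (subst (asm) ennreal_le_iff)
    then show ?thesis by (simp add: power2_eq_square algebra_simps)
  qed
  have "e \<le> x"
  proof (rule ccontr)
    assume "\<not> e \<le> x"
    define d where "d = e - x"
    have d: "d > 0" using \<open>\<not> e \<le> x\<close> by (simp add: d_def)
    define s where "s = j + 2 * d + 1"
    have s: "s > 0" using j d by (simp add: s_def)
    \<comment> \<open>With this step length the minimality inequality yields
      \<open>2 * d \<le> t * (j + 2 * d) \<le> d\<close>.\<close>
    define t where "t = d / s"
    have t: "0 < t" "t < 1" using d s j by (auto simp: t_def s_def)
    have "2 * d \<le> t * (j + 2 * d)"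
    proof -
      have "e \<le> t\<^sup>2 * j + 2 * t * (1 - t) * (e - d) + (1 - t)\<^sup>2 * e" using quad[OF t] by (simp add: d_def)
      then have "0 \<le> t\<^sup>2 * (j + 2 * d - e) - 2 * t * d" by (simp add: power2_eq_square algebra_simps)
      then have "0 \<le> t * (t * (j + 2 * d - e) - 2 * d)" by (simp add: power2_eq_square algebra_simps)
      then have "2 * d \<le> t * (j + 2 * d - e)" using t by (simp add: zero_le_mult_iff)
      also have "\<dots> \<le> t * (j + 2 * d)" using t e by (intro mult_left_mono) auto
      finally show ?thesis .
    qed
    also have "t * (j + 2 * d) \<le> t * s" using t by (intro mult_left_mono) (auto simp: s_def)
    also have "t * s = d" using s by (simp add: t_def)
    finally show False using d by simp
  qed
  then show ?thesis using e real by (simp add: ennreal_leI)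
qed (use top_greatest in auto)

text \<open>Frostman's theorem for the minimizer: its potential is constant on the support, and the set
  where it is smaller carries no measure of finite energy.\<close>

lemma minimizer_potential_AE:
  assumes E: "closed E" and \<omega>: "\<omega> \<in> prob_measures_on E"
    and min: "\<And>\<nu>. \<nu> \<in> prob_measures_on E \<Longrightarrow> mutual_energy D \<omega> \<omega> \<le> mutual_energy D \<nu> \<nu>"
    and fin: "mutual_energy D \<omega> \<omega> < top"
  shows "AE z in \<omega>. (\<integral>\<^sup>+w. log_kernel D z w \<partial>\<omega>) = mutual_energy D \<omega> \<omega>"
proof -
  have p: "prob_space \<omega>" "sets \<omega> = sets borel" "AE z in \<omega>. z \<in> E"
    using \<omega> prob_measures_on_iff[OF E] by auto
  interpret prob_space \<omega> by fact
  note [measurable_cong] = p(2)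
  define e where "e = mutual_energy D \<omega> \<omega>"
  define u where "u z = (\<integral>\<^sup>+w. log_kernel D z w \<partial>\<omega>)" for z
  have u[measurable]: "u \<in> borel_measurable borel"
    unfolding u_def using p by (intro measurable_log_kernel_nn_integral) (auto intro: finite_measure)
  have eu: "(\<integral>\<^sup>+z. u z \<partial>\<omega>) = e" by (simp add: u_def e_def mutual_energy_def)
  have fin': "e < top" using fin by (simp add: e_def)
  have ae: "AE z in \<omega>. \<not> u z + \<eta> \<le> e" if \<eta>: "\<eta> > 0" for \<eta> :: ennreal
  proof -
    define S where "S = {z \<in> E. u z + \<eta> \<le> e}"
    have S[measurable]: "S \<in> sets borel"
    proof -
      have "S = E \<inter> {z \<in> space borel. u z + \<eta> \<le> e}" by (auto simp: S_def)
      also have "\<dots> \<in> sets borel" using E by (intro sets.Int) measurable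
      finally show ?thesis .
    qed
    \<comment> \<open>Otherwise the normalised restriction of \<open>\<omega>\<close> to
      \<open>S\<close> has finite energy, at most \<open>e\<close> over the squared mass, while its
      mean potential is at most \<open>e - \<eta>\<close>, against the variation inequality.\<close>
    have "emeasure \<omega> S = 0"
    proof (rule ccontr)
      assume pos: "emeasure \<omega> S \<noteq> 0"
      define \<mu> where "\<mu> = uniform_measure \<omega> S"
      have \<mu>: "prob_space \<mu>" unfolding \<mu>_def using pos by (intro prob_space_uniform_measure) auto
      have s: "sets \<mu> = sets borel" by (simp add: \<mu>_def p(2))
      have aeS: "AE z in \<mu>. z \<in> S" unfolding \<mu>_def using p(2) S by (intro AE_uniform_measureI) auto
      have "AE z in \<mu>. z \<in> E" using aeS by eventually_elim (simp add: S_def)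
      then have \<mu>E: "\<mu> \<in> prob_measures_on E" using prob_measures_on_iff[OF E] \<mu> s by simp
      define a where "a = emeasure \<omega> S"
      have a: "a \<noteq> 0" using pos by (simp add: a_def)
      have le: "(\<integral>\<^sup>+z. f z \<partial>\<mu>) \<le> (\<integral>\<^sup>+z. f z \<partial>\<omega>) / a" if [measurable]: "f \<in> borel_measurable borel" for f
      proof -
        have "(\<integral>\<^sup>+z. f z \<partial>\<mu>) = (\<integral>\<^sup>+z. f z * indicator S z \<partial>\<omega>) / a"
          unfolding \<mu>_def a_def by (rule nn_integral_uniform_measure) measurable
        also have "\<dots> \<le> (\<integral>\<^sup>+z. f z \<partial>\<omega>) / a"
          by (intro divide_right_mono_ennreal nn_integral_mono) (auto simp: indicator_def)
        finally show ?thesis .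
      qed
      have "mutual_energy D \<mu> \<mu> \<le> (\<integral>\<^sup>+z. u z / a \<partial>\<mu>)"
        unfolding mutual_energy_def u_def by (intro nn_integral_mono le) simp
      also have "\<dots> \<le> (\<integral>\<^sup>+z. u z / a \<partial>\<omega>) / a" by (intro le) measurable
      also have "(\<integral>\<^sup>+z. u z / a \<partial>\<omega>) = e / a" using eu by (subst nn_integral_divide) auto
      finally have "mutual_energy D \<mu> \<mu> \<le> e / a / a" .
      also have "\<dots> < top"
      proof -
        obtain r where r: "e = ennreal r" "r \<ge> 0" using fin' by (cases e) auto
        obtain b where b: "a = ennreal b" "b \<ge> 0" using emeasure_finite[of S] unfolding a_def by (cases "emeasure \<omega> S") auto
        then have "b > 0" using a by (metis ennreal_0 less_eq_real_def)
        then show ?thesis using r b by (simp add: divide_ennreal)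
      qed
      finally have "e \<le> mutual_energy D \<mu> \<omega>"
        unfolding e_def by (intro minimal_energy_variation[OF E \<omega> min fin \<mu>E])
      also have "mutual_energy D \<mu> \<omega> = (\<integral>\<^sup>+z. u z \<partial>\<mu>)" by (simp add: mutual_energy_def u_def)
      finally have 1: "e \<le> (\<integral>\<^sup>+z. u z \<partial>\<mu>)" .
      interpret \<mu>: prob_space \<mu> by fact
      have um: "u \<in> borel_measurable \<mu>" using u by (simp add: measurable_cong_sets[OF s refl])
      have "(\<integral>\<^sup>+z. u z + \<eta> \<partial>\<mu>) \<le> (\<integral>\<^sup>+z. e \<partial>\<mu>)"
        by (intro nn_integral_mono_AE, use aeS in eventually_elim) (simp add: S_def)
      then have "(\<integral>\<^sup>+z. u z \<partial>\<mu>) + \<eta> \<le> e" using um by (subst (asm) nn_integral_add) (simp_all add: \<mu>.emeasure_space_1)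
      then have "e + \<eta> \<le> e" using add_right_mono[OF 1, of \<eta>] by (rule order_trans[rotated])
      then show False using fin' \<eta>
        by (cases e; cases \<eta>) (auto simp: ennreal_plus[symmetric] top_unique simp del: ennreal_plus)
    qed
    then have "AE z in \<omega>. z \<notin> S" using p(2) by (intro AE_not_in null_setsI) auto
    with p(3) show ?thesis by eventually_elim (simp add: S_def)
  qed
  have "AE z in \<omega>. \<forall>k::nat. \<not> u z + ennreal (1 / real (Suc k)) \<le> e"
    unfolding AE_all_countable by (intro allI ae) simp
  then have ge: "AE z in \<omega>. e \<le> u z"
  proof eventually_elim
    case (elim z)
    show ?case
    proof (rule ccontr)
      assume "\<not> e \<le> u z"
      then have lt: "u z < e" by simp
      obtain r where r: "e = ennreal r" "r \<ge> 0" using fin' by (cases e) auto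
      obtain v where v: "u z = ennreal v" "v \<ge> 0" using lt fin' by (cases "u z") auto
      have "v < r" using lt r v by (simp add: ennreal_less_iff)
      then obtain k where "1 / real (Suc k) < r - v" using nat_approx_posE[of "r - v"] by (metis diff_gt_0_iff_gt)
      then have "u z + ennreal (1 / real (Suc k)) \<le> e"
        using r v by (simp add: ennreal_plus[symmetric] ennreal_leI del: ennreal_plus)
      then show False using elim by blast
    qed
  qed
  \<comment> \<open>The potential is almost everywhere at least its own mean, hence almost
    everywhere equal to it.\<close>
  have "AE z in \<omega>. u z \<le> e"
  proof (rule ccontr)
    assume "\<not> ?thesis"
    then have "(\<integral>\<^sup>+z. e \<partial>\<omega>) < (\<integral>\<^sup>+z. u z \<partial>\<omega>)"
      using ge fin' by (intro nn_integral_less) (auto simp: emeasure_space_1)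
    then show False using eu by (simp add: emeasure_space_1)
  qed
  with ge show ?thesis unfolding u_def e_def by eventually_elim (rule antisym)
qed

section \<open>The Green's function\<close>

lemma ext_integral_eq_integral:
  assumes h: "integrable \<mu> h" and f: "AE z in \<mu>. f z = ereal (h z)"
  shows "ext_integral \<mu> f = ereal (\<integral>z. h z \<partial>\<mu>)"
proof -
  have "(\<integral>\<^sup>+z. e2ennreal (f z) \<partial>\<mu>) = (\<integral>\<^sup>+z. ennreal (h z) \<partial>\<mu>)"
    by (intro nn_integral_cong_AE, use f in eventually_elim) (simp add: e2ennreal_ereal)
  moreover have "(\<integral>\<^sup>+z. e2ennreal (- f z) \<partial>\<mu>) = (\<integral>\<^sup>+z. ennreal (- h z) \<partial>\<mu>)"
    by (intro nn_integral_cong_AE, use f in eventually_elim) (simp add: e2ennreal_ereal)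
  moreover obtain a b where "(\<integral>\<^sup>+z. ennreal (h z) \<partial>\<mu>) = ennreal a" "a \<ge> 0" "(\<integral>\<^sup>+z. ennreal (- h z) \<partial>\<mu>) = ennreal b" "b \<ge> 0"
    using h[unfolded real_integrable_def] by (metis ennreal_cases infinity_ennreal_def)
  ultimately show ?thesis
    unfolding ext_integral_def real_lebesgue_integral_def[OF h] by (simp add: enn2ereal_ennreal)
qed

text \<open>Passes from the extended-valued definitions to a real function. The last property
  records that the part of \<open>E\<close> where \<open>g \<ge> \<delta>\<close> is polar:
  minimality forbids measures of finite energy on it, and small products are the form in which this
  is used later.\<close>

lemma green_potential:
  assumes reg: "regular_compact E"
  obtains \<omega> g where "\<omega> \<in> prob_measures_on E" "log_cap E > 0" "continuous_on UNIV g"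
    "\<And>z. z \<in> msupport \<omega> \<Longrightarrow> g z = 0"
    "\<And>z. z \<notin> msupport \<omega> \<Longrightarrow> g z = (\<integral>w. ln (cmod (z - w)) \<partial>\<omega>) - ln (log_cap E)"
    "\<And>\<delta> \<rho>. \<delta> > 0 \<Longrightarrow> \<rho> > 0 \<Longrightarrow> \<exists>m>0. \<exists>c::nat \<Rightarrow> complex.
      (\<forall>i<m. c i \<in> E) \<and> (\<forall>z\<in>{z \<in> E. g z \<ge> \<delta>}. (\<Prod>i<m. cmod (z - c i)) \<le> \<rho> ^ m)"
proof -
  have E: "compact E" and np: "nonpolar E" and gc: "continuous_on UNIV (green E)"
    using reg by (auto simp: regular_compact_def)
  have cl: "closed E" using E by (rule compact_imp_closed)
  obtain R where R: "R > 0" "\<And>z. z \<in> E \<Longrightarrow> cmod z \<le> R" using compact_imp_bounded[OF E] bounded_pos by blast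
  define D where "D = 2 * R + 1"
  have D: "D \<ge> 1" using R by (simp add: D_def)
  have diam: "cmod (z - w) \<le> D" if "z \<in> E" "w \<in> E" for z w
    using R(2)[OF that(1)] R(2)[OF that(2)] norm_triangle_ineq4[of z w] by (simp add: D_def)
  have en: "log_energy \<mu> = ereal (ln D) - enn2ereal (mutual_energy D \<mu> \<mu>)" if "\<mu> \<in> prob_measures_on E" for \<mu>
    using log_energy_conv_mutual_energy[OF that cl D diam] .
  obtain \<nu>\<^sub>0 where \<nu>\<^sub>0: "\<nu>\<^sub>0 \<in> prob_measures_on E" "log_energy \<nu>\<^sub>0 > -\<infinity>" using np by (auto simp: nonpolar_def)
  have "mutual_energy D \<nu>\<^sub>0 \<nu>\<^sub>0 < top"
    using \<nu>\<^sub>0(2) en[OF \<nu>\<^sub>0(1)] by (cases "mutual_energy D \<nu>\<^sub>0 \<nu>\<^sub>0") auto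
  then obtain \<mu>\<^sub>0 where \<mu>\<^sub>0: "\<mu>\<^sub>0 \<in> prob_measures_on E"
    "\<And>\<nu>. \<nu> \<in> prob_measures_on E \<Longrightarrow> mutual_energy D \<mu>\<^sub>0 \<mu>\<^sub>0 \<le> mutual_energy D \<nu> \<nu>"
    using exists_minimal_energy[OF D E \<nu>\<^sub>0(1)] by blast
  \<comment> \<open>The choice operator behind \<open>equilibrium_measure\<close> yields a maximizer
    only once one is known to exist.\<close>
  have "is_arg_max log_energy (\<lambda>\<mu>. \<mu> \<in> prob_measures_on E) \<mu>\<^sub>0"
    unfolding is_arg_max_def
  proof (intro conjI notI)
    assume "\<exists>\<nu>. \<nu> \<in> prob_measures_on E \<and> log_energy \<mu>\<^sub>0 < log_energy \<nu>"
    then obtain \<nu> where \<nu>: "\<nu> \<in> prob_measures_on E" "log_energy \<mu>\<^sub>0 < log_energy \<nu>" by blast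
    have "log_energy \<nu> \<le> log_energy \<mu>\<^sub>0"
      unfolding en[OF \<nu>(1)] en[OF \<mu>\<^sub>0(1)] using \<mu>\<^sub>0(2)[OF \<nu>(1)] by (intro ereal_minus_mono) (auto simp: less_eq_ennreal.rep_eq)
    then show False using \<nu>(2) by simp
  qed (rule \<mu>\<^sub>0(1))
  then have max: "is_arg_max log_energy (\<lambda>\<mu>. \<mu> \<in> prob_measures_on E) (equilibrium_measure E)"
    unfolding equilibrium_measure_def arg_max_on_def arg_max_def by (rule someI)
  define \<omega> where "\<omega> = equilibrium_measure E"
  have \<omega>: "\<omega> \<in> prob_measures_on E" using max by (simp add: is_arg_max_def \<omega>_def)
  have fin: "mutual_energy D \<omega> \<omega> < top"
  proof -
    have "\<not> log_energy \<omega> < log_energy \<nu>\<^sub>0" using max \<nu>\<^sub>0 by (auto simp: is_arg_max_def \<omega>_def)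
    then have "log_energy \<omega> > -\<infinity>" using \<nu>\<^sub>0(2) by auto
    then show ?thesis using en[OF \<omega>] by (cases "mutual_energy D \<omega> \<omega>") auto
  qed
  then obtain e where e: "mutual_energy D \<omega> \<omega> = ennreal e" "e \<ge> 0" by (cases "mutual_energy D \<omega> \<omega>") auto
  have min: "mutual_energy D \<omega> \<omega> \<le> mutual_energy D \<nu> \<nu>" if \<nu>: "\<nu> \<in> prob_measures_on E" for \<nu>
  proof -
    have "\<not> log_energy \<omega> < log_energy \<nu>" using max \<nu> by (auto simp: is_arg_max_def \<omega>_def)
    then show ?thesis
      unfolding en[OF \<nu>] en[OF \<omega>] e(1)
      using e(2) by (cases "mutual_energy D \<nu> \<nu>") (auto simp: enn2ereal_ennreal ennreal_le_iff)
  qed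
  have cap: "log_cap E = exp (ln D - e)"
    using np en[OF \<omega>] e by (simp add: log_cap_def enn2ereal_ennreal flip: \<omega>_def)
  have p: "prob_space \<omega>" "sets \<omega> = sets borel" "AE z in \<omega>. z \<in> E"
    using \<omega> prob_measures_on_iff[OF cl] by auto
  interpret prob_space \<omega> by fact
  note [measurable_cong] = p(2)
  define u where "u z = (\<integral>\<^sup>+w. log_kernel D z w \<partial>\<omega>)" for z
  have ub: "u \<in> borel_measurable borel"
    unfolding u_def by (rule measurable_log_kernel_nn_integral[OF _ p(2)]) (rule finite_measure_axioms)
  have grE: "green E z = ereal (ln D) - enn2ereal (u z) - ereal (ln D - e)" if "z \<in> E" for z
    using log_potential_conv_log_kernel[OF \<omega> cl D] diam that by (simp add: green_def cap u_def flip: \<omega>_def)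
  have "AE z in \<omega>. (\<integral>\<^sup>+w. log_kernel D z w \<partial>\<omega>) = mutual_energy D \<omega> \<omega>"
    by (rule minimizer_potential_AE[OF cl \<omega> _ fin]) (rule min)
  with p(3) have ae0: "AE z in \<omega>. green E z = 0"
  proof eventually_elim
    case (elim z)
    then show ?case using e by (simp add: grE u_def enn2ereal_ennreal zero_ereal_def)
  qed
  \<comment> \<open>The potential is known almost everywhere only. Continuity of
    \<open>green E\<close> extends this to every point of the support, because the set where it is
    nonzero is open and null.\<close>
  have gr0: "green E z = 0" if z: "z \<in> msupport \<omega>" for z
  proof (rule ccontr)
    assume nz: "green E z \<noteq> 0"
    define U where "U = green E -` (- {0})"
    have "open U" unfolding U_def using gc by (intro open_vimage) (auto simp: open_Compl)
    moreover have "z \<in> U" using nz by (simp add: U_def)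
    ultimately have "emeasure \<omega> U > 0" using z by (simp add: msupport_def)
    moreover have "emeasure \<omega> U = 0"
      using ae0 \<open>open U\<close> AE_iff_measurable[of U \<omega> "\<lambda>z. green E z = 0"] p(2)
      by (auto simp: U_def sets_eq_imp_space_eq[OF p(2)])
    ultimately show False by simp
  qed
  have aes: "AE w in \<omega>. w \<in> msupport \<omega>" using p(2) by (rule AE_msupport)
  have gro: "green E z = ereal ((\<integral>w. ln (cmod (z - w)) \<partial>\<omega>) - ln (log_cap E))" if z: "z \<notin> msupport \<omega>" for z
  proof -
    obtain d where d: "d > 0" "ball z d \<subseteq> - msupport \<omega>"
      using z closed_msupport[of \<omega>] by (metis ComplI closed_def openE)
    have far: "d \<le> cmod (z - w)" if "w \<in> msupport \<omega>" for w
      using d(2) that by (force simp: dist_norm not_less)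
    have int: "integrable \<omega> (\<lambda>w. ln (cmod (z - w)))"
    proof (rule integrable_const_bound)
      show "AE w in \<omega>. norm (ln (cmod (z - w))) \<le> max \<bar>ln d\<bar> \<bar>ln (cmod z + R)\<bar>"
        using p(3) aes
      proof eventually_elim
        case (elim w)
        have "cmod (z - w) \<le> cmod z + R" using R(2)[OF elim(1)] norm_triangle_ineq4[of z w] by simp
        then have "ln d \<le> ln (cmod (z - w))" "ln (cmod (z - w)) \<le> ln (cmod z + R)"
          using far[OF elim(2)] d(1) by (auto intro!: ln_mono)
        then show ?case by (simp add: abs_le_iff) linarith
      qed
    qed measurable
    have "AE w in \<omega>. elog (cmod (z - w)) = ereal (ln (cmod (z - w)))"
      using aes
    proof eventually_elim
      case (elim w)
      then have "cmod (z - w) \<noteq> 0" using far[OF elim] d(1) by linarith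
      then show ?case by (simp add: elog_def)
    qed
    then have "log_potential \<omega> z = ereal (\<integral>w. ln (cmod (z - w)) \<partial>\<omega>)"
      unfolding log_potential_def by (intro ext_integral_eq_integral int)
    then show ?thesis by (simp add: green_def flip: \<omega>_def)
  qed
  define g where "g z = real_of_ereal (green E z)" for z
  have grg: "green E z = ereal (g z)" for z
  proof (cases "z \<in> msupport \<omega>")
    case True
    show ?thesis unfolding g_def gr0[OF True] by simp
  next
    case False
    show ?thesis unfolding g_def gro[OF False] by simp
  qed
  have gcont: "continuous_on UNIV g"
  proof -
    have "\<bar>green E z\<bar> \<noteq> \<infinity>" for z by (simp add: grg)
    then have "continuous_on UNIV (real_of_ereal \<circ> green E)" using gc by (subst continuous_on_iff_real[symmetric]) auto
    then show ?thesis by (simp add: g_def[abs_def] o_def)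
  qed
  have polar: "\<exists>m>0. \<exists>c::nat \<Rightarrow> complex.
      (\<forall>i<m. c i \<in> E) \<and> (\<forall>z\<in>{z \<in> E. g z \<ge> \<delta>}. (\<Prod>i<m. cmod (z - c i)) \<le> \<rho> ^ m)"
    if \<delta>: "\<delta> > 0" and \<rho>: "\<rho> > 0" for \<delta> \<rho>
  proof (rule small_polynomial_on_polar_set[OF D])
    let ?F = "{z \<in> E. g z \<ge> \<delta>}"
    have "?F = E \<inter> g -` {\<delta>..}" by auto
    then show F: "compact ?F"
      using E gcont by (simp add: compact_Int_closed closed_vimage)
    show "E \<noteq> {}" using p(3) AE_False by auto
    fix \<mu> assume \<mu>F: "\<mu> \<in> prob_measures_on ?F"
    have pm: "prob_space \<mu>" "sets \<mu> = sets borel" "AE z in \<mu>. z \<in> ?F"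
      using \<mu>F prob_measures_on_iff[OF compact_imp_closed[OF F]] by auto
    interpret \<mu>: prob_space \<mu> by fact
    have "AE z in \<mu>. z \<in> E" using pm(3) by eventually_elim simp
    then have \<mu>E: "\<mu> \<in> prob_measures_on E" using pm prob_measures_on_iff[OF cl] by simp
    show "mutual_energy D \<mu> \<mu> = top"
    proof (rule ccontr)
      assume "mutual_energy D \<mu> \<mu> \<noteq> top"
      then have "mutual_energy D \<mu> \<mu> < top" by (simp add: less_top)
      then have "mutual_energy D \<omega> \<omega> \<le> mutual_energy D \<mu> \<omega>"
        by (intro minimal_energy_variation[OF cl \<omega> _ fin \<mu>E] min)
      then have 1: "ennreal e \<le> (\<integral>\<^sup>+z. u z \<partial>\<mu>)" unfolding e(1) unfolding mutual_energy_def u_def .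
      have um: "u \<in> borel_measurable \<mu>" using ub unfolding measurable_cong_sets[OF pm(2) refl, of borel] .
      \<comment> \<open>On \<open>E\<close> the function \<open>g\<close> equals
        \<open>e - u\<close>, so the mean of \<open>u\<close> under \<open>\<mu>\<close> is at most
        \<open>e - \<delta>\<close>, below the bound from the variation.\<close>
      have "u z + ennreal \<delta> \<le> ennreal e" if "z \<in> ?F" for z
      proof -
        have "z \<in> E" using that by simp
        then have "ereal (g z) = ereal (ln D) - enn2ereal (u z) - ereal (ln D - e)"
          unfolding grg[symmetric] by (rule grE)
        moreover have "g z \<ge> \<delta>" using that by simp
        ultimately show ?thesis using \<delta> e(2)
          by (cases "u z") (auto simp: enn2ereal_ennreal ennreal_plus[symmetric] ennreal_le_iff simp del: ennreal_plus)
      qed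
      then have "(\<integral>\<^sup>+z. u z + ennreal \<delta> \<partial>\<mu>) \<le> (\<integral>\<^sup>+z. ennreal e \<partial>\<mu>)"
        by (intro nn_integral_mono_AE, use pm(3) in eventually_elim) blast
      then have "(\<integral>\<^sup>+z. u z \<partial>\<mu>) + ennreal \<delta> \<le> ennreal e"
        using um by (subst (asm) nn_integral_add) (simp_all add: \<mu>.emeasure_space_1)
      then have "ennreal e + ennreal \<delta> \<le> ennreal e"
        using add_right_mono[OF 1, of "ennreal \<delta>"] by (rule order_trans[rotated])
      then show False using \<delta> e(2) by (simp add: ennreal_plus[symmetric] ennreal_le_iff del: ennreal_plus)
    qed
  qed (use diam \<rho> in auto)
  show thesis
  proof (rule that[OF \<omega> _ gcont _ _ polar])
    show "log_cap E > 0" by (simp add: cap)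
    show "g z = 0" if "z \<in> msupport \<omega>" for z using gr0[OF that] by (simp add: g_def)
    show "g z = (\<integral>w. ln (cmod (z - w)) \<partial>\<omega>) - ln (log_cap E)" if "z \<notin> msupport \<omega>" for z
      using gro[OF that] by (simp add: g_def)
  qed
qed

section \<open>Neighbourhoods of connected sets, and products with prescribed zeros\<close>

lemma connected_open_neighbourhood:
  fixes P U :: "'a::euclidean_space set"
  assumes "compact P" "connected P" "P \<noteq> {}" "open U" "P \<subseteq> U"
  obtains G where "open G" "connected G" "P \<subseteq> G" "compact (closure G)" "closure G \<subseteq> U"
proof -
  obtain e where e: "e > 0" "(\<Union>x\<in>P. cball x e) \<subseteq> U"
    using compact_subset_open_imp_cball_epsilon_subset[OF assms(1,4,5)] by blast
  define G where "G = (\<Union>x\<in>P. ball x e)"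
  have "P \<union> \<Union>((\<lambda>x. ball x e) ` P) = G" using e(1) by (auto simp: G_def)
  moreover have "connected (P \<union> \<Union>((\<lambda>x. ball x e) ` P))"
    using e(1) by (intro connected_Un_UN assms(2)) (auto intro!: connected_ball)
  ultimately have "connected G" by simp
  moreover have sub: "closure G \<subseteq> (\<Union>x\<in>P. cball x e)"
  proof (rule closure_minimal)
    show "G \<subseteq> (\<Union>x\<in>P. cball x e)" by (auto simp: G_def)
    have "(\<Union>x\<in>P. cball x e) = {y. infdist y P \<le> e}"
    proof (intro set_eqI iffI)
      fix y assume "y \<in> (\<Union>x\<in>P. cball x e)"
      then show "y \<in> {y. infdist y P \<le> e}" using infdist_le2 by (fastforce simp: dist_commute)
    next
      fix y assume y: "y \<in> {y. infdist y P \<le> e}"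
      obtain x where "x \<in> P" "infdist y P = dist y x"
        using infdist_attains_inf[of P y] assms(1,3) compact_imp_closed by blast
      then show "y \<in> (\<Union>x\<in>P. cball x e)" using y by (auto simp: dist_commute)
    qed
    then show "closed (\<Union>x\<in>P. cball x e)"
      by (simp add: closed_Collect_le continuous_on_infdist)
  qed
  moreover have "bounded G"
  proof -
    obtain b where b: "\<forall>x\<in>P. norm x \<le> b" using compact_imp_bounded[OF assms(1)] unfolding bounded_iff by blast
    then show ?thesis unfolding G_def
    proof (intro boundedI[of _ "b + e"])
      fix y assume "y \<in> (\<Union>x\<in>P. ball x e)"
      then obtain x where "x \<in> P" "norm (y - x) < e" by (auto simp: dist_norm norm_minus_commute)
      then show "norm y \<le> b + e" using norm_triangle_sub[of y x] b by fastforce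
    qed
  qed
  ultimately show thesis
    using e assms by (intro that[of G]) (auto simp: G_def compact_closure)
qed

definition root_prod :: "(nat \<Rightarrow> complex) \<Rightarrow> nat \<Rightarrow> complex \<Rightarrow> complex" where
  "root_prod x n z = (\<Prod>i<n. z - x i)"

lemma root_prod_holomorphic [holomorphic_intros]: "root_prod x n holomorphic_on A"
  unfolding root_prod_def[abs_def] by (intro holomorphic_intros)

lemma root_prod_continuous [continuous_intros]: "continuous_on A (root_prod x n)"
  by (intro holomorphic_on_imp_continuous_on holomorphic_intros)

lemma root_prod_eq_0_iff: "root_prod x n z = 0 \<longleftrightarrow> (\<exists>i<n. z = x i)"
  by (auto simp: root_prod_def)

lemma root_prod_lower:
  assumes "\<And>i. i < n \<Longrightarrow> cmod (x i) \<le> R" "cmod z \<ge> R"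
  shows "(cmod z - R) ^ n \<le> cmod (root_prod x n z)"
proof -
  have "(\<Prod>i<n. cmod z - R) \<le> (\<Prod>i<n. cmod (z - x i))"
  proof (rule prod_mono)
    fix i assume "i \<in> {..<n}"
    then show "0 \<le> cmod z - R \<and> cmod z - R \<le> cmod (z - x i)"
      using assms norm_triangle_ineq2[of z "x i"] by fastforce
  qed
  then show ?thesis by (simp add: root_prod_def prod_norm)
qed

lemma root_prod_upper:
  assumes "\<And>i. i < n \<Longrightarrow> cmod (x i) \<le> R" "cmod z \<le> r"
  shows "cmod (root_prod x n z) \<le> (r + R) ^ n"
proof -
  have "(\<Prod>i<n. cmod (z - x i)) \<le> (\<Prod>i<n. r + R)"
  proof (intro prod_mono conjI)
    fix i assume "i \<in> {..<n}"
    then show "cmod (z - x i) \<le> r + R" using assms norm_triangle_ineq4[of z "x i"] by (simp add: order_trans add_mono)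
  qed auto
  then show ?thesis by (simp add: root_prod_def prod_norm)
qed

lemma root_prod_eventually_ge:
  assumes "\<And>i. i < n \<Longrightarrow> cmod (x i) \<le> R" "R \<ge> 0"
  shows "\<forall>\<^sub>F z in at_infinity. (cmod z / 2) ^ n \<le> cmod (root_prod x n z)"
  unfolding eventually_at_infinity
proof (intro exI allI impI)
  fix z :: complex assume z: "2 * R \<le> cmod z"
  then have "(cmod z / 2) ^ n \<le> (cmod z - R) ^ n" by (intro power_mono) auto
  also have "\<dots> \<le> cmod (root_prod x n z)" using z assms by (intro root_prod_lower) auto
  finally show "(cmod z / 2) ^ n \<le> cmod (root_prod x n z)" .
qed

lemma poly_norm_bound_infinity:
  fixes Q :: "complex poly"
  assumes "degree Q \<le> n"
  obtains A where "A \<ge> 0" "\<And>z. cmod z \<ge> 1 \<Longrightarrow> cmod (poly Q z) \<le> A * cmod z ^ n"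
proof
  show "(\<Sum>i\<le>degree Q. cmod (coeff Q i)) \<ge> 0" by (intro sum_nonneg) auto
  fix z :: complex assume z: "cmod z \<ge> 1"
  have "cmod (poly Q z) \<le> (\<Sum>i\<le>degree Q. cmod (coeff Q i * z ^ i))"
    unfolding poly_altdef by (rule norm_sum)
  also have "\<dots> \<le> (\<Sum>i\<le>degree Q. cmod (coeff Q i) * cmod z ^ n)"
    using z assms by (intro sum_mono) (auto simp: norm_mult norm_power intro!: mult_left_mono power_increasing)
  finally show "cmod (poly Q z) \<le> (\<Sum>i\<le>degree Q. cmod (coeff Q i)) * cmod z ^ n" by (simp add: sum_distrib_right)
qed

text \<open>\<open>g\<close> is the Green's function of the complement of \<open>E\<close>, \<open>c\<close> the capacity and \<open>S\<close> the support
  of the equilibrium measure \<open>\<omega>\<close>.  Continuity forces \<open>g = 0\<close> on \<open>S\<close> only: \<open>E\<close> may have a polar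
  part on which \<open>g > 0\<close>.\<close>

locale green_function =
  fixes E S :: "complex set" and \<omega> :: "complex measure" and c :: real and g :: "complex \<Rightarrow> real"
  assumes \<omega>_prob: "prob_space \<omega>" and \<omega>_sets: "sets \<omega> = sets borel" and \<omega>_S: "AE w in \<omega>. w \<in> S"
    and S_compact: "compact S" and S_sub: "S \<subseteq> E" and E_compact: "compact E" and c_pos: "c > 0"
    and g_cont: "continuous_on UNIV g" and g_S: "\<And>z. z \<in> S \<Longrightarrow> g z = 0"
    and g_off: "\<And>z. z \<notin> S \<Longrightarrow> g z = (\<integral>w. ln (cmod (z - w)) \<partial>\<omega>) - ln c"
begin

lemma S_nonempty: "S \<noteq> {}"
proof
  assume "S = {}"
  interpret prob_space \<omega> by (rule \<omega>_prob)
  show False using \<omega>_S AE_False \<open>S = {}\<close> by simp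
qed

lemma ln_diff_le:
  fixes a b d :: real
  assumes "0 < d" "d \<le> a" "d \<le> b"
  shows "\<bar>ln a - ln b\<bar> \<le> \<bar>a - b\<bar> / d"
proof -
  have main: "ln a - ln b \<le> \<bar>a - b\<bar> / d" if "d \<le> a" "d \<le> b" for a b :: real
  proof -
    have "ln a - ln b = ln (a / b)" using that assms(1) by (subst ln_divide_pos) auto
    also have "\<dots> \<le> a / b - 1" using that assms(1) by (intro ln_le_minus_one) simp
    also have "\<dots> = (a - b) / b" using that assms(1) by (simp add: diff_divide_distrib)
    also have "\<dots> \<le> \<bar>a - b\<bar> / d" using that assms(1) by (intro frac_le) auto
    finally show ?thesis .
  qed
  show ?thesis using main[of a b] main[of b a] assms by (simp add: abs_le_iff abs_minus_commute)
qed

text \<open>The equilibrium measure is cut into small cells, and each cell contributes its share of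
  the \<open>n\<close> points.\<close>

lemma discretization:
  assumes C: "compact C" "C \<inter> S = {}" and \<eta>: "\<eta> > 0"
  shows "\<exists>N. \<forall>n\<ge>N. \<exists>x. (\<forall>i<n. x i \<in> S) \<and>
    (\<forall>z\<in>C. \<bar>(\<Sum>i<n. ln (cmod (z - x i))) - real n * (g z + ln c)\<bar> \<le> real n * \<eta>)"
proof (cases "C = {}")
  case True
  moreover obtain w where "w \<in> S" using S_nonempty by blast
  ultimately show ?thesis by (intro exI[of _ 0] allI impI exI[of _ "\<lambda>_. w"]) simp
next
  case False
  interpret prob_space \<omega> by (rule \<omega>_prob)
  note [measurable_cong] = \<omega>_sets
  obtain d where d: "d > 0" "\<forall>z\<in>C. \<forall>w\<in>S. d \<le> dist z w"
    using separate_compact_closed[OF C(1) compact_imp_closed[OF S_compact] C(2)] by blast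
  have dn: "d \<le> cmod (z - w)" if "z \<in> C" "w \<in> S" for z w using d(2) that by (simp add: dist_norm)
  obtain R where "\<forall>z\<in>C \<union> S. cmod z \<le> R"
    using compact_imp_bounded[OF compact_Un[OF C(1) S_compact]] unfolding bounded_iff by blast
  then have R: "\<And>z. z \<in> C \<union> S \<Longrightarrow> cmod z \<le> R" by blast
  define K where "K = max \<bar>ln d\<bar> \<bar>ln (2 * R)\<bar>"
  have K: "\<bar>ln (cmod (z - w))\<bar> \<le> K" if "z \<in> C" "w \<in> S" for z w
  proof -
    have "cmod (z - w) \<le> 2 * R" using R[of z] R[of w] that norm_triangle_ineq4[of z w] by simp
    then have "ln d \<le> ln (cmod (z - w))" "ln (cmod (z - w)) \<le> ln (2 * R)"
      using dn[OF that] d(1) by (auto intro!: ln_mono)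
    then show ?thesis by (simp add: K_def abs_le_iff) linarith
  qed
  have K0: "K \<ge> 0" by (simp add: K_def)
  \<comment> \<open>Points of \<open>C\<close> have distance at least \<open>d\<close> from
    \<open>S\<close>, so moving a point of \<open>S\<close> by \<open>h\<close> changes the
    logarithm by at most \<open>\<eta> / 2\<close>.\<close>
  define h where "h = \<eta> * d / 2"
  have h: "h > 0" using \<eta> d by (simp add: h_def)
  obtain T where T: "finite T" "T \<subseteq> S" "S \<subseteq> (\<Union>t\<in>T. ball t h)"
    by (rule compactE_image[OF S_compact, of S "\<lambda>t. ball t h"]) (use h in auto)
  obtain cs where cs: "set cs = T" using T(1) finite_list by blast
  define m where "m = length cs"
  have csS: "cs ! j \<in> S" if "j < m" for j using that T(2) cs nth_mem unfolding m_def by blast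
  have "T \<noteq> {}" using S_nonempty T(3) by blast
  then have m: "m > 0" using cs unfolding m_def by auto
  define P where "P = disjointed (\<lambda>j. if j < m then ball (cs ! j) h else {})"
  have P_sub: "P j \<subseteq> ball (cs ! j) h" if "j < m" for j
    using disjointed_subset[of "\<lambda>j. if j < m then ball (cs ! j) h else {}" j] that unfolding P_def by simp
  have P_dis: "disjoint_family P" unfolding P_def by (rule disjoint_family_disjointed)
  have P_emp: "P j = {}" if "\<not> j < m" for j
    using disjointed_subset[of "\<lambda>j. if j < m then ball (cs ! j) h else {}" j] that unfolding P_def by simp
  have P_cov: "\<exists>j<m. w \<in> P j" if w: "w \<in> S" for w
  proof -
    obtain t where "t \<in> set cs" "w \<in> ball t h" using T(3) w cs by blast
    then obtain j where "j < m" "w \<in> ball (cs ! j) h" unfolding in_set_conv_nth m_def by blast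
    then have "w \<in> (\<Union>j. if j < m then ball (cs ! j) h else {})" by (intro UN_I[of j]) simp_all
    then have "w \<in> (\<Union>j. P j)" unfolding P_def UN_disjointed_eq .
    then show ?thesis using P_emp by blast
  qed
  have Pm[measurable]: "P j \<in> sets borel" for j
    unfolding P_def disjointed_def by (intro sets.Diff sets.finite_UN) auto
  define a where "a j = measure \<omega> (P j)" for j
  have one: "(\<Sum>j<m. indicator (P j) w) = (1::real)" if w: "w \<in> S" for w
  proof -
    obtain j where j: "j < m" "w \<in> P j" using P_cov[OF w] by blast
    then have "w \<notin> P k" if "k \<noteq> j" for k using P_dis that by (auto simp: disjoint_family_on_def)
    then have "(\<Sum>k<m. indicator (P k) w) = (\<Sum>k<m. if k = j then 1 else (0::real))"
      using j by (intro sum.cong) auto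
    then show ?thesis using j by simp
  qed
  have inta: "(\<integral>w. (\<Sum>j<m. indicator (P j) w * f j) \<partial>\<omega>) = (\<Sum>j<m. a j * f j)"
    and intf: "integrable \<omega> (\<lambda>w. \<Sum>j<m. indicator (P j) w * f j)" for f :: "nat \<Rightarrow> real"
  proof -
    have i: "integrable \<omega> (\<lambda>w. indicator (P j) w * f j)" for j by (auto simp: less_top[symmetric] intro!: integrable_mult_left)
    then show "integrable \<omega> (\<lambda>w. \<Sum>j<m. indicator (P j) w * f j)" by (intro Bochner_Integration.integrable_sum)
    show "(\<integral>w. (\<Sum>j<m. indicator (P j) w * f j) \<partial>\<omega>) = (\<Sum>j<m. a j * f j)"
      using i by (subst Bochner_Integration.integral_sum) (auto simp: a_def)
  qed
  have "(\<integral>w. (\<Sum>j<m. indicator (P j) w * 1) \<partial>\<omega>) = (\<integral>w. (1::real) \<partial>\<omega>)"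
    by (intro integral_cong_AE, measurable, use \<omega>_S in eventually_elim) (simp add: one)
  then have a1: "(\<Sum>j<m. a j) = 1" unfolding inta by (simp add: prob_space)
  have step: "\<bar>(\<integral>w. ln (cmod (z - w)) \<partial>\<omega>) - (\<Sum>j<m. a j * ln (cmod (z - cs ! j)))\<bar> \<le> \<eta> / 2" if z: "z \<in> C" for z
  proof -
    let ?s = "\<lambda>w. \<Sum>j<m. indicator (P j) w * ln (cmod (z - cs ! j))"
    have i1: "integrable \<omega> (\<lambda>w. ln (cmod (z - w)))"
    proof (rule integrable_const_bound)
      show "AE w in \<omega>. norm (ln (cmod (z - w))) \<le> K" using \<omega>_S by eventually_elim (use K z in simp)
    qed measurable
    have close: "\<bar>ln (cmod (z - w)) - ?s w\<bar> \<le> \<eta> / 2" if w: "w \<in> S" for w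
    proof -
      obtain j where j: "j < m" "w \<in> P j" using P_cov[OF w] by blast
      then have "w \<notin> P k" if "k \<noteq> j" for k using P_dis that by (auto simp: disjoint_family_on_def)
      then have "?s w = (\<Sum>k<m. if k = j then ln (cmod (z - cs ! j)) else 0)"
        using j by (intro sum.cong) auto
      then have s: "?s w = ln (cmod (z - cs ! j))" using j by simp
      have "\<bar>ln (cmod (z - w)) - ln (cmod (z - cs ! j))\<bar> \<le> \<bar>cmod (z - w) - cmod (z - cs ! j)\<bar> / d"
        using dn[OF z w] dn[OF z csS[OF j(1)]] d(1) by (intro ln_diff_le)
      also have "\<dots> \<le> h / d"
      proof (rule divide_right_mono)
        have "w \<in> ball (cs ! j) h" using P_sub j by blast
        then show "\<bar>cmod (z - w) - cmod (z - cs ! j)\<bar> \<le> h"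
          using norm_triangle_ineq3[of "z - w" "z - cs ! j"] by (simp add: dist_norm)
      qed (use d in simp)
      also have "\<dots> = \<eta> / 2" using d by (simp add: h_def)
      finally show ?thesis by (simp add: s)
    qed
    have "\<bar>(\<integral>w. ln (cmod (z - w)) \<partial>\<omega>) - (\<integral>w. ?s w \<partial>\<omega>)\<bar> = \<bar>\<integral>w. ln (cmod (z - w)) - ?s w \<partial>\<omega>\<bar>"
      using i1 intf by simp
    also have "\<dots> \<le> (\<integral>w. \<bar>ln (cmod (z - w)) - ?s w\<bar> \<partial>\<omega>)" by (rule integral_abs_bound)
    also have "\<dots> \<le> (\<integral>w. \<eta> / 2 \<partial>\<omega>)"
      using i1 intf \<omega>_S close by (intro integral_mono_AE) (auto elim!: eventually_mono)
    finally show ?thesis unfolding inta by (simp add: prob_space)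
  qed
  \<comment> \<open>Rounding the shares and placing the leftover points cost at most
    \<open>m * K\<close> each; for these \<open>n\<close> the sum is at most half of
    \<open>n * \<eta>\<close>.\<close>
  obtain N where N: "4 * real m * K / \<eta> \<le> real N" using real_arch_simple by blast
  show ?thesis
  proof (intro exI[of _ N] allI impI)
    fix n assume n: "n \<ge> N"
    define k where "k j = nat \<lfloor>real n * a j\<rfloor>" for j
    have ka: "real (k j) \<le> real n * a j" "real n * a j - real (k j) \<le> 1" for j
    proof -
      have "0 \<le> real n * a j" by (simp add: a_def)
      then show "real (k j) \<le> real n * a j" "real n * a j - real (k j) \<le> 1" unfolding k_def by linarith+
    qed
    have "real (\<Sum>j<m. k j) \<le> (\<Sum>j<m. real n * a j)" using ka by (simp add: sum_mono)
    also have "\<dots> = real n" using a1 by (simp add: sum_distrib_left[symmetric])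
    finally have kn: "(\<Sum>j<m. k j) \<le> n" by linarith
    define r where "r = n - (\<Sum>j<m. k j)"
    have rr: "real r = (\<Sum>j<m. real n * a j - real (k j))"
      using kn a1 by (simp add: r_def sum_subtractf sum_distrib_left[symmetric] of_nat_diff)
    also have "\<dots> \<le> (\<Sum>j<m. 1)" using ka by (intro sum_mono) auto
    finally have rm: "real r \<le> real m" by simp
    \<comment> \<open>Rounding down leaves at most \<open>m\<close> points unassigned; they all go
      to the first centre.\<close>
    define xs where "xs = concat (map (\<lambda>j. replicate (k j) (cs ! j)) [0..<m]) @ replicate r (cs ! 0)"
    have sl: "sum_list (map f xs) = (\<Sum>j<m. real (k j) * f (cs ! j)) + real r * f (cs ! 0)" for f :: "complex \<Rightarrow> real"
    proof -
      have "sum_list (map f (concat (map (\<lambda>j. replicate (k j) (cs ! j)) [0..<M]))) = (\<Sum>j<M. real (k j) * f (cs ! j))" for M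
        by (induction M) (simp_all add: sum_list_replicate)
      then show ?thesis by (simp add: xs_def sum_list_replicate)
    qed
    have "real (length xs) = real n" using sl[of "\<lambda>_. 1"] rr a1
      by (simp add: sum_list_triv sum_subtractf sum_distrib_left[symmetric])
    then have len: "length xs = n" by simp
    have xsS: "set xs \<subseteq> S" using csS m by (auto simp: xs_def)
    show "\<exists>x. (\<forall>i<n. x i \<in> S) \<and>
      (\<forall>z\<in>C. \<bar>(\<Sum>i<n. ln (cmod (z - x i))) - real n * (g z + ln c)\<bar> \<le> real n * \<eta>)"
    proof (intro exI[of _ "\<lambda>i. xs ! i"] conjI allI impI ballI)
      show "xs ! i \<in> S" if "i < n" for i using xsS len that by auto
      fix z assume z: "z \<in> C"
      let ?f = "\<lambda>w. ln (cmod (z - w))"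
      have "(\<Sum>i<n. ?f (xs ! i)) = sum_list (map ?f xs)"
        using len by (simp add: sum_list_sum_nth lessThan_atLeast0)
      also have "\<dots> = (\<Sum>j<m. real (k j) * ?f (cs ! j)) + real r * ?f (cs ! 0)" by (rule sl)
      finally have 1: "(\<Sum>i<n. ?f (xs ! i)) = (\<Sum>j<m. real (k j) * ?f (cs ! j)) + real r * ?f (cs ! 0)" .
      have "\<bar>(\<Sum>j<m. real (k j) * ?f (cs ! j)) - (\<Sum>j<m. real n * a j * ?f (cs ! j))\<bar>
          = \<bar>\<Sum>j<m. (real (k j) - real n * a j) * ?f (cs ! j)\<bar>"
        by (simp add: sum_subtractf left_diff_distrib)
      also have "\<dots> \<le> (\<Sum>j<m. 1 * K)"
      proof (rule order_trans[OF sum_abs sum_mono])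
        fix j assume "j \<in> {..<m}"
        then show "\<bar>(real (k j) - real n * a j) * ?f (cs ! j)\<bar> \<le> 1 * K"
          unfolding abs_mult using ka[of j] K[OF z csS[of j]] by (intro mult_mono) auto
      qed
      finally have 2: "\<bar>(\<Sum>j<m. real (k j) * ?f (cs ! j)) - real n * (\<Sum>j<m. a j * ?f (cs ! j))\<bar> \<le> real m * K"
        by (simp add: sum_distrib_left mult.assoc)
      have 3: "\<bar>real r * ?f (cs ! 0)\<bar> \<le> real m * K"
        unfolding abs_mult using rm K[OF z csS[OF m]] by (intro mult_mono) auto
      have "z \<notin> S" using z C(2) by blast
      then have "(\<integral>w. ?f w \<partial>\<omega>) = g z + ln c" using g_off by simp
      then have "\<bar>real n * ((\<Sum>j<m. a j * ?f (cs ! j)) - (g z + ln c))\<bar> \<le> real n * (\<eta> / 2)"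
        unfolding abs_mult using step[OF z] by (intro mult_mono) (auto simp: abs_minus_commute)
      then have 4: "\<bar>real n * (\<Sum>j<m. a j * ?f (cs ! j)) - real n * (g z + ln c)\<bar> \<le> real n * (\<eta> / 2)"
        by (simp add: right_diff_distrib)
      have "4 * real m * K / \<eta> \<le> real n" using N n by linarith
      then have "4 * real m * K \<le> real n * \<eta>" using \<eta> by (simp add: divide_simps split: if_splits)
      then show "\<bar>(\<Sum>i<n. ln (cmod (z - xs ! i))) - real n * (g z + ln c)\<bar> \<le> real n * \<eta>"
        unfolding 1 using 2 3 4 by linarith
    qed
  qed
qed

lemma approximation:
  assumes C: "compact C" "C \<inter> S = {}" and \<eta>: "\<eta> > 0"
  obtains N where "\<And>n. n \<ge> N \<Longrightarrow> \<exists>x. (\<forall>i<n. x i \<in> S) \<and>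
    (\<forall>z\<in>C. exp (real n * (g z + ln c - \<eta>)) \<le> cmod (root_prod x n z) \<and>
      cmod (root_prod x n z) \<le> exp (real n * (g z + ln c + \<eta>)))"
proof -
  have conv: "exp (real n * (g z + ln c - \<eta>)) \<le> cmod (root_prod x n z) \<and>
      cmod (root_prod x n z) \<le> exp (real n * (g z + ln c + \<eta>))"
    if "\<And>i. i < n \<Longrightarrow> x i \<in> S" "z \<in> C"
      "\<bar>(\<Sum>i<n. ln (cmod (z - x i))) - real n * (g z + ln c)\<bar> \<le> real n * \<eta>" for n x z
  proof -
    have "z \<noteq> x i" if "i < n" for i using C(2) \<open>z \<in> C\<close> \<open>\<And>i. i < n \<Longrightarrow> x i \<in> S\<close>[OF that] by blast
    then have "cmod (root_prod x n z) = exp (\<Sum>i<n. ln (cmod (z - x i)))"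
      by (simp add: root_prod_def prod_norm[symmetric] exp_sum)
    then show ?thesis using that(3) by (auto simp: algebra_simps abs_le_iff)
  qed
  obtain N where "\<And>n. n \<ge> N \<Longrightarrow> \<exists>x. (\<forall>i<n. x i \<in> S) \<and>
    (\<forall>z\<in>C. \<bar>(\<Sum>i<n. ln (cmod (z - x i))) - real n * (g z + ln c)\<bar> \<le> real n * \<eta>)"
    using discretization[OF assms] by blast
  then show thesis using conv by (intro that[of N]) meson
qed

end

section \<open>Maximum principles for the Green's function by way of discretized potentials\<close>

context green_function
begin

lemma S_bound: obtains R where "R > 0" "\<And>w. w \<in> S \<Longrightarrow> cmod w \<le> R"
proof -
  obtain R where "R > 0" "\<forall>w\<in>S. cmod w \<le> R"
    using compact_imp_bounded[OF S_compact] unfolding bounded_pos by blast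
  then show thesis by (intro that[of R]) auto
qed

lemma closed_infdist_eq: "closed {w. infdist w S = r}"
  by (intro closed_Collect_eq continuous_on_infdist continuous_intros)

lemma compact_infdist_eq: "compact {w. infdist w S = r}"
proof -
  obtain R where R: "R > 0" "\<And>w. w \<in> S \<Longrightarrow> cmod w \<le> R" by (rule S_bound) blast
  have "cmod w \<le> R + r" if w: "infdist w S = r" for w
  proof -
    obtain s where "s \<in> S" "infdist w S = dist w s"
      using infdist_attains_inf[OF compact_imp_closed[OF S_compact] S_nonempty] by blast
    then show ?thesis using R(2)[of s] w norm_triangle_sub[of w s] by (simp add: dist_norm)
  qed
  then have "bounded {w. infdist w S = r}" by (intro boundedI[of _ "R + r"]) auto
  then show ?thesis using closed_infdist_eq by (simp add: compact_eq_bounded_closed)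
qed

text \<open>Discretized potentials are accurate only off \<open>S\<close>, so boundary values are
  taken at distance \<open>r\<close> from \<open>S\<close> instead of on \<open>S\<close>
  itself.\<close>

lemma exterior_collar:
  fixes r :: real
  defines "G \<equiv> {w. infdist w S > r}"
  assumes r: "r > 0"
  shows "open G" "frontier G \<subseteq> {w. infdist w S = r}" "closure G \<inter> S = {}"
    "\<And>x. x \<in> S \<Longrightarrow> ball x r \<inter> G = {}"
proof -
  show "open G" unfolding G_def by (intro open_Collect_less continuous_on_infdist continuous_intros)
  have cl: "closure G \<subseteq> {w. infdist w S \<ge> r}"
    unfolding G_def by (intro closure_minimal closed_Collect_le continuous_on_infdist continuous_intros) auto
  then show "frontier G \<subseteq> {w. infdist w S = r}"
    using \<open>open G\<close> by (auto simp: frontier_def interior_open G_def)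
  show "closure G \<inter> S = {}" using cl r by force
  show "ball x r \<inter> G = {}" if "x \<in> S" for x
  proof -
    have "infdist y S < r" if "y \<in> ball x r" for y
      using infdist_le[OF \<open>x \<in> S\<close>, of y] that by (simp add: dist_commute)
    then show ?thesis by (force simp: G_def)
  qed
qed

lemma collar_near_S:
  assumes "open U" "S \<subseteq> U" "z \<notin> S"
  obtains r where "r > 0" "r < infdist z S" "{w. infdist w S \<le> r} \<subseteq> U"
proof -
  obtain e where e: "e > 0" "(\<Union>x\<in>S. ball x e) \<subseteq> U"
    using compact_subset_open_imp_ball_epsilon_subset[OF S_compact assms(1,2)] by blast
  have pos: "infdist z S > 0"
    using assms(3) in_closed_iff_infdist_zero[OF compact_imp_closed[OF S_compact] S_nonempty] infdist_nonneg[of z S] by force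
  define r where "r = min (e / 2) (infdist z S / 2)"
  have "{w. infdist w S \<le> r} \<subseteq> U"
  proof
    fix w assume w: "w \<in> {w. infdist w S \<le> r}"
    obtain s where "s \<in> S" "infdist w S = dist w s"
      using infdist_attains_inf[OF compact_imp_closed[OF S_compact] S_nonempty] by blast
    moreover have "infdist w S < e" using w e(1) by (auto simp: r_def)
    ultimately have "w \<in> ball s e" by (simp add: dist_commute)
    then show "w \<in> U" using e(2) \<open>s \<in> S\<close> by blast
  qed
  then show thesis using e pos by (intro that[of r]) (auto simp: r_def)
qed

text \<open>The minimum principle: near \<open>S\<close> continuity gives
  \<open>g > - \<eta>\<close>, and the reciprocal of a product approximating
  \<open>exp (n * (g + ln c))\<close> is bounded in the exterior by its maximum on the
  collar.\<close>

lemma g_nonneg: "g z \<ge> 0"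
proof (cases "z \<in> S")
  case False
  have "- g z \<le> 0 + e" if e: "e > 0" for e
  proof -
    define \<eta> where "\<eta> = e / 3"
    have \<eta>: "\<eta> > 0" using e by (simp add: \<eta>_def)
    have "open {w. g w > - \<eta>}" by (intro open_Collect_less g_cont continuous_intros)
    moreover have "S \<subseteq> {w. g w > - \<eta>}" using g_S \<eta> by auto
    ultimately obtain r where r: "r > 0" "r < infdist z S" "{w. infdist w S \<le> r} \<subseteq> {w. g w > - \<eta>}"
      using collar_near_S False by blast
    define G where "G = {w. infdist w S > r}"
    note coll = exterior_collar[OF r(1), folded G_def]
    define C where "C = insert z {w. infdist w S = r}"
    have "compact C" "C \<inter> S = {}" using compact_infdist_eq False r(1) by (auto simp: C_def)
    then obtain N where N: "\<And>n. n \<ge> N \<Longrightarrow> \<exists>x. (\<forall>i<n. x i \<in> S) \<and>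
      (\<forall>w\<in>C. exp (real n * (g w + ln c - \<eta>)) \<le> cmod (root_prod x n w) \<and>
      cmod (root_prod x n w) \<le> exp (real n * (g w + ln c + \<eta>)))" using approximation \<eta> by metis
    define n where "n = Suc N"
    obtain x where x: "\<And>i. i < n \<Longrightarrow> x i \<in> S"
      and lo: "\<And>w. w \<in> C \<Longrightarrow> exp (real n * (g w + ln c - \<eta>)) \<le> cmod (root_prod x n w)"
      and up: "\<And>w. w \<in> C \<Longrightarrow> cmod (root_prod x n w) \<le> exp (real n * (g w + ln c + \<eta>))"
      using N[of n] by (auto simp: n_def)
    have nz: "root_prod x n w \<noteq> 0" if "w \<notin> S" for w using x that by (auto simp: root_prod_eq_0_iff)
    obtain s where s: "s \<in> S" using S_nonempty by blast
    obtain R where R: "R > 0" "\<And>w. w \<in> S \<Longrightarrow> cmod w \<le> R" by (rule S_bound) blast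
    have "cmod (1 / root_prod x n z) \<le> exp (- (real n * (ln c - 2 * \<eta>)))"
    proof (rule exterior_maximum_modulus[where f = "\<lambda>w. 1 / root_prod x n w" and z = z and G = G and ?x0.0 = s and r = r and C = 1])
      show "(\<lambda>w. 1 / root_prod x n w) holomorphic_on G"
        using nz coll(3) closure_subset[of G] by (intro holomorphic_intros) blast
      show "continuous_on (closure G) (\<lambda>w. 1 / root_prod x n w)"
        using nz coll(3) by (intro continuous_intros) blast
      show "\<forall>\<^sub>F w in at_infinity. w \<in> G \<longrightarrow> cmod (1 / root_prod x n w) \<le> 1"
        unfolding eventually_at_infinity
      proof (intro exI allI impI)
        fix w assume w: "R + 1 \<le> cmod w"
        have "1 \<le> (cmod w - R) ^ n" using w by (intro one_le_power) simp
        also have "\<dots> \<le> cmod (root_prod x n w)" using w x R by (intro root_prod_lower) auto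
        finally show "cmod (1 / root_prod x n w) \<le> 1" by (simp add: norm_divide divide_simps)
      qed
      fix w assume "w \<in> frontier G"
      then have w: "infdist w S = r" using coll(2) by blast
      then have "g w > - \<eta>" using r(3) by auto
      then have "exp (real n * (ln c - 2 * \<eta>)) \<le> exp (real n * (g w + ln c - \<eta>))"
        by (simp add: mult_left_mono)
      also have "\<dots> \<le> cmod (root_prod x n w)" using w by (intro lo) (simp add: C_def)
      finally show "cmod (1 / root_prod x n w) \<le> exp (- (real n * (ln c - 2 * \<eta>)))"
        by (simp add: norm_divide exp_minus inverse_eq_divide frac_le)
    qed (use coll r s in \<open>auto simp: G_def\<close>)
    moreover have "cmod (1 / root_prod x n z) \<ge> exp (- (real n * (g z + ln c + \<eta>)))"
      using up[of z] nz[OF False] by (simp add: C_def norm_divide exp_minus inverse_eq_divide frac_le)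
    ultimately have "exp (- (real n * (g z + ln c + \<eta>))) \<le> exp (- (real n * (ln c - 2 * \<eta>)))" by linarith
    then have "real n * (ln c - 2 * \<eta>) \<le> real n * (g z + ln c + \<eta>)" by simp
    then show ?thesis by (simp add: n_def \<eta>_def del: of_nat_Suc)
  qed
  then have "- g z \<le> 0" by (rule field_le_epsilon)
  then show ?thesis by simp
qed (simp add: g_S)

lemma g_growth:
  assumes R: "\<And>w. w \<in> S \<Longrightarrow> cmod w \<le> R" and z: "cmod z > R"
  shows "ln (cmod z - R) - ln c \<le> g z"
proof -
  interpret prob_space \<omega> by (rule \<omega>_prob)
  note [measurable_cong] = \<omega>_sets
  have "z \<notin> S" using R z by force
  have lo: "ln (cmod z - R) \<le> ln (cmod (z - w))" and up: "ln (cmod (z - w)) \<le> ln (cmod z + R)" if "w \<in> S" for w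
  proof -
    have "cmod z - R \<le> cmod (z - w)" using R[OF that] norm_triangle_ineq2[of z w] by simp
    then show "ln (cmod z - R) \<le> ln (cmod (z - w))" "ln (cmod (z - w)) \<le> ln (cmod z + R)"
      using z R[OF that] norm_triangle_ineq4[of z w] by (auto intro!: ln_mono)
  qed
  have int: "integrable \<omega> (\<lambda>w. ln (cmod (z - w)))"
  proof (rule integrable_const_bound[of _ "\<bar>ln (cmod z - R)\<bar> + \<bar>ln (cmod z + R)\<bar>"])
    show "AE w in \<omega>. norm (ln (cmod (z - w))) \<le> \<bar>ln (cmod z - R)\<bar> + \<bar>ln (cmod z + R)\<bar>"
      using \<omega>_S by eventually_elim (use lo up in \<open>smt (verit) real_norm_def\<close>)
  qed measurable
  have "(\<integral>w. ln (cmod z - R) \<partial>\<omega>) \<le> (\<integral>w. ln (cmod (z - w)) \<partial>\<omega>)"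
    using int \<omega>_S lo by (intro integral_mono_AE) (auto elim!: eventually_mono)
  then show ?thesis using g_off[OF \<open>z \<notin> S\<close>] by (simp add: prob_space)
qed

lemma g_large: obtains R where "R > 0" "\<And>z. cmod z \<ge> R \<Longrightarrow> g z > b"
proof -
  obtain R where R: "R > 0" "\<And>w. w \<in> S \<Longrightarrow> cmod w \<le> R" by (rule S_bound) blast
  show thesis
  proof (rule that[of "R + c * exp (b + 1)"])
    fix z assume z: "R + c * exp (b + 1) \<le> cmod z"
    have e: "c * exp (b + 1) > 0" using c_pos by simp
    have "b + 1 = ln (c * exp (b + 1)) - ln c" using c_pos by (simp add: ln_mult)
    also have "\<dots> \<le> ln (cmod z - R) - ln c" using z e by (intro diff_right_mono ln_mono) auto
    also have "\<dots> \<le> g z" using R z e by (intro g_growth) auto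
    finally show "b < g z" by simp
  qed (use R c_pos in \<open>auto intro: add_pos_pos\<close>)
qed

lemma bounded_sublevel: "bounded {z. g z \<le> t}"
proof -
  obtain R where "\<And>z. cmod z \<ge> R \<Longrightarrow> g z > t" by (rule g_large) blast
  then show ?thesis by (intro boundedI[of _ R]) (smt (verit) mem_Collect_eq)
qed

lemma compact_level: "compact {z. g z = t}"
proof -
  have "bounded {z. g z = t}" using bounded_sublevel[of t] by (rule bounded_subset) auto
  moreover have "closed {z. g z = t}" by (intro closed_Collect_eq g_cont continuous_intros)
  ultimately show ?thesis by (simp add: compact_eq_bounded_closed)
qed

lemma level_disjoint: "t > 0 \<Longrightarrow> {z. g z = t} \<inter> S = {}"
  using g_S by force

lemma sublevel_maximum_modulus:
  assumes "f holomorphic_on UNIV" "\<And>w. g w = t \<Longrightarrow> cmod (f w) \<le> B" "g z \<le> t"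
  shows "cmod (f z) \<le> B"
proof (cases "g z = t")
  case False
  let ?W = "{w. g w < t}"
  have op: "open ?W" by (intro open_Collect_less g_cont continuous_intros)
  have cl: "closure ?W \<subseteq> {w. g w \<le> t}" by (intro closure_minimal closed_Collect_le g_cont continuous_intros) auto
  show ?thesis
  proof (rule maximum_modulus_frontier[of f ?W])
    show "bounded ?W" using bounded_sublevel[of t] by (rule bounded_subset) auto
    show "cmod (f w) \<le> B" if "w \<in> frontier ?W" for w
      using that cl op by (intro assms(2)) (auto simp: frontier_def interior_open not_less intro!: antisym)
  qed (use assms False in \<open>auto intro: holomorphic_on_subset holomorphic_on_imp_continuous_on continuous_on_subset\<close>)
qed (use assms in auto)

lemma open_superlevel: "open {z. g z > t}"
  by (intro open_Collect_less g_cont continuous_intros)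

lemma frontier_superlevel: "frontier {z. g z > t} \<subseteq> {z. g z = t}" and closure_superlevel: "closure {z. g z > t} \<subseteq> {z. g z \<ge> t}"
proof -
  show cl: "closure {z. g z > t} \<subseteq> {z. g z \<ge> t}"
    by (intro closure_minimal closed_Collect_le g_cont continuous_intros) auto
  then show "frontier {z. g z > t} \<subseteq> {z. g z = t}"
    using open_superlevel[of t] by (auto simp: frontier_def interior_open not_less intro!: antisym)
qed

text \<open>A component missing the neighbourhood \<open>X\<close> of infinity would be bounded with
  \<open>g = t\<close> on its frontier, and the maximum modulus principle for the approximating
  products would force \<open>g \<le> t\<close> inside.\<close>

lemma connected_superlevel:
  assumes t: "t > 0"
  shows "connected {z. g z > t}"
proof -
  let ?G = "{z. g z > t}"
  obtain R where R: "R > 0" "\<And>z. cmod z \<ge> R \<Longrightarrow> g z > t" by (rule g_large) blast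
  define X where "X = - ball (0::complex) R"
  have "connected X" unfolding X_def by (intro connected_complement_bounded_convex) auto
  moreover have "X \<subseteq> ?G" using R(2) by (auto simp: X_def not_less)
  moreover have "of_real R \<in> X" using R(1) by (simp add: X_def)
  then have "X \<noteq> {}" by blast
  ultimately have X: "connected X" "X \<subseteq> ?G" "X \<noteq> {}" by blast+
  have sub: "X \<subseteq> connected_component_set ?G z" if z: "g z > t" for z
  proof -
    let ?V = "connected_component_set ?G z"
    have zV: "z \<in> ?V" using z by (simp add: connected_component_refl_eq)
    have opV: "open ?V" by (rule open_connected_component[OF open_superlevel])
    have VG: "?V \<subseteq> ?G" by (rule connected_component_subset)
    have "\<not> ?V \<subseteq> ball 0 R"
    proof
      assume "?V \<subseteq> ball 0 R"
      then have bd: "bounded ?V" using bounded_ball bounded_subset by blast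
      have clV: "closure ?V \<subseteq> {w. g w \<ge> t}" using closure_mono[OF VG] closure_superlevel by blast
      have fr: "frontier ?V \<subseteq> {w. g w = t}"
        using frontier_of_connected_component_subset[of ?G z] frontier_superlevel by blast
      have "g z \<le> t + e" if e: "e > 0" for e
      proof -
        have "compact (closure ?V)" using bd by simp
        moreover have "closure ?V \<inter> S = {}" using clV g_S t by force
        ultimately obtain N where N: "\<And>n. n \<ge> N \<Longrightarrow> \<exists>x. (\<forall>i<n. x i \<in> S) \<and>
          (\<forall>w\<in>closure ?V. exp (real n * (g w + ln c - e / 2)) \<le> cmod (root_prod x n w) \<and>
          cmod (root_prod x n w) \<le> exp (real n * (g w + ln c + e / 2)))"
          using approximation[of "closure ?V" "e / 2"] e by (metis half_gt_zero)
        define n where "n = Suc N"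
        obtain x where lo: "\<And>w. w \<in> closure ?V \<Longrightarrow> exp (real n * (g w + ln c - e / 2)) \<le> cmod (root_prod x n w)"
          and up: "\<And>w. w \<in> closure ?V \<Longrightarrow> cmod (root_prod x n w) \<le> exp (real n * (g w + ln c + e / 2))"
          using N[of n] by (auto simp: n_def)
        have "cmod (root_prod x n z) \<le> exp (real n * (t + ln c + e / 2))"
        proof (rule maximum_modulus_frontier[of "root_prod x n" ?V])
          fix w assume w: "w \<in> frontier ?V"
          then have "w \<in> closure ?V" "g w = t" using fr by (auto simp: frontier_def)
          then show "cmod (root_prod x n w) \<le> exp (real n * (t + ln c + e / 2))" using up[of w] by simp
        qed (use zV bd in \<open>auto intro!: holomorphic_intros continuous_intros\<close>)
        moreover have "exp (real n * (g z + ln c - e / 2)) \<le> cmod (root_prod x n z)"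
          using zV closure_subset[of ?V] by (intro lo) blast
        ultimately have "exp (real n * (g z + ln c - e / 2)) \<le> exp (real n * (t + ln c + e / 2))"
          by linarith
        then have "real n * (g z + ln c - e / 2) \<le> real n * (t + ln c + e / 2)" by simp
        then show ?thesis by (simp add: n_def del: of_nat_Suc)
      qed
      then have "g z \<le> t" by (rule field_le_epsilon)
      then show False using z by simp
    qed
    then obtain y where y: "y \<in> ?V" "y \<in> X" unfolding X_def by blast
    then have "X \<subseteq> connected_component_set ?G y" using X by (intro connected_component_maximal) auto
    then show ?thesis using y(1) by (metis connected_component_eq)
  qed
  show ?thesis
    unfolding connected_iff_connected_component
  proof (intro ballI)
    fix z w assume "z \<in> ?G" "w \<in> ?G"
    obtain y where "y \<in> X" using X(3) by blast
    then have "connected_component ?G z y" "connected_component ?G w y"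
      using sub \<open>z \<in> ?G\<close> \<open>w \<in> ?G\<close> by blast+
    then show "connected_component ?G z w" using connected_component_sym connected_component_trans by metis
  qed
qed

text \<open>The quotient of \<open>Q ^ k\<close> by a product of \<open>n * k\<close> factors is
  bounded at infinity and controlled near \<open>S\<close>. A large \<open>k\<close> makes the
  discretization accurate although \<open>n\<close> is fixed, and the k-th root removes
  \<open>k\<close> again.\<close>

lemma bernstein_walsh:
  fixes Q :: "complex poly"
  assumes n: "degree Q \<le> n" "n > 0" and Q: "\<And>w. w \<in> S \<Longrightarrow> cmod (poly Q w) \<le> M" and M: "M > 0"
  shows "cmod (poly Q z) \<le> M * exp (real n * g z)"
proof (cases "z \<in> S")
  case True
  then show ?thesis using Q g_S by simp
next
  case False
  have bound: "cmod (poly Q z) \<le> M * exp (real n * g z + e)" if e: "e > 0" for e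
  proof -
    \<comment> \<open>One \<open>\<eta>\<close> is lost in enlarging \<open>M\<close> near
      \<open>S\<close>, and one per degree in each of the two uses of the discretization.\<close>
    define \<eta> where "\<eta> = e / (1 + 2 * real n)"
    have \<eta>: "\<eta> > 0" "\<eta> * (1 + 2 * real n) = e" using e n by (auto simp: \<eta>_def)
    have "open {w. cmod (poly Q w) < M * exp \<eta>}" by (intro open_Collect_less continuous_intros)
    moreover have "S \<subseteq> {w. cmod (poly Q w) < M * exp \<eta>}"
    proof
      fix w assume "w \<in> S"
      then have "cmod (poly Q w) \<le> M" by (rule Q)
      also have "M < M * exp \<eta>" using M \<eta> by simp
      finally show "w \<in> {w. cmod (poly Q w) < M * exp \<eta>}" by simp
    qed
    ultimately obtain r where r: "r > 0" "r < infdist z S" "{w. infdist w S \<le> r} \<subseteq> {w. cmod (poly Q w) < M * exp \<eta>}"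
      using collar_near_S False by blast
    define G where "G = {w. infdist w S > r}"
    note coll = exterior_collar[OF r(1), folded G_def]
    define C where "C = insert z {w. infdist w S = r}"
    have "compact C" "C \<inter> S = {}" using compact_infdist_eq False r(1) by (auto simp: C_def)
    then obtain N where N: "\<And>n. n \<ge> N \<Longrightarrow> \<exists>x. (\<forall>i<n. x i \<in> S) \<and>
      (\<forall>w\<in>C. exp (real n * (g w + ln c - \<eta>)) \<le> cmod (root_prod x n w) \<and>
      cmod (root_prod x n w) \<le> exp (real n * (g w + ln c + \<eta>)))" using approximation \<eta>(1) by metis
    define k where "k = Suc N"
    have "1 * k \<le> n * k" using n by (intro mult_right_mono) auto
    then have k: "k > 0" "n * k \<ge> N" by (simp_all add: k_def)
    obtain x where x: "\<And>i. i < n * k \<Longrightarrow> x i \<in> S"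
      and lo: "\<And>w. w \<in> C \<Longrightarrow> exp (real (n * k) * (g w + ln c - \<eta>)) \<le> cmod (root_prod x (n * k) w)"
      and up: "\<And>w. w \<in> C \<Longrightarrow> cmod (root_prod x (n * k) w) \<le> exp (real (n * k) * (g w + ln c + \<eta>))"
      using N[OF k(2)] by blast
    let ?F = "root_prod x (n * k)"
    have nz: "?F w \<noteq> 0" if "w \<notin> S" for w using x that by (auto simp: root_prod_eq_0_iff)
    obtain s where s: "s \<in> S" using S_nonempty by blast
    obtain R where R: "R > 0" "\<And>w. w \<in> S \<Longrightarrow> cmod w \<le> R" by (rule S_bound) blast
    obtain A where A: "A \<ge> 0" "\<And>z. cmod z \<ge> 1 \<Longrightarrow> cmod (poly Q z) \<le> A * cmod z ^ n"
      by (rule poly_norm_bound_infinity[OF n(1)]) blast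
    let ?b = "(M * exp (\<eta> - real n * (ln c - \<eta>))) ^ k"
    have "cmod (poly Q z ^ k / ?F z) \<le> ?b"
    proof (rule exterior_maximum_modulus[where f = "\<lambda>w. poly Q w ^ k / ?F w" and z = z and G = G and ?x0.0 = s and r = r and C = "A ^ k * 2 ^ (n * k)"])
      show "(\<lambda>w. poly Q w ^ k / ?F w) holomorphic_on G"
        using nz coll(3) closure_subset[of G] by (intro holomorphic_intros) blast
      show "continuous_on (closure G) (\<lambda>w. poly Q w ^ k / ?F w)"
        using nz coll(3) by (intro continuous_intros) blast
      have "\<forall>\<^sub>F w in at_infinity. (cmod w / 2) ^ (n * k) \<le> cmod (?F w)"
        using x R by (intro root_prod_eventually_ge[of _ _ R]) auto
      moreover have "\<forall>\<^sub>F w in at_infinity. 1 \<le> cmod w" by (auto simp: eventually_at_infinity)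
      ultimately show "\<forall>\<^sub>F w in at_infinity. w \<in> G \<longrightarrow> cmod (poly Q w ^ k / ?F w) \<le> A ^ k * 2 ^ (n * k)"
      proof eventually_elim
        case (elim w)
        have "cmod (poly Q w) ^ k \<le> (A * cmod w ^ n) ^ k" using A(2)[OF elim(2)] by (intro power_mono) auto
        also have "\<dots> = A ^ k * 2 ^ (n * k) * (cmod w / 2) ^ (n * k)"
          by (simp add: power_mult_distrib power_mult power_divide)
        also have "\<dots> \<le> A ^ k * 2 ^ (n * k) * cmod (?F w)"
          using elim A(1) by (intro mult_left_mono) auto
        finally have "cmod (poly Q w) ^ k \<le> A ^ k * 2 ^ (n * k) * cmod (?F w)" .
        moreover have "0 < cmod w" using elim(2) by linarith
        then have "0 < (cmod w / 2) ^ (n * k)" by (intro zero_less_power) simp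
        then have "0 < cmod (?F w)" using elim(1) by linarith
        ultimately show ?case by (simp add: norm_divide norm_power pos_divide_le_eq)
      qed
      show "0 \<le> ?b" using M by simp
      fix w assume "w \<in> frontier G"
      then have w: "infdist w S = r" using coll(2) by blast
      have "cmod (poly Q w) ^ k \<le> (M * exp \<eta>) ^ k"
        using w r(3) by (intro power_mono) (auto simp: less_imp_le)
      moreover have "exp (real (n * k) * (ln c - \<eta>)) \<le> cmod (?F w)"
      proof -
        have "exp (real (n * k) * (ln c - \<eta>)) \<le> exp (real (n * k) * (g w + ln c - \<eta>))"
          using g_nonneg[of w] by (simp add: mult_left_mono)
        also have "\<dots> \<le> cmod (?F w)" using w by (intro lo) (simp add: C_def)
        finally show ?thesis .
      qed
      ultimately have "cmod (poly Q w) ^ k / cmod (?F w) \<le> (M * exp \<eta>) ^ k / exp (real (n * k) * (ln c - \<eta>))"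
        using M by (intro frac_le) auto
      also have "exp (real (n * k) * (ln c - \<eta>)) = exp (real n * (ln c - \<eta>)) ^ k"
        by (simp add: exp_of_nat_mult[symmetric] mult_ac)
      also have "(M * exp \<eta>) ^ k / exp (real n * (ln c - \<eta>)) ^ k = ?b"
        by (simp add: exp_diff power_divide)
      finally show "cmod (poly Q w ^ k / ?F w) \<le> ?b" by (simp add: norm_divide norm_power)
    qed (use coll r s in \<open>auto simp: G_def\<close>)
    then have "cmod (poly Q z) ^ k \<le> ?b * cmod (?F z)"
      using nz[OF False] by (simp add: norm_divide norm_power pos_divide_le_eq)
    also have "\<dots> \<le> ?b * exp (real (n * k) * (g z + ln c + \<eta>))"
      using M by (intro mult_left_mono up) (auto simp: C_def)
    also have "exp (real (n * k) * (g z + ln c + \<eta>)) = exp (real n * (g z + ln c + \<eta>)) ^ k"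
      by (simp add: exp_of_nat_mult[symmetric] mult_ac)
    also have "?b * exp (real n * (g z + ln c + \<eta>)) ^ k = (M * exp (\<eta> - real n * (ln c - \<eta>) + real n * (g z + ln c + \<eta>))) ^ k"
      unfolding exp_add by (simp add: power_mult_distrib)
    also have "\<eta> - real n * (ln c - \<eta>) + real n * (g z + ln c + \<eta>) = real n * g z + e"
      using \<eta>(2) by (simp add: algebra_simps)
    finally show ?thesis using M k by (subst (asm) power_mono_iff) auto
  qed
  have "((\<lambda>e. M * exp (real n * g z + e)) \<longlongrightarrow> M * exp (real n * g z + 0)) (at_right 0)"
    by (intro tendsto_intros)
  moreover have "\<forall>\<^sub>F e in at_right 0. cmod (poly Q z) \<le> M * exp (real n * g z + e)"
    using bound by (auto simp: eventually_at_right_less intro: eventually_mono[OF eventually_at_right_less])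
  ultimately show ?thesis using tendsto_lowerbound[OF _ _ trivial_limit_at_right_real] by fastforce
qed

text \<open>The strong minimum principle: if \<open>g z = 0\<close>, the two constants principle for
  a normalised reciprocal product carries this vanishing along a path from \<open>z\<close> to a
  distant point, where \<open>g\<close> is positive by its growth.\<close>

lemma g_pos_outside:
  assumes "z \<in> outside S"
  shows "g z > 0"
proof (rule ccontr)
  assume "\<not> g z > 0"
  then have gz: "g z = 0" using g_nonneg[of z] by simp
  obtain R where R: "R > 0" "\<And>z. cmod z \<ge> R \<Longrightarrow> g z > 0" by (rule g_large) blast
  have bS: "bounded S" using S_compact by (rule compact_imp_bounded)
  have "\<not> bounded (outside S)" using unbounded_outside[OF bS] .
  then obtain b where b: "b \<in> outside S" "cmod b > R" unfolding bounded_iff by (meson not_le)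
  have op: "open (outside S)" using open_outside[OF compact_imp_closed[OF S_compact]] .
  have "path_connected (outside S)"
    using op connected_outside[OF bS] by (simp add: connected_open_path_connected)
  then obtain p where p: "path p" "path_image p \<subseteq> outside S" "pathstart p = z" "pathfinish p = b"
    using assms b(1) unfolding path_connected_def by blast
  define P where "P = path_image p"
  have P: "compact P" "connected P" "P \<subseteq> outside S" "z \<in> P" "b \<in> P"
    using p pathstart_in_path_image[of p] pathfinish_in_path_image[of p]
    by (auto simp: P_def compact_path_image connected_path_image)
  then have "P \<noteq> {}" by blast
  then obtain G where G: "open G" "connected G" "P \<subseteq> G" "compact (closure G)" "closure G \<subseteq> outside S"
    using connected_open_neighbourhood[OF P(1,2) _ op P(3)] by blast
  have GS: "closure G \<inter> S = {}" using G(5) outside_no_overlap[of S] by blast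
  obtain M where M: "M \<ge> 0" "\<And>A B m s y z. A holomorphic_on G \<Longrightarrow> B holomorphic_on G \<Longrightarrow>
    (\<forall>z\<in>G. cmod (B z) \<le> 1) \<Longrightarrow> (\<forall>z\<in>G. cmod (A z * B z) \<le> exp m) \<Longrightarrow>
    y \<in> P \<Longrightarrow> exp (-s) \<le> cmod (B y) \<Longrightarrow> z \<in> P \<Longrightarrow> cmod (A z) \<le> exp (m + M * s)"
    using two_constants[OF G(1,2) P(1) G(3)] by blast
  have "g b \<le> 0 + e" if e: "e > 0" for e
  proof -
    define \<eta> where "\<eta> = e / (2 * M + 1)"
    have \<eta>: "\<eta> > 0" "\<eta> * (2 * M + 1) = e" using e M(1) by (auto simp: \<eta>_def add_nonneg_pos)
    obtain N where N: "\<And>n. n \<ge> N \<Longrightarrow> \<exists>x. (\<forall>i<n. x i \<in> S) \<and>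
      (\<forall>w\<in>closure G. exp (real n * (g w + ln c - \<eta>)) \<le> cmod (root_prod x n w) \<and>
      cmod (root_prod x n w) \<le> exp (real n * (g w + ln c + \<eta>)))"
      using approximation[OF G(4) GS \<eta>(1)] by metis
    define n where "n = Suc N"
    obtain x where x: "\<And>i. i < n \<Longrightarrow> x i \<in> S"
      and lo: "\<And>w. w \<in> closure G \<Longrightarrow> exp (real n * (g w + ln c - \<eta>)) \<le> cmod (root_prod x n w)"
      and up: "\<And>w. w \<in> closure G \<Longrightarrow> cmod (root_prod x n w) \<le> exp (real n * (g w + ln c + \<eta>))"
      using N[of n] by (auto simp: n_def)
    have nz: "root_prod x n w \<noteq> 0" if "w \<in> G" for w
      using x that GS closure_subset[of G] by (auto simp: root_prod_eq_0_iff)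
    \<comment> \<open>As \<open>g \<ge> 0\<close>, this is a lower bound for the product on
      \<open>G\<close>, so that \<open>k / root_prod\<close> has modulus at most 1.\<close>
    define k where "k = exp (real n * (ln c - \<eta>))"
    have k: "k > 0" by (simp add: k_def)
    have "cmod (root_prod x n b / of_real k) \<le> exp (0 + M * (real n * (2 * \<eta>)))"
    proof (rule M(2)[of "\<lambda>w. root_prod x n w / of_real k" "\<lambda>w. of_real k / root_prod x n w" 0 z _ b])
      show "\<forall>w\<in>G. cmod (of_real k / root_prod x n w) \<le> 1"
      proof
        fix w assume w: "w \<in> G"
        have "k \<le> exp (real n * (g w + ln c - \<eta>))" using g_nonneg[of w] by (simp add: k_def mult_left_mono)
        also have "\<dots> \<le> cmod (root_prod x n w)" using w closure_subset by (intro lo) blast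
        finally show "cmod (of_real k / root_prod x n w) \<le> 1" using k nz[OF w] by (simp add: norm_divide)
      qed
      have "z \<in> G" using P G by blast
      then have "cmod (root_prod x n z) \<le> exp (real n * (ln c + \<eta>))" using up[of z] gz closure_subset[of G] by auto
      then have "k / exp (real n * (ln c + \<eta>)) \<le> cmod (of_real k / root_prod x n z)"
        using k nz[OF \<open>z \<in> G\<close>] by (simp add: norm_divide frac_le)
      then show "exp (- (real n * (2 * \<eta>))) \<le> cmod (of_real k / root_prod x n z)"
        by (simp add: k_def exp_diff[symmetric] algebra_simps)
    qed (use P nz k in \<open>auto intro!: holomorphic_intros simp: norm_divide norm_mult\<close>)
    then have "cmod (root_prod x n b) \<le> k * exp (M * (real n * (2 * \<eta>)))"
      using k by (simp add: norm_divide pos_divide_le_eq mult.commute)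
    moreover have "exp (real n * (g b + ln c - \<eta>)) \<le> cmod (root_prod x n b)"
      using P(5) G(3) closure_subset by (intro lo) blast
    ultimately have "exp (real n * (g b + ln c - \<eta>)) \<le> exp (real n * (ln c - \<eta>) + M * (real n * (2 * \<eta>)))"
      by (simp add: k_def exp_add)
    then have "real n * g b \<le> real n * (2 * M * \<eta>)" by (simp add: algebra_simps)
    then have "g b \<le> 2 * M * \<eta>" by (simp add: n_def del: of_nat_Suc)
    then show ?thesis using \<eta> by (simp add: algebra_simps)
  qed
  then have "g b \<le> 0" by (rule field_le_epsilon)
  then show False using R(2)[of b] b(2) by simp
qed

end

section \<open>Escaping polynomials\<close>

lemma poly_root_bounds:
  fixes p :: "complex poly"
  assumes "\<And>z. poly p z = 0 \<Longrightarrow> cmod z \<le> R" "p \<noteq> 0"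
  shows "cmod w \<ge> R \<Longrightarrow> cmod (lead_coeff p) * (cmod w - R) ^ degree p \<le> cmod (poly p w)"
    and "cmod (poly p w) \<le> cmod (lead_coeff p) * (cmod w + R) ^ degree p"
proof -
  have "(cmod w \<ge> R \<longrightarrow> cmod (lead_coeff p) * (cmod w - R) ^ degree p \<le> cmod (poly p w)) \<and>
    cmod (poly p w) \<le> cmod (lead_coeff p) * (cmod w + R) ^ degree p"
    using assms
  proof (induction "degree p" arbitrary: p)
    case 0
    then obtain a where "p = [:a:]" by (metis degree_eq_zeroE)
    then show ?case by simp
  next
    case (Suc d)
    have "\<not> constant (poly p)" using Suc.hyps(2) by (simp add: constant_degree)
    then obtain a where a: "poly p a = 0" using fundamental_theorem_of_algebra by blast
    then obtain q where q: "p = [:-a, 1:] * q" by (metis dvdE poly_eq_0_iff_dvd)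
    then have q0: "q \<noteq> 0" using Suc.prems by auto
    have dp: "degree p = Suc (degree q)" unfolding q using q0 by (subst degree_mult_eq) auto
    have lp: "lead_coeff p = lead_coeff q" unfolding q using lead_coeff_mult[of "[:-a, 1:]" q] by simp
    have IH: "(cmod w \<ge> R \<longrightarrow> cmod (lead_coeff q) * (cmod w - R) ^ degree q \<le> cmod (poly q w)) \<and>
      cmod (poly q w) \<le> cmod (lead_coeff q) * (cmod w + R) ^ degree q"
      using Suc.hyps dp q0 Suc.prems(1) by (intro Suc.hyps(1)) (auto simp: q)
    have aR: "cmod a \<le> R" using a Suc.prems(1) by blast
    have R0: "0 \<le> cmod w + R" using order_trans[OF norm_ge_zero aR] by simp
    have pw: "cmod (poly p w) = cmod (w - a) * cmod (poly q w)"
      by (simp add: q norm_mult[symmetric] algebra_simps)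
    show ?case unfolding pw lp unfolding dp
    proof (intro conjI impI)
      assume wR: "cmod w \<ge> R"
      have "(cmod w - R) * (cmod (lead_coeff q) * (cmod w - R) ^ degree q) \<le> cmod (w - a) * cmod (poly q w)"
        using IH wR aR norm_triangle_ineq2[of w a] by (intro mult_mono) auto
      then show "cmod (lead_coeff q) * (cmod w - R) ^ Suc (degree q) \<le> cmod (w - a) * cmod (poly q w)"
        by (simp add: mult_ac)
    next
      have "cmod (w - a) * cmod (poly q w) \<le> (cmod w + R) * (cmod (lead_coeff q) * (cmod w + R) ^ degree q)"
        using IH aR norm_triangle_ineq4[of w a] R0 by (intro mult_mono) auto
      then show "cmod (w - a) * cmod (poly q w) \<le> cmod (lead_coeff q) * (cmod w + R) ^ Suc (degree q)"
        by (simp add: mult_ac)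
    qed
  qed
  then show "cmod w \<ge> R \<Longrightarrow> cmod (lead_coeff p) * (cmod w - R) ^ degree p \<le> cmod (poly p w)"
    and "cmod (poly p w) \<le> cmod (lead_coeff p) * (cmod w + R) ^ degree p" by blast+
qed

text \<open>Uniform growth estimates for a polynomial of degree \<open>n\<close>: the constants do not depend on \<open>n\<close>.\<close>

locale escaping_polynomial =
  fixes p :: "complex poly" and n :: nat and a b R :: real
  assumes n: "n \<ge> 2" and a: "a \<ge> 0" and b: "b \<ge> 0" and R: "R \<ge> 1" and Ra: "ln R \<ge> 2 * a + 1"
    and lower: "\<And>w. cmod w \<ge> R \<Longrightarrow> (exp (-a) * cmod w) ^ n \<le> cmod (poly p w)"
    and upper: "\<And>w. cmod (poly p w) \<le> (exp b * max 1 (cmod w)) ^ n"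
begin

lemma ln_lower:
  assumes "cmod w \<ge> R"
  shows "real n * (ln (cmod w) - a) \<le> ln (cmod (poly p w))"
proof -
  have w: "cmod w > 0" using assms R by linarith
  have "real n * (ln (cmod w) - a) = ln ((exp (-a) * cmod w) ^ n)"
    using w by (simp add: ln_realpow ln_mult)
  also have "\<dots> \<le> ln (cmod (poly p w))" using lower[OF assms] w by (intro ln_mono) auto
  finally show ?thesis .
qed

text \<open>Subtracting \<open>2 * a\<close> makes the recursion multiplicative:
  \<open>n * (t - a) - 2 * a \<ge> n * (t - 2 * a)\<close> because \<open>n \<ge> 2\<close>. The
  condition \<open>ln R \<ge> 2 * a + 1\<close> keeps the orbit outside radius
  \<open>R\<close>.\<close>

lemma iterate_lower:
  assumes "cmod w \<ge> R"
  shows "R \<le> cmod ((poly p ^^ j) w) \<and> real n ^ j * (ln (cmod w) - 2 * a) \<le> ln (cmod ((poly p ^^ j) w)) - 2 * a"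
proof (induction j)
  case (Suc j)
  let ?v = "(poly p ^^ j) w"
  have v: "cmod ?v \<ge> R" using Suc by blast
  have na: "2 * a \<le> real n * a" using n a by (intro mult_right_mono) auto
  have lv: "ln R \<le> ln (cmod ?v)" using v R by (intro ln_mono) auto
  have "real n ^ Suc j * (ln (cmod w) - 2 * a) \<le> real n * (ln (cmod ?v) - 2 * a)"
    using Suc by (simp add: mult.assoc mult_left_mono)
  also have "\<dots> \<le> real n * (ln (cmod ?v) - a) - 2 * a" using na by (simp add: algebra_simps)
  also have "\<dots> \<le> ln (cmod (poly p ?v)) - 2 * a" using ln_lower[OF v] by simp
  finally have 1: "real n ^ Suc j * (ln (cmod w) - 2 * a) \<le> ln (cmod (poly p ?v)) - 2 * a" .
  have "2 * (ln R - 2 * a) \<le> real n * (ln (cmod ?v) - 2 * a)" using n lv Ra by (intro mult_mono) auto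
  then have "ln R \<le> real n * (ln (cmod ?v) - 2 * a) + 2 * a" using Ra by simp
  also have "\<dots> \<le> real n * (ln (cmod ?v) - a)" using na by (simp add: algebra_simps)
  also have "\<dots> \<le> ln (cmod (poly p ?v))" by (rule ln_lower[OF v])
  finally have lR: "ln R \<le> ln (cmod (poly p ?v))" .
  have "0 < (exp (-a) * cmod ?v) ^ n" using v R by (intro zero_less_power mult_pos_pos) auto
  then have "cmod (poly p ?v) > 0" using lower[OF v] by linarith
  then have "R \<le> cmod (poly p ?v)" using lR R by (subst (asm) ln_le_cancel_iff) auto
  with 1 show ?case by simp
qed (use assms in simp)

lemma filled_julia_bounded: "filled_julia p \<subseteq> ball 0 R"
proof
  fix z assume z: "z \<in> filled_julia p"
  show "z \<in> ball 0 R"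
  proof (rule ccontr)
    assume "z \<notin> ball 0 R"
    then have zR: "cmod z \<ge> R" by simp
    have "bounded (range (\<lambda>j. (poly p ^^ j) z))" using z by (simp add: filled_julia_def)
    then obtain C where C: "\<And>j. cmod ((poly p ^^ j) z) \<le> C" unfolding bounded_iff by blast
    have "ln R \<le> ln (cmod z)" using zR R by (intro ln_mono) auto
    then have one: "1 \<le> ln (cmod z) - 2 * a" using Ra by linarith
    have "real n ^ j \<le> ln C" for j
    proof -
      have "real n ^ j * 1 \<le> real n ^ j * (ln (cmod z) - 2 * a)" using one by (intro mult_left_mono) auto
      also have "\<dots> \<le> ln (cmod ((poly p ^^ j) z))" using iterate_lower[OF zR, of j] a by linarith
      also have "\<dots> \<le> ln C" using C[of j] iterate_lower[OF zR, of j] R by (intro ln_mono) auto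
      finally show ?thesis by simp
    qed
    moreover obtain j where "ln C < real n ^ j" using real_arch_pow[of "real n" "ln C"] n by auto
    ultimately show False by (meson not_le)
  qed
qed

lemma not_filled_julia_escapes:
  assumes "z \<notin> filled_julia p"
  shows "\<exists>j. cmod ((poly p ^^ j) z) > R"
proof (rule ccontr)
  assume "\<not> ?thesis"
  then have "\<And>j. cmod ((poly p ^^ j) z) \<le> R" by (simp add: not_less)
  then have "bounded (range (\<lambda>j. (poly p ^^ j) z))" by (intro boundedI[of _ R]) auto
  then show False using assms by (simp add: filled_julia_def)
qed

lemma escape_in: "cmod (poly p z) \<ge> R \<Longrightarrow> z \<notin> filled_julia p"
proof
  assume h: "R \<le> cmod (poly p z)" "z \<in> filled_julia p"
  have "range (\<lambda>j. (poly p ^^ j) (poly p z)) \<subseteq> range (\<lambda>j. (poly p ^^ j) z)"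
  proof
    fix v assume "v \<in> range (\<lambda>j. (poly p ^^ j) (poly p z))"
    then obtain j where "v = (poly p ^^ Suc j) z" by (auto simp: funpow_swap1)
    then show "v \<in> range (\<lambda>j. (poly p ^^ j) z)" by blast
  qed
  then have "poly p z \<in> filled_julia p" using h(2) unfolding filled_julia_def by (auto intro: bounded_subset)
  then show False using filled_julia_bounded h(1) by force
qed

text \<open>The same device as for the lower bound, with \<open>2 * b\<close> added instead of
  \<open>2 * a\<close> subtracted.\<close>

lemma iterate_upper:
  "ln (max 1 (cmod ((poly p ^^ j) w))) \<le> real n ^ j * (ln (max 1 (cmod w)) + 2 * b) - 2 * b"
proof (induction j)
  case (Suc j)
  let ?v = "(poly p ^^ j) w"
  have "max 1 (cmod (poly p ?v)) \<le> (exp b * max 1 (cmod ?v)) ^ n"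
  proof (rule max.boundedI[OF _ upper])
    have "1 * 1 \<le> exp b * max 1 (cmod ?v)" using b by (intro mult_mono) auto
    then show "1 \<le> (exp b * max 1 (cmod ?v)) ^ n" by (intro one_le_power) simp
  qed
  then have "ln (max 1 (cmod (poly p ?v))) \<le> ln ((exp b * max 1 (cmod ?v)) ^ n)" by (intro ln_mono) auto
  also have "\<dots> = real n * (b + ln (max 1 (cmod ?v)))" by (simp add: ln_realpow ln_mult)
  also have "\<dots> \<le> real n * (b + (real n ^ j * (ln (max 1 (cmod w)) + 2 * b) - 2 * b))"
    using Suc by (intro mult_left_mono) auto
  also have "\<dots> = real n ^ Suc j * (ln (max 1 (cmod w)) + 2 * b) - real n * b" by (simp add: algebra_simps)
  also have "\<dots> \<le> real n ^ Suc j * (ln (max 1 (cmod w)) + 2 * b) - 2 * b"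
    using n b by (simp add: mult_right_mono)
  finally show ?case by simp
qed simp

text \<open>A fixed point of \<open>p\<close> exists because the degree is at least 2, and this is
  read off the lower growth bound, which a polynomial of degree at most 1 would violate.\<close>

lemma filled_julia_nonempty: "filled_julia p \<noteq> {}"
proof -
  have "degree p \<ge> 2"
  proof (rule ccontr)
    assume "\<not> 2 \<le> degree p"
    then have d: "degree p \<le> 1" by simp
    obtain A where A: "A \<ge> 0" "\<And>z. cmod z \<ge> 1 \<Longrightarrow> cmod (poly p z) \<le> A * cmod z ^ 1"
      by (rule poly_norm_bound_infinity[OF d]) blast
    \<comment> \<open>At this radius the quadratic lower bound \<open>(exp (- a) * t) ^ 2\<close>
      exceeds the linear upper bound \<open>A * t\<close>.\<close>
    define t where "t = max R ((A + 1) * exp (2 * a))"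
    have t: "t \<ge> R" "t \<ge> (A + 1) * exp (2 * a)" "t \<ge> 1" using R by (auto simp: t_def)
    have "exp (2 * a) \<le> exp (ln R)" using Ra by simp
    then have "exp (2 * a) \<le> t" using R t by simp
    have "exp a * exp a \<le> t" using \<open>exp (2 * a) \<le> t\<close> by (simp add: exp_add[symmetric])
    moreover have "exp a \<ge> 1" using a by simp
    then have "exp a \<le> exp a * exp a" by simp
    ultimately have "exp a \<le> t" by linarith
    then have "1 \<le> exp (-a) * t" by (simp add: exp_minus field_simps)
    then have "(exp (-a) * t) ^ 2 \<le> (exp (-a) * t) ^ n" using n by (intro power_increasing) auto
    also have "\<dots> \<le> cmod (poly p (of_real t))" using lower[of "of_real t"] t by simp
    also have "\<dots> \<le> A * t" using A(2)[of "of_real t"] t by simp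
    finally have "exp (- (2 * a)) * (t * t) \<le> A * t"
      by (simp add: power2_eq_square exp_add[symmetric] mult_ac)
    then have "exp (- (2 * a)) * t \<le> A" using t by simp
    then have "t \<le> A * exp (2 * a)" by (simp add: exp_minus field_simps)
    moreover have "A * exp (2 * a) < (A + 1) * exp (2 * a)" by simp
    ultimately show False using t by linarith
  qed
  then have d: "degree (p - [:0, 1:]) = degree p"
    unfolding diff_conv_add_uminus by (intro degree_add_eq_left) (simp del: minus_pCons)
  then have "\<not> constant (poly (p - [:0, 1:]))" using \<open>degree p \<ge> 2\<close> unfolding constant_degree d by simp
  then obtain z where "poly (p - [:0, 1:]) z = 0" using fundamental_theorem_of_algebra by blast
  then have "poly p z = z" by simp
  then have "(poly p ^^ j) z = z" for j by (induction j) auto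
  then have "z \<in> filled_julia p" by (simp add: filled_julia_def image_constant_conv)
  then show ?thesis by blast
qed

text \<open>Harnack's inequality for the iterates transports the growth at infinity to the rest of \<open>G\<close>.\<close>

lemma growth_off_filled_julia:
  assumes G: "compact (closure G)" "closure G \<inter> filled_julia p = {}"
    and M: "M > 0" "\<And>h. h holomorphic_on G \<Longrightarrow> (\<And>w. w \<in> G \<Longrightarrow> cmod (h w) \<ge> 1) \<Longrightarrow>
      ln (cmod (h y)) \<le> M * ln (cmod (h z))"
    and yz: "z \<in> G" "y \<in> G" "cmod y \<ge> R"
  shows "real n \<le> M * (ln (max 1 (cmod (poly p z))) + 2 * b)"
proof -
  have holit: "(poly p ^^ j) holomorphic_on A" for j A
    by (induction j arbitrary: A) (auto simp: o_def id_def intro!: holomorphic_intros)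
  \<comment> \<open>Increasing open sets that exhaust the complement of the filled Julia set. By
    compactness one iterate escapes on all of \<open>G\<close>; its logarithm is nonnegative there,
    as Harnack's inequality demands.\<close>
  define U where "U j = {w. cmod ((poly p ^^ j) w) > R}" for j
  have opU: "open (U j)" for j
    unfolding U_def by (intro open_Collect_less continuous_intros holomorphic_on_imp_continuous_on holit)
  have mono: "w \<in> U k" if "w \<in> U j" "j \<le> k" for w j k
  proof -
    have st: "w \<in> U (Suc j)" if "w \<in> U j" for j
    proof -
      let ?v = "(poly p ^^ j) w"
      have v: "cmod ?v \<ge> R" "cmod ?v > R" using that by (auto simp: U_def)
      have "ln R < ln (cmod ?v)" using v R by (subst ln_less_cancel_iff) auto
      moreover have "2 * (ln (cmod ?v) - 2 * a) \<le> ln (cmod (poly p ?v)) - 2 * a"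
      proof -
        have "ln R \<le> ln (cmod ?v)" using v R by (intro ln_mono) auto
        then have "2 * (ln (cmod ?v) - 2 * a) \<le> real n * (ln (cmod ?v) - 2 * a)"
          using n Ra by (intro mult_right_mono) auto
        then show ?thesis using iterate_lower[OF v(1), of 1] by simp
      qed
      ultimately have "ln R < ln (cmod (poly p ?v))" using Ra by (simp add: algebra_simps)
      moreover have "cmod (poly p ?v) \<ge> R" using iterate_lower[OF v(1), of 1] by simp
      ultimately have "R < cmod (poly p ?v)" using R by (metis less_eq_real_def less_irrefl)
      then show ?thesis by (simp add: U_def)
    qed
    show ?thesis using \<open>j \<le> k\<close>
    proof (induction rule: dec_induct)
      case base
      show ?case by (rule \<open>w \<in> U j\<close>)
    next
      case (step i)
      show ?case by (rule st[OF step.IH])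
    qed
  qed
  have cov: "closure G \<subseteq> (\<Union>j\<in>UNIV. U j)"
    using G(2) not_filled_julia_escapes by (fastforce simp: U_def)
  obtain J where "J \<subseteq> UNIV" and J: "finite J" "closure G \<subseteq> (\<Union>j\<in>J. U j)"
    by (rule compactE_image[OF G(1) _ cov]) (rule opU)
  define k where "k = Max (insert 0 J)"
  have Uk: "w \<in> U (Suc k)" if "w \<in> G" for w
  proof -
    have "w \<in> closure G" using that closure_subset[of G] by blast
    then obtain j where "j \<in> J" "w \<in> U j" using J(2) by blast
    moreover have "j \<le> Suc k" using J(1) \<open>j \<in> J\<close> by (simp add: k_def le_SucI)
    ultimately show ?thesis using mono[of w j "Suc k"] by simp
  qed
  let ?h = "poly p ^^ Suc k"
  have "cmod (?h w) \<ge> 1" if "w \<in> G" for w using Uk[OF that] R unfolding U_def by auto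
  then have 1: "ln (cmod (?h y)) \<le> M * ln (cmod (?h z))" by (intro M(2) holit)
  have "ln R \<le> ln (cmod y)" using yz R by (intro ln_mono) auto
  then have "1 \<le> ln (cmod y) - 2 * a" using Ra by linarith
  then have "real n ^ Suc k * 1 \<le> real n ^ Suc k * (ln (cmod y) - 2 * a)" by (intro mult_left_mono) auto
  also have "\<dots> \<le> ln (cmod (?h y))" using iterate_lower[OF yz(3), of "Suc k"] a by linarith
  also note 1
  \<comment> \<open>\<open>Suc k\<close> iterates starting at \<open>y\<close> are compared with
    \<open>k\<close> iterates starting at \<open>poly p z\<close>: the surplus factor
    \<open>n\<close> between the two rates is the conclusion.\<close>
  also have "ln (cmod (?h z)) \<le> ln (max 1 (cmod ((poly p ^^ k) (poly p z))))"
    using Uk[OF yz(1)] R by (intro ln_mono) (auto simp: U_def funpow_swap1)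
  also have "\<dots> \<le> real n ^ k * (ln (max 1 (cmod (poly p z))) + 2 * b)"
    using iterate_upper[of k "poly p z"] b by linarith
  finally have "real n ^ Suc k \<le> M * (real n ^ k * (ln (max 1 (cmod (poly p z))) + 2 * b))"
    using M(1) by simp
  then have "real n ^ k * real n \<le> real n ^ k * (M * (ln (max 1 (cmod (poly p z))) + 2 * b))"
    by (simp add: mult_ac)
  then show ?thesis using n by (subst (asm) mult_le_cancel_left_pos) auto
qed

end

section \<open>Orthonormal polynomials of a regular measure\<close>

definition root_poly :: "(nat \<Rightarrow> complex) \<Rightarrow> nat \<Rightarrow> complex poly" where
  "root_poly x n = (\<Prod>i<n. [:- x i, 1:])"

lemma poly_root_poly: "poly (root_poly x n) z = root_prod x n z"
  by (simp add: root_poly_def root_prod_def poly_prod)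

lemma root_poly_monic: "degree (root_poly x n) = n \<and> lead_coeff (root_poly x n) = 1"
proof (induction n)
  case (Suc n)
  have eq: "root_poly x (Suc n) = root_poly x n * [:- x n, 1:]" by (simp add: root_poly_def)
  have "root_poly x n \<noteq> 0" using Suc by (metis leading_coeff_0_iff zero_neq_one)
  then have "degree (root_poly x (Suc n)) = Suc n" unfolding eq using Suc by (subst degree_mult_eq) auto
  moreover have "lead_coeff (root_poly x (Suc n)) = lead_coeff (root_poly x n) * lead_coeff [:- x n, 1:]"
    unfolding eq by (rule lead_coeff_mult)
  then have "lead_coeff (root_poly x (Suc n)) = 1" using conjunct2[OF Suc] by simp
  ultimately show ?case by simp
qed (simp add: root_poly_def)

text \<open>The synthetic quotient is the difference quotient \<open>(Q w - Q z) / (w - z)\<close>.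
  On the circle of radius \<open>2 * R\<close> its denominator is at least 1 in modulus, and the
  maximum principle brings the bound inside.\<close>

lemma synthetic_div_bound:
  fixes Q :: "complex poly" and x z :: complex
  assumes R: "R \<ge> 1" and Q: "\<And>w. cmod w \<le> 2 * R \<Longrightarrow> cmod (poly Q w) \<le> X" and xz: "cmod x \<le> R" "cmod z \<le> R"
  shows "cmod (poly (synthetic_div Q z) x) \<le> 2 * X"
proof (rule maximum_modulus_frontier[of "poly (synthetic_div Q z)" "cball 0 (2 * R)"])
  fix w :: complex assume "w \<in> frontier (cball 0 (2 * R))"
  then have w: "cmod w = 2 * R" using R by auto
  have "poly Q w = (w - z) * poly (synthetic_div Q z) w + poly Q z"
    by (subst synthetic_div_correct'[of z Q, symmetric]) (simp add: algebra_simps)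
  then have "cmod (w - z) * cmod (poly (synthetic_div Q z) w) = cmod (poly Q w - poly Q z)" by (simp add: norm_mult)
  also have "\<dots> \<le> 2 * X" using Q[of w] Q[of z] w xz R norm_triangle_ineq4[of "poly Q w" "poly Q z"] by simp
  finally have 1: "cmod (w - z) * cmod (poly (synthetic_div Q z) w) \<le> 2 * X" .
  have "1 \<le> cmod (w - z)" using norm_triangle_ineq2[of w z] w xz R by simp
  then have "1 * cmod (poly (synthetic_div Q z) w) \<le> cmod (w - z) * cmod (poly (synthetic_div Q z) w)"
    by (intro mult_right_mono) auto
  then show "cmod (poly (synthetic_div Q z) w) \<le> 2 * X" using 1 by simp
qed (use xz R in \<open>auto intro!: holomorphic_intros continuous_intros\<close>)

lemma norm_integral_le:
  fixes f :: "'a \<Rightarrow> 'b::{banach, second_countable_topology}"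
  assumes "integrable M f" "integrable M h" "AE x in M. norm (f x) \<le> h x"
  shows "norm (\<integral>x. f x \<partial>M) \<le> (\<integral>x. h x \<partial>M)"
  by (rule order_trans[OF integral_norm_bound integral_mono_AE]) (use assms in auto)

text \<open>The integrand lives on \<open>A\<close>, at positive distance from \<open>z\<close>, so
  the difference quotient differs from the integral of \<open>- \<psi> x / (z - x)\<^sup>2\<close>
  by a multiple of \<open>cmod h\<close>.\<close>

lemma Cauchy_transform:
  assumes \<psi>: "integrable \<tau> \<psi>" "\<And>x. x \<notin> A \<Longrightarrow> \<psi> x = (0::complex)" and A: "closed A" and s: "sets \<tau> = sets borel"
  shows Cauchy_transform_integrable: "\<And>z. z \<notin> A \<Longrightarrow> integrable \<tau> (\<lambda>x. \<psi> x / (z - x))"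
    and Cauchy_transform_holomorphic: "(\<lambda>z. \<integral>x. \<psi> x / (z - x) \<partial>\<tau>) holomorphic_on - A"
proof -
  note [measurable_cong] = s
  have [measurable]: "\<psi> \<in> borel_measurable borel"
    using borel_measurable_integrable[OF \<psi>(1)] by (simp add: measurable_cong_sets[OF s refl])
  show int: "integrable \<tau> (\<lambda>x. \<psi> x / (z - x))" if "z \<notin> A" for z
  proof -
    obtain d where d: "d > 0" "ball z d \<subseteq> - A" using A \<open>z \<notin> A\<close> by (metis ComplI closed_def openE)
    have "integrable \<tau> (\<lambda>x. cmod (\<psi> x) / d)" using \<psi>(1) by (intro integrable_divide_zero integrable_norm) auto
    then show ?thesis
    proof (rule Bochner_Integration.integrable_bound)
      show "AE x in \<tau>. norm (\<psi> x / (z - x)) \<le> norm (cmod (\<psi> x) / d)"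
      proof (rule AE_I2)
        fix x
        show "norm (\<psi> x / (z - x)) \<le> norm (cmod (\<psi> x) / d)"
        proof (cases "x \<in> A")
          case True
          then have "d \<le> cmod (z - x)" using d(2) by (force simp: dist_norm not_less)
          then show ?thesis using d by (auto simp: norm_divide intro!: divide_left_mono mult_pos_pos)
        qed (simp add: \<psi>)
      qed
    qed measurable
  qed
  show "(\<lambda>z. \<integral>x. \<psi> x / (z - x) \<partial>\<tau>) holomorphic_on - A"
    unfolding holomorphic_on_open[OF open_Compl[OF A]]
  proof
    fix z assume "z \<in> - A"
    then obtain d' where d': "d' > 0" "ball z d' \<subseteq> - A" using A by (metis closed_def openE)
    define d where "d = d' / 2"
    have d: "d > 0" "ball z (2 * d) \<subseteq> - A" using d' by (auto simp: d_def)
    have far: "2 * d \<le> cmod (z - x)" if "x \<in> A" for x using d(2) that by (force simp: dist_norm not_less)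
    have far': "d \<le> cmod (z + h - x)" if "x \<in> A" "cmod h < d" for x h
      using far[OF that(1)] that(2) norm_diff_ineq[of "z - x" h] by (simp add: algebra_simps)
    have i2: "integrable \<tau> (\<lambda>x. \<psi> x / (z - x)\<^sup>2)"
    proof (rule Bochner_Integration.integrable_bound)
      show "integrable \<tau> (\<lambda>x. cmod (\<psi> x) / (2 * d)\<^sup>2)" using \<psi>(1) by (intro integrable_divide_zero integrable_norm) auto
      show "AE x in \<tau>. norm (\<psi> x / (z - x)\<^sup>2) \<le> norm (cmod (\<psi> x) / (2 * d)\<^sup>2)"
      proof (rule AE_I2)
        fix x
        show "norm (\<psi> x / (z - x)\<^sup>2) \<le> norm (cmod (\<psi> x) / (2 * d)\<^sup>2)"
        proof (cases "x \<in> A")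
          case True
          then have "(2 * d)\<^sup>2 \<le> (cmod (z - x))\<^sup>2" using far d by (intro power_mono) auto
          then show ?thesis using d far[OF True]
            by (auto simp: norm_divide norm_power intro!: divide_left_mono mult_pos_pos)
        qed (simp add: \<psi>)
      qed
    qed measurable
    define K where "K = (\<integral>x. cmod (\<psi> x) \<partial>\<tau>) / (4 * d ^ 3)"
    let ?f = "\<lambda>z. \<integral>x. \<psi> x / (z - x) \<partial>\<tau>" and ?D = "- (\<integral>x. \<psi> x / (z - x)\<^sup>2 \<partial>\<tau>)"
    have est: "norm ((?f (z + h) - ?f z) / h - ?D) \<le> K * cmod h" if h: "h \<noteq> 0" "cmod h < d" for h
    proof -
      have zh: "z + h \<notin> A" using d(2) h(2) d(1) by (auto simp: dist_norm subset_iff)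
      have zA: "z \<notin> A" using \<open>z \<in> - A\<close> by simp
      have "(?f (z + h) - ?f z) / h - ?D = (\<integral>x. (\<psi> x / (z + h - x) - \<psi> x / (z - x)) / h + \<psi> x / (z - x)\<^sup>2 \<partial>\<tau>)"
        using int[OF zh] int[OF zA] i2 by simp
      also have "norm \<dots> \<le> (\<integral>x. cmod h * (cmod (\<psi> x) / (4 * d ^ 3)) \<partial>\<tau>)"
      proof (rule norm_integral_le[OF _ _ AE_I2])
        show "integrable \<tau> (\<lambda>x. (\<psi> x / (z + h - x) - \<psi> x / (z - x)) / h + \<psi> x / (z - x)\<^sup>2)"
          using int[OF zh] int[OF zA] i2 by simp
        show "integrable \<tau> (\<lambda>x. cmod h * (cmod (\<psi> x) / (4 * d ^ 3)))" using \<psi>(1) by simp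
        fix x
        show "norm ((\<psi> x / (z + h - x) - \<psi> x / (z - x)) / h + \<psi> x / (z - x)\<^sup>2) \<le> cmod h * (cmod (\<psi> x) / (4 * d ^ 3))"
        proof (cases "x \<in> A")
          case True
          have nz: "z + h - x \<noteq> 0" "z - x \<noteq> 0" using far[OF True] far'[OF True h(2)] d(1) by auto
          have alg: "(\<psi> x / v - \<psi> x / u) / h + \<psi> x / u\<^sup>2 = h * \<psi> x / (v * u\<^sup>2)"
            if "v = u + h" "u \<noteq> 0" "v \<noteq> 0" for u v
            using that h(1) by (simp add: divide_simps power2_eq_square) (simp add: algebra_simps)
          have "(\<psi> x / (z + h - x) - \<psi> x / (z - x)) / h + \<psi> x / (z - x)\<^sup>2 = h * \<psi> x / ((z + h - x) * (z - x)\<^sup>2)"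
            by (rule alg) (use nz in auto)
          then have "norm ((\<psi> x / (z + h - x) - \<psi> x / (z - x)) / h + \<psi> x / (z - x)\<^sup>2) =
              cmod h * cmod (\<psi> x) / (cmod (z + h - x) * (cmod (z - x))\<^sup>2)"
            by (simp add: norm_divide norm_mult norm_power)
          also have "\<dots> \<le> cmod h * cmod (\<psi> x) / (d * (2 * d)\<^sup>2)"
          proof (rule divide_left_mono)
            show "d * (2 * d)\<^sup>2 \<le> cmod (z + h - x) * (cmod (z - x))\<^sup>2"
              using far[OF True] far'[OF True h(2)] d(1) by (intro mult_mono power_mono) auto
          qed (use d nz in auto)
          also have "d * (2 * d)\<^sup>2 = 4 * d ^ 3" by (simp add: power2_eq_square power3_eq_cube)
          finally show ?thesis by simp
        qed (simp add: \<psi>)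
      qed
      also have "\<dots> = K * cmod h" by (simp add: K_def)
      finally show ?thesis .
    qed
    have "((\<lambda>h. (?f (z + h) - ?f z) / h - ?D) \<longlongrightarrow> 0) (at 0)"
    proof (rule Lim_null_comparison)
      show "\<forall>\<^sub>F h in at 0. norm ((?f (z + h) - ?f z) / h - ?D) \<le> K * cmod h"
        using est d(1) by (auto simp: eventually_at dist_norm intro!: exI[of _ d])
      show "((\<lambda>h::complex. K * cmod h) \<longlongrightarrow> 0) (at 0)" by (auto intro!: tendsto_eq_intros)
    qed
    then have "((\<lambda>h. (?f (z + h) - ?f z) / h) \<longlongrightarrow> ?D) (at 0)" by (rule LIM_zero_cancel)
    then show "\<exists>f'. (?f has_field_derivative f') (at z)" by (auto simp: DERIV_def)
  qed
qed

text \<open>The factor \<open>z - x0\<close> cancels the decay of the transform, as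
  \<open>(z - x0) / (z - x)\<close> tends to 1 uniformly for \<open>x\<close> in the bounded set
  \<open>A\<close>. This limit is how a leading coefficient enters the two constants
  principle.\<close>

lemma Cauchy_transform_at_infinity:
  assumes \<psi>: "integrable \<tau> \<psi>" "\<And>x. x \<notin> A \<Longrightarrow> \<psi> x = (0::complex)" and A: "closed A" and s: "sets \<tau> = sets borel"
    and R: "\<And>x. x \<in> A \<Longrightarrow> cmod x \<le> R" "cmod x0 \<le> R" "R > 0"
  shows "((\<lambda>z. (z - x0) * (\<integral>x. \<psi> x / (z - x) \<partial>\<tau>)) \<longlongrightarrow> (\<integral>x. \<psi> x \<partial>\<tau>)) at_infinity"
proof (rule LIM_zero_cancel, rule Lim_null_comparison)
  define K where "K = 2 * R * (\<integral>x. cmod (\<psi> x) \<partial>\<tau>)"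
  show "\<forall>\<^sub>F z in at_infinity. norm ((z - x0) * (\<integral>x. \<psi> x / (z - x) \<partial>\<tau>) - (\<integral>x. \<psi> x \<partial>\<tau>)) \<le> 2 * K / cmod z"
    unfolding eventually_at_infinity
  proof (intro exI allI impI)
    fix z :: complex assume z: "3 * R \<le> cmod z"
    have zA: "z \<notin> A" using R(1)[of z] z R(3) by auto
    have zx: "cmod z / 2 \<le> cmod (z - x)" if "x \<in> A" for x using R(1)[OF that] z R(3) norm_triangle_ineq2[of z x] by simp
    have i1: "integrable \<tau> (\<lambda>x. \<psi> x / (z - x))" by (rule Cauchy_transform_integrable[OF \<psi> A s zA])
    have "(z - x0) * (\<integral>x. \<psi> x / (z - x) \<partial>\<tau>) - (\<integral>x. \<psi> x \<partial>\<tau>) = (\<integral>x. (z - x0) * (\<psi> x / (z - x)) - \<psi> x \<partial>\<tau>)"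
    proof -
      have "(\<integral>x. (z - x0) * (\<psi> x / (z - x)) - \<psi> x \<partial>\<tau>) = (\<integral>x. (z - x0) * (\<psi> x / (z - x)) \<partial>\<tau>) - (\<integral>x. \<psi> x \<partial>\<tau>)"
        by (rule Bochner_Integration.integral_diff[OF integrable_mult_right[OF i1] \<psi>(1)])
      then show ?thesis by (simp only: integral_mult_right_zero)
    qed
    also have "norm \<dots> \<le> (\<integral>x. cmod (\<psi> x) * (2 * R * (2 / cmod z)) \<partial>\<tau>)"
    proof (rule norm_integral_le[OF _ _ AE_I2])
      fix x
      show "norm ((z - x0) * (\<psi> x / (z - x)) - \<psi> x) \<le> cmod (\<psi> x) * (2 * R * (2 / cmod z))"
      proof (cases "x \<in> A")
        case True
        have nz: "cmod z > 0" "cmod (z - x) > 0" using zx[OF True] z R(3) by auto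
        then have "(z - x0) * (\<psi> x / (z - x)) - \<psi> x = \<psi> x * ((x - x0) / (z - x))" by (simp add: field_simps)
        then have "norm ((z - x0) * (\<psi> x / (z - x)) - \<psi> x) = cmod (\<psi> x) * (cmod (x - x0) / cmod (z - x))"
          by (simp add: norm_mult norm_divide)
        also have "cmod (x - x0) / cmod (z - x) \<le> 2 * R / (cmod z / 2)"
          using R(1)[OF True] R(2) norm_triangle_ineq4[of x x0] zx[OF True] nz R(3) by (intro frac_le) auto
        finally show ?thesis by (simp add: mult_left_mono)
      qed (simp add: \<psi>)
    next
      show "integrable \<tau> (\<lambda>x. (z - x0) * (\<psi> x / (z - x)) - \<psi> x)"
        by (rule Bochner_Integration.integrable_diff[OF integrable_mult_right[OF i1] \<psi>(1)])
    qed (use \<psi>(1) in auto)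
    also have "\<dots> = 2 * K / cmod z" by (simp add: K_def)
    finally show "norm ((z - x0) * (\<integral>x. \<psi> x / (z - x) \<partial>\<tau>) - (\<integral>x. \<psi> x \<partial>\<tau>)) \<le> 2 * K / cmod z" .
  qed
  show "((\<lambda>z::complex. 2 * K / cmod z) \<longlongrightarrow> 0) at_infinity"
    by (intro tendsto_divide_0[OF tendsto_const] filterlim_at_top_imp_at_infinity filterlim_norm_at_top)
qed

section \<open>Integral estimates for orthonormal polynomials\<close>

locale regular_measure = green_function +
  fixes \<tau> :: "complex measure" and P :: "nat \<Rightarrow> complex poly"
  assumes \<tau>_fin: "finite_measure \<tau>" and \<tau>_sets: "sets \<tau> = sets borel" and \<tau>_E: "AE x in \<tau>. x \<in> E"
    and orthonormal: "orthonormal_polys \<tau> P"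
begin

lemma integrable_continuous:
  fixes f :: "complex \<Rightarrow> 'b::{banach, second_countable_topology}"
  assumes "continuous_on UNIV f"
  shows "integrable \<tau> f"
proof -
  interpret finite_measure \<tau> by (rule \<tau>_fin)
  have cE: "compact (f ` E)"
    by (rule compact_continuous_image[OF continuous_on_subset[OF assms] E_compact]) simp
  obtain B where B: "\<forall>y\<in>f ` E. norm y \<le> B" using compact_imp_bounded[OF cE] unfolding bounded_iff by blast
  show ?thesis
  proof (rule integrable_const_bound)
    show "AE x in \<tau>. norm (f x) \<le> B" using \<tau>_E by eventually_elim (use B in blast)
    show "f \<in> borel_measurable \<tau>"
      using borel_measurable_continuous_onI[OF assms] by (simp add: measurable_cong_sets[OF \<tau>_sets refl])
  qed
qed

text \<open>The summand 1 is the squared norm of an orthonormal polynomial: by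
  \<open>t \<le> 1 + t\<^sup>2\<close> the value bounds the integral of its modulus.\<close>

definition total :: real where "total = measure \<tau> (space \<tau>) + 1"

definition \<gamma> :: "nat \<Rightarrow> real" where "\<gamma> n = Re (lead_coeff (P n))"

lemma total_ge_1: "total \<ge> 1" by (simp add: total_def)

lemma \<gamma>_pos: "\<gamma> n > 0" and lead_P: "lead_coeff (P n) = of_real (\<gamma> n)" and degree_P: "degree (P n) = n"
proof -
  have *: "degree (P n) = n \<and> lead_coeff (P n) \<in> \<real> \<and> Re (lead_coeff (P n)) > 0"
    using orthonormal unfolding orthonormal_polys_def by blast
  show "\<gamma> n > 0" "degree (P n) = n" using * unfolding \<gamma>_def by blast+
  show "lead_coeff (P n) = of_real (\<gamma> n)" using * unfolding \<gamma>_def by (metis of_real_Re)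
qed

lemma inner_P: "(\<integral>x. poly (P m) x * cnj (poly (P n) x) \<partial>\<tau>) = (if m = n then 1 else 0)"
  by (rule conjunct2[OF orthonormal[unfolded orthonormal_polys_def], rule_format])

text \<open>Subtracting a multiple of \<open>P d\<close> lowers the degree of \<open>Q\<close>; what
  remains is orthogonal to \<open>P N\<close>, so at most a top coefficient survives.\<close>

lemma integral_times_P:
  fixes Q :: "complex poly"
  assumes "degree Q \<le> N"
  shows "(\<integral>x. poly Q x * cnj (poly (P N) x) \<partial>\<tau>) = coeff Q N / of_real (\<gamma> N)"
  using assms
proof (induction "degree Q" arbitrary: Q rule: less_induct)
  case less
  define d where "d = degree Q"
  define a where "a = lead_coeff Q / of_real (\<gamma> d)"
  define Q' where "Q' = Q - smult a (P d)"
  have cP: "coeff (P d) d = of_real (\<gamma> d)" using lead_P[of d] degree_P[of d] by simp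
  have "coeff Q' d = 0" using \<gamma>_pos[of d] by (simp add: Q'_def a_def d_def[symmetric] cP)
  moreover have "degree Q' \<le> d" unfolding Q'_def d_def by (rule degree_diff_le) (use degree_P in auto)
  ultimately have dQ': "degree Q' < d \<or> Q' = 0" using leading_coeff_0_iff[of Q'] by (cases "degree Q' = d") auto
  have IH: "(\<integral>x. poly Q' x * cnj (poly (P N) x) \<partial>\<tau>) = 0"
    using dQ'
  proof
    assume "degree Q' < d"
    then have "(\<integral>x. poly Q' x * cnj (poly (P N) x) \<partial>\<tau>) = coeff Q' N / of_real (\<gamma> N)"
      using less by (intro less.hyps) (auto simp: d_def)
    also have "coeff Q' N = 0" using \<open>degree Q' < d\<close> less.prems by (intro coeff_eq_0) (simp add: d_def)
    finally show ?thesis by simp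
  qed simp
  have "poly Q x * cnj (poly (P N) x) = poly Q' x * cnj (poly (P N) x) + a * (poly (P d) x * cnj (poly (P N) x))" for x
    by (simp add: Q'_def algebra_simps)
  then have "(\<integral>x. poly Q x * cnj (poly (P N) x) \<partial>\<tau>) =
      (\<integral>x. poly Q' x * cnj (poly (P N) x) + a * (poly (P d) x * cnj (poly (P N) x)) \<partial>\<tau>)" by simp
  also have "\<dots> = (\<integral>x. poly Q' x * cnj (poly (P N) x) \<partial>\<tau>) + (\<integral>x. a * (poly (P d) x * cnj (poly (P N) x)) \<partial>\<tau>)"
    by (intro Bochner_Integration.integral_add integrable_continuous continuous_intros)
  also have "\<dots> = a * (if d = N then 1 else 0)" by (simp add: IH inner_P)
  also have "\<dots> = coeff Q N / of_real (\<gamma> N)"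
    using less.prems by (auto simp: a_def d_def coeff_eq_0)
  finally show ?case .
qed

lemma P_square_integral: "(\<integral>x. (cmod (poly (P N) x))\<^sup>2 \<partial>\<tau>) = 1"
proof -
  have "of_real (\<integral>x. (cmod (poly (P N) x))\<^sup>2 \<partial>\<tau>) = (\<integral>x. poly (P N) x * cnj (poly (P N) x) \<partial>\<tau>)"
    by (simp only: integral_complex_of_real[symmetric] complex_norm_square)
  then show ?thesis using inner_P[of N N] by simp
qed

lemma P_integral_le: "(\<integral>x. cmod (poly (P N) x) \<partial>\<tau>) \<le> total"
proof -
  have "(\<integral>x. cmod (poly (P N) x) \<partial>\<tau>) \<le> (\<integral>x. 1 + (cmod (poly (P N) x))\<^sup>2 \<partial>\<tau>)"
  proof (intro integral_mono integrable_continuous continuous_intros)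
    fix x
    have "0 \<le> (cmod (poly (P N) x) - 1)\<^sup>2" "0 \<le> (cmod (poly (P N) x))\<^sup>2" by auto
    then show "cmod (poly (P N) x) \<le> 1 + (cmod (poly (P N) x))\<^sup>2" unfolding power2_diff one_power2 mult_1_right by linarith
  qed
  also have "\<dots> = (\<integral>x. 1 \<partial>\<tau>) + (\<integral>x. (cmod (poly (P N) x))\<^sup>2 \<partial>\<tau>)"
    by (intro Bochner_Integration.integral_add integrable_continuous continuous_intros)
  finally show ?thesis by (simp add: P_square_integral total_def)
qed

text \<open>Cauchy-Schwarz, obtained by integrating
  \<open>s * t \<le> A / 2 * s\<^sup>2 + t\<^sup>2 / (2 * A)\<close>.\<close>

lemma P_times_integral_le:
  assumes h: "continuous_on UNIV h" and A: "A > 0" "(\<integral>x. (cmod (h x))\<^sup>2 \<partial>\<tau>) \<le> A\<^sup>2"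
  shows "(\<integral>x. cmod (poly (P N) x) * cmod (h x) \<partial>\<tau>) \<le> A"
proof -
  have "(\<integral>x. cmod (poly (P N) x) * cmod (h x) \<partial>\<tau>) \<le> (\<integral>x. A / 2 * (cmod (poly (P N) x))\<^sup>2 + 1 / (2 * A) * (cmod (h x))\<^sup>2 \<partial>\<tau>)"
  proof (intro integral_mono integrable_continuous continuous_intros h)
    fix x
    have "0 \<le> (A * cmod (poly (P N) x) - cmod (h x))\<^sup>2 / (2 * A)" using A by simp
    also have "\<dots> = A / 2 * (cmod (poly (P N) x))\<^sup>2 + 1 / (2 * A) * (cmod (h x))\<^sup>2 - cmod (poly (P N) x) * cmod (h x)"
      using A by (simp add: power2_eq_square field_simps)
    finally show "cmod (poly (P N) x) * cmod (h x) \<le> A / 2 * (cmod (poly (P N) x))\<^sup>2 + 1 / (2 * A) * (cmod (h x))\<^sup>2" by simp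
  qed
  also have "\<dots> = (\<integral>x. A / 2 * (cmod (poly (P N) x))\<^sup>2 \<partial>\<tau>) + (\<integral>x. 1 / (2 * A) * (cmod (h x))\<^sup>2 \<partial>\<tau>)"
    by (intro Bochner_Integration.integral_add integrable_continuous continuous_intros h)
  also have "\<dots> = A / 2 + 1 / (2 * A) * (\<integral>x. (cmod (h x))\<^sup>2 \<partial>\<tau>)" by (simp add: P_square_integral)
  also have "\<dots> \<le> A / 2 + 1 / (2 * A) * A\<^sup>2" using A by (intro add_left_mono mult_left_mono) auto
  also have "\<dots> = A" using A by (simp add: power2_eq_square)
  finally show ?thesis .
qed

end

lemma frontier_norm_gt: "frontier {z::complex. cmod z > R} \<subseteq> {z. cmod z = R}"
proof -
  have "open {z::complex. cmod z > R}" by (intro open_Collect_less continuous_intros)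
  moreover have "closure {z::complex. cmod z > R} \<subseteq> {z. cmod z \<ge> R}"
    by (intro closure_minimal closed_Collect_le continuous_intros) auto
  ultimately show ?thesis by (auto simp: frontier_def interior_open)
qed

text \<open>The maximum principle outside a circle, with infinity as an interior point.\<close>

lemma limit_at_infinity_le_circle:
  fixes B :: "complex \<Rightarrow> complex"
  assumes B: "B holomorphic_on G" "{z. cmod z \<ge> R} \<subseteq> G" "R > 0" and lim: "(B \<longlongrightarrow> l) at_infinity"
    and le: "\<And>z. cmod z = R \<Longrightarrow> cmod (B z) \<le> \<beta>"
  shows "cmod l \<le> \<beta>"
proof -
  let ?G = "{z. cmod z > R}"
  have op: "open ?G" by (intro open_Collect_less continuous_intros)
  have cl: "closure ?G \<subseteq> {z. cmod z \<ge> R}" by (intro closure_minimal closed_Collect_le continuous_intros) auto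
  have b0: "\<beta> \<ge> 0" using le[of "of_real R"] B(3) norm_ge_zero[of "B (of_real R)"] by (simp del: norm_ge_zero)
  have ev: "\<forall>\<^sub>F z in at_infinity. dist (B z) l < 1" using tendstoD[OF lim] by simp
  have "cmod (B z) \<le> \<beta>" if "z \<in> ?G" for z
  proof (rule exterior_maximum_modulus[of ?G B R 0 "cmod l + 1"])
    show "B holomorphic_on ?G" by (rule holomorphic_on_subset[OF B(1)]) (use B(2) in auto)
    show "continuous_on (closure ?G) B"
      using holomorphic_on_imp_continuous_on[OF B(1)] by (rule continuous_on_subset) (use cl B(2) in blast)
    show "\<forall>\<^sub>F z in at_infinity. z \<in> ?G \<longrightarrow> cmod (B z) \<le> cmod l + 1"
      using ev
    proof eventually_elim
      case (elim z)
      then show ?case using norm_triangle_sub[of "B z" l] by (simp add: dist_norm)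
    qed
    show "cmod (B z) \<le> \<beta>" if "z \<in> frontier ?G" for z using that frontier_norm_gt by (intro le) blast
  qed (use op B(3) b0 that in auto)
  moreover have "\<forall>\<^sub>F z in at_infinity. z \<in> ?G" unfolding eventually_at_infinity by (intro exI[of _ "R + 1"]) auto
  ultimately have "\<forall>\<^sub>F z in at_infinity. cmod (B z) \<le> \<beta>" by (auto elim: eventually_mono)
  then show ?thesis by (rule tendsto_upperbound[OF tendsto_norm[OF lim]]) (rule trivial_limit_at_infinity)
qed

section \<open>The estimate for one degree\<close>

context regular_measure
begin

text \<open>With \<open>Q = P\<^bsub>n+j\<^esub>\<close>, \<open>T\<close> a monic polynomial of degree \<open>j\<close> that is tiny on the part of \<open>E\<close>
  where \<open>g \<ge> \<delta>'\<close>, and \<open>C\<^sub>h\<close> the Cauchy transform of \<open>cnj Q T h \<tau>\<close> restricted to \<open>g < \<delta>'\<close>,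
  orthogonality makes \<open>h C\<^sub>1 - C\<^sub>h\<close> negligible for every polynomial \<open>h\<close> of degree at most \<open>n\<close>.
  Hence \<open>p C\<^sub>F / F\<close> is nearly \<open>C\<^sub>p\<close>, which is controlled by an \<open>L\<^sup>2\<close> norm alone.  Since \<open>C\<^sub>F\<close> behaves
  like \<open>1 / (\<gamma> z)\<close> at infinity, the two constants principle turns this into a bound for \<open>p / F\<close>.\<close>

context
  fixes \<delta> \<delta>' \<eta> R0 R1 X d0 \<theta> A b M :: real and n j :: nat and p :: "complex poly" and x t :: "nat \<Rightarrow> complex"
  assumes \<delta>: "0 < \<delta>'" "\<delta>' < \<delta>"
    and R0: "R0 \<ge> 1" "E \<subseteq> cball 0 R0" "{z. g z \<le> 2 * \<delta>} \<subseteq> cball 0 R0"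
    and R1: "R1 > 0" "\<And>z. cmod z \<ge> R1 \<Longrightarrow> g z > \<delta>"
    and M: "\<And>A B m s y z. A holomorphic_on {z. g z > \<delta>} \<Longrightarrow> B holomorphic_on {z. g z > \<delta>} \<Longrightarrow>
      (\<And>z. g z > \<delta> \<Longrightarrow> cmod (B z) \<le> 1) \<Longrightarrow> (\<And>z. g z > \<delta> \<Longrightarrow> cmod (A z * B z) \<le> exp m) \<Longrightarrow>
      cmod y = R1 \<Longrightarrow> exp (-s) \<le> cmod (B y) \<Longrightarrow> g z = 2 * \<delta> \<Longrightarrow> cmod (A z) \<le> exp (m + M * s)"
    and d0: "d0 > 0" "\<And>w z. w \<in> E \<Longrightarrow> g w \<le> \<delta>' \<Longrightarrow> g z \<ge> \<delta> \<Longrightarrow> d0 \<le> cmod (z - w)"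
    and n: "n > 0" and p: "degree p \<le> n" and X: "X \<ge> 1" "\<And>w. cmod w \<le> 2 * R0 \<Longrightarrow> cmod (poly p w) \<le> X ^ n"
    and x: "\<And>i. i < n \<Longrightarrow> x i \<in> S"
    and F1: "\<And>w. g w = \<delta>' \<Longrightarrow> cmod (root_prod x n w) \<le> exp (real n * (ln c + \<delta>' + \<eta>))"
    and F2: "\<And>w. g w = \<delta> \<Longrightarrow> exp (real n * ln c) \<le> cmod (root_prod x n w)"
    and F3: "\<And>w. g w = 2 * \<delta> \<Longrightarrow> cmod (root_prod x n w) \<le> exp (real n * (ln c + 2 * \<delta> + \<eta>))"
    and F4: "\<And>w. cmod w \<le> 2 * R0 \<Longrightarrow> cmod (root_prod x n w) \<le> X ^ n"
    and t: "\<And>i. i < j \<Longrightarrow> t i \<in> E" "\<And>w. w \<in> E \<Longrightarrow> g w \<ge> \<delta>' \<Longrightarrow> cmod (root_prod t j w) \<le> \<theta>"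
    and \<theta>: "\<theta> \<ge> 0" "\<theta> * X ^ n \<le> 1" "\<theta> * X ^ n * (X ^ n / exp (real n * ln c)) \<le> 1"
      "total * \<theta> * X ^ n \<le> 1 / (2 * \<gamma> (n + j))"
    and A: "A \<ge> 1" "(\<integral>w. (cmod (root_prod t j w * poly p w))\<^sup>2 \<partial>\<tau>) \<le> A\<^sup>2"
    and b: "b = 2 * R0 * total / d0 * (2 * R0) ^ j * exp (real n * (ln c + \<delta>' + \<eta>))"
begin

abbreviation "Q \<equiv> poly (P (n + j))"
abbreviation "T \<equiv> root_prod t j"
abbreviation "F \<equiv> root_prod x n"

text \<open>Integrals run over \<open>g < \<delta>'\<close>, because
  \<open>g \<ge> \<delta>'\<close> is where \<open>T\<close> is known to be small. The closed
  version is the set off which the Cauchy transforms are holomorphic.\<close>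

definition near :: "complex set" where "near = {w \<in> E. g w < \<delta>'}"
definition near_closed :: "complex set" where "near_closed = {w \<in> E. g w \<le> \<delta>'}"
definition kern :: "(complex \<Rightarrow> complex) \<Rightarrow> complex \<Rightarrow> complex" where
  "kern h w = indicat_real near w *\<^sub>R (cnj (Q w) * T w * h w)"
definition cauchy :: "(complex \<Rightarrow> complex) \<Rightarrow> complex \<Rightarrow> complex" where
  "cauchy h z = (\<integral>w. kern h w / (z - w) \<partial>\<tau>)"
text \<open>The commutator term: the error made in moving \<open>poly q z\<close> under the Cauchy
  transform.\<close>

definition rest :: "complex poly \<Rightarrow> complex \<Rightarrow> complex" where
  "rest q z = (\<integral>w. kern (poly (synthetic_div q z)) w \<partial>\<tau>)"

lemma E_bound: "w \<in> E \<Longrightarrow> cmod w \<le> R0" and level_bound: "g w \<le> 2 * \<delta> \<Longrightarrow> cmod w \<le> R0"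
  using R0(2,3) by fastforce+

lemma b_pos: "b > 0"
  unfolding b using R0 d0 total_ge_1 by (intro mult_pos_pos divide_pos_pos zero_less_power) auto

lemma near_sets: "near \<in> sets borel"
proof -
  have "near = E \<inter> {w. g w < \<delta>'}" by (auto simp: near_def)
  moreover have "open {w. g w < \<delta>'}" by (intro open_Collect_less g_cont continuous_intros)
  ultimately show ?thesis using E_compact by (simp add: compact_imp_closed sets.Int)
qed

lemma closed_near_closed: "closed near_closed"
proof -
  have "near_closed = E \<inter> {w. g w \<le> \<delta>'}" by (auto simp: near_closed_def)
  moreover have "closed {w. g w \<le> \<delta>'}" by (intro closed_Collect_le g_cont continuous_intros)
  ultimately show ?thesis using E_compact by (simp add: compact_imp_closed closed_Int)
qed

lemma near_sub: "near \<subseteq> near_closed" by (auto simp: near_def near_closed_def)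

lemma kern_integrable:
  assumes "continuous_on UNIV h"
  shows "integrable \<tau> (kern h)"
  unfolding kern_def[abs_def]
  by (intro integrable_mult_indicator integrable_continuous continuous_intros assms) (simp add: \<tau>_sets near_sets)

lemma kern_zero: "w \<notin> near_closed \<Longrightarrow> kern h w = 0"
  using near_sub by (auto simp: kern_def indicator_def)

lemma far_near: "g z \<ge> \<delta> \<Longrightarrow> z \<notin> near_closed"
  using \<delta> by (auto simp: near_closed_def)

lemma cauchy_integrable: "continuous_on UNIV h \<Longrightarrow> g z \<ge> \<delta> \<Longrightarrow> integrable \<tau> (\<lambda>w. kern h w / (z - w))"
  by (rule Cauchy_transform_integrable[OF kern_integrable kern_zero closed_near_closed \<tau>_sets far_near])

lemma poly_cauchy:
  assumes z: "g z \<ge> \<delta>"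
  shows "poly q z * cauchy (\<lambda>_. 1) z = cauchy (poly q) z + rest q z"
proof -
  have pt: "poly q z * (kern (\<lambda>_. 1) w / (z - w)) = kern (poly q) w / (z - w) + kern (poly (synthetic_div q z)) w" for w
  proof (cases "w \<in> near")
    case True
    then have "z \<noteq> w" using far_near[OF z] near_sub by blast
    moreover have "poly q w = (w - z) * poly (synthetic_div q z) w + poly q z"
      by (subst synthetic_div_correct'[of z q, symmetric]) (simp add: algebra_simps)
    then have "poly q z = poly q w + (z - w) * poly (synthetic_div q z) w" by (simp add: algebra_simps)
    ultimately show ?thesis using True by (simp add: kern_def divide_simps) (simp add: algebra_simps)
  qed (simp add: kern_def)
  have "poly q z * cauchy (\<lambda>_. 1) z = (\<integral>w. poly q z * (kern (\<lambda>_. 1) w / (z - w)) \<partial>\<tau>)"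
    unfolding cauchy_def by (rule integral_mult_right_zero[symmetric])
  also have "\<dots> = (\<integral>w. kern (poly q) w / (z - w) + kern (poly (synthetic_div q z)) w \<partial>\<tau>)" unfolding pt ..
  also have "\<dots> = cauchy (poly q) z + rest q z"
    unfolding cauchy_def rest_def
    by (intro Bochner_Integration.integral_add cauchy_integrable kern_integrable continuous_intros z)
  finally show ?thesis .
qed

text \<open>Restriction to \<open>near\<close> drops only points where \<open>T\<close> is at most
  \<open>\<theta>\<close>, and the integral of \<open>cmod (Q w)\<close> is at most
  \<open>total\<close>.\<close>

lemma kern_complement_bound:
  assumes h: "continuous_on UNIV h" and Y: "\<And>w. w \<in> E \<Longrightarrow> cmod (h w) \<le> Y" "Y \<ge> 0"
  shows "cmod ((\<integral>w. cnj (Q w) * T w * h w \<partial>\<tau>) - (\<integral>w. kern h w \<partial>\<tau>)) \<le> total * \<theta> * Y"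
proof -
  have i: "integrable \<tau> (\<lambda>w. cnj (Q w) * T w * h w)" by (intro integrable_continuous continuous_intros h)
  have "(\<integral>w. cnj (Q w) * T w * h w \<partial>\<tau>) - (\<integral>w. kern h w \<partial>\<tau>) = (\<integral>w. cnj (Q w) * T w * h w - kern h w \<partial>\<tau>)"
    by (rule Bochner_Integration.integral_diff[OF i kern_integrable[OF h], symmetric])
  also have "cmod \<dots> \<le> (\<integral>w. cmod (Q w) * (\<theta> * Y) \<partial>\<tau>)"
  proof (rule norm_integral_le)
    show "integrable \<tau> (\<lambda>w. cnj (Q w) * T w * h w - kern h w)"
      by (rule Bochner_Integration.integrable_diff[OF i kern_integrable[OF h]])
    show "integrable \<tau> (\<lambda>w. cmod (Q w) * (\<theta> * Y))" by (intro integrable_continuous continuous_intros)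
    show "AE w in \<tau>. cmod (cnj (Q w) * T w * h w - kern h w) \<le> cmod (Q w) * (\<theta> * Y)"
      using \<tau>_E
    proof eventually_elim
      case (elim w)
      show ?case
      proof (cases "w \<in> near")
        case True
        then show ?thesis using \<theta> Y by (simp add: kern_def)
      next
        case False
        then have "g w \<ge> \<delta>'" using elim by (simp add: near_def)
        then have "cmod (T w) \<le> \<theta>" "cmod (h w) \<le> Y" using t(2) Y(1) elim by auto
        then have "cmod (T w) * cmod (h w) \<le> \<theta> * Y" using \<theta> by (intro mult_mono) auto
        then show ?thesis using False by (simp add: kern_def norm_mult mult.assoc mult_left_mono)
      qed
    qed
  qed
  also have "\<dots> = (\<theta> * Y) * (\<integral>w. cmod (Q w) \<partial>\<tau>)" by (simp add: mult.commute)
  also have "\<dots> \<le> (\<theta> * Y) * total" using P_integral_le[of "n + j"] \<theta> Y by (intro mult_left_mono) auto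
  finally show ?thesis by (simp add: mult_ac)
qed

text \<open>Over all of \<open>E\<close> the integral vanishes, since \<open>T\<close> times the
  synthetic quotient has degree below \<open>n + j\<close> and is orthogonal to \<open>Q\<close>.
  Hence \<open>rest\<close> is minus the discarded far part.\<close>

lemma rest_bound:
  assumes q: "degree q \<le> n" "\<And>w. cmod w \<le> 2 * R0 \<Longrightarrow> cmod (poly q w) \<le> X ^ n" and z: "cmod z \<le> R0"
  shows "cmod (rest q z) \<le> 2 * (total * \<theta> * X ^ n)"
proof -
  let ?s = "synthetic_div q z"
  have deg: "degree (root_poly t j * ?s) < n + j"
    using n q(1) degree_mult_le[of "root_poly t j" ?s] root_poly_monic[of t j] degree_synthetic_div[of q z] by linarith
  have "(\<integral>w. cnj (Q w) * T w * poly ?s w \<partial>\<tau>) = (\<integral>w. poly (root_poly t j * ?s) w * cnj (Q w) \<partial>\<tau>)"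
    by (simp add: poly_root_poly mult_ac)
  also have "\<dots> = 0" using deg by (subst integral_times_P) (auto simp: coeff_eq_0)
  finally have 0: "(\<integral>w. cnj (Q w) * T w * poly ?s w \<partial>\<tau>) = 0" .
  have "cmod ((\<integral>w. cnj (Q w) * T w * poly ?s w \<partial>\<tau>) - rest q z) \<le> total * \<theta> * (2 * X ^ n)"
    unfolding rest_def
  proof (rule kern_complement_bound)
    show "cmod (poly ?s w) \<le> 2 * X ^ n" if "w \<in> E" for w
      using that R0 q z by (intro synthetic_div_bound[of R0]) auto
  qed (use X in \<open>auto intro!: continuous_intros\<close>)
  then show ?thesis unfolding 0 by (simp add: mult_ac)
qed

lemma root_prod_T_bound: "w \<in> E \<Longrightarrow> cmod (T w) \<le> (2 * R0) ^ j"
  unfolding mult_2 by (intro root_prod_upper E_bound t)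

text \<open>Points of \<open>near\<close> have distance at least \<open>d0\<close> from
  \<open>z\<close> and \<open>Q\<close> is normalised, so only the square norm of
  \<open>T * p\<close> enters.\<close>

lemma cauchy_p_bound: "g z \<ge> \<delta> \<Longrightarrow> cmod (cauchy (poly p) z) \<le> A / d0"
proof -
  assume z: "g z \<ge> \<delta>"
  have "cmod (cauchy (poly p) z) \<le> (\<integral>w. cmod (Q w) * cmod (T w * poly p w) / d0 \<partial>\<tau>)"
    unfolding cauchy_def
  proof (rule norm_integral_le[OF cauchy_integrable[OF _ z] _ AE_I2])
    show "integrable \<tau> (\<lambda>w. cmod (Q w) * cmod (T w * poly p w) / d0)"
      using d0 by (intro integrable_continuous continuous_intros) auto
    fix w
    show "cmod (kern (poly p) w / (z - w)) \<le> cmod (Q w) * cmod (T w * poly p w) / d0"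
    proof (cases "w \<in> near")
      case True
      then have "d0 \<le> cmod (z - w)" using z by (intro d0) (auto simp: near_def)
      then have "cmod (Q w) * cmod (T w * poly p w) / cmod (z - w) \<le> cmod (Q w) * cmod (T w * poly p w) / d0"
        using d0(1) by (intro divide_left_mono mult_pos_pos mult_nonneg_nonneg) auto
      then show ?thesis using True by (simp add: kern_def norm_mult norm_divide mult_ac)
    qed (use d0 in \<open>simp add: kern_def\<close>)
  qed (intro continuous_intros)
  also have "\<dots> = (\<integral>w. cmod (Q w) * cmod (T w * poly p w) \<partial>\<tau>) / d0" by simp
  also have "\<dots> \<le> A / d0"
    using A d0(1) by (intro divide_right_mono P_times_integral_le continuous_intros) auto
  finally show ?thesis .
qed

lemma F_bound_near: "g w \<le> \<delta>' \<Longrightarrow> cmod (F w) \<le> exp (real n * (ln c + \<delta>' + \<eta>))"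
  by (rule sublevel_maximum_modulus[of F \<delta>']) (use F1 in \<open>auto intro!: holomorphic_intros\<close>)

lemma cauchy_F_bound: "g z \<ge> \<delta> \<Longrightarrow> 2 * R0 * cmod (cauchy F z) \<le> b"
proof -
  assume z: "g z \<ge> \<delta>"
  let ?Y = "(2 * R0) ^ j * exp (real n * (ln c + \<delta>' + \<eta>))"
  have Y0: "?Y \<ge> 0" using R0 by simp
  have "cmod (cauchy F z) \<le> (\<integral>w. cmod (Q w) * (?Y / d0) \<partial>\<tau>)"
    unfolding cauchy_def
  proof (rule norm_integral_le[OF cauchy_integrable[OF _ z] _ AE_I2])
    show "integrable \<tau> (\<lambda>w. cmod (Q w) * (?Y / d0))"
      using d0 by (intro integrable_continuous continuous_intros) auto
    fix w
    show "cmod (kern F w / (z - w)) \<le> cmod (Q w) * (?Y / d0)"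
    proof (cases "w \<in> near")
      case True
      then have w: "w \<in> E" "g w \<le> \<delta>'" by (auto simp: near_def)
      then have "d0 \<le> cmod (z - w)" using z by (intro d0)
      moreover have "cmod (T w) * cmod (F w) \<le> ?Y"
        using root_prod_T_bound[OF w(1)] F_bound_near[OF w(2)] R0 by (intro mult_mono) auto
      ultimately have "cmod (T w) * cmod (F w) / cmod (z - w) \<le> ?Y / d0"
        using d0(1) Y0 by (intro frac_le) auto
      then have "cmod (Q w) * (cmod (T w) * cmod (F w) / cmod (z - w)) \<le> cmod (Q w) * (?Y / d0)"
        by (intro mult_left_mono) auto
      then show ?thesis using True by (simp add: kern_def norm_mult norm_divide mult_ac)
    qed (use d0 Y0 in \<open>simp add: kern_def\<close>)
  qed (intro continuous_intros)
  also have "\<dots> = (\<integral>w. cmod (Q w) \<partial>\<tau>) * (?Y / d0)" by simp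
  also have "\<dots> \<le> total * (?Y / d0)"
    using P_integral_le[of "n + j"] d0(1) Y0 by (intro mult_right_mono) auto
  finally have "2 * R0 * cmod (cauchy F z) \<le> 2 * R0 * (total * (?Y / d0))" using R0 by (intro mult_left_mono) auto
  then show ?thesis by (simp add: b mult_ac)
qed

lemma F_nonzero: "g z > 0 \<Longrightarrow> F z \<noteq> 0"
  using x g_S by (fastforce simp: root_prod_eq_0_iff)

text \<open>The transform of the constant 1, for which nothing is known, is eliminated between the
  identities for \<open>p\<close> and for \<open>F\<close>. What is left is the transform of
  \<open>p\<close> and two rests made harmless by the smallness of \<open>\<theta>\<close>.\<close>

lemma product_bound:
  assumes z: "g z = \<delta>"
  shows "2 * R0 * cmod (poly p z / F z * cauchy F z) \<le> 2 * R0 * ((1 / d0 + 4 * total) * A)"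
proof -
  have zR: "cmod z \<le> R0" using z \<delta> by (intro level_bound) simp
  have Fz: "F z \<noteq> 0" using F_nonzero z \<delta> by simp
  have z': "g z \<ge> \<delta>" using z by simp
  have e1: "poly p z * cauchy (\<lambda>_. 1) z = cauchy (poly p) z + rest p z" by (rule poly_cauchy[OF z'])
  have e2: "F z * cauchy (\<lambda>_. 1) z = cauchy F z + rest (root_poly x n) z"
  proof -
    have "poly (root_poly x n) = F" by (rule ext) (simp add: poly_root_poly)
    then show ?thesis using poly_cauchy[OF z', of "root_poly x n"] by simp
  qed
  have "poly p z / F z * cauchy F z = poly p z / F z * (F z * cauchy (\<lambda>_. 1) z - rest (root_poly x n) z)"
    using e2 by simp
  also have "\<dots> = cauchy (poly p) z + rest p z - poly p z / F z * rest (root_poly x n) z"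
    using Fz e1 by (simp add: right_diff_distrib)
  finally have eq: "poly p z / F z * cauchy F z = cauchy (poly p) z + rest p z - poly p z / F z * rest (root_poly x n) z" .
  have r1: "cmod (rest p z) \<le> 2 * (total * \<theta> * X ^ n)" by (rule rest_bound[OF p X(2) zR])
  have r2: "cmod (rest (root_poly x n) z) \<le> 2 * (total * \<theta> * X ^ n)"
    using root_poly_monic[of x n] F4 by (intro rest_bound zR) (auto simp: poly_root_poly)
  have "cmod (poly p z / F z) \<le> X ^ n / exp (real n * ln c)"
    unfolding norm_divide using F2[OF z] X(2)[of z] zR R0(1) X(1) by (intro frac_le) auto
  then have r3: "cmod (poly p z / F z * rest (root_poly x n) z) \<le> X ^ n / exp (real n * ln c) * (2 * (total * \<theta> * X ^ n))"
    unfolding norm_mult using r2 X(1) by (intro mult_mono) auto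
  have "total * (\<theta> * X ^ n) \<le> total * 1" "total * (\<theta> * X ^ n * (X ^ n / exp (real n * ln c))) \<le> total * 1"
    using \<theta> total_ge_1 by (intro mult_left_mono; simp)+
  moreover have "X ^ n / exp (real n * ln c) * (2 * (total * \<theta> * X ^ n)) = 2 * (total * (\<theta> * X ^ n * (X ^ n / exp (real n * ln c))))"
    by (simp only: mult_ac)
  moreover have "total * \<theta> * X ^ n = total * (\<theta> * X ^ n)" by (simp only: mult_ac)
  ultimately have s: "2 * (total * \<theta> * X ^ n) \<le> 2 * total" "X ^ n / exp (real n * ln c) * (2 * (total * \<theta> * X ^ n)) \<le> 2 * total"
    by linarith+
  have "cmod (poly p z / F z * cauchy F z) \<le> A / d0 + 2 * total + 2 * total"
    unfolding eq using norm_triangle_ineq4[of "cauchy (poly p) z + rest p z" "poly p z / F z * rest (root_poly x n) z"]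
      norm_triangle_ineq[of "cauchy (poly p) z" "rest p z"] cauchy_p_bound[OF z'] r1 r3 s by linarith
  also have "\<dots> \<le> A / d0 + 4 * total * A" using A(1) total_ge_1 by simp
  also have "\<dots> = (1 / d0 + 4 * total) * A" by (simp add: distrib_right)
  finally show ?thesis using R0 by (intro mult_left_mono) auto
qed

text \<open>\<open>T * F\<close> is monic of degree \<open>n + j\<close>, so its full integral
  against \<open>cnj Q\<close> is \<open>1 / \<gamma> (n + j)\<close>; at most half of it is lost on
  the far part.\<close>

lemma kern_F_integral: "1 / (2 * \<gamma> (n + j)) \<le> cmod (\<integral>w. kern F w \<partial>\<tau>)"
proof -
  have "(\<integral>w. cnj (Q w) * T w * F w \<partial>\<tau>) = (\<integral>w. poly (root_poly t j * root_poly x n) w * cnj (Q w) \<partial>\<tau>)"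
    by (simp add: poly_root_poly mult_ac)
  also have "\<dots> = coeff (root_poly t j * root_poly x n) (n + j) / of_real (\<gamma> (n + j))"
    using root_poly_monic[of t j] root_poly_monic[of x n] degree_mult_le[of "root_poly t j" "root_poly x n"]
    by (intro integral_times_P) simp
  also have "coeff (root_poly t j * root_poly x n) (n + j) = 1"
    using coeff_degree_mult[of "root_poly t j" "root_poly x n"] root_poly_monic[of t j] root_poly_monic[of x n]
    by (metis add.commute degree_mult_eq leading_coeff_0_iff mult_1 zero_neq_one)
  finally have "cmod (\<integral>w. cnj (Q w) * T w * F w \<partial>\<tau>) = 1 / \<gamma> (n + j)"
    using \<gamma>_pos[of "n + j"] by (simp add: norm_divide)
  moreover have "cmod ((\<integral>w. cnj (Q w) * T w * F w \<partial>\<tau>) - (\<integral>w. kern F w \<partial>\<tau>)) \<le> total * \<theta> * X ^ n"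
    using R0 F4 X(1) by (intro kern_complement_bound continuous_intros) auto
  moreover have "1 / \<gamma> (n + j) = 1 / (2 * \<gamma> (n + j)) + 1 / (2 * \<gamma> (n + j))" using \<gamma>_pos[of "n + j"] by (simp add: field_simps)
  ultimately show ?thesis
    using \<theta>(4) norm_triangle_ineq2[of "\<integral>w. cnj (Q w) * T w * F w \<partial>\<tau>" "\<integral>w. kern F w \<partial>\<tau>"] by linarith
qed

text \<open>The two constants principle for \<open>a = p / F\<close> and
  \<open>B = (w - x0) * cauchy F w / b\<close>. Division by \<open>b\<close> makes \<open>B\<close>
  at most 1 on the level \<open>g = \<delta>\<close>, hence in the exterior, and
  \<open>a * B\<close> is bounded there through \<open>product_bound\<close>. The required lower
  bound for \<open>B\<close> comes from its limit at infinity, the integral of \<open>kern F\<close>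
  over \<open>b\<close>.\<close>

lemma single_degree_estimate:
  assumes z: "g z \<le> 2 * \<delta>"
  shows "cmod (poly p z) \<le> exp (real n * (ln c + 2 * \<delta> + \<eta>)) *
    (2 * R0 * ((1 / d0 + 4 * total) * A) / b * exp (M * ln (4 * \<gamma> (n + j) * b)))"
proof -
  let ?G = "{z. g z > \<delta>}"
  obtain x0 where x0: "x0 \<in> S" using S_nonempty by blast
  have x0R: "cmod x0 \<le> R0" using x0 S_sub by (intro E_bound) blast
  have "open {z. g z < \<delta>}" by (intro open_Collect_less g_cont continuous_intros)
  then obtain r where r: "r > 0" "ball x0 r \<subseteq> {z. g z < \<delta>}" using g_S[OF x0] \<delta> unfolding open_contains_ball by fastforce
  have rG: "ball x0 r \<inter> ?G = {}" using r(2) by fastforce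
  have clG: "g w \<ge> \<delta>" if "w \<in> closure ?G" for w using that closure_superlevel[of \<delta>] by blast
  have frG: "g w = \<delta>" if "w \<in> frontier ?G" for w using that frontier_superlevel[of \<delta>] by blast
  have cF: "continuous_on UNIV F" by (intro continuous_intros)
  have holC: "cauchy F holomorphic_on - near_closed"
    unfolding cauchy_def[abs_def]
    by (rule Cauchy_transform_holomorphic[OF kern_integrable[OF cF] kern_zero closed_near_closed \<tau>_sets])
  define B where "B w = (w - x0) * cauchy F w / of_real b" for w
  define a where "a w = poly p w / F w" for w
  have holB: "B holomorphic_on closure ?G"
    unfolding B_def[abs_def] using b_pos clG far_near
    by (intro holomorphic_intros holomorphic_on_subset[OF holC]) auto
  have hola: "a holomorphic_on closure ?G"
    unfolding a_def[abs_def] using clG F_nonzero \<delta> by (intro holomorphic_intros) fastforce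
  have limC: "((\<lambda>w. (w - x0) * cauchy F w) \<longlongrightarrow> (\<integral>w. kern F w \<partial>\<tau>)) at_infinity"
    unfolding cauchy_def
    by (rule Cauchy_transform_at_infinity[OF kern_integrable[OF cF] kern_zero closed_near_closed \<tau>_sets, of R0])
      (use R0 x0R in \<open>auto simp: near_closed_def\<close>)
  define l where "l = (\<integral>w. kern F w \<partial>\<tau>) / of_real b"
  have lim: "(B \<longlongrightarrow> l) at_infinity"
    unfolding B_def[abs_def] l_def using b_pos by (intro tendsto_divide limC tendsto_const) auto
  have evB: "\<forall>\<^sub>F w in at_infinity. cmod (B w) \<le> cmod l + 1"
  proof -
    have "\<forall>\<^sub>F w in at_infinity. dist (B w) l < 1" using tendstoD[OF lim] by simp
    then show ?thesis
    proof eventually_elim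
      case (elim w)
      then show ?case using norm_triangle_sub[of "B w" l] by (simp add: dist_norm)
    qed
  qed
  obtain Y where Y: "Y \<ge> 0" "\<And>w. cmod w \<ge> 1 \<Longrightarrow> cmod (poly p w) \<le> Y * cmod w ^ n"
    by (rule poly_norm_bound_infinity[OF p]) blast
  have evF: "\<forall>\<^sub>F w in at_infinity. (cmod w / 2) ^ n \<le> cmod (F w)"
    using x S_sub E_bound R0(1) by (intro root_prod_eventually_ge[of _ _ R0]) auto
  have ev1: "\<forall>\<^sub>F w::complex in at_infinity. 1 \<le> cmod w" by (auto simp: eventually_at_infinity)
  have eva: "\<forall>\<^sub>F w in at_infinity. cmod (a w) \<le> Y * 2 ^ n"
    using evF ev1
  proof eventually_elim
    case (elim w)
    have w0: "0 < (cmod w / 2) ^ n" using elim(2) by (intro zero_less_power) linarith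
    have "cmod (poly p w) \<le> Y * cmod w ^ n" using Y(2) elim(2) by blast
    also have "\<dots> = Y * 2 ^ n * (cmod w / 2) ^ n" by (simp add: power_divide)
    also have "\<dots> \<le> Y * 2 ^ n * cmod (F w)" using elim(1) Y(1) by (intro mult_left_mono) auto
    finally have "cmod (poly p w) \<le> Y * 2 ^ n * cmod (F w)" .
    then show ?case using w0 elim(1) unfolding a_def norm_divide by (subst pos_divide_le_eq) linarith+
  qed
  have near_x0: "cmod (w - x0) \<le> 2 * R0" if "g w = \<delta>" for w
  proof -
    have "cmod w \<le> R0" using that \<delta> by (intro level_bound) simp
    then show ?thesis using x0R norm_triangle_ineq4[of w x0] by simp
  qed
  have B1: "cmod (B w) \<le> 1" if "g w > \<delta>" for w
  proof (rule exterior_maximum_modulus[of ?G B r x0 "cmod l + 1"])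
    show "B holomorphic_on ?G" by (rule holomorphic_on_subset[OF holB]) (rule closure_subset)
    show "\<forall>\<^sub>F w in at_infinity. w \<in> ?G \<longrightarrow> cmod (B w) \<le> cmod l + 1" using evB by (auto elim: eventually_mono)
    fix v assume "v \<in> frontier ?G"
    then have v: "g v = \<delta>" by (rule frG)
    have "cmod (v - x0) * cmod (cauchy F v) \<le> 2 * R0 * cmod (cauchy F v)" by (intro mult_right_mono near_x0 v) simp
    also have "\<dots> \<le> b" using v by (intro cauchy_F_bound) simp
    finally show "cmod (B v) \<le> 1" using b_pos by (simp add: B_def norm_mult norm_divide)
  qed (use r rG that open_superlevel holB in \<open>auto intro: holomorphic_on_imp_continuous_on\<close>)
  define m where "m = ln (2 * R0 * ((1 / d0 + 4 * total) * A) / b)"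
  have "0 < 2 * R0 * ((1 / d0 + 4 * total) * A) / b"
    using R0 d0(1) total_ge_1 A(1) b_pos by (intro divide_pos_pos mult_pos_pos add_pos_pos) auto
  then have em: "exp m = 2 * R0 * ((1 / d0 + 4 * total) * A) / b" unfolding m_def by simp
  have aB: "cmod (a w * B w) \<le> exp m" if "g w > \<delta>" for w
  proof (rule exterior_maximum_modulus[of ?G "\<lambda>w. a w * B w" r x0 "Y * 2 ^ n * (cmod l + 1)"])
    show "(\<lambda>w. a w * B w) holomorphic_on ?G"
      by (intro holomorphic_intros holomorphic_on_subset[OF holB] holomorphic_on_subset[OF hola] closure_subset)
    show "continuous_on (closure ?G) (\<lambda>w. a w * B w)"
      by (intro continuous_intros holomorphic_on_imp_continuous_on holB hola)
    show "\<forall>\<^sub>F w in at_infinity. w \<in> ?G \<longrightarrow> cmod (a w * B w) \<le> Y * 2 ^ n * (cmod l + 1)"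
      using evB eva
    proof eventually_elim
      case (elim w)
      then show ?case unfolding norm_mult using Y(1) by (intro impI mult_mono) auto
    qed
    fix v assume "v \<in> frontier ?G"
    then have v: "g v = \<delta>" by (rule frG)
    have "cmod (a v * B v) = cmod (v - x0) * cmod (a v * cauchy F v) / b"
      using b_pos by (simp add: B_def norm_mult norm_divide mult_ac)
    also have "\<dots> \<le> 2 * R0 * cmod (a v * cauchy F v) / b"
      using b_pos by (intro divide_right_mono mult_right_mono near_x0 v) auto
    also have "\<dots> \<le> 2 * R0 * ((1 / d0 + 4 * total) * A) / b"
      using b_pos product_bound[OF v] unfolding a_def by (intro divide_right_mono) auto
    finally show "cmod (a v * B v) \<le> exp m" unfolding em .
  qed (use r rG that open_superlevel in auto)
  \<comment> \<open>\<open>exp (- s)\<close> is half the lower bound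
    \<open>1 / (2 * \<gamma> (n + j) * b)\<close> for the limit of \<open>B\<close>, so it must be
    exceeded somewhere on the circle of radius \<open>R1\<close>.\<close>
  define s where "s = ln (4 * \<gamma> (n + j) * b)"
  have sb: "exp (-s) = 1 / (4 * \<gamma> (n + j) * b)"
    unfolding s_def using \<gamma>_pos[of "n + j"] b_pos by (simp add: exp_minus inverse_eq_divide)
  have "\<exists>y. cmod y = R1 \<and> exp (-s) \<le> cmod (B y)"
  proof (rule ccontr)
    assume "\<not> ?thesis"
    then have lt: "cmod (B y) \<le> exp (-s)" if "cmod y = R1" for y using that by force
    have "cmod l \<le> exp (-s)"
    proof (rule limit_at_infinity_le_circle[OF holB _ R1(1) lim lt])
      show "{z. R1 \<le> cmod z} \<subseteq> closure ?G" using R1(2) closure_subset[of ?G] by blast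
    qed
    moreover have "1 / (2 * \<gamma> (n + j)) / b \<le> cmod l"
      using divide_right_mono[OF kern_F_integral less_imp_le[OF b_pos]]
      unfolding l_def norm_divide norm_of_real abs_of_pos[OF b_pos] .
    ultimately have "1 / (2 * \<gamma> (n + j)) / b \<le> 1 / (4 * \<gamma> (n + j) * b)" unfolding sb by linarith
    then show False using \<gamma>_pos[of "n + j"] b_pos by (simp add: field_simps)
  qed
  then obtain y where y: "cmod y = R1" "exp (-s) \<le> cmod (B y)" by blast
  show ?thesis
  proof (rule sublevel_maximum_modulus[OF _ _ z])
    fix w assume w: "g w = 2 * \<delta>"
    have "cmod (a w) \<le> exp (m + M * s)"
    proof (rule M[of a B m y s w])
      show "a holomorphic_on ?G" "B holomorphic_on ?G"
        by (rule holomorphic_on_subset[OF hola closure_subset] holomorphic_on_subset[OF holB closure_subset])+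
    qed (use B1 aB y w in auto)
    moreover have "cmod (poly p w) = cmod (F w) * cmod (a w)"
      using F_nonzero[of w] w \<delta> by (simp add: a_def norm_divide)
    moreover have "cmod (F w) \<le> exp (real n * (ln c + 2 * \<delta> + \<eta>))" by (rule F3[OF w])
    ultimately have "cmod (poly p w) \<le> exp (real n * (ln c + 2 * \<delta> + \<eta>)) * exp (m + M * s)"
      by (simp add: mult_mono)
    then show "cmod (poly p w) \<le> exp (real n * (ln c + 2 * \<delta> + \<eta>)) *
      (2 * R0 * ((1 / d0 + 4 * total) * A) / b * exp (M * ln (4 * \<gamma> (n + j) * b)))"
      unfolding exp_add em s_def .
  qed (intro holomorphic_intros)
qed

end

end

section \<open>From one degree to subexponential bounds as the degree grows\<close>

lemma eventually_const_le_exp: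
  fixes \<delta> C :: real
  assumes "\<delta> > 0"
  shows "\<forall>\<^sub>F n::nat in sequentially. C \<le> exp (\<delta> * real n)"
proof -
  have "\<forall>\<^sub>F n::nat in sequentially. C / \<delta> \<le> real n"
    using filterlim_real_sequentially by (simp add: filterlim_at_top)
  then show ?thesis
  proof eventually_elim
    case (elim n)
    then have "C \<le> \<delta> * real n" using assms by (simp add: field_simps)
    also have "\<dots> \<le> exp (\<delta> * real n)" using exp_ge_add_one_self[of "\<delta> * real n"] by linarith
    finally show ?case .
  qed
qed

lemma root_prod_add: "root_prod x (a + b) z = root_prod x a z * root_prod (\<lambda>i. x (a + i)) b z"
  by (induction b) (auto simp: root_prod_def)

lemma root_prod_periodic:
  fixes x :: "nat \<Rightarrow> complex"
  shows "root_prod (\<lambda>i. x (i mod m)) (k * m) z = root_prod x m z ^ k"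
proof (induction k)
  case (Suc k)
  have "root_prod (\<lambda>i. x ((k * m + i) mod m)) m z = root_prod x m z"
    unfolding root_prod_def by (rule prod.cong) auto
  then show ?case using root_prod_add[of "\<lambda>i. x (i mod m)" "k * m" m z] Suc.IH by (simp add: mult.commute add.commute)
qed (simp add: root_prod_def)

lemma root_limit_upper:
  fixes a :: "nat \<Rightarrow> real"
  assumes lim: "(\<lambda>n. root n (a n)) \<longlonglongrightarrow> 1 / c" and pos: "\<And>n. a n > 0" and c: "c > 0" and e: "e > 0"
  shows "\<forall>\<^sub>F n in sequentially. ln (a n) \<le> real n * (- ln c + e)"
proof -
  have "(\<lambda>n. ln (root n (a n))) \<longlonglongrightarrow> ln (1 / c)" using c by (intro tendsto_ln lim) auto
  then have "\<forall>\<^sub>F n in sequentially. ln (root n (a n)) < ln (1 / c) + e" using e by (intro order_tendstoD(2)) auto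
  then show ?thesis using eventually_gt_at_top[of 0]
  proof eventually_elim
    case (elim n)
    then have "ln (a n) / real n \<le> - ln c + e" using c pos[of n] by (simp add: ln_root ln_div)
    then show ?case using elim(2) by (simp add: field_simps)
  qed
qed

context regular_measure
begin

text \<open>The self-improving step: on the part of \<open>E\<close> where \<open>p\<close> is not yet controlled by the
  \<open>L\<^sup>2\<close> norm of \<open>T p\<close>, the factor \<open>T\<close> is negligible.\<close>

lemma bootstrap:
  fixes T p :: "complex \<Rightarrow> complex"
  assumes cont: "continuous_on UNIV T" "continuous_on UNIV p"
    and A: "A = 1 + sqrt (\<integral>w. (cmod (T w * p w))\<^sup>2 \<partial>\<tau>)"
    and q: "0 < q" "q \<le> 2" and D: "D \<ge> 1" "\<And>w. w \<in> E \<Longrightarrow> cmod (T w) \<le> D" and Y: "Y \<ge> 1"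
    and alt: "\<And>w. w \<in> E \<Longrightarrow> cmod (T w * p w) \<le> 1 \<or> cmod (p w) \<le> Y * A"
    and e: "(\<integral>w. cmod (p w) powr q \<partial>\<tau>) \<le> e" "e \<ge> 1"
  shows "A powr q \<le> (4 + 2 * total) * D\<^sup>2 * Y\<^sup>2 * e"
proof -
  let ?I = "\<integral>w. (cmod (T w * p w))\<^sup>2 \<partial>\<tau>"
  have I0: "?I \<ge> 0" by (rule integral_nonneg_AE) simp
  have A1: "A \<ge> 1" using A I0 by simp
  have YA: "Y * A \<ge> 1" using mult_mono[of 1 Y 1 A] A1 Y by simp
  have cp: "continuous_on UNIV (\<lambda>w. cmod (p w) powr q)"
    using q by (intro continuous_on_powr' continuous_intros cont) auto
  have "?I \<le> (\<integral>w. 1 + D\<^sup>2 * (Y * A) powr (2 - q) * cmod (p w) powr q \<partial>\<tau>)"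
  proof (rule integral_mono_AE)
    show "integrable \<tau> (\<lambda>w. (cmod (T w * p w))\<^sup>2)" by (intro integrable_continuous continuous_intros cont)
    show "integrable \<tau> (\<lambda>w. 1 + D\<^sup>2 * (Y * A) powr (2 - q) * cmod (p w) powr q)"
      by (intro integrable_continuous continuous_on_add continuous_on_mult continuous_on_const cp)
    show "AE w in \<tau>. (cmod (T w * p w))\<^sup>2 \<le> 1 + D\<^sup>2 * (Y * A) powr (2 - q) * cmod (p w) powr q"
      using \<tau>_E
    proof eventually_elim
      case (elim w)
      have nn: "0 \<le> D\<^sup>2 * (Y * A) powr (2 - q) * cmod (p w) powr q" by simp
      show ?case
        using alt[OF elim]
      proof
        assume "cmod (T w * p w) \<le> 1"
        then have "(cmod (T w * p w))\<^sup>2 \<le> 1" by (intro power_le_one) auto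
        then show ?thesis by (rule add_increasing2[OF nn])
      next
        assume le: "cmod (p w) \<le> Y * A"
        \<comment> \<open>Interpolation: \<open>2 - q\<close> of the two powers are estimated by the
          supremum bound, the remaining \<open>q\<close> by the integral. So \<open>A\<close> occurs
          on the right only to the power \<open>2 - q\<close>, and \<open>A powr q\<close> survives
          the division.\<close>
        have "(cmod (p w))\<^sup>2 = cmod (p w) powr (2 - q) * cmod (p w) powr q"
          by (cases "p w = 0") (simp_all add: powr_add[symmetric])
        also have "\<dots> \<le> (Y * A) powr (2 - q) * cmod (p w) powr q"
          using le q by (intro mult_right_mono powr_mono2) auto
        finally have "(cmod (T w))\<^sup>2 * (cmod (p w))\<^sup>2 \<le> D\<^sup>2 * ((Y * A) powr (2 - q) * cmod (p w) powr q)"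
          using D(2)[OF elim] by (intro mult_mono power_mono) auto
        then show ?thesis by (simp add: norm_mult power_mult_distrib mult.assoc)
      qed
    qed
  qed
  also have "\<dots> = (\<integral>w. 1 \<partial>\<tau>) + (\<integral>w. D\<^sup>2 * (Y * A) powr (2 - q) * cmod (p w) powr q \<partial>\<tau>)"
    by (intro Bochner_Integration.integral_add integrable_continuous continuous_on_mult continuous_on_const cp)
  also have "\<dots> = (total - 1) + D\<^sup>2 * (Y * A) powr (2 - q) * (\<integral>w. cmod (p w) powr q \<partial>\<tau>)" by (simp add: total_def)
  also have "\<dots> \<le> (total - 1) + D\<^sup>2 * (Y * A) powr (2 - q) * e" using e by (intro add_left_mono mult_left_mono) auto
  finally have I: "?I \<le> total + D\<^sup>2 * (Y * A) powr (2 - q) * e" by simp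
  let ?Z = "D\<^sup>2 * (Y * A) powr (2 - q) * e"
  have "1 \<le> D\<^sup>2 * (Y * A) powr (2 - q)"
    using mult_mono[of 1 "D\<^sup>2" 1 "(Y * A) powr (2 - q)"] D YA q by (simp add: ge_one_powr_ge_zero)
  then have Z1: "1 \<le> ?Z" using mult_mono[of 1 "D\<^sup>2 * (Y * A) powr (2 - q)" 1 e] e by simp
  have "A\<^sup>2 \<le> 2 + 2 * ?I"
  proof -
    have "0 \<le> (sqrt ?I - 1)\<^sup>2" by simp
    then show ?thesis unfolding A power2_eq_square using I0 by (simp add: algebra_simps)
  qed
  also have "\<dots> \<le> (2 + 2 * total) * 1 + 2 * ?Z" using I by simp
  also have "\<dots> \<le> (2 + 2 * total) * ?Z + 2 * ?Z" using Z1 total_ge_1 by (intro add_right_mono mult_left_mono) auto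
  also have "\<dots> = (4 + 2 * total) * ?Z" by (simp add: algebra_simps)
  also have "?Z = D\<^sup>2 * (Y powr (2 - q) * A powr (2 - q)) * e" using Y A1 by (simp add: powr_mult)
  also have "\<dots> \<le> D\<^sup>2 * (Y\<^sup>2 * A powr (2 - q)) * e"
  proof -
    have "Y powr (2 - q) \<le> Y powr 2" using Y q by (intro powr_mono) auto
    then have "Y powr (2 - q) \<le> Y\<^sup>2" using Y by simp
    then show ?thesis using e by (intro mult_right_mono mult_left_mono) auto
  qed
  finally have "A\<^sup>2 \<le> (4 + 2 * total) * (D\<^sup>2 * (Y\<^sup>2 * A powr (2 - q)) * e)" using total_ge_1 by (simp add: mult_left_mono)
  also have "\<dots> = ((4 + 2 * total) * D\<^sup>2 * Y\<^sup>2 * e) * A powr (2 - q)" by (simp only: mult_ac)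
  finally have "A\<^sup>2 / A powr (2 - q) \<le> (4 + 2 * total) * D\<^sup>2 * Y\<^sup>2 * e" using A1 by (simp add: divide_le_eq)
  moreover have "A\<^sup>2 = A powr q * A powr (2 - q)" using A1 by (simp add: powr_add[symmetric])
  ultimately show ?thesis using A1 by simp
qed

text \<open>For each large \<open>n\<close> the single-degree estimate feeds the bootstrap. The
  parameters are fixed in the order \<open>\<delta>\<close>, then \<open>a\<close> (both the level
  \<open>\<delta>'\<close> and the discretization error), then the small product with
  \<open>m\<close> zeros, and last the degree \<open>j\<close>, a multiple of \<open>m\<close> close
  to \<open>a * n\<close>.\<close>

lemma eventually_bounded_on_support:
  fixes p :: "nat \<Rightarrow> complex poly"
  assumes polar: "\<And>\<delta> \<rho>. \<delta> > 0 \<Longrightarrow> \<rho> > 0 \<Longrightarrow> \<exists>m>0. \<exists>t::nat \<Rightarrow> complex.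
      (\<forall>i<m. t i \<in> E) \<and> (\<forall>z\<in>{z \<in> E. g z \<ge> \<delta>}. (\<Prod>i<m. cmod (z - t i)) \<le> \<rho> ^ m)"
    and deg: "\<And>n. degree (p n) \<le> n"
    and X: "\<And>R. \<exists>X::real. \<forall>\<^sub>F n in sequentially. \<forall>w. cmod w \<le> R \<longrightarrow> cmod (poly (p n) w) \<le> X ^ n"
    and q: "0 < q" "q \<le> 2"
    and int: "\<And>e. e > 0 \<Longrightarrow> \<forall>\<^sub>F n in sequentially. (\<integral>w. cmod (poly (p n) w) powr q \<partial>\<tau>) \<le> exp (e * real n)"
    and \<gamma>_lim: "(\<lambda>n. root n (\<gamma> n)) \<longlonglongrightarrow> 1 / c"
    and \<kappa>: "\<kappa> > 0"
  shows "\<forall>\<^sub>F n in sequentially. \<forall>z\<in>S. cmod (poly (p n) z) \<le> exp (\<kappa> * real n)"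
proof -
  \<comment> \<open>The final bound is \<open>Y * A\<close>, with exponent
    \<open>4 * \<delta>\<close> for \<open>Y\<close> and \<open>11 * \<delta> / q\<close> for
    \<open>A\<close>.\<close>
  define \<delta> where "\<delta> = \<kappa> / (4 + 11 / q)"
  have \<delta>: "\<delta> > 0" unfolding \<delta>_def using \<kappa> q by (intro divide_pos_pos add_pos_pos) auto
  have \<kappa>_eq: "4 * \<delta> + 11 * \<delta> / q = \<kappa>"
  proof -
    have "4 + 11 / q > 0" using q by (intro add_pos_pos) auto
    moreover have "4 * \<delta> + 11 * \<delta> / q = \<delta> * (4 + 11 / q)" by (simp add: distrib_left)
    ultimately show ?thesis by (simp add: \<delta>_def)
  qed
  have "bounded ({z. g z \<le> 2 * \<delta>} \<union> E)" using bounded_sublevel E_compact compact_imp_bounded by simp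
  then obtain R where "\<forall>z\<in>{z. g z \<le> 2 * \<delta>} \<union> E. cmod z \<le> R" unfolding bounded_iff by blast
  then have R: "{z. g z \<le> 2 * \<delta>} \<union> E \<subseteq> cball 0 R" by auto
  define R0 where "R0 = max 1 R"
  have R0: "R0 \<ge> 1" "E \<subseteq> cball 0 R0" "{z. g z \<le> 2 * \<delta>} \<subseteq> cball 0 R0" using R by (auto simp: R0_def)
  have ER0: "cmod w \<le> R0" if "w \<in> E" for w using R0(2) that by fastforce
  obtain R1 where R1: "R1 > 0" "\<And>z. cmod z \<ge> R1 \<Longrightarrow> g z > \<delta>" by (rule g_large) blast
  have c1: "compact ({z. g z = 2 * \<delta>} \<union> sphere 0 R1)" by (intro compact_Un compact_level compact_sphere)
  have c2: "{z. g z = 2 * \<delta>} \<union> sphere 0 R1 \<subseteq> {z. g z > \<delta>}" using \<delta> R1 by auto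
  from two_constants[OF open_superlevel connected_superlevel[OF \<delta>] c1 c2] obtain M where M: "M \<ge> 0" and M2: "\<forall>A B m s y. A holomorphic_on {z. g z > \<delta>} \<longrightarrow> B holomorphic_on {z. g z > \<delta>} \<longrightarrow>
      (\<forall>z\<in>{z. g z > \<delta>}. cmod (B z) \<le> 1) \<longrightarrow> (\<forall>z\<in>{z. g z > \<delta>}. cmod (A z * B z) \<le> exp m) \<longrightarrow>
      y \<in> {z. g z = 2 * \<delta>} \<union> sphere 0 R1 \<longrightarrow> exp (-s) \<le> cmod (B y) \<longrightarrow>
      (\<forall>z\<in>{z. g z = 2 * \<delta>} \<union> sphere 0 R1. cmod (A z) \<le> exp (m + M * s))"
    by (elim exE conjE) (rule that)
  define l where "l = ln (2 * R0)"
  have l: "l \<ge> 0" unfolding l_def using R0 by simp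
  define L where "L = l + \<bar>ln c\<bar> + 4"
  \<comment> \<open>Besides \<open>a < \<delta>\<close>, two costs of a factor of degree
    \<open>j \<le> a * n\<close> must stay below \<open>\<delta> * n\<close>: the two constants loss
    \<open>a * (M * L) * n\<close> and the exponent \<open>2 * a * l * n\<close> of the squared
    bound for \<open>T\<close>.\<close>
  define a where "a = min (min (\<delta> / 2) 1) (min (\<delta> / (M * L + 1)) (\<delta> / (2 * l + 1)))"
  have ML0: "M * L \<ge> 0" unfolding L_def using M l by (intro mult_nonneg_nonneg) auto
  have a: "a > 0" "a \<le> \<delta> / 2" "a \<le> 1" "a \<le> \<delta> / (M * L + 1)" "a \<le> \<delta> / (2 * l + 1)"
  proof -
    show "a > 0" unfolding a_def using \<delta> ML0 l by (auto simp: min_less_iff_conj intro!: divide_pos_pos)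
    show "a \<le> \<delta> / 2" "a \<le> 1" "a \<le> \<delta> / (M * L + 1)" "a \<le> \<delta> / (2 * l + 1)"
      unfolding a_def by linarith+
  qed
  have aM: "a * (M * L) \<le> \<delta>" using a(1,4) ML0 by (simp add: field_simps)
  have al: "2 * a * l \<le> \<delta>" using a(1,5) l by (simp add: field_simps)
  let ?near = "{w \<in> E. g w \<le> a}" and ?far = "{z. g z \<ge> \<delta>}"
  have cn: "compact ?near"
  proof -
    have "?near = E \<inter> {w. g w \<le> a}" by auto
    moreover have "closed {w. g w \<le> a}" by (intro closed_Collect_le g_cont continuous_intros)
    ultimately show ?thesis using E_compact by (simp add: compact_Int_closed)
  qed
  moreover have "closed ?far" by (intro closed_Collect_le g_cont continuous_intros)
  moreover have "?near \<inter> ?far = {}" using a \<delta> by auto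
  ultimately obtain d0 where d0: "d0 > 0" "\<forall>w\<in>?near. \<forall>z\<in>?far. d0 \<le> dist w z"
    using separate_compact_closed by blast
  have d0': "d0 \<le> cmod (z - w)" if "w \<in> E" "g w \<le> a" "g z \<ge> \<delta>" for w z
    using d0(2) that by (auto simp: dist_norm norm_minus_commute)
  obtain X' where X': "\<forall>\<^sub>F n in sequentially. \<forall>w. cmod w \<le> 2 * R0 \<longrightarrow> cmod (poly (p n) w) \<le> X' ^ n" using X by blast
  define X where "X = max \<bar>X'\<bar> (3 * R0)"
  have X1: "X \<ge> 1" and X3: "X \<ge> 3 * R0" using R0 by (auto simp: X_def)
  have evX: "\<forall>\<^sub>F n in sequentially. \<forall>w. cmod w \<le> 2 * R0 \<longrightarrow> cmod (poly (p n) w) \<le> X ^ n"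
    using X'
  proof eventually_elim
    case (elim n)
    have "X' ^ n \<le> \<bar>X'\<bar> ^ n" by (metis abs_ge_self power_abs)
    also have "\<dots> \<le> X ^ n" by (intro power_mono) (auto simp: X_def)
    finally show ?case using elim by force
  qed
  \<comment> \<open>Large enough for the smallness conditions on
    \<open>\<theta> \<le> exp (- \<Lambda> * n)\<close>: the first term pays for two factors
    \<open>X ^ n\<close>, the second for the capacity and for \<open>\<gamma> (n + j)\<close>, the
    last for the constants.\<close>
  define \<Lambda> where "\<Lambda> = 2 * ln X + 3 * \<bar>ln c\<bar> + 3"
  have lX: "ln X \<ge> 0" using X1 by simp
  have \<Lambda>0: "\<Lambda> \<ge> 0" using lX by (simp add: \<Lambda>_def)
  \<comment> \<open>Since \<open>j \<ge> a * n / 2\<close> below, this gives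
    \<open>\<rho> ^ j \<le> exp (- \<Lambda> * n)\<close>.\<close>
  define \<rho> where "\<rho> = exp (- (2 * \<Lambda> / a))"
  obtain m and t :: "nat \<Rightarrow> complex" where m: "m > 0" and tE: "\<forall>i<m. t i \<in> E"
    and t\<rho>: "\<forall>z\<in>{z \<in> E. g z \<ge> a}. (\<Prod>i<m. cmod (z - t i)) \<le> \<rho> ^ m"
    using polar[OF a(1), of \<rho>] by (auto simp: \<rho>_def)
  let ?C = "{z. g z = a} \<union> {z. g z = \<delta>} \<union> {z. g z = 2 * \<delta>}"
  have "compact ?C" by (intro compact_Un compact_level)
  moreover have "?C \<inter> S = {}" using level_disjoint[OF a(1)] level_disjoint[OF \<delta>] level_disjoint[of "2 * \<delta>"] \<delta> by auto
  ultimately obtain N0 where N0: "\<And>n. n \<ge> N0 \<Longrightarrow> \<exists>x. (\<forall>i<n. x i \<in> S) \<and>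
    (\<forall>z\<in>?C. exp (real n * (g z + ln c - a)) \<le> cmod (root_prod x n z) \<and>
      cmod (root_prod x n z) \<le> exp (real n * (g z + ln c + a)))"
    by (rule approximation[OF _ _ a(1)]) blast
  from root_limit_upper[OF \<gamma>_lim \<gamma>_pos c_pos a(1)]
  obtain N1 where N1: "\<And>n. n \<ge> N1 \<Longrightarrow> ln (\<gamma> n) \<le> real n * (- ln c + a)"
    unfolding eventually_sequentially by blast
  define b0 where "b0 = 2 * R0 * total / d0"
  have b0: "b0 > 0" unfolding b0_def using R0 d0(1) total_ge_1 by (intro divide_pos_pos mult_pos_pos) auto
  define K1 where "K1 = 2 * R0 * (1 / d0 + 4 * total)"
  have K1: "K1 > 0" unfolding K1_def using R0 d0(1) total_ge_1 by (intro mult_pos_pos add_pos_pos) auto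
  define C0 where "C0 = \<bar>ln 4 + ln b0\<bar>"
  show ?thesis
    using eventually_ge_at_top[of N0] eventually_ge_at_top[of N1] eventually_gt_at_top[of 0]
      evX int[OF \<delta>] eventually_const_le_exp[OF \<delta>, of "K1 / b0 * exp (M * C0)"]
      eventually_const_le_exp[OF \<delta>, of "4 + 2 * total"]
      eventually_const_le_exp[of 1 "2 * total", OF zero_less_one]
      eventually_ge_at_top[of "nat \<lceil>2 * real m / a\<rceil>"]
  proof eventually_elim
    case (elim n)
    note evs = elim
    have n: "real n > 0" using evs(3) by simp
    obtain x where xS: "\<And>i. i < n \<Longrightarrow> x i \<in> S" and x: "\<And>z. z \<in> ?C \<Longrightarrow> exp (real n * (g z + ln c - a)) \<le> cmod (root_prod x n z) \<and>
      cmod (root_prod x n z) \<le> exp (real n * (g z + ln c + a))" using N0[OF evs(1)] by blast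
    \<comment> \<open>The \<open>m\<close> zeros are repeated \<open>k\<close> times, so that
      \<open>j = k * m\<close> falls short of \<open>a * n\<close> by less than
      \<open>m\<close>.\<close>
    define k where "k = nat \<lfloor>a * real n / real m\<rfloor>"
    define j where "j = k * m"
    have "real k \<le> a * real n / real m" "a * real n / real m < real k + 1"
      unfolding k_def using a(1) by (simp_all add: of_nat_nat)
    then have "real k * real m \<le> a * real n" "a * real n < (real k + 1) * real m" using m by (simp_all add: field_simps)
    then have j: "real j \<le> a * real n" "a * real n < real j + real m" by (simp_all add: j_def algebra_simps)
    have "2 * real m / a \<le> real n" using evs(9) by linarith
    then have "real m \<le> a * real n / 2" using a(1) by (simp add: field_simps)
    then have j2: "a * real n / 2 \<le> real j" using j(2) by linarith
    have jn: "real j \<le> real n" using j(1) a(1,3) n mult_right_mono[of a 1 "real n"] by linarith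
    define T where "T = root_prod (\<lambda>i. t (i mod m)) j"
    define \<theta> where "\<theta> = \<rho> ^ j"
    have \<theta>: "\<theta> \<le> exp (- \<Lambda> * real n)"
    proof -
      have "\<theta> = exp (- (2 * \<Lambda> / a * real j))" unfolding \<theta>_def \<rho>_def by (simp add: exp_of_nat_mult[symmetric] mult_ac)
      also have "2 * \<Lambda> / a * real j \<ge> 2 * \<Lambda> / a * (a * real n / 2)" using j2 \<Lambda>0 a(1) by (intro mult_left_mono) auto
      then have "exp (- (2 * \<Lambda> / a * real j)) \<le> exp (- \<Lambda> * real n)" using a(1) by simp
      finally show ?thesis .
    qed
    have \<theta>0: "\<theta> \<ge> 0" by (simp add: \<theta>_def \<rho>_def)
    have tE': "t (i mod m) \<in> E" for i using tE m by simp
    have T\<theta>: "cmod (T w) \<le> \<theta>" if "w \<in> E" "g w \<ge> a" for w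
    proof -
      have "cmod (root_prod t m w) \<le> \<rho> ^ m" using t\<rho> that by (simp add: root_prod_def prod_norm)
      then have "cmod (root_prod t m w) ^ k \<le> (\<rho> ^ m) ^ k" by (intro power_mono) auto
      then show ?thesis
        unfolding T_def j_def \<theta>_def root_prod_periodic norm_power power_mult[symmetric] by (simp add: mult.commute)
    qed
    have TD: "cmod (T w) \<le> (2 * R0) ^ j" if "w \<in> E" for w
      unfolding T_def mult_2 by (intro root_prod_upper ER0 tE' that)
    have Xn: "X ^ n = exp (real n * ln X)" using X1 by (simp add: exp_of_nat_mult)
    have \<theta>1: "\<theta> * X ^ n \<le> exp (- \<Lambda> * real n + real n * ln X)"
      unfolding Xn exp_add using \<theta> by (intro mult_right_mono) auto
    have cge: "0 \<le> real n * \<bar>ln c\<bar>" "0 \<le> real n * ln X" "real n * (- ln c) \<le> real n * \<bar>ln c\<bar>"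
      by (intro mult_nonneg_nonneg mult_left_mono; use n lX in simp)+
    have \<Lambda>n: "\<Lambda> * real n = 2 * (real n * ln X) + 3 * (real n * \<bar>ln c\<bar>) + 3 * real n"
      by (simp add: \<Lambda>_def algebra_simps)
    have \<theta>2: "\<theta> * X ^ n \<le> 1"
      by (rule order_trans[OF \<theta>1]) (unfold exp_le_one_iff, use \<Lambda>n cge n in linarith)
    have \<theta>3: "\<theta> * X ^ n * (X ^ n / exp (real n * ln c)) \<le> 1"
    proof -
      have "\<theta> * X ^ n * (X ^ n / exp (real n * ln c)) \<le> exp (- \<Lambda> * real n + real n * ln X) * (X ^ n / exp (real n * ln c))"
        using X1 \<theta>1 by (intro mult_right_mono) auto
      also have "\<dots> = exp (- \<Lambda> * real n + real n * ln X + (real n * ln X - real n * ln c))"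
        unfolding Xn exp_diff[symmetric] exp_add[symmetric] ..
      also have "\<dots> \<le> 1" unfolding exp_le_one_iff using \<Lambda>n cge n by linarith
      finally show ?thesis .
    qed
    have \<gamma>N: "ln (\<gamma> (n + j)) \<le> (real n + real j) * (- ln c + a)" using N1[of "n + j"] evs(2) by simp
    have \<theta>4: "total * \<theta> * X ^ n \<le> 1 / (2 * \<gamma> (n + j))"
    proof -
      have "(real n + real j) * (- ln c + a) \<le> (2 * real n) * (\<bar>ln c\<bar> + 1)"
        using jn a(1,3) by (intro order_trans[OF mult_left_mono[of _ "\<bar>ln c\<bar> + 1"] mult_right_mono]) auto
      then have "ln (\<gamma> (n + j)) \<le> 2 * (real n * \<bar>ln c\<bar>) + 2 * real n" using \<gamma>N by (simp add: algebra_simps)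
      then have "exp (ln (\<gamma> (n + j))) \<le> exp (2 * (real n * \<bar>ln c\<bar>) + 2 * real n)" by simp
      then have g1: "\<gamma> (n + j) \<le> exp (2 * (real n * \<bar>ln c\<bar>) + 2 * real n)" using \<gamma>_pos[of "n + j"] by simp
      have "(2 * total) * (\<theta> * X ^ n) * \<gamma> (n + j) \<le> exp (1 * real n) * exp (- \<Lambda> * real n + real n * ln X) * exp (2 * (real n * \<bar>ln c\<bar>) + 2 * real n)"
        using evs(8) \<theta>1 g1 \<theta>0 X1 \<gamma>_pos[of "n + j"] total_ge_1 by (intro mult_mono) auto
      also have "\<dots> = exp (1 * real n + (- \<Lambda> * real n + real n * ln X) + (2 * (real n * \<bar>ln c\<bar>) + 2 * real n))"
        unfolding exp_add ..
      also have "\<dots> \<le> 1" unfolding exp_le_one_iff using \<Lambda>n cge n by linarith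
      finally show ?thesis using \<gamma>_pos[of "n + j"] by (simp add: field_simps)
    qed
    define A where "A = 1 + sqrt (\<integral>w. (cmod (T w * poly (p n) w))\<^sup>2 \<partial>\<tau>)"
    have I0: "(\<integral>w. (cmod (T w * poly (p n) w))\<^sup>2 \<partial>\<tau>) \<ge> 0" by (rule integral_nonneg_AE) simp
    have A1: "A \<ge> 1" using I0 by (simp add: A_def)
    have A2: "(\<integral>w. (cmod (T w * poly (p n) w))\<^sup>2 \<partial>\<tau>) \<le> A\<^sup>2"
      using I0 by (simp add: A_def power2_sum)
    define b where "b = 2 * R0 * total / d0 * (2 * R0) ^ j * exp (real n * (ln c + a + a))"
    have b_eq: "b = exp (ln b0 + real j * l + real n * (ln c + 2 * a))"
    proof -
      have "exp (ln b0) = 2 * R0 * total / d0" using b0 unfolding b0_def by (rule exp_ln)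
      moreover have "exp (real j * l) = (2 * R0) ^ j" using R0(1) by (simp add: l_def exp_of_nat_mult)
      moreover have "ln c + 2 * a = ln c + a + a" by simp
      ultimately show ?thesis by (simp only: b_def exp_add)
    qed
    have est: "cmod (poly (p n) z) \<le> exp (real n * (ln c + 2 * \<delta> + a)) *
      (2 * R0 * ((1 / d0 + 4 * total) * A) / b * exp (M * ln (4 * \<gamma> (n + j) * b)))" if "g z \<le> 2 * \<delta>" for z
    proof (rule single_degree_estimate[where \<delta> = \<delta> and \<delta>' = a and ?R1.0 = R1 and X = X and x = x
          and t = "\<lambda>i. t (i mod m)" and \<theta> = \<theta>])
      show "0 < a" "a < \<delta>" using a \<delta> by auto
      show "1 \<le> R0" "E \<subseteq> cball 0 R0" "{z. g z \<le> 2 * \<delta>} \<subseteq> cball 0 R0" by (rule R0)+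
      show "0 < R1" by (rule R1)
      show "\<delta> < g z" if "R1 \<le> cmod z" for z using that by (rule R1)
      show "cmod (A z) \<le> exp (m + M * s)"
        if "A holomorphic_on {z. g z > \<delta>}" "B holomorphic_on {z. g z > \<delta>}"
          "\<And>z. g z > \<delta> \<Longrightarrow> cmod (B z) \<le> 1" "\<And>z. g z > \<delta> \<Longrightarrow> cmod (A z * B z) \<le> exp m"
          "cmod y = R1" "exp (-s) \<le> cmod (B y)" "g z = 2 * \<delta>" for A B m s y z
        using M2[rule_format, of A B m y s z] that by simp
      show "0 < d0" by (rule d0)
      show "d0 \<le> cmod (z - w)" if "w \<in> E" "g w \<le> a" "\<delta> \<le> g z" for w z by (rule d0'[OF that])
      show "0 < n" "degree (p n) \<le> n" "1 \<le> X" by (rule evs deg X1)+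
      show "cmod (poly (p n) w) \<le> X ^ n" if "cmod w \<le> 2 * R0" for w using evs(4) that by blast
      show "x i \<in> S" if "i < n" for i using that by (rule xS)
      show "cmod (root_prod x n w) \<le> exp (real n * (ln c + a + a))" if "g w = a" for w
        using x[of w] that by (simp add: add_ac)
      show "exp (real n * ln c) \<le> cmod (root_prod x n w)" if "g w = \<delta>" for w
      proof -
        have "real n * ln c \<le> real n * (g w + ln c - a)" using a \<delta> that by (intro mult_left_mono) auto
        then have "exp (real n * ln c) \<le> exp (real n * (g w + ln c - a))" by simp
        moreover have "w \<in> ?C" using that by simp
        ultimately show ?thesis using x[of w] by linarith
      qed
      show "cmod (root_prod x n w) \<le> exp (real n * (ln c + 2 * \<delta> + a))" if "g w = 2 * \<delta>" for w
        using x[of w] that by (simp add: add_ac)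
      show "cmod (root_prod x n w) \<le> X ^ n" if "cmod w \<le> 2 * R0" for w
      proof -
        have "cmod (root_prod x n w) \<le> (2 * R0 + R0) ^ n" using xS S_sub ER0 that by (intro root_prod_upper) auto
        also have "\<dots> \<le> X ^ n" using X3 R0 by (intro power_mono) auto
        finally show ?thesis .
      qed
      show "t (i mod m) \<in> E" for i by (rule tE')
      show "cmod (root_prod (\<lambda>i. t (i mod m)) j w) \<le> \<theta>" if "w \<in> E" "a \<le> g w" for w
        using T\<theta>[OF that] by (simp add: T_def)
      show "(\<integral>w. (cmod (root_prod (\<lambda>i. t (i mod m)) j w * poly (p n) w))\<^sup>2 \<partial>\<tau>) \<le> A\<^sup>2" using A2 by (simp add: T_def)
    qed (fact \<theta>0 \<theta>2 \<theta>3 \<theta>4 A1 b_def that)+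
    \<comment> \<open>Two multiples of \<open>\<delta>\<close> come from comparing \<open>F\<close>
      on the level \<open>g = 2 * \<delta>\<close> with \<open>b\<close>, one from the two constants
      principle, and one absorbs the constants.\<close>
    define Y where "Y = exp (4 * \<delta> * real n)"
    have Y1: "Y \<ge> 1" using \<delta> by (simp add: Y_def)
    have "ln (4 * \<gamma> (n + j) * b) = ln 4 + ln (\<gamma> (n + j)) + (ln b0 + real j * l + real n * (ln c + 2 * a))"
      unfolding b_eq using \<gamma>_pos[of "n + j"] by (simp add: ln_mult)
    also have "\<dots> \<le> C0 + real j * (- ln c + a + l) + 3 * (a * real n)"
      using \<gamma>N by (simp add: C0_def algebra_simps)
    also have "\<dots> \<le> C0 + real j * (\<bar>ln c\<bar> + 1 + l) + 3 * (a * real n)"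
      using a(3) by (intro add_right_mono add_left_mono mult_left_mono) auto
    also have "\<dots> \<le> C0 + (a * real n) * (\<bar>ln c\<bar> + 1 + l) + 3 * (a * real n)"
      using j(1) a(1,3) l by (intro add_mono mult_mono) auto
    also have "\<dots> = C0 + a * L * real n" by (simp add: L_def algebra_simps)
    finally have "M * ln (4 * \<gamma> (n + j) * b) \<le> M * (C0 + a * L * real n)" using M by (intro mult_left_mono)
    also have "\<dots> = M * C0 + a * (M * L) * real n" by (simp add: algebra_simps)
    also have "\<dots> \<le> M * C0 + \<delta> * real n" using aM by (intro add_left_mono mult_right_mono) auto
    finally have e1: "exp (M * ln (4 * \<gamma> (n + j) * b)) \<le> exp (M * C0) * exp (\<delta> * real n)"
      unfolding exp_add[symmetric] by simp
    have "exp (real n * (ln c + 2 * \<delta> + a)) / b \<le> exp (2 * \<delta> * real n) / b0"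
    proof -
      have "exp (real n * (ln c + 2 * \<delta> + a)) / b =
          exp (real n * (ln c + 2 * \<delta> + a) - (ln b0 + real j * l + real n * (ln c + 2 * a)))"
        unfolding b_eq exp_diff ..
      also have "\<dots> \<le> exp (2 * \<delta> * real n - ln b0)" using a(1) n l by (simp add: algebra_simps)
      also have "\<dots> = exp (2 * \<delta> * real n) / b0" using b0 by (simp add: exp_diff)
      finally show ?thesis .
    qed
    then have "exp (real n * (ln c + 2 * \<delta> + a)) / b * K1 * exp (M * ln (4 * \<gamma> (n + j) * b))
        \<le> exp (2 * \<delta> * real n) / b0 * K1 * (exp (M * C0) * exp (\<delta> * real n))"
      using e1 K1 b0 by (intro mult_mono) auto
    also have "\<dots> = (K1 / b0 * exp (M * C0)) * (exp (2 * \<delta> * real n) * exp (\<delta> * real n))" by (simp add: mult_ac)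
    also have "\<dots> \<le> exp (\<delta> * real n) * (exp (2 * \<delta> * real n) * exp (\<delta> * real n))"
      using evs(6) by (intro mult_right_mono) auto
    also have "\<dots> = Y" unfolding Y_def exp_add[symmetric] by (simp add: algebra_simps)
    finally have YY: "exp (real n * (ln c + 2 * \<delta> + a)) / b * K1 * exp (M * ln (4 * \<gamma> (n + j) * b)) \<le> Y" .
    have pY: "cmod (poly (p n) z) \<le> Y * A" if "g z \<le> 2 * \<delta>" for z
    proof -
      have "cmod (poly (p n) z) \<le> (exp (real n * (ln c + 2 * \<delta> + a)) / b * K1 * exp (M * ln (4 * \<gamma> (n + j) * b))) * A"
        using est[OF that] by (simp add: K1_def mult_ac)
      also have "\<dots> \<le> Y * A" using YY A1 by (intro mult_right_mono) auto
      finally show ?thesis .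
    qed
    \<comment> \<open>Eleven multiples of \<open>\<delta>\<close> will result: eight from
      \<open>Y\<^sup>2\<close>, and one each from the constant, from the squared bound for
      \<open>T\<close> and from the integral.\<close>
    have "A powr q \<le> (4 + 2 * total) * ((2 * R0) ^ j)\<^sup>2 * Y\<^sup>2 * exp (\<delta> * real n)"
    proof (rule bootstrap[of T "poly (p n)" A])
      show "1 \<le> (2 * R0) ^ j" using R0 by (intro one_le_power) auto
      show "cmod (T w * poly (p n) w) \<le> 1 \<or> cmod (poly (p n) w) \<le> Y * A" if w: "w \<in> E" for w
      proof (cases "g w \<le> 2 * \<delta>")
        case False
        then have "cmod (T w) \<le> \<theta>" using a \<delta> w by (intro T\<theta>) auto
        moreover have "cmod (poly (p n) w) \<le> X ^ n" using evs(4) ER0[OF w] R0 by auto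
        ultimately have "cmod (T w * poly (p n) w) \<le> \<theta> * X ^ n" unfolding norm_mult using \<theta>0 by (intro mult_mono) auto
        then show ?thesis using \<theta>2 by linarith
      qed (use pY in blast)
    qed (use A_def q TD Y1 evs(5) \<delta> in \<open>auto simp: T_def intro!: continuous_intros\<close>)
    also have "((2 * R0) ^ j)\<^sup>2 = exp (2 * (real j * l))" using R0 by (simp add: l_def exp_of_nat_mult exp_double)
    also have "(4 + 2 * total) * exp (2 * (real j * l)) * Y\<^sup>2 * exp (\<delta> * real n)
        \<le> exp (\<delta> * real n) * exp (\<delta> * real n) * Y\<^sup>2 * exp (\<delta> * real n)"
    proof -
      have "2 * (real j * l) \<le> 2 * (a * real n * l)" using j(1) l by (intro mult_left_mono mult_right_mono) auto
      also have "\<dots> = (2 * a * l) * real n" by simp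
      also have "\<dots> \<le> \<delta> * real n" using al by (intro mult_right_mono) auto
      finally show ?thesis using evs(7) total_ge_1 by (intro mult_right_mono mult_mono) auto
    qed
    also have "\<dots> = exp (11 * \<delta> * real n)"
      unfolding Y_def power2_eq_square exp_add[symmetric] by (simp add: algebra_simps)
    finally have "A powr q \<le> exp (11 * \<delta> * real n)" .
    then have "(A powr q) powr (1 / q) \<le> exp (11 * \<delta> * real n) powr (1 / q)" using q by (intro powr_mono2) auto
    then have Aq: "A \<le> exp (11 * \<delta> / q * real n)" using q A1 by (simp add: powr_powr powr_def)
    show ?case
    proof
      fix z assume "z \<in> S"
      then have "cmod (poly (p n) z) \<le> Y * A" using g_S \<delta> by (intro pY) simp
      also have "\<dots> \<le> Y * exp (11 * \<delta> / q * real n)" using Aq Y1 by (intro mult_left_mono) auto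
      also have "\<dots> = exp ((4 * \<delta> + 11 * \<delta> / q) * real n)" unfolding Y_def exp_add[symmetric] by (simp add: algebra_simps)
      finally show "cmod (poly (p n) z) \<le> exp (\<kappa> * real n)" unfolding \<kappa>_eq .
    qed
  qed
qed

end

section \<open>Limits of filled Julia sets\<close>

lemma outside_subset:
  fixes E F :: "complex set"
  assumes "bounded F" "E \<inter> outside F = {}"
  shows "outside F \<subseteq> outside E"
proof
  fix z assume z: "z \<in> outside F"
  have "outside F \<subseteq> connected_component_set (- E) z"
    using assms z connected_outside[of F] by (intro connected_component_maximal) auto
  moreover have "\<not> bounded (outside F)" using assms by (intro unbounded_outside)
  ultimately have "\<not> bounded (connected_component_set (- E) z)" using bounded_subset by blast
  then show "z \<in> outside E" by (simp add: outside)
qed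

lemma compact_Pc: "compact E \<Longrightarrow> compact (Pc E)"
  unfolding Pc_def by (simp add: compact_eq_bounded_closed cobounded_outside closed_Compl open_outside)

lemma subset_Pc: "E \<subseteq> Pc E"
  unfolding Pc_def using outside_no_overlap[of E] by blast

text \<open>A tube around a path from \<open>z\<close> to a distant point. Growth estimates are
  carried along it, so its closure has to be compact and off \<open>F\<close>.\<close>

lemma outside_neighbourhood:
  fixes F :: "complex set"
  assumes F: "compact F" and z: "z \<in> outside F"
  obtains G b where "open G" "connected G" "compact (closure G)" "closure G \<subseteq> outside F"
    "z \<in> G" "b \<in> G" "cmod b \<ge> R"
proof -
  have bd: "bounded F" and cl: "closed F" using F by (auto simp: compact_eq_bounded_closed)
  have op: "open (outside F)" by (rule open_outside[OF cl])
  have "\<exists>b\<in>outside F. \<not> cmod b \<le> R" using unbounded_outside[OF bd] unfolding bounded_iff by blast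
  then obtain b where b: "b \<in> outside F" "cmod b \<ge> R" by force
  have "path_connected (outside F)" using connected_outside[OF bd] op by (simp add: connected_open_path_connected)
  then obtain \<gamma> where \<gamma>: "path \<gamma>" "path_image \<gamma> \<subseteq> outside F" "pathstart \<gamma> = z" "pathfinish \<gamma> = b"
    using z b unfolding path_connected_def by blast
  have ne: "path_image \<gamma> \<noteq> {}" by (rule path_image_nonempty)
  obtain G where "open G" "connected G" "path_image \<gamma> \<subseteq> G" "compact (closure G)" "closure G \<subseteq> outside F"
    by (rule connected_open_neighbourhood[OF compact_path_image[OF \<gamma>(1)] connected_path_image[OF \<gamma>(1)] ne op \<gamma>(2)])
  moreover have "z \<in> path_image \<gamma>" "b \<in> path_image \<gamma>"
    using pathstart_in_path_image[of \<gamma>] pathfinish_in_path_image[of \<gamma>] \<gamma> by auto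
  ultimately show thesis using b by (intro that[of G b]) auto
qed

text \<open>Boundedness matters because \<open>hausdorff_excess\<close> is a real supremum, which
  bounds its members only if the set is bounded above.\<close>

lemma infdist_le_hausdorff_distance:
  assumes "bounded A" "B \<noteq> {}" "a \<in> A"
  shows "infdist a B \<le> hausdorff_distance A B"
proof -
  obtain b where b: "b \<in> B" using assms by blast
  obtain C where C: "\<forall>x\<in>A. dist b x \<le> C" using assms(1) unfolding bounded_any_center[of A b] by blast
  have "bdd_above ((\<lambda>a. infdist a B) ` A)"
  proof (rule bdd_aboveI2)
    fix x assume "x \<in> A"
    then show "infdist x B \<le> C" using infdist_le[OF b, of x] C dist_commute[of b x] by force
  qed
  then have "infdist a B \<le> hausdorff_excess A B" unfolding hausdorff_excess_def using assms(3) by (intro cSUP_upper)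
  then show ?thesis by (simp add: hausdorff_distance_def)
qed

lemma hausdorff_distance_commute: "hausdorff_distance A B = hausdorff_distance B A"
  by (simp add: hausdorff_distance_def max.commute)

lemma hausdorff_limit_disjoint:
  assumes lim: "(\<lambda>k. hausdorff_distance (A k) B) \<longlonglongrightarrow> 0" and A: "\<forall>\<^sub>F k in sequentially. bounded (A k)"
    and B: "closed B" "B \<noteq> {}" and C: "compact C" "C \<inter> B = {}"
  shows "\<forall>\<^sub>F k in sequentially. C \<inter> A k = {}"
proof -
  obtain d where d: "d > 0" "\<forall>x\<in>C. \<forall>y\<in>B. d \<le> dist x y" using separate_compact_closed[OF C(1) B(1) C(2)] by blast
  have "\<forall>\<^sub>F k in sequentially. hausdorff_distance (A k) B < d" using lim d(1) by (rule order_tendstoD)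
  then show ?thesis using A
  proof eventually_elim
    case (elim k)
    have "d \<le> infdist x B" if "x \<in> C" for x
      unfolding infdist_notempty[OF B(2)] using d that B(2) by (intro cINF_greatest) auto
    then show ?case using infdist_le_hausdorff_distance[OF elim(2) B(2)] elim(1) by fastforce
  qed
qed

lemma hausdorff_limit_approach:
  assumes lim: "(\<lambda>k. hausdorff_distance (A k) B) \<longlonglongrightarrow> 0" and A: "\<forall>\<^sub>F k in sequentially. A k \<noteq> {}"
    and B: "bounded B" "w \<in> B" and e: "e > 0"
  shows "\<forall>\<^sub>F k in sequentially. ball w e \<inter> A k \<noteq> {}"
proof -
  have "\<forall>\<^sub>F k in sequentially. hausdorff_distance (A k) B < e" using lim e by (rule order_tendstoD)
  then show ?thesis using A
  proof eventually_elim
    case (elim k)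
    have "infdist w (A k) < e"
      using infdist_le_hausdorff_distance[OF B(1) elim(2) B(2)] elim(1) hausdorff_distance_commute[of B "A k"] by simp
    then obtain a where "a \<in> A k" "dist w a < e"
      unfolding infdist_notempty[OF elim(2)] using cINF_less_iff[of "A k" "dist w" e] elim(2)
      by (metis bdd_below_image_dist)
    then show ?case by auto
  qed
qed

section \<open>Growth of the polynomials outside the two hulls\<close>

locale minimal_polynomials = green_function +
  fixes p :: "nat \<Rightarrow> complex poly"
  assumes degree_p: "degree (p n) = n" and lead_p: "coeff (p n) n \<noteq> 0"
    and lead_lim: "(\<lambda>n. 1 / real n * ln (cmod (coeff (p n) n))) \<longlonglongrightarrow> - ln c"
    and zeros: "\<epsilon> > 0 \<Longrightarrow> \<exists>N. \<forall>n\<ge>N. {z. poly (p n) z = 0} \<subseteq> {z. infdist z (Pc E) < \<epsilon>}"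
begin

lemma Pc_nonempty: "Pc E \<noteq> {}"
  using S_nonempty S_sub subset_Pc[of E] by blast

lemma lead_bounds:
  assumes e: "e > 0"
  shows "\<forall>\<^sub>F n in sequentially. exp (real n * (- ln c - e)) \<le> cmod (coeff (p n) n) \<and>
    cmod (coeff (p n) n) \<le> exp (real n * (- ln c + e))"
proof -
  have "\<forall>\<^sub>F n in sequentially. dist (1 / real n * ln (cmod (coeff (p n) n))) (- ln c) < e"
    by (rule tendstoD[OF lead_lim e])
  then show ?thesis using eventually_gt_at_top[of 0]
  proof eventually_elim
    case (elim n)
    define l where "l = ln (cmod (coeff (p n) n))"
    have "- ln c - e \<le> l / real n" "l / real n \<le> - ln c + e" using elim(1) unfolding dist_real_def l_def by auto
    then have "real n * (- ln c - e) \<le> l" "l \<le> real n * (- ln c + e)" using elim(2) by (simp_all add: field_simps)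
    then have "exp (real n * (- ln c - e)) \<le> exp l" "exp l \<le> exp (real n * (- ln c + e))" by simp_all
    moreover have "exp l = cmod (coeff (p n) n)" using lead_p[of n] by (simp add: l_def)
    ultimately show ?case by simp
  qed
qed

lemma zeros_off:
  assumes C: "closed C" "C \<inter> Pc E = {}"
  shows "\<forall>\<^sub>F n in sequentially. \<forall>z\<in>C. poly (p n) z \<noteq> 0"
proof -
  have "C \<inter> Pc E = Pc E \<inter> C" by blast
  then obtain d where d: "d > 0" "\<forall>x\<in>Pc E. \<forall>y\<in>C. d \<le> dist x y"
    using separate_compact_closed[OF compact_Pc[OF E_compact] C(1)] C(2) by metis
  obtain N where N: "\<forall>n\<ge>N. {z. poly (p n) z = 0} \<subseteq> {z. infdist z (Pc E) < d}" using zeros[OF d(1)] by blast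
  show ?thesis
    unfolding eventually_sequentially
  proof (intro exI[of _ N] allI impI ballI notI)
    fix n z assume n: "N \<le> n" "z \<in> C" "poly (p n) z = 0"
    have "infdist z (Pc E) < d" using N n by blast
    moreover have "d \<le> infdist z (Pc E)"
      unfolding infdist_notempty[OF Pc_nonempty] using d(2) n(2) Pc_nonempty by (intro cINF_greatest) (auto simp: dist_commute)
    ultimately show False by simp
  qed
qed

lemma zeros_bounded:
  obtains R where "R \<ge> 1" "Pc E \<subseteq> ball 0 R" "\<forall>\<^sub>F n in sequentially. \<forall>z. poly (p n) z = 0 \<longrightarrow> cmod z \<le> R"
proof -
  obtain R where "\<forall>z\<in>Pc E. cmod z \<le> R"
    using compact_imp_bounded[OF compact_Pc[OF E_compact]] unfolding bounded_iff by blast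
  then have R: "cmod z \<le> R" if "z \<in> Pc E" for z using that by blast
  define R' where "R' = max 1 (R + 1)"
  have "closed (- ball 0 R' :: complex set)" by (rule closed_Compl[OF open_ball])
  moreover have "- ball 0 R' \<inter> Pc E = {}" using R by (force simp: R'_def)
  ultimately have "\<forall>\<^sub>F n in sequentially. \<forall>z\<in>- ball 0 R'. poly (p n) z \<noteq> 0" by (rule zeros_off)
  then have "\<forall>\<^sub>F n in sequentially. \<forall>z. poly (p n) z = 0 \<longrightarrow> cmod z \<le> R'"
    by eventually_elim force
  moreover have "Pc E \<subseteq> ball 0 R'" using R by (force simp: R'_def)
  ultimately show thesis by (intro that[of R']) (auto simp: R'_def)
qed

lemma p_nonzero: "p n \<noteq> 0" using lead_p[of n] by auto

lemma lead_coeff_p: "lead_coeff (p n) = coeff (p n) n" by (simp add: degree_p)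

lemma eventually_upper:
  shows "\<exists>X. \<forall>\<^sub>F n in sequentially. \<forall>w. cmod w \<le> R \<longrightarrow> cmod (poly (p n) w) \<le> X ^ n"
proof -
  obtain R0 where R0: "R0 \<ge> 1" and z: "\<forall>\<^sub>F n in sequentially. \<forall>z. poly (p n) z = 0 \<longrightarrow> cmod z \<le> R0"
    by (rule zeros_bounded) blast
  have "\<forall>\<^sub>F n in sequentially. \<forall>w. cmod w \<le> R \<longrightarrow> cmod (poly (p n) w) \<le> (exp (- ln c + 1) * (R + R0)) ^ n"
    using z lead_bounds[of 1, OF zero_less_one]
  proof eventually_elim
    case (elim n)
    show ?case
    proof (intro allI impI)
      fix w assume w: "cmod w \<le> R"
      have "cmod (poly (p n) w) \<le> cmod (lead_coeff (p n)) * (cmod w + R0) ^ degree (p n)"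
        using elim(1) p_nonzero by (intro poly_root_bounds) auto
      also have "\<dots> \<le> exp (real n * (- ln c + 1)) * (R + R0) ^ n"
        unfolding lead_coeff_p degree_p using elim(2) w R0 by (intro mult_mono power_mono) auto
      also have "\<dots> = (exp (- ln c + 1) * (R + R0)) ^ n" by (simp only: power_mult_distrib exp_of_nat_mult)
      finally show "cmod (poly (p n) w) \<le> (exp (- ln c + 1) * (R + R0)) ^ n" .
    qed
  qed
  then show ?thesis by blast
qed

lemma eventually_escaping:
  obtains a b R0 where "b \<ge> 0" "\<And>R. R \<ge> R0 \<Longrightarrow> \<forall>\<^sub>F n in sequentially. escaping_polynomial (p n) n a b R"
proof -
  obtain R1 where R1: "R1 \<ge> 1" and z: "\<forall>\<^sub>F n in sequentially. \<forall>z. poly (p n) z = 0 \<longrightarrow> cmod z \<le> R1"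
    by (rule zeros_bounded) blast
  \<comment> \<open>The leading coefficient contributes \<open>\<bar>ln c\<bar> + 1\<close> to both
    constants. All zeros lie within \<open>R1\<close>: beyond radius \<open>2 * R1\<close> each
    linear factor is at least half of \<open>cmod w\<close>, and everywhere it is at most
    \<open>2 * R1 * max 1 (cmod w)\<close>.\<close>
  define a where "a = \<bar>ln c\<bar> + 1 + ln 2"
  define b where "b = \<bar>ln c\<bar> + 1 + ln (2 * R1)"
  define R0 where "R0 = max (2 * R1) (exp (2 * a + 1))"
  have b: "b \<ge> 0" and a: "a \<ge> 0" using R1 by (auto simp: a_def b_def)
  have "\<forall>\<^sub>F n in sequentially. escaping_polynomial (p n) n a b R" if R: "R \<ge> R0" for R
    using z lead_bounds[of 1, OF zero_less_one] eventually_ge_at_top[of 2]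
  proof eventually_elim
    case (elim n)
    have RR: "R \<ge> 2 * R1" "R \<ge> exp (2 * a + 1)" using R by (auto simp: R0_def)
    show ?case
    proof
      show "2 \<le> n" "0 \<le> a" "0 \<le> b" by (rule elim a b)+
      show "1 \<le> R" using RR R1 by simp
      have "ln (exp (2 * a + 1)) \<le> ln R" using RR(2) by (intro ln_mono) auto
      then show "2 * a + 1 \<le> ln R" by simp
      fix w
      show "(exp (- a) * cmod w) ^ n \<le> cmod (poly (p n) w)" if w: "R \<le> cmod w"
      proof -
        have e2: "exp (- a) = exp (- \<bar>ln c\<bar> - 1) * (1 / 2)" by (simp add: a_def exp_diff exp_minus exp_add field_simps)
        have "(exp (- a) * cmod w) ^ n = exp (real n * (- \<bar>ln c\<bar> - 1)) * (cmod w / 2) ^ n"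
          unfolding e2 by (simp only: exp_of_nat_mult power_mult_distrib[symmetric]) simp
        also have "\<dots> \<le> cmod (coeff (p n) n) * (cmod w - R1) ^ n"
        proof (intro mult_mono power_mono)
          have "real n * (- \<bar>ln c\<bar> - 1) \<le> real n * (- ln c - 1)" by (intro mult_left_mono) auto
          then have "exp (real n * (- \<bar>ln c\<bar> - 1)) \<le> exp (real n * (- ln c - 1))" by simp
          then show "exp (real n * (- \<bar>ln c\<bar> - 1)) \<le> cmod (coeff (p n) n)" using elim(2) by linarith
        qed (use w RR R1 in auto)
        also have "\<dots> \<le> cmod (poly (p n) w)"
          using poly_root_bounds(1)[of "p n" R1 w] elim(1) p_nonzero w RR R1 by (simp add: degree_p)
        finally show ?thesis .
      qed
      show "cmod (poly (p n) w) \<le> (exp b * max 1 (cmod w)) ^ n"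
      proof -
        have "cmod (poly (p n) w) \<le> cmod (coeff (p n) n) * (cmod w + R1) ^ n"
          using poly_root_bounds(2)[of "p n" R1 w] elim(1) p_nonzero by (simp add: degree_p)
        also have "\<dots> \<le> exp (real n * (\<bar>ln c\<bar> + 1)) * (2 * R1 * max 1 (cmod w)) ^ n"
        proof (intro mult_mono power_mono)
          have "real n * (- ln c + 1) \<le> real n * (\<bar>ln c\<bar> + 1)" by (intro mult_left_mono) auto
          then have "exp (real n * (- ln c + 1)) \<le> exp (real n * (\<bar>ln c\<bar> + 1))" by simp
          then show "cmod (coeff (p n) n) \<le> exp (real n * (\<bar>ln c\<bar> + 1))" using elim(2) by linarith
          have "R1 \<le> R1 * max 1 (cmod w)" "max 1 (cmod w) \<le> R1 * max 1 (cmod w)"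
            using R1 mult_left_mono[of 1 "max 1 (cmod w)" R1] mult_right_mono[of 1 R1 "max 1 (cmod w)"] by auto
          then show "cmod w + R1 \<le> 2 * R1 * max 1 (cmod w)" by linarith
        qed (use R1 in auto)
        also have "\<dots> = (exp (\<bar>ln c\<bar> + 1) * (2 * R1 * max 1 (cmod w))) ^ n"
          by (simp only: exp_of_nat_mult power_mult_distrib)
        also have "exp (\<bar>ln c\<bar> + 1) * (2 * R1 * max 1 (cmod w)) = exp b * max 1 (cmod w)"
          using R1 by (simp add: b_def exp_add)
        finally show ?thesis .
      qed
    qed
  qed
  then show thesis using b by (rule that[rotated])
qed


text \<open>Bernstein-Walsh bounds the normalised quotient \<open>B\<close> by 1, so for the two
  constants principle with \<open>A = 1 / B\<close> a lower bound for \<open>B\<close> at a single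
  point of a large circle suffices. The small rate \<open>\<eta>\<close> is chosen against the
  positive value \<open>g z1\<close>.\<close>

lemma growth_on_outside:
  assumes bd: "\<And>\<kappa>. \<kappa> > 0 \<Longrightarrow> \<forall>\<^sub>F n in sequentially. \<forall>z\<in>S. cmod (poly (p n) z) \<le> exp (\<kappa> * real n)"
    and z1: "z1 \<in> outside E"
  obtains \<rho> \<kappa> where "\<rho> > 0" "\<kappa> > 0" "\<forall>\<^sub>F n in sequentially. \<forall>z\<in>cball z1 \<rho>. exp (\<kappa> * real n) \<le> cmod (poly (p n) z)"
proof -
  obtain R where R: "R \<ge> 1" "Pc E \<subseteq> ball 0 R" by (rule zeros_bounded) blast
  obtain U b where U: "open U" "connected U" "compact (closure U)" "closure U \<subseteq> outside E" "z1 \<in> U" "b \<in> U" "cmod b \<ge> R + 1"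
    by (rule outside_neighbourhood[OF E_compact z1])
  \<comment> \<open>The tube \<open>U\<close> is glued to a neighbourhood of infinity, so that
    \<open>G\<close> contains both \<open>z1\<close> and a circle on which the limit at infinity is
    felt.\<close>
  define V where "V = - cball (0::complex) R"
  have V: "open V" "connected V" "b \<in> V"
    unfolding V_def using U(7) by (auto intro!: connected_complement_bounded_convex)
  have clV: "closure V \<subseteq> - ball 0 R" unfolding V_def by (intro closure_minimal) (auto simp: closed_Compl)
  define G where "G = U \<union> V"
  have opG: "open G" unfolding G_def by (rule open_Un[OF U(1) V(1)])
  have conG: "connected G" unfolding G_def using U(2,6) V(2,3) by (intro connected_Un) auto
  have clG: "closure G \<inter> Pc E = {}"
  proof -
    have "closure G = closure U \<union> closure V" by (simp add: G_def closure_Un)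
    moreover have "outside E \<inter> Pc E = {}" by (auto simp: Pc_def)
    ultimately show ?thesis using U(4) clV R(2) by blast
  qed
  have offS: "z \<notin> S" if "z \<in> closure G" for z using that clG subset_Pc[of E] S_sub by blast
  have G_out: "z \<in> outside S" if "z \<in> closure G" for z
    using that clG outside_mono[OF S_sub] by (auto simp: Pc_def)
  have z1G: "z1 \<in> G" using U(5) by (simp add: G_def)
  have gz1: "g z1 > 0" using z1G closure_subset[of G] by (intro g_pos_outside G_out) blast
  define \<kappa> where "\<kappa> = g z1 / 3"
  have \<kappa>: "\<kappa> > 0" using gz1 by (simp add: \<kappa>_def)
  have "open (G \<inter> {z. g z > 2 * \<kappa>})" by (intro open_Int opG open_superlevel)
  moreover have "z1 \<in> G \<inter> {z. g z > 2 * \<kappa>}" using z1G gz1 by (simp add: \<kappa>_def)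
  ultimately obtain \<rho> where \<rho>: "\<rho> > 0" "cball z1 \<rho> \<subseteq> G \<inter> {z. g z > 2 * \<kappa>}"
    unfolding open_contains_cball by blast
  define C where "C = cball z1 \<rho> \<union> sphere 0 (R + 1)"
  have c1: "compact C" unfolding C_def by (intro compact_Un compact_cball compact_sphere)
  have c2: "C \<subseteq> G" using \<rho>(2) by (auto simp: C_def G_def V_def)
  from two_constants[OF opG conG c1 c2] obtain M where M: "M \<ge> 0" and M2: "\<forall>A B m s y. A holomorphic_on G \<longrightarrow> B holomorphic_on G \<longrightarrow>
      (\<forall>z\<in>G. cmod (B z) \<le> 1) \<longrightarrow> (\<forall>z\<in>G. cmod (A z * B z) \<le> exp m) \<longrightarrow>
      y \<in> C \<longrightarrow> exp (-s) \<le> cmod (B y) \<longrightarrow> (\<forall>z\<in>C. cmod (A z) \<le> exp (m + M * s))"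
    by (elim exE conjE) (rule that)
  define \<eta> where "\<eta> = \<kappa> / (3 * M + 1)"
  have \<eta>: "\<eta> > 0" unfolding \<eta>_def using \<kappa> M by (intro divide_pos_pos add_nonneg_pos) auto
  have \<eta>M: "3 * M * \<eta> \<le> \<kappa>" using \<eta> \<kappa> M by (simp add: \<eta>_def field_simps)
  \<comment> \<open>The discretization is uniform on compact sets only. In the unbounded part
    \<open>V\<close> the bound for \<open>B\<close> is deduced from its values on the circle of
    radius \<open>R\<close>.\<close>
  define D where "D = closure U \<union> sphere 0 R \<union> cball z1 \<rho>"
  have "compact D" unfolding D_def by (intro compact_Un U compact_sphere compact_cball)
  moreover have "D \<inter> S = {}"
  proof -
    have "closure U \<subseteq> closure G" "cball z1 \<rho> \<subseteq> closure G"
      using \<rho>(2) closure_subset[of G] by (auto simp: G_def closure_Un)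
    moreover have "sphere 0 R \<inter> S = {}" using R(2) subset_Pc[of E] S_sub by force
    ultimately show ?thesis using offS unfolding D_def by blast
  qed
  ultimately obtain N where N: "\<And>n. n \<ge> N \<Longrightarrow> \<exists>x. (\<forall>i<n. x i \<in> S) \<and>
    (\<forall>z\<in>D. exp (real n * (g z + ln c - \<eta>)) \<le> cmod (root_prod x n z) \<and>
      cmod (root_prod x n z) \<le> exp (real n * (g z + ln c + \<eta>)))"
    by (rule approximation[OF _ _ \<eta>]) blast
  have "\<forall>\<^sub>F n in sequentially. \<forall>z\<in>cball z1 \<rho>. exp (\<kappa> * real n) \<le> cmod (poly (p n) z)"
    using eventually_ge_at_top[of N] eventually_gt_at_top[of 0] bd[OF \<eta>] lead_bounds[OF \<eta>]
      zeros_off[OF closed_closure clG] eventually_ge_at_top[of "nat \<lceil>M\<rceil>"]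
  proof eventually_elim
    case (elim n)
    obtain x where xS: "\<And>i. i < n \<Longrightarrow> x i \<in> S" and x: "\<And>z. z \<in> D \<Longrightarrow> exp (real n * (g z + ln c - \<eta>)) \<le> cmod (root_prod x n z) \<and>
      cmod (root_prod x n z) \<le> exp (real n * (g z + ln c + \<eta>))" using N[OF elim(1)] by blast
    define F where "F = root_prod x n"
    \<comment> \<open>Chosen so that \<open>exp (n * (g + \<eta>)) = exp (n * (g + ln c - \<eta>)) *
      exp \<beta>\<close>: the upper bound for the polynomial against the lower bound for
      \<open>F\<close>.\<close>
    define \<beta> where "\<beta> = real n * (2 * \<eta> - ln c)"
    define B where "B z = poly (p n) z / F z / of_real (exp \<beta>)" for z
    have F0: "F z \<noteq> 0" if "z \<in> closure G" for z
      using offS[OF that] xS unfolding F_def root_prod_eq_0_iff by blast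
    have bw: "cmod (poly (p n) z) \<le> exp (\<eta> * real n) * exp (real n * g z)" for z
      using elim(2,3) by (intro bernstein_walsh) (auto simp: degree_p)
    have quot: "cmod (B z) \<le> 1" if z: "z \<in> D" for z
    proof -
      have "cmod (poly (p n) z) \<le> exp (real n * (g z + ln c - \<eta>)) * exp \<beta>"
        using bw[of z] unfolding exp_add[symmetric] by (simp add: \<beta>_def algebra_simps)
      also have "\<dots> \<le> cmod (F z) * exp \<beta>" using x[OF z] unfolding F_def by (intro mult_right_mono) auto
      finally have "cmod (poly (p n) z) \<le> cmod (F z) * exp \<beta>" .
      moreover have "cmod (F z) > 0" using x[OF z] exp_gt_zero[of "real n * (g z + ln c - \<eta>)"] unfolding F_def by linarith
      moreover have "cmod (B z) = cmod (poly (p n) z) / (cmod (F z) * exp \<beta>)" by (simp add: B_def norm_divide norm_mult)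
      ultimately show ?thesis by simp
    qed
    have holB: "B holomorphic_on closure G" unfolding B_def[abs_def] F_def
      using F0 by (intro holomorphic_intros) (auto simp: F_def)
    have holBG: "B holomorphic_on G" by (rule holomorphic_on_subset[OF holB closure_subset])
    define l where "l = coeff (p n) n / of_real (exp \<beta>)"
    have lim: "(B \<longlongrightarrow> l) at_infinity"
    proof -
      have "((\<lambda>z. (poly (p n) z / z ^ n) / (poly (root_poly x n) z / z ^ n) / of_real (exp \<beta>)) \<longlongrightarrow>
          coeff (p n) n / 1 / of_real (exp \<beta>)) at_infinity"
        using poly_divide_tendsto_aux[of "p n"] poly_divide_tendsto_aux[of "root_poly x n"] root_poly_monic[of x n]
        by (intro tendsto_divide tendsto_const) (auto simp: degree_p)
      moreover have "\<forall>\<^sub>F z in at_infinity. (poly (p n) z / z ^ n) / (poly (root_poly x n) z / z ^ n) / of_real (exp \<beta>) = B z"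
        unfolding eventually_at_infinity by (intro exI[of _ 1]) (auto simp: B_def F_def poly_root_poly)
      ultimately show ?thesis unfolding l_def by (simp add: tendsto_cong)
    qed
    have B1: "cmod (B z) \<le> 1" if z: "z \<in> G" for z
    proof (cases "z \<in> D")
      case False
      then have zV: "z \<in> V" using z closure_subset[of U] by (auto simp: G_def D_def)
      have VG: "closure V \<subseteq> closure G" by (simp add: G_def closure_Un)
      show ?thesis
      proof (rule exterior_maximum_modulus[of V B R 0 "cmod l + 1"])
        show "B holomorphic_on V" by (rule holomorphic_on_subset[OF holBG]) (simp add: G_def)
        show "continuous_on (closure V) B"
          by (intro holomorphic_on_imp_continuous_on holomorphic_on_subset[OF holB VG])
        have "\<forall>\<^sub>F w in at_infinity. dist (B w) l < 1" using tendstoD[OF lim] by simp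
        then show "\<forall>\<^sub>F w in at_infinity. w \<in> V \<longrightarrow> cmod (B w) \<le> cmod l + 1"
        proof eventually_elim
          case (elim w)
          then show ?case using norm_triangle_sub[of "B w" l] by (simp add: dist_norm)
        qed
        fix w assume w: "w \<in> frontier V"
        have "w \<in> - ball 0 R" "w \<notin> V" using w clV V(1) by (auto simp: frontier_def interior_open)
        then show "cmod (B w) \<le> 1" by (intro quot) (auto simp: D_def V_def)
      qed (use V zV R in \<open>auto simp: V_def\<close>)
    qed (rule quot)
    \<comment> \<open>Two \<open>\<eta>\<close> stem from \<open>\<beta>\<close> and one from the
      leading coefficient.\<close>
    define s where "s = 3 * \<eta> * real n"
    have lb: "exp (- s) \<le> cmod l"
    proof -
      have "exp (- s) = exp (real n * (- ln c - \<eta>) - \<beta>)" by (simp add: s_def \<beta>_def algebra_simps)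
      also have "\<dots> = exp (real n * (- ln c - \<eta>)) / exp \<beta>" by (rule exp_diff)
      also have "\<dots> \<le> cmod (coeff (p n) n) / exp \<beta>" using elim(4) by (intro divide_right_mono) auto
      finally show ?thesis by (simp add: l_def norm_divide)
    qed
    \<comment> \<open>\<open>s + \<eta>\<close> in place of \<open>s\<close> leaves room for the
      strict inequality that the indirect argument needs.\<close>
    have "\<exists>y. cmod y = R + 1 \<and> exp (- (s + \<eta>)) \<le> cmod (B y)"
    proof (rule ccontr)
      assume "\<not> ?thesis"
      then have "cmod l \<le> exp (- (s + \<eta>))"
        using R(1) by (intro limit_at_infinity_le_circle[OF holBG _ _ lim, of "R + 1"]) (auto simp: G_def V_def)
      then have "exp (- s) \<le> exp (- (s + \<eta>))" using lb by linarith
      then show False using \<eta> by simp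
    qed
    then obtain y where y: "cmod y = R + 1" "exp (- (s + \<eta>)) \<le> cmod (B y)" by blast
    have B0: "B z \<noteq> 0" if "z \<in> G" for z
      using that closure_subset[of G] F0[of z] elim(5) by (auto simp: B_def)
    have inv: "cmod (1 / B z) \<le> exp (0 + M * (s + \<eta>))" if "z \<in> C" for z
    proof (rule M2[rule_format, of "\<lambda>z. 1 / B z" B 0 y])
      show "(\<lambda>z. 1 / B z) holomorphic_on G" using B0 by (intro holomorphic_intros holBG)
    qed (use holBG B1 B0 y that in \<open>auto simp: C_def\<close>)
    show ?case
    proof
      fix z assume z: "z \<in> cball z1 \<rho>"
      then have zC: "z \<in> C" "z \<in> D" "z \<in> G" "g z > 2 * \<kappa>" using \<rho>(2) by (auto simp: C_def D_def)
      have "1 \<le> exp (M * (s + \<eta>)) * cmod (B z)"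
        using inv[OF zC(1)] B0[OF zC(3)] by (simp add: norm_divide divide_le_eq)
      then have 1: "exp (- (M * (s + \<eta>))) \<le> cmod (B z)"
        unfolding exp_minus by (subst inverse_le_iff_le[symmetric]) (use B0[OF zC(3)] in \<open>simp_all add: field_simps\<close>)
      have "\<kappa> * real n \<le> real n * (g z + ln c - \<eta>) + \<beta> - M * (s + \<eta>)"
      proof -
        have "M * \<eta> \<le> real n * \<eta>" using elim(6) \<eta> by (intro mult_right_mono) linarith+
        moreover have "(3 * M * \<eta>) * real n \<le> \<kappa> * real n" using \<eta>M by (intro mult_right_mono) auto
        moreover have "(2 * \<kappa>) * real n \<le> g z * real n" using zC(4) by (intro mult_right_mono) auto
        ultimately show ?thesis by (simp add: s_def \<beta>_def algebra_simps)
      qed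
      then have "exp (\<kappa> * real n) \<le> exp (real n * (g z + ln c - \<eta>)) * exp \<beta> * exp (- (M * (s + \<eta>)))"
        unfolding exp_add[symmetric] by simp
      also have "\<dots> \<le> cmod (F z) * exp \<beta> * cmod (B z)"
        using x[OF zC(2)] 1 unfolding F_def by (intro mult_mono) auto
      also have "\<dots> = cmod (poly (p n) z)"
        using F0[of z] zC(3) closure_subset[of G] by (auto simp: B_def norm_divide norm_mult)
      finally show "exp (\<kappa> * real n) \<le> cmod (poly (p n) z)" .
    qed
  qed
  then show thesis by (rule that[OF \<rho>(1) \<kappa>])
qed

context
  fixes K :: "complex set" and r :: "nat \<Rightarrow> nat"
  assumes K: "compact K" "K \<noteq> {}" and r: "strict_mono r"
    and lim: "(\<lambda>k. hausdorff_distance (filled_julia (p (r k))) K) \<longlonglongrightarrow> 0"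
begin

lemma filled_julia_eventually:
  "\<forall>\<^sub>F k in sequentially. bounded (filled_julia (p (r k)))"
  "\<forall>\<^sub>F k in sequentially. filled_julia (p (r k)) \<noteq> {}"
proof -
  obtain a b R0 where esc: "\<And>R. R \<ge> R0 \<Longrightarrow> \<forall>\<^sub>F n in sequentially. escaping_polynomial (p n) n a b R"
    by (rule eventually_escaping) blast
  have "\<forall>\<^sub>F k in sequentially. bounded (filled_julia (p (r k))) \<and> filled_julia (p (r k)) \<noteq> {}"
    using eventually_subseq[OF r esc[OF order_refl]]
  proof eventually_elim
    case (elim k)
    then interpret escaping_polynomial "p (r k)" "r k" a b R0 .
    show ?case using filled_julia_bounded filled_julia_nonempty bounded_subset[OF bounded_ball] by blast
  qed
  then show "\<forall>\<^sub>F k in sequentially. bounded (filled_julia (p (r k)))"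
    "\<forall>\<^sub>F k in sequentially. filled_julia (p (r k)) \<noteq> {}" by (auto simp: eventually_conj_iff)
qed

text \<open>Hausdorff convergence frees the closed tube \<open>closure G\<close> of filled Julia
  sets from some index on, while the Harnack constant depends on the tube and the chosen compact set
  only. Hence one rate \<open>\<kappa>\<close> serves all large degrees.\<close>

lemma growth_off_limit:
  assumes z0: "z0 \<in> outside K"
  obtains \<rho> \<kappa> where "\<rho> > 0" "\<kappa> > 0"
    "\<forall>\<^sub>F k in sequentially. \<forall>z\<in>ball z0 \<rho>. exp (\<kappa> * real (r k)) \<le> cmod (poly (p (r k)) z)"
proof -
  obtain a b R where b: "b \<ge> 0" and esc: "\<And>R'. R' \<ge> R \<Longrightarrow> \<forall>\<^sub>F n in sequentially. escaping_polynomial (p n) n a b R'"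
    by (rule eventually_escaping) blast
  obtain G y where G: "open G" "connected G" "compact (closure G)" "closure G \<subseteq> outside K" "z0 \<in> G" "y \<in> G" "cmod y \<ge> R"
    by (rule outside_neighbourhood[OF K(1) z0])
  obtain \<rho> where \<rho>: "\<rho> > 0" "cball z0 \<rho> \<subseteq> G" using G(1,5) unfolding open_contains_cball by blast
  have c1: "compact (insert y (cball z0 \<rho>))" and c2: "insert y (cball z0 \<rho>) \<subseteq> G"
    using \<rho>(2) G(6) by (auto intro: compact_insert compact_cball)
  from two_constants[OF G(1,2) c1 c2] obtain M where M: "M \<ge> 0" and M2: "\<forall>A B m s x. A holomorphic_on G \<longrightarrow> B holomorphic_on G \<longrightarrow>
      (\<forall>z\<in>G. cmod (B z) \<le> 1) \<longrightarrow> (\<forall>z\<in>G. cmod (A z * B z) \<le> exp m) \<longrightarrow>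
      x \<in> insert y (cball z0 \<rho>) \<longrightarrow> exp (-s) \<le> cmod (B x) \<longrightarrow> (\<forall>z\<in>insert y (cball z0 \<rho>). cmod (A z) \<le> exp (m + M * s))"
    by (elim exE conjE) (rule that)
  \<comment> \<open>The two constants principle with \<open>A = h\<close> and
    \<open>B = 1 / h\<close>; \<open>M + 1\<close> instead of \<open>M\<close> makes the constant
    strictly positive.\<close>
  have harnack: "ln (cmod (h y)) \<le> (M + 1) * ln (cmod (h z))"
    if h: "h holomorphic_on G" "\<And>w. w \<in> G \<Longrightarrow> cmod (h w) \<ge> 1" and z: "z \<in> cball z0 \<rho>" for h z
  proof -
    have zG: "z \<in> G" using z \<rho>(2) by blast
    have hz: "cmod (h z) \<ge> 1" "cmod (h y) \<ge> 1" using h(2) zG G(6) by auto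
    have h0: "h w \<noteq> 0" if "w \<in> G" for w using h(2)[OF that] by auto
    have "cmod (h y) \<le> exp (0 + M * ln (cmod (h z)))"
    proof (rule M2[rule_format, of h "\<lambda>w. 1 / h w" 0 z])
      show "(\<lambda>w. 1 / h w) holomorphic_on G" using h0 by (intro holomorphic_intros h)
      show "cmod (1 / h w) \<le> 1" if "w \<in> G" for w using h(2)[OF that] by (simp add: norm_divide divide_le_eq)
      show "exp (- ln (cmod (h z))) \<le> cmod (1 / h z)"
        using hz h0[OF zG] by (simp add: exp_minus norm_divide inverse_eq_divide)
    qed (use h h0 z in auto)
    then have "ln (cmod (h y)) \<le> ln (exp (0 + M * ln (cmod (h z))))" using hz by (intro ln_mono) auto
    moreover have "ln (cmod (h z)) \<ge> 0" using hz by simp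
    ultimately show ?thesis by (simp add: distrib_right)
  qed
  \<comment> \<open>Harnack gives the rate \<open>1 / (M + 1)\<close>; half of it absorbs the
    additive constant \<open>2 * b\<close>.\<close>
  define \<kappa> where "\<kappa> = 1 / (2 * (M + 1))"
  have \<kappa>: "\<kappa> > 0" using M by (simp add: \<kappa>_def)
  have "closure G \<inter> K = {}" using G(4) outside_no_overlap[of K] by blast
  then have "\<forall>\<^sub>F k in sequentially. closure G \<inter> filled_julia (p (r k)) = {}"
    using K G(3) by (intro hausdorff_limit_disjoint[OF lim] filled_julia_eventually compact_imp_closed)
  then have "\<forall>\<^sub>F k in sequentially. \<forall>z\<in>ball z0 \<rho>. exp (\<kappa> * real (r k)) \<le> cmod (poly (p (r k)) z)"
    using eventually_subseq[OF r esc[OF order_refl]]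
      eventually_subseq[OF r eventually_gt_at_top[of "nat \<lceil>2 * b / \<kappa>\<rceil>"]]
  proof eventually_elim
    case (elim k)
    interpret escaping_polynomial "p (r k)" "r k" a b R by (rule elim)
    have rk: "2 * b / \<kappa> < real (r k)" using elim(3) by linarith
    show ?case
    proof
      fix z assume z: "z \<in> ball z0 \<rho>"
      have "real (r k) \<le> (M + 1) * (ln (max 1 (cmod (poly (p (r k)) z))) + 2 * b)"
      proof (rule growth_off_filled_julia[OF G(3) elim(1) _ _ _ G(6,7)])
        show "ln (cmod (h y)) \<le> (M + 1) * ln (cmod (h z))"
          if "h holomorphic_on G" "\<And>w. w \<in> G \<Longrightarrow> cmod (h w) \<ge> 1" for h
          using z by (intro harnack that) auto
      qed (use z \<rho>(2) M in auto)
      also have "(M + 1) = 1 / (2 * \<kappa>)" using M by (simp add: \<kappa>_def)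
      finally have "2 * \<kappa> * real (r k) \<le> ln (max 1 (cmod (poly (p (r k)) z))) + 2 * b" using \<kappa> by (simp add: field_simps)
      moreover have "2 * b < \<kappa> * real (r k)" using rk \<kappa> by (simp add: field_simps)
      ultimately have le: "\<kappa> * real (r k) < ln (max 1 (cmod (poly (p (r k)) z)))" by simp
      have "exp (\<kappa> * real (r k)) < exp (ln (max 1 (cmod (poly (p (r k)) z))))" using le by (simp only: exp_less_cancel_iff)
      also have "\<dots> = max 1 (cmod (poly (p (r k)) z))" by (rule exp_ln) simp
      finally have "exp (\<kappa> * real (r k)) < max 1 (cmod (poly (p (r k)) z))" .
      moreover have "1 \<le> exp (\<kappa> * real (r k))" using \<kappa> by simp
      ultimately show "exp (\<kappa> * real (r k)) \<le> cmod (poly (p (r k)) z)" by linarith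
    qed
  qed
  then show thesis by (rule that[OF \<rho>(1) \<kappa>])
qed

text \<open>\<open>bd\<close> and \<open>small\<close> isolate what depends on the type of norm: an
  upper bound at all points of \<open>S\<close>, but on \<open>E\<close> only smallness somewhere
  near each point, which an integral norm provides on a polar part as well.\<close>

lemma Pc_limit:
  assumes bd: "\<And>\<kappa>. \<kappa> > 0 \<Longrightarrow> \<forall>\<^sub>F n in sequentially. \<forall>z\<in>S. cmod (poly (p n) z) \<le> exp (\<kappa> * real n)"
    and small: "\<And>z0 \<rho> \<kappa>. z0 \<in> E \<Longrightarrow> \<rho> > 0 \<Longrightarrow> \<kappa> > 0 \<Longrightarrow>
      \<forall>\<^sub>F n in sequentially. \<exists>z\<in>ball z0 \<rho>. cmod (poly (p n) z) < exp (\<kappa> * real n)"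
  shows "Pc K = Pc E"
proof -
  have "E \<inter> outside K = {}"
  proof (rule ccontr)
    assume "E \<inter> outside K \<noteq> {}"
    then obtain z0 where z0: "z0 \<in> E" "z0 \<in> outside K" by blast
    obtain \<rho> \<kappa> where g: "\<rho> > 0" "\<kappa> > 0"
      "\<forall>\<^sub>F k in sequentially. \<forall>z\<in>ball z0 \<rho>. exp (\<kappa> * real (r k)) \<le> cmod (poly (p (r k)) z)"
      by (rule growth_off_limit[OF z0(2)])
    have "\<forall>\<^sub>F k in sequentially. False"
      using g(3) eventually_subseq[OF r small[OF z0(1) g(1,2)]] by eventually_elim force
    then show False by simp
  qed
  moreover have "K \<inter> outside E = {}"
  proof (rule ccontr)
    assume "K \<inter> outside E \<noteq> {}"
    then obtain z1 where z1: "z1 \<in> K" "z1 \<in> outside E" by blast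
    obtain \<rho> \<kappa> where g: "\<rho> > 0" "\<kappa> > 0" "\<forall>\<^sub>F n in sequentially. \<forall>z\<in>cball z1 \<rho>. exp (\<kappa> * real n) \<le> cmod (poly (p n) z)"
      by (rule growth_on_outside[OF bd z1(2)])
    obtain a b R0 where esc: "\<And>R. R \<ge> R0 \<Longrightarrow> \<forall>\<^sub>F n in sequentially. escaping_polynomial (p n) n a b R"
      by (rule eventually_escaping) blast
    have "\<forall>\<^sub>F k in sequentially. ball z1 \<rho> \<inter> filled_julia (p (r k)) \<noteq> {}"
      using K z1(1) g(1) by (intro hausdorff_limit_approach[OF lim] filled_julia_eventually compact_imp_bounded)
    then have "\<forall>\<^sub>F k in sequentially. False"
      using eventually_subseq[OF r g(3)] eventually_subseq[OF r esc[OF order_refl]]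
        eventually_subseq[OF r eventually_const_le_exp[OF g(2), of R0]]
    proof eventually_elim
      case (elim k)
      interpret escaping_polynomial "p (r k)" "r k" a b R0 by (rule elim)
      obtain z where z: "z \<in> ball z1 \<rho>" "z \<in> filled_julia (p (r k))" using elim(1) by blast
      then have "exp (\<kappa> * real (r k)) \<le> cmod (poly (p (r k)) z)" using elim(2) by simp
      then have "R0 \<le> cmod (poly (p (r k)) z)" using elim(4) by linarith
      then show False using escape_in z(2) by blast
    qed
    then show False by simp
  qed
  ultimately show ?thesis
    using outside_subset[of K E] outside_subset[of E K] K E_compact unfolding Pc_def by (blast dest: compact_imp_bounded)
qed

end

end

section \<open>Consequences of a finite exponent, and the conclusion\<close>

lemma eventually_le_exp_of_log_limit:
  fixes x :: "nat \<Rightarrow> real"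
  assumes lim: "(\<lambda>n. 1 / real n * ln (x n)) \<longlonglongrightarrow> 0" and x: "\<And>n. x n \<ge> 0" and e: "e > 0"
  shows "\<forall>\<^sub>F n in sequentially. x n \<le> exp (e * real n)"
proof -
  have "\<forall>\<^sub>F n in sequentially. 1 / real n * ln (x n) < e" using lim e by (rule order_tendstoD)
  then show ?thesis using eventually_gt_at_top[of 0]
  proof eventually_elim
    case (elim n)
    \<comment> \<open>Zero is treated apart, because there the logarithm takes its default value
      0.\<close>
    show ?case
    proof (cases "x n = 0")
      case False
      then have "ln (x n) \<le> e * real n" using elim by (simp add: field_simps)
      then have "exp (ln (x n)) \<le> exp (e * real n)" by simp
      then show ?thesis using False x[of n] by simp
    qed simp
  qed
qed

locale regular_minimal_polynomials = regular_measure + minimal_polynomials +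
  fixes q :: real
  assumes q: "q > 0" and Lq: "(\<lambda>n. 1 / real n * ln (Lq_norm q \<tau> (poly (p n)))) \<longlonglongrightarrow> 0"
begin

lemma continuous_power_norm: "s > 0 \<Longrightarrow> continuous_on UNIV (\<lambda>z. cmod (poly u z) powr s)"
  by (intro continuous_on_powr' continuous_intros) auto

lemma eventually_integral_le:
  assumes e: "e > 0"
  shows "\<forall>\<^sub>F n in sequentially. (\<integral>z. cmod (poly (p n) z) powr q \<partial>\<tau>) \<le> exp (e * real n)"
proof -
  have "\<forall>\<^sub>F n in sequentially. Lq_norm q \<tau> (poly (p n)) \<le> exp (e / q * real n)"
    by (rule eventually_le_exp_of_log_limit[OF Lq]) (use e q in \<open>auto simp: Lq_norm_def\<close>)
  then show ?thesis
  proof eventually_elim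
    case (elim n)
    let ?I = "\<integral>z. cmod (poly (p n) z) powr q \<partial>\<tau>"
    have I: "?I \<ge> 0" by (rule integral_nonneg_AE) simp
    have "?I = (?I powr (1 / q)) powr q" using I q by (simp add: powr_powr)
    also have "\<dots> \<le> exp (e / q * real n) powr q" using elim q unfolding Lq_norm_def by (intro powr_mono2) auto
    also have "\<dots> = exp (e * real n)" using q by (simp add: powr_def)
    finally show ?case .
  qed
qed

text \<open>The interpolation with the supremum bound works for exponents at most 2;
  \<open>min q 1\<close> satisfies this, and \<open>t powr min q 1 \<le> 1 + t powr q\<close>
  transfers the bound.\<close>

lemma eventually_integral_min_le:
  assumes e: "e > 0"
  shows "\<forall>\<^sub>F n in sequentially. (\<integral>z. cmod (poly (p n) z) powr min q 1 \<partial>\<tau>) \<le> exp (e * real n)"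
proof -
  have e2: "e / 2 > 0" using e by simp
  show ?thesis
    using eventually_integral_le[OF e2] eventually_const_le_exp[OF e2, of "total + 1"]
  proof eventually_elim
    case (elim n)
    have "(\<integral>z. cmod (poly (p n) z) powr min q 1 \<partial>\<tau>) \<le> (\<integral>z. 1 + cmod (poly (p n) z) powr q \<partial>\<tau>)"
    proof (rule integral_mono)
      show "integrable \<tau> (\<lambda>z. cmod (poly (p n) z) powr min q 1)"
        using q by (intro integrable_continuous continuous_power_norm) simp
      show "integrable \<tau> (\<lambda>z. 1 + cmod (poly (p n) z) powr q)"
        using q by (intro integrable_continuous continuous_on_add continuous_on_const continuous_power_norm)
      fix z
      show "cmod (poly (p n) z) powr min q 1 \<le> 1 + cmod (poly (p n) z) powr q"
      proof (cases "cmod (poly (p n) z) \<le> 1")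
        case True
        then have "cmod (poly (p n) z) powr min q 1 \<le> 1 powr min q 1" using q by (intro powr_mono2) auto
        then show ?thesis by (simp add: add_increasing2)
      next
        case False
        then have "cmod (poly (p n) z) powr min q 1 \<le> cmod (poly (p n) z) powr q" by (intro powr_mono) auto
        then show ?thesis by simp
      qed
    qed
    also have "\<dots> = (\<integral>z. 1 \<partial>\<tau>) + (\<integral>z. cmod (poly (p n) z) powr q \<partial>\<tau>)"
      using q by (intro Bochner_Integration.integral_add integrable_continuous continuous_power_norm continuous_on_const)
    also have "(\<integral>z. 1 \<partial>\<tau>) = total - 1" by (simp add: total_def)
    also have "total - 1 + (\<integral>z. cmod (poly (p n) z) powr q \<partial>\<tau>) \<le> total * exp (e / 2 * real n)"
    proof -
      have "(total - 1) * 1 \<le> (total - 1) * exp (e / 2 * real n)" using total_ge_1 e by (intro mult_left_mono) auto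
      then show ?thesis using elim(1) by (simp add: algebra_simps)
    qed
    also have "\<dots> \<le> exp (e / 2 * real n) * exp (e / 2 * real n)" using elim(2) by (intro mult_right_mono) auto
    also have "\<dots> = exp (e * real n)" unfolding exp_add[symmetric] by simp
    finally show ?case .
  qed
qed

text \<open>Chebyshev's argument: a ball about a support point has a positive mass \<open>t\<close>
  independent of \<open>n\<close>, so exponential growth on the whole ball would show in the
  integral.\<close>

lemma eventually_small_somewhere:
  assumes z0: "z0 \<in> msupport \<tau>" and \<rho>: "\<rho> > 0" and \<kappa>: "\<kappa> > 0"
  shows "\<forall>\<^sub>F n in sequentially. \<exists>z\<in>ball z0 \<rho>. cmod (poly (p n) z) < exp (\<kappa> * real n)"
proof -
  interpret finite_measure \<tau> by (rule \<tau>_fin)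
  define t where "t = measure \<tau> (ball z0 \<rho>)"
  have bs: "ball z0 \<rho> \<in> sets \<tau>" by (simp add: \<tau>_sets)
  have "emeasure \<tau> (ball z0 \<rho>) > 0" using z0 \<rho> unfolding msupport_def by auto
  then have t: "t > 0" unfolding t_def by (simp add: emeasure_eq_measure)
  define e where "e = \<kappa> * q / 2"
  have e: "e > 0" using \<kappa> q by (simp add: e_def)
  show ?thesis
    using eventually_integral_le[OF e] eventually_const_le_exp[OF e, of "2 / t"]
  proof eventually_elim
    case (elim n)
    show ?case
    proof (rule ccontr)
      assume "\<not> ?thesis"
      then have ge: "exp (\<kappa> * real n) \<le> cmod (poly (p n) z)" if "z \<in> ball z0 \<rho>" for z using that by force
      have "t * exp (2 * e * real n) = (\<integral>z. exp (2 * e * real n) * indicator (ball z0 \<rho>) z \<partial>\<tau>)"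
        using bs by (simp add: t_def)
      also have "\<dots> \<le> (\<integral>z. cmod (poly (p n) z) powr q \<partial>\<tau>)"
      proof (rule integral_mono)
        show "integrable \<tau> (\<lambda>z. exp (2 * e * real n) * indicator (ball z0 \<rho>) z)"
          using bs by (intro integrable_mult_right integrable_real_indicator) (auto simp: less_top[symmetric])
        show "integrable \<tau> (\<lambda>z. cmod (poly (p n) z) powr q)" using q by (intro integrable_continuous continuous_power_norm)
        fix z
        show "exp (2 * e * real n) * indicator (ball z0 \<rho>) z \<le> cmod (poly (p n) z) powr q"
        proof (cases "z \<in> ball z0 \<rho>")
          case True
          have "exp (\<kappa> * real n) powr q \<le> cmod (poly (p n) z) powr q" using ge[OF True] q by (intro powr_mono2) auto
          moreover have "exp (\<kappa> * real n) powr q = exp (2 * e * real n)" by (simp add: powr_def e_def mult_ac)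
          ultimately show ?thesis using True by simp
        qed simp
      qed
      also have "\<dots> \<le> exp (e * real n)" by (rule elim)
      finally have "t * (exp (e * real n) * exp (e * real n)) \<le> exp (e * real n)"
        unfolding exp_add[symmetric] by (simp add: algebra_simps)
      then have "t * exp (e * real n) \<le> 1" by (simp add: mult.assoc[symmetric])
      moreover have "2 \<le> t * exp (e * real n)" using elim(2) t by (simp add: field_simps)
      ultimately show False by simp
    qed
  qed
qed

end

theorem proposition4p4:
  fixes E K :: "complex set" and p :: "nat \<Rightarrow> complex poly"
  assumes "regular_compact E"
    and "asymptotically_minimal E p"
    and "\<And>\<epsilon>::real. \<epsilon> > 0 \<Longrightarrow>
      \<exists>N. \<forall>n\<ge>N. {z. poly (p n) z = 0} \<subseteq> {z. infdist z (Pc E) < \<epsilon>}"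
    and "julia_limit_point p K"
  shows "Pc K = Pc E"
proof -
  obtain r where K: "compact K" "K \<noteq> {}" and r: "strict_mono r"
    and lim: "(\<lambda>k. hausdorff_distance (filled_julia (p (r k))) K) \<longlonglongrightarrow> 0"
    using assms(4) unfolding julia_limit_point_def by blast
  have E: "compact E" using assms(1) by (simp add: regular_compact_def)
  obtain \<omega> g where \<omega>: "\<omega> \<in> prob_measures_on E" and c: "log_cap E > 0" and g: "continuous_on UNIV g"
    "\<And>z. z \<in> msupport \<omega> \<Longrightarrow> g z = 0"
    "\<And>z. z \<notin> msupport \<omega> \<Longrightarrow> g z = (\<integral>w. ln (cmod (z - w)) \<partial>\<omega>) - ln (log_cap E)"
    and polar: "\<And>\<delta> \<rho>. \<delta> > 0 \<Longrightarrow> \<rho> > 0 \<Longrightarrow> \<exists>m>0. \<exists>c::nat \<Rightarrow> complex.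
      (\<forall>i<m. c i \<in> E) \<and> (\<forall>z\<in>{z \<in> E. g z \<ge> \<delta>}. (\<Prod>i<m. cmod (z - c i)) \<le> \<rho> ^ m)"
    by (rule green_potential[OF assms(1)]) (rule that; assumption)
  have \<omega>': "prob_space \<omega>" "sets \<omega> = sets borel" "msupport \<omega> \<subseteq> E"
    using \<omega> by (auto simp: prob_measures_on_def)
  have S: "compact (msupport \<omega>)"
    using compact_Int_closed[OF E closed_msupport[of \<omega>]] \<omega>'(3) by (simp add: inf.absorb2)
  note minimal = assms(2)[unfolded asymptotically_minimal_def]
  have deg: "degree (p n) = n" "coeff (p n) n \<noteq> 0" for n using conjunct1[OF minimal] by blast+
  have lead: "(\<lambda>n. 1 / real n * ln (cmod (coeff (p n) n))) \<longlonglongrightarrow> - ln (log_cap E)"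
    by (rule conjunct1[OF conjunct2[OF minimal]])
  interpret minimal_polynomials E "msupport \<omega>" \<omega> "log_cap E" g p
    by (intro minimal_polynomials.intro green_function.intro minimal_polynomials_axioms.intro)
      (fact \<omega>' AE_msupport[OF \<omega>'(2)] S E c g deg lead assms(3))+
  note Pc_limit = Pc_limit[OF K r lim]
  have "(\<exists>\<tau>\<in>Reg. \<exists>q>0. msupport \<tau> = E \<and> (\<lambda>n. 1 / real n * ln (Lq_norm q \<tau> (poly (p n)))) \<longlonglongrightarrow> 0) \<or>
      (\<lambda>n. 1 / real n * ln (sup_norm E (poly (p n)))) \<longlonglongrightarrow> 0"
    by (rule conjunct2[OF conjunct2[OF minimal]])
  then show ?thesis
  proof
    assume sup: "(\<lambda>n. 1 / real n * ln (sup_norm E (poly (p n)))) \<longlonglongrightarrow> 0"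
    have le: "cmod (poly (p n) z) \<le> sup_norm E (poly (p n))" if "z \<in> E" for n z
    proof -
      have "compact ((\<lambda>z. cmod (poly (p n) z)) ` E)" by (intro compact_continuous_image continuous_intros E)
      then have "bdd_above ((\<lambda>z. cmod (poly (p n) z)) ` E)" by (intro bounded_imp_bdd_above compact_imp_bounded)
      then show ?thesis unfolding sup_norm_def using that by (intro cSUP_upper)
    qed
    obtain w where "w \<in> E" using S_nonempty \<omega>'(3) by blast
    then have nn: "sup_norm E (poly (p n)) \<ge> 0" for n using le[of w n] norm_ge_zero order_trans by blast
    have small: "\<forall>\<^sub>F n in sequentially. \<forall>z\<in>E. cmod (poly (p n) z) \<le> exp (\<kappa> * real n)" if "\<kappa> > 0" for \<kappa>
      using eventually_le_exp_of_log_limit[OF sup nn that] by eventually_elim (blast intro: order_trans le)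
    show ?thesis
    proof (rule Pc_limit)
      show "\<forall>\<^sub>F n in sequentially. \<forall>z\<in>msupport \<omega>. cmod (poly (p n) z) \<le> exp (\<kappa> * real n)" if "\<kappa> > 0" for \<kappa>
        using small[OF that] by eventually_elim (use \<omega>'(3) in blast)
      show "\<forall>\<^sub>F n in sequentially. \<exists>z\<in>ball z0 \<rho>. cmod (poly (p n) z) < exp (\<kappa> * real n)"
        if h: "z0 \<in> E" "\<rho> > 0" "\<kappa> > 0" for z0 \<rho> \<kappa>
      proof -
        \<comment> \<open>Halving the rate turns the weak inequality into the strict one for
          \<open>n > 0\<close>.\<close>
        have "\<kappa> / 2 > 0" using h by simp
        from small[OF this] show ?thesis using eventually_gt_at_top[of 0]
        proof eventually_elim
          case (elim n)
          have "cmod (poly (p n) z0) \<le> exp (\<kappa> / 2 * real n)" using elim h by blast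
          also have "\<dots> < exp (\<kappa> * real n)" using elim h by simp
          finally show ?case using h(2) by (intro bexI[of _ z0]) auto
        qed
      qed
    qed
  next
    assume "\<exists>\<tau>\<in>Reg. \<exists>q>0. msupport \<tau> = E \<and> (\<lambda>n. 1 / real n * ln (Lq_norm q \<tau> (poly (p n)))) \<longlonglongrightarrow> 0"
    then obtain \<tau> q where \<tau>: "\<tau> \<in> Reg" and q: "q > 0" and supp: "msupport \<tau> = E"
      and Lq: "(\<lambda>n. 1 / real n * ln (Lq_norm q \<tau> (poly (p n)))) \<longlonglongrightarrow> 0" by blast
    obtain P where fin: "finite_measure \<tau>" "sets \<tau> = sets borel" and P: "orthonormal_polys \<tau> P"
      and reg: "(\<lambda>n. ereal (root n (Re (lead_coeff (P n))))) \<longlonglongrightarrow> 1 / ereal (log_cap E)"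
      using \<tau> supp unfolding Reg_def finite_compact_measure_def by blast
    have "AE x in \<tau>. x \<in> E" using AE_msupport[OF fin(2)] supp by simp
    then interpret R: regular_minimal_polynomials E "msupport \<omega>" \<omega> "log_cap E" g \<tau> P p q
      by (intro regular_minimal_polynomials.intro regular_measure.intro regular_measure_axioms.intro
          regular_minimal_polynomials_axioms.intro green_function_axioms minimal_polynomials_axioms fin P q Lq)
    \<comment> \<open>Positive capacity makes the extended quotient finite, so the limit is one of
      real numbers.\<close>
    have "(\<lambda>n. ereal (root n (R.\<gamma> n))) \<longlonglongrightarrow> ereal (1 / log_cap E)" using reg c by (simp add: R.\<gamma>_def one_ereal_def)
    then have \<gamma>: "(\<lambda>n. root n (R.\<gamma> n)) \<longlonglongrightarrow> 1 / log_cap E" by simp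
    show ?thesis
    proof (rule Pc_limit)
      show "\<forall>\<^sub>F n in sequentially. \<forall>z\<in>msupport \<omega>. cmod (poly (p n) z) \<le> exp (\<kappa> * real n)" if "\<kappa> > 0" for \<kappa>
      proof (rule R.eventually_bounded_on_support[where q = "min q 1", OF polar _ eventually_upper])
        show "degree (p n) \<le> n" for n by (simp add: deg)
      qed (use q \<gamma> that R.eventually_integral_min_le in auto)
      show "\<forall>\<^sub>F n in sequentially. \<exists>z\<in>ball z0 \<rho>. cmod (poly (p n) z) < exp (\<kappa> * real n)"
        if "z0 \<in> E" "\<rho> > 0" "\<kappa> > 0" for z0 \<rho> \<kappa>
        using that by (intro R.eventually_small_somewhere) (auto simp: supp)
    qed
  qed
qed

end
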